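(* Let $N\in\mathbb{Z}_{>0}$, $l\in\frac12\mathbb{Z}_{>0}$ with $Nl\in\mathbb{Z}$, $\tau\in i\mathbb{R}_{>0}$, and let $\eta=\frac{r'}{2lr}\in\bigl[-\frac{1}{2(2l+1)},\frac{1}{2(2l+1)}\bigr]$ with $r,r'\in\mathbb{Z}$, $r>0$. Let $\mathcal{H}$, $T(u)$, $U_1$, $U_3$, $h_\pm(u)$, $[z;a]_k$ and the scalar products be as in the context. For $\lambda,u\in\mathbb{C}$ put $$f_\pm(\lambda,u,z):=\Bigl[z;\tfrac{\pm\lambda+u}{2}+(-l+1)\eta\Bigr]_{2l}\in\Theta^{4l+}_{00}.$$ Let $\tau_{kj}$ ($1\le k\le 2l+1$, $1\le j\le r$) be generic complex parameters. For $i,j\in\{1,\dots,r\}$ define linear maps $S^i_j(u):\mathbb{C}^{2l+1}\to\Theta^{4l+}_{00}$ on the standard basis $e_1,\dots,e_{2l+1}$ by $$S^{j\pm1}_j(u)e_k=\tau_{kj}f_\pm(2(2j-1)l\eta,u,z)\ \ (1\le j\pm1\le r),$$ $$S^1_1(u)e_k=\tau_{k1}f_-(2l\eta,u,z),\qquad S^r_r(u)e_k=\tau_{kr}f_+(2(2r-1)l\eta,u,z),$$ and $S^i_j(u)=0$ for all other $(i,j)$. Define $Q_R(u):(\mathbb{C}^{2l+1})^{\otimes N}\to\mathcal{H}$ by $$Q_R(u)(e_{k_N}\otimes\cdots\otimes e_{k_1})=\sum_{i_1,\dots,i_N=1}^{r}S^{i_N}_{i_{N-1}}(u)e_{k_N}\otimes\cdots\otimes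 S^{i_2}_{i_1}(u)e_{k_2}\otimes S^{i_1}_{i_0}(u)e_{k_1},\qquad i_0:=i_N,$$ and $Q_L(u):=Q_R(-\bar u)^*:\mathcal{H}\to(\mathbb{C}^{2l+1})^{\otimes N}$ (Hermitian adjoint). Then for all $u,u'\in\mathbb{C}$: (i) $T(u)Q_R(u)=h_-(u)Q_R(u-2\eta)+h_+(u)Q_R(u+2\eta)$. (ii) $Q_L(u)T(u)=h_-(u)Q_L(u-2\eta)+h_+(u)Q_L(u+2\eta)$. (iii) $Q_L(u)Q_R(u')=Q_L(u')Q_R(u)$. (iv) $U_1^{\otimes N}Q_R(u)=e^{-Nl\pi i}Q_R(u+1)$, $\ U_3^{\otimes N}Q_R(u)=e^{Nl\pi i(\tau-1)+2Nl\pi iu}Q_R(u+\tau)$, $\ Q_L(u)U_1^{\otimes N}=e^{-Nl\pi i}Q_L(u+1)$, $\ Q_L(u)U_3^{\otimes N}=e^{Nl\pi i(\tau-1)+2Nl\pi iu}Q_L(u+\tau)$. (v) If there exists $u_0\in\mathbb{C}$ such that $Q_R(u_0)$ and $Q_L(u_0)$ are invertible, then $Q_R(u)Q_R(u_0)^{-1}=Q_L(u_0)^{-1}Q_L(u)$ for all $u$, and the operator $Q(u):=Q_R(u)Q_R(u_0)^{-1}$ on $\mathcal{H}$ satisfies, for all $u,v\in\mathbb{C}$, $$T(u)Q(u)=Q(u)T(u)=h_-(u)Q(u-2\eta)+h_+(u)Q(u+2\eta),\qquad Q(u)Q(v)=Q(v)Q(u),$$ $$U_1^{\otimes N}Q(u)=Q(u)U_1^{\otimes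 N}=e^{-Nl\pi i}Q(u+1),$$ $$U_3^{\otimes N}Q(u)=Q(u)U_3^{\otimes N}=e^{Nl\pi i(\tau-1)+2Nl\pi iu}Q(u+\tau).$$
   Context: Theta functions: $\theta_{ab}(z,\tau)=\sum_{n\in\mathbb{Z}}\exp\bigl(\pi i(\frac a2+n)^2\tau+2\pi i(\frac a2+n)(\frac b2+z)\bigr)$ for $a,b\in\{0,1\}$; $[z]:=\theta_{11}(z,\tau)$; $[z]_k:=\prod_{j=0}^{k-1}[z+2j\eta]$, $[z]_0=1$; $[z;a]_k:=[z+a]_k[-z+a]_k$ (regarded as a function of $z$). Pauli matrices: $\sigma^0=\begin{pmatrix}1&0\\0&1\end{pmatrix}$, $\sigma^1=\begin{pmatrix}0&1\\1&0\end{pmatrix}$, $\sigma^2=\begin{pmatrix}0&-i\\i&0\end{pmatrix}$, $\sigma^3=\begin{pmatrix}1&0\\0&-1\end{pmatrix}$. Local space: $\Theta^{4l+}_{00}$ is the space of entire functions $f$ with $f(z+1)=f(-z)=f(z)$ and $f(z+\tau)=e^{-4l\pi i(2z+\tau)}f(z)$; it has dimension $2l+1$. Spin $l$ representation $\rho^l$ of the generators $S^0,\dots,S^3$ of the Sklyanin algebra on $\Theta^{4l+}_{00}$: $$(\rho^l(S^a)f)(z)=\frac{s_a(z-l\eta)f(z+\eta)-s_a(-z-l\eta)f(z-\eta)}{\theta_{11}(2z,\tau)},$$ $s_0(z)=\theta_{11}(\eta,\tau)\theta_{11}(2z,\tau)$, $s_1(z)=\theta_{10}(\eta,\tau)\theta_{10}(2z,\tau)$,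 $s_2(z)=i\theta_{00}(\eta,\tau)\theta_{00}(2z,\tau)$, $s_3(z)=\theta_{01}(\eta,\tau)\theta_{01}(2z,\tau)$. Transfer matrix: $\mathcal{H}=V_N\otimes\cdots\otimes V_1$ with every $V_n=\Theta^{4l+}_{00}$. Put $W_0^L(u)=\frac{\theta_{11}(u,\tau)}{\theta_{11}(\eta,\tau)}$, $W_1^L(u)=\frac{\theta_{10}(u,\tau)}{\theta_{10}(\eta,\tau)}$, $W_2^L(u)=\frac{\theta_{00}(u,\tau)}{\theta_{00}(\eta,\tau)}$, $W_3^L(u)=\frac{\theta_{01}(u,\tau)}{\theta_{01}(\eta,\tau)}$, and $L_n(u)=\sum_{a=0}^3W_a^L(u)\rho_n(S^a)\otimes\sigma^a$ on $\mathcal{H}\otimes\mathbb{C}^2$, where $\rho_n(S^a)$ acts as $\rho^l(S^a)$ on $V_n$ and as the identity on the other factors. Then $T(u)=\operatorname{tr}_{\mathbb{C}^2}L_N(u)L_{N-1}(u)\cdots L_1(u)$, an operator on $\mathcal{H}$. Also $h_\pm(u):=(2[u\mp2l\eta])^N$. Scalar products: on $\Theta^{4l+}_{00}$ the Sklyanin form (conjugate-linear in the first argument) is $$\langle f,g\rangle=\int_0^1dx\int_0^{\tau/i}dy\,\overline{f(z)}g(z)\mu(z,\bar z),\quad z=x+iy,$$ $$\mu(z,w)=\frac{\theta_{11}(2z,\tau)\theta_{11}(2w,\tau)}{\prod_{j=0}^{2l+1}\theta_{00}(z+w+(2j-2l-1)\eta,\tau)\,\theta_{00}(z-w+(2j-2l-1)\eta,\tau)};$$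 it is a positive definite Hermitian scalar product. $\mathcal{H}$ carries the tensor product scalar product, and $(\mathbb{C}^{2l+1})^{\otimes N}$ the tensor product of the standard scalar product on $\mathbb{C}^{2l+1}$, $(e_i,e_j)=\delta_{ij}$. The adjoint $^*$ is taken with respect to these. Unitary operators on $\Theta^{4l+}_{00}$: $(U_1f)(z)=e^{\pi il}f(z+\frac12)$, $(U_3f)(z)=e^{\pi il}e^{\pi il(4z+\tau)}f(z+\frac\tau2)$; $U_a^{\otimes N}$ acts on $\mathcal{H}$.
   Formalization: Claims with T(u) are proved for η≠0, since W_0^L divides by θ_11(0)=0 at η=0; claims with Q_L, including all of (v), are proved for |η|<1/(2(2l+1)), since at the endpoints the integral defining ⟨f,f⟩ diverges for every f≠0. *)

theory Defs
  imports "HOL-Complex_Analysis.Complex_Analysis"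
begin

text \<open>
  Throughout, the natural number \<open>m\<close> stands for \<open>2 l\<close>, twice the spin.
  All symbols that depend on \<open>\<tau>\<close>, \<open>\<eta>\<close>, \<open>m\<close>, \<open>N\<close>, ... take them as explicit arguments.
\<close>

abbreviation spin :: "nat \<Rightarrow> complex"
  where "spin m \<equiv> of_nat m / 2"


subsection \<open>Theta functions\<close>

definition theta :: "nat \<Rightarrow> nat \<Rightarrow> complex \<Rightarrow> complex \<Rightarrow> complex" where
  "theta a b z \<tau> = (\<Sum>\<^sub>\<infinity>n\<in>(UNIV :: int set).
     exp (of_real pi * \<i> * (of_nat a / 2 + of_int n)\<^sup>2 * \<tau>
          + 2 * of_real pi * \<i> * (of_nat a / 2 + of_int n) * (of_nat b / 2 + z)))"

definition br :: "complex \<Rightarrow> complex \<Rightarrow> complex" where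
  "br \<tau> z = theta 1 1 z \<tau>"

definition br_fac :: "complex \<Rightarrow> real \<Rightarrow> nat \<Rightarrow> complex \<Rightarrow> complex" where
  "br_fac \<tau> \<eta> k z = (\<Prod>j<k. br \<tau> (z + 2 * of_nat j * of_real \<eta>))"

definition br_pair :: "complex \<Rightarrow> real \<Rightarrow> nat \<Rightarrow> complex \<Rightarrow> complex \<Rightarrow> complex" where
  "br_pair \<tau> \<eta> k a z = br_fac \<tau> \<eta> k (z + a) * br_fac \<tau> \<eta> k (- z + a)"


subsection \<open>The local space and its Sklyanin form\<close>

definition Theta_space :: "complex \<Rightarrow> nat \<Rightarrow> (complex \<Rightarrow> complex) set" where
  "Theta_space \<tau> m = {f. f holomorphic_on UNIV \<and>
     (\<forall>z. f (z + 1) = f z \<and> f (- z) = f z \<and>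
          f (z + \<tau>) = exp (- 4 * spin m * of_real pi * \<i> * (2 * z + \<tau>)) * f z)}"

definition sklyanin_mu :: "complex \<Rightarrow> real \<Rightarrow> nat \<Rightarrow> complex \<Rightarrow> complex \<Rightarrow> complex" where
  "sklyanin_mu \<tau> \<eta> m z w = theta 1 1 (2 * z) \<tau> * theta 1 1 (2 * w) \<tau> /
     (\<Prod>j=0..m+1. theta 0 0 (z + w + (2 * of_nat j - 2 * spin m - 1) * of_real \<eta>) \<tau>
                 * theta 0 0 (z - w + (2 * of_nat j - 2 * spin m - 1) * of_real \<eta>) \<tau>)"

text \<open>
  For purely imaginary \<open>\<tau>\<close> the upper limit \<open>\<tau>/i\<close> of the inner integral is \<open>Im \<tau>\<close>.
  At \<open>\<bar>\<eta>\<bar> = 1/(2(2l+1))\<close> the factors \<open>j = 0\<close> and \<open>j = 2l+1\<close> of the denominator produce a double zero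
  on the lines \<open>y = Im \<tau>/4\<close> and \<open>y = 3 Im \<tau>/4\<close>, the integral of \<open>\<bar>f\<bar>\<^sup>2 \<mu>\<close> diverges for every nonzero \<open>f\<close>,
  and the form does not exist.
\<close>

definition sklyanin_form ::
    "complex \<Rightarrow> real \<Rightarrow> nat \<Rightarrow> (complex \<Rightarrow> complex) \<Rightarrow> (complex \<Rightarrow> complex) \<Rightarrow> complex" where
  "sklyanin_form \<tau> \<eta> m f g =
     integral {0..1} (\<lambda>x. integral {0..Im \<tau>} (\<lambda>y.
       let z = Complex x y in cnj (f z) * g z * sklyanin_mu \<tau> \<eta> m z (cnj z)))"


subsection \<open>Tensor powers\<close>

text \<open>
  For a space \<open>V\<close> of functions of one variable, the \<open>N\<close>-th tensor power of \<open>V\<close> is realised as the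
  span of the products \<open>f\<^sub>1(z\<^sub>1) \<dots> f\<^sub>N(z\<^sub>N)\<close>, the factor with number \<open>n\<close> being
  attached to the variable \<open>z n\<close>. For \<open>N > 0\<close> scalar coefficients are absorbed in the factors.
\<close>

definition pure_tensor :: "nat \<Rightarrow> (nat \<Rightarrow> complex \<Rightarrow> complex) \<Rightarrow> (nat \<Rightarrow> complex) \<Rightarrow> complex" where
  "pure_tensor N f z = (\<Prod>n=1..N. f n (z n))"

definition tensor_power :: "nat \<Rightarrow> (complex \<Rightarrow> complex) set \<Rightarrow> ((nat \<Rightarrow> complex) \<Rightarrow> complex) set" where
  "tensor_power N V = {F. \<exists>(M :: nat) \<phi>. (\<forall>j<M. \<forall>n\<in>{1..N}. \<phi> j n \<in> V) \<and>
     F = (\<lambda>z. \<Sum>j<M. pure_tensor N (\<phi> j) z)}"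

definition op_at ::
    "nat \<Rightarrow> ((complex \<Rightarrow> complex) \<Rightarrow> (complex \<Rightarrow> complex)) \<Rightarrow>
     ((nat \<Rightarrow> complex) \<Rightarrow> complex) \<Rightarrow> ((nat \<Rightarrow> complex) \<Rightarrow> complex)" where
  "op_at n A F = (\<lambda>z. A (\<lambda>w. F (z(n := w))) (z n))"

fun op_tensor_power ::
    "nat \<Rightarrow> ((complex \<Rightarrow> complex) \<Rightarrow> (complex \<Rightarrow> complex)) \<Rightarrow>
     ((nat \<Rightarrow> complex) \<Rightarrow> complex) \<Rightarrow> ((nat \<Rightarrow> complex) \<Rightarrow> complex)" where
  "op_tensor_power 0 A = id"
| "op_tensor_power (Suc n) A = op_at (Suc n) A \<circ> op_tensor_power n A"

definition sesquilinear_on ::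
    "('a \<Rightarrow> complex) set \<Rightarrow> (('a \<Rightarrow> complex) \<Rightarrow> ('a \<Rightarrow> complex) \<Rightarrow> complex) \<Rightarrow> bool" where
  "sesquilinear_on V B \<longleftrightarrow> (\<forall>f\<in>V. \<forall>g\<in>V. \<forall>h\<in>V. \<forall>a b.
     B (\<lambda>x. a * f x + b * g x) h = cnj a * B f h + cnj b * B g h \<and>
     B h (\<lambda>x. a * f x + b * g x) = a * B h f + b * B h g)"

definition is_tensor_form ::
    "nat \<Rightarrow> (complex \<Rightarrow> complex) set \<Rightarrow> ((complex \<Rightarrow> complex) \<Rightarrow> (complex \<Rightarrow> complex) \<Rightarrow> complex) \<Rightarrow>
     (((nat \<Rightarrow> complex) \<Rightarrow> complex) \<Rightarrow> ((nat \<Rightarrow> complex) \<Rightarrow> complex) \<Rightarrow> complex) \<Rightarrow> bool" where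
  "is_tensor_form N V b B \<longleftrightarrow> sesquilinear_on (tensor_power N V) B \<and>
     (\<forall>f g. (\<forall>n\<in>{1..N}. f n \<in> V \<and> g n \<in> V) \<longrightarrow>
        B (pure_tensor N f) (pure_tensor N g) = (\<Prod>n=1..N. b (f n) (g n)))"

text \<open>The choice is immaterial: any two tensor forms agree on the tensor power.\<close>

definition tensor_form ::
    "nat \<Rightarrow> (complex \<Rightarrow> complex) set \<Rightarrow> ((complex \<Rightarrow> complex) \<Rightarrow> (complex \<Rightarrow> complex) \<Rightarrow> complex) \<Rightarrow>
     ((nat \<Rightarrow> complex) \<Rightarrow> complex) \<Rightarrow> ((nat \<Rightarrow> complex) \<Rightarrow> complex) \<Rightarrow> complex" where
  "tensor_form N V b = (SOME B. is_tensor_form N V b B)"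

text \<open>
  The \<open>N\<close>-th tensor power of \<open>\<complex>\<^bsup>2l+1\<^esup>\<close>: coordinate vectors with respect to the basis
  \<open>e\<^bsub>k N\<^esub> \<otimes> \<dots> \<otimes> e\<^bsub>k 1\<^esub>\<close>, indexed by the tuples \<open>k\<close> in \<open>index_set N m\<close>.
\<close>

definition index_set :: "nat \<Rightarrow> nat \<Rightarrow> (nat \<Rightarrow> nat) set" where
  "index_set N m = ({1..N} \<rightarrow>\<^sub>E {1..m+1})"

definition coord_space :: "nat \<Rightarrow> nat \<Rightarrow> ((nat \<Rightarrow> nat) \<Rightarrow> complex) set" where
  "coord_space N m = {v. \<forall>k. k \<notin> index_set N m \<longrightarrow> v k = 0}"

definition coord_form ::
    "nat \<Rightarrow> nat \<Rightarrow> ((nat \<Rightarrow> nat) \<Rightarrow> complex) \<Rightarrow> ((nat \<Rightarrow> nat) \<Rightarrow> complex) \<Rightarrow> complex" where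
  "coord_form N m v w = (\<Sum>k\<in>index_set N m. cnj (v k) * w k)"

text \<open>
  Adjoint of an operator \<open>A\<close> from \<open>K\<close> (with scalar product \<open>ipK\<close>) to a space with scalar product
  \<open>ipH\<close>; scalar products are conjugate-linear in the first argument.
\<close>

definition hermitian_adjoint ::
    "'k set \<Rightarrow> ('k \<Rightarrow> 'k \<Rightarrow> complex) \<Rightarrow> ('h \<Rightarrow> 'h \<Rightarrow> complex) \<Rightarrow> ('k \<Rightarrow> 'h) \<Rightarrow> 'h \<Rightarrow> 'k" where
  "hermitian_adjoint K ipK ipH A F = (THE w. w \<in> K \<and> (\<forall>v\<in>K. ipK w v = ipH F (A v)))"


subsection \<open>The Sklyanin algebra and the transfer matrix\<close>

definition pauli :: "nat \<Rightarrow> complex^2^2" where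
  "pauli a = [vector [vector [1, 0], vector [0, 1]],
              vector [vector [0, 1], vector [1, 0]],
              vector [vector [0, - \<i>], vector [\<i>, 0]],
              vector [vector [1, 0], vector [0, - 1]]] ! a"

definition theta_comp :: "nat \<Rightarrow> complex \<Rightarrow> complex \<Rightarrow> complex" where
  "theta_comp a = [theta 1 1, theta 1 0, theta 0 0, theta 0 1] ! a"

text \<open>For \<open>a = 0\<close> the denominator is \<open>\<theta>\<^sub>1\<^sub>1(\<eta>, \<tau>)\<close>, so this is meaningful only for \<open>\<eta> \<noteq> 0\<close>.\<close>

definition W_fun :: "complex \<Rightarrow> real \<Rightarrow> nat \<Rightarrow> complex \<Rightarrow> complex" where
  "W_fun \<tau> \<eta> a u = theta_comp a u \<tau> / theta_comp a (of_real \<eta>) \<tau>"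

definition s_fun :: "complex \<Rightarrow> real \<Rightarrow> nat \<Rightarrow> complex \<Rightarrow> complex" where
  "s_fun \<tau> \<eta> a z = (if a = 2 then \<i> else 1) * theta_comp a (of_real \<eta>) \<tau> * theta_comp a (2 * z) \<tau>"

text \<open>The zeros of \<open>\<theta>\<^sub>1\<^sub>1(2z, \<tau>)\<close> are removable singularities of the quotient.\<close>

definition sklyanin_rep ::
    "complex \<Rightarrow> real \<Rightarrow> nat \<Rightarrow> nat \<Rightarrow> (complex \<Rightarrow> complex) \<Rightarrow> (complex \<Rightarrow> complex)" where
  "sklyanin_rep \<tau> \<eta> m a f = remove_sings (\<lambda>z.
     (s_fun \<tau> \<eta> a (z - spin m * of_real \<eta>) * f (z + of_real \<eta>)
      - s_fun \<tau> \<eta> a (- z - spin m * of_real \<eta>) * f (z - of_real \<eta>)) / theta 1 1 (2 * z) \<tau>)"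

text \<open>Elements of \<open>\<H> \<otimes> \<complex>\<^sup>2\<close> are pairs of elements of \<open>\<H>\<close>, indexed by the type \<open>2\<close>.\<close>

definition L_op ::
    "complex \<Rightarrow> real \<Rightarrow> nat \<Rightarrow> nat \<Rightarrow> complex \<Rightarrow>
     (2 \<Rightarrow> (nat \<Rightarrow> complex) \<Rightarrow> complex) \<Rightarrow> (2 \<Rightarrow> (nat \<Rightarrow> complex) \<Rightarrow> complex)" where
  "L_op \<tau> \<eta> m n u F = (\<lambda>\<alpha> z. \<Sum>a=0..3. \<Sum>\<beta>\<in>UNIV.
     W_fun \<tau> \<eta> a u * pauli a $ \<alpha> $ \<beta> * op_at n (sklyanin_rep \<tau> \<eta> m a) (F \<beta>) z)"

fun monodromy ::
    "complex \<Rightarrow> real \<Rightarrow> nat \<Rightarrow> nat \<Rightarrow> complex \<Rightarrow>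
     (2 \<Rightarrow> (nat \<Rightarrow> complex) \<Rightarrow> complex) \<Rightarrow> (2 \<Rightarrow> (nat \<Rightarrow> complex) \<Rightarrow> complex)" where
  "monodromy \<tau> \<eta> m 0 u = id"
| "monodromy \<tau> \<eta> m (Suc n) u = L_op \<tau> \<eta> m (Suc n) u \<circ> monodromy \<tau> \<eta> m n u"

definition transfer ::
    "complex \<Rightarrow> real \<Rightarrow> nat \<Rightarrow> nat \<Rightarrow> complex \<Rightarrow>
     ((nat \<Rightarrow> complex) \<Rightarrow> complex) \<Rightarrow> ((nat \<Rightarrow> complex) \<Rightarrow> complex)" where
  "transfer \<tau> \<eta> m N u F = (\<lambda>z. \<Sum>\<alpha>\<in>UNIV.
     monodromy \<tau> \<eta> m N u (\<lambda>\<beta>. if \<beta> = \<alpha> then F else (\<lambda>_. 0)) \<alpha> z)"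

definition U1_op :: "nat \<Rightarrow> (complex \<Rightarrow> complex) \<Rightarrow> (complex \<Rightarrow> complex)" where
  "U1_op m f = (\<lambda>z. exp (of_real pi * \<i> * spin m) * f (z + 1 / 2))"

definition U3_op :: "complex \<Rightarrow> nat \<Rightarrow> (complex \<Rightarrow> complex) \<Rightarrow> (complex \<Rightarrow> complex)" where
  "U3_op \<tau> m f = (\<lambda>z. exp (of_real pi * \<i> * spin m) *
     exp (of_real pi * \<i> * spin m * (4 * z + \<tau>)) * f (z + \<tau> / 2))"


subsection \<open>The operators \<open>Q\<^sub>R\<close> and \<open>Q\<^sub>L\<close>\<close>

text \<open>The argument \<open>s\<close> is the sign \<open>1\<close> or \<open>-1\<close> in \<open>h\<^sub>\<plusminus>\<close> and \<open>f\<^sub>\<plusminus>\<close>.\<close>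

definition h_fun :: "complex \<Rightarrow> real \<Rightarrow> nat \<Rightarrow> nat \<Rightarrow> complex \<Rightarrow> complex \<Rightarrow> complex" where
  "h_fun \<tau> \<eta> m N s u = (2 * br \<tau> (u - s * (2 * spin m * of_real \<eta>))) ^ N"

definition f_fun :: "complex \<Rightarrow> real \<Rightarrow> nat \<Rightarrow> complex \<Rightarrow> complex \<Rightarrow> complex \<Rightarrow> complex \<Rightarrow> complex" where
  "f_fun \<tau> \<eta> m s x u = br_pair \<tau> \<eta> m ((s * x + u) / 2 + (- spin m + 1) * of_real \<eta>)"

text \<open>
  \<open>S_vec \<tau> \<eta> m r t i j u k\<close> is \<open>S\<^sup>i\<^sub>j(u) e\<^sub>k\<close>, where \<open>t k j\<close> is the parameter \<open>\<tau>\<^sub>k\<^sub>j\<close>.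
  The two diagonal cases overlap only for \<open>r = 1\<close>; then \<open>\<eta> = r'/(2 l)\<close> can lie in the
  prescribed interval only if \<open>\<eta> = 0\<close>, and both prescriptions give the same function.
  The indices \<open>i\<close>, \<open>j\<close> only ever range over \<open>{1..r}\<close>, which supplies the side condition on \<open>j \<plusminus> 1\<close>.
\<close>

definition S_vec ::
    "complex \<Rightarrow> real \<Rightarrow> nat \<Rightarrow> nat \<Rightarrow> (nat \<Rightarrow> nat \<Rightarrow> complex) \<Rightarrow>
     nat \<Rightarrow> nat \<Rightarrow> complex \<Rightarrow> nat \<Rightarrow> complex \<Rightarrow> complex" where
  "S_vec \<tau> \<eta> m r t i j u k = (\<lambda>z.
     if i = j + 1 then
       t k j * f_fun \<tau> \<eta> m 1 (2 * (2 * of_nat j - 1) * spin m * of_real \<eta>) u z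
     else if j = i + 1 then
       t k j * f_fun \<tau> \<eta> m (- 1) (2 * (2 * of_nat j - 1) * spin m * of_real \<eta>) u z
     else if i = 1 \<and> j = 1 then
       t k 1 * f_fun \<tau> \<eta> m (- 1) (2 * spin m * of_real \<eta>) u z
     else if i = r \<and> j = r then
       t k r * f_fun \<tau> \<eta> m 1 (2 * (2 * of_nat r - 1) * spin m * of_real \<eta>) u z
     else 0)"

definition Q_R ::
    "complex \<Rightarrow> real \<Rightarrow> nat \<Rightarrow> nat \<Rightarrow> nat \<Rightarrow> (nat \<Rightarrow> nat \<Rightarrow> complex) \<Rightarrow> complex \<Rightarrow>
     ((nat \<Rightarrow> nat) \<Rightarrow> complex) \<Rightarrow> ((nat \<Rightarrow> complex) \<Rightarrow> complex)" where
  "Q_R \<tau> \<eta> m N r t u v = (\<lambda>z. \<Sum>k\<in>index_set N m. v k *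
     (\<Sum>i\<in>({1..N} \<rightarrow>\<^sub>E {1..r}).
        pure_tensor N (\<lambda>n. S_vec \<tau> \<eta> m r t (i n) (if n = 1 then i N else i (n - 1)) u (k n)) z))"

definition Q_L ::
    "complex \<Rightarrow> real \<Rightarrow> nat \<Rightarrow> nat \<Rightarrow> nat \<Rightarrow> (nat \<Rightarrow> nat \<Rightarrow> complex) \<Rightarrow> complex \<Rightarrow>
     ((nat \<Rightarrow> complex) \<Rightarrow> complex) \<Rightarrow> ((nat \<Rightarrow> nat) \<Rightarrow> complex)" where
  "Q_L \<tau> \<eta> m N r t u =
     hermitian_adjoint (coord_space N m) (coord_form N m)
       (tensor_form N (Theta_space \<tau> m) (sklyanin_form \<tau> \<eta> m))
       (Q_R \<tau> \<eta> m N r t (- cnj u))"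

end

theory Submission imports Defs
begin

text \<open>
  The images of the basis vectors under \<open>Q\<^sub>R(u)\<close> are sums over closed paths in the chain \<open>1, \<dots>, r\<close>. A path
  contributes a product of functions \<open>phi c = [z; c]\<^bsub>2l\<^esub>\<close>, one for each site. All the properties of \<open>Q\<^sub>R\<close> and \<open>Q\<^sub>L\<close> follow from local
  properties of these functions at a single site, which are arranged so that the parts depending on the
  path cancel around a closed path.

  Part (i). Let \<open>t0 x = \<theta>\<^sub>0\<^sub>0(x, \<tau>/2)\<close> and \<open>t1 x = \<theta>\<^sub>0\<^sub>1(x, \<tau>/2)\<close>. The weights of \<open>L(u)\<close> add up to a matrix of rank
  one, a column \<open>a(x) = (t0 x, - t1 x)\<close> times a row \<open>b(y) = (t1 y, t0 y)\<close> (\<open>pauli_theta_rank_one\<close>). So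
  \<open>L(u)\<close> acts on \<open>phi c\<close> in triangular form with respect to these vectors: \<open>a(g)\<close> goes to \<open>a(g + 2l\<eta>)\<close>,
  with \<open>c\<close> shifted by \<open>-\<eta>\<close>, and the row \<open>b(g + 2l\<eta>)\<close> to \<open>b(g)\<close>, with \<open>c\<close> shifted by \<open>\<eta>\<close> (\<open>lop_column\<close>,
  \<open>lop_row\<close>). Along a path the vectors at neighbouring sites match; the reflections at the two ends of
  the chain are harmless because \<open>a\<close> and \<open>b\<close> are even and periodic and \<open>\<eta>\<close> is rational (\<open>step_vec\<close>). The
  trace of the product over the sites is the sum of two eigenvalues, and these are the two terms of the
  functional relation (\<open>transfer_Q_R\<close>).

  Part (ii). The generators \<open>\<rho>(S\<^sup>a)\<close> are self-adjoint for the Sklyanin form. A three-term theta identity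
  writes the difference of the two sides as the integral of a function that has only those poles that a
  shift of the contour does not meet, and after the shift the integrand is odd
  (\<open>rep_self_adjoint\<close>). Consequently the adjoint of \<open>T(u)\<close> is \<open>(-1)\<^sup>N T(- cnj u)\<close> (\<open>transfer_adjoint\<close>),
  and (ii) is the adjoint of (i). For \<open>|\<eta>| < 1/(2(2l+1))\<close> the form is an iterated integral of a
  continuous function, and the tensor form is obtained by integrating over all the variables.

  Part (iii). The operator \<open>Q\<^sub>L(u) Q\<^sub>R(u')\<close> has as matrix elements sums over pairs of closed paths of
  products of scalar products \<open>Phi c' c\<close> of two product functions. For \<open>\<eta> \<noteq> 0\<close> these are known explicitly:
  moving \<open>L(u)\<close> from one argument of the form to the other gives a difference equation (\<open>Phi_difference\<close>),
  the difference equation forces \<open>2l\<close> zeros (\<open>Phi_zero\<close>), and an even theta function is determined by its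
  zeros up to a constant (\<open>theta_determined_by_zeros\<close>). The result is a product of two strings of theta
  functions (\<open>Phi_formula\<close>). One of them is symmetric in the two spectral parameters. The other one
  changes under their exchange by a quotient of values of a potential on pairs of sites, which is
  compatible with the reflections at the ends, so that the quotients cancel around a pair of closed
  paths (\<open>cyclic_paths_exchange_factor\<close>). For \<open>\<eta> = 0\<close> each factor is symmetric by itself.

  Part (iv) is a direct calculation on the product functions; the multiplier of \<open>U\<^sub>3\<close> telescopes along
  closed paths, and \<open>Nl \<in> \<int>\<close> makes the constants in the adjoint relations equal to one. Part (v) is
  algebra: (iii) says that \<open>Q(u) = Q\<^sub>R(u) Q\<^sub>R(u\<^sub>0)\<^sup>-\<^sup>1\<close> is also \<open>Q\<^sub>L(u\<^sub>0)\<^sup>-\<^sup>1 Q\<^sub>L(u)\<close>, and combining the two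
  expressions gives the commutation relations.
\<close>

section \<open>Theta functions\<close>

definition theta_term :: "real \<Rightarrow> complex \<Rightarrow> complex \<Rightarrow> int \<Rightarrow> complex" where
  "theta_term \<alpha> \<tau> w n = exp (of_real pi * \<i> * (of_real \<alpha> + of_int n)\<^sup>2 * \<tau>
     + 2 * of_real pi * \<i> * (of_real \<alpha> + of_int n) * w)"

lemma theta_eq_term: "theta a b z \<tau> = (\<Sum>\<^sub>\<infinity>n. theta_term (a / 2) \<tau> (of_nat b / 2 + z) n)"
  by (simp add: theta_def theta_term_def)

lemma summable_exp_neg_abs_int: "(\<lambda>n::int. exp (- \<bar>real_of_int n\<bar>)) summable_on UNIV"
proof -
  have geo: "(\<lambda>n. exp (- real n)) summable_on UNIV"
  proof (rule norm_summable_imp_summable_on)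
    have "summable (\<lambda>n. exp (-1::real) ^ n)" by (rule summable_geometric) auto
    then show "summable (\<lambda>n. norm (exp (- real n)))"
      by (simp add: exp_of_nat_mult[symmetric])
  qed
  have "(\<lambda>n::int. exp (- \<bar>real_of_int n\<bar>)) summable_on range int"
    by (subst summable_on_reindex) (use geo in \<open>auto simp: o_def\<close>)
  moreover have "(\<lambda>n::int. exp (- \<bar>real_of_int n\<bar>)) summable_on range (\<lambda>n. - int n)"
    by (subst summable_on_reindex) (use geo in \<open>auto simp: o_def inj_on_def\<close>)
  ultimately have "(\<lambda>n::int. exp (- \<bar>real_of_int n\<bar>)) summable_on (range int \<union> range (\<lambda>n. - int n))"
    by (rule summable_on_union)
  moreover have "range int \<union> range (\<lambda>n. - int n) = UNIV"
  proof -
    have "k \<in> range int \<union> range (\<lambda>n. - int n)" for k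
      by (cases k rule: int_cases2) auto
    then show ?thesis by blast
  qed
  ultimately show ?thesis by simp
qed

text \<open>Completing the square: the Gaussian factor beats any linear exponent, uniformly in strips.\<close>

lemma norm_theta_term_le:
  assumes "Im \<tau> > 0" "\<bar>Im w\<bar> \<le> R"
  shows "norm (theta_term \<alpha> \<tau> w n) \<le>
    exp ((2 * pi * R + 1)\<^sup>2 / (4 * pi * Im \<tau>) + \<bar>\<alpha>\<bar>) * exp (- \<bar>real_of_int n\<bar>)"
proof -
  define X where "X = \<alpha> + real_of_int n"
  define t where "t = pi * Im \<tau>"
  define B where "B = 2 * pi * R + 1"
  have t: "t > 0" using assms by (simp add: t_def)
  have X: "complex_of_real \<alpha> + of_int n = of_real X" by (simp add: X_def)
  have nrm: "norm (theta_term \<alpha> \<tau> w n) = exp (- t * X\<^sup>2 - 2 * pi * X * Im w)"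
    unfolding theta_term_def X norm_exp_eq_Re by (simp add: t_def algebra_simps power2_eq_square)
  have "- 2 * pi * X * Im w \<le> 2 * pi * (\<bar>X\<bar> * R)"
  proof -
    have "- (X * Im w) \<le> \<bar>X\<bar> * \<bar>Im w\<bar>" by (metis abs_ge_minus_self abs_mult)
    also have "\<dots> \<le> \<bar>X\<bar> * R" using assms by (intro mult_left_mono) auto
    finally have "2 * pi * (- (X * Im w)) \<le> 2 * pi * (\<bar>X\<bar> * R)" by (intro mult_left_mono) auto
    then show ?thesis by simp
  qed
  moreover have "- t * X\<^sup>2 + B * \<bar>X\<bar> \<le> B\<^sup>2 / (4 * t)"
  proof -
    have "0 \<le> (2 * t * \<bar>X\<bar> - B)\<^sup>2" by simp
    also have "\<dots> = 4 * t\<^sup>2 * X\<^sup>2 - 4 * t * B * \<bar>X\<bar> + B\<^sup>2"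
      by (simp add: power2_eq_square algebra_simps)
    finally have "4 * t * (B * \<bar>X\<bar> - t * X\<^sup>2) \<le> B\<^sup>2" by (simp add: power2_eq_square algebra_simps)
    then show ?thesis using t by (simp add: field_simps)
  qed
  moreover have "\<bar>X\<bar> \<ge> \<bar>real_of_int n\<bar> - \<bar>\<alpha>\<bar>" unfolding X_def by linarith
  ultimately have "- t * X\<^sup>2 - 2 * pi * X * Im w \<le> B\<^sup>2 / (4 * t) + \<bar>\<alpha>\<bar> - \<bar>real_of_int n\<bar>"
    by (simp add: B_def algebra_simps)
  then show ?thesis unfolding nrm by (simp add: exp_add[symmetric] B_def t_def algebra_simps)
qed

lemma theta_term_abs_summable:
  assumes "Im \<tau> > 0" shows "(\<lambda>n. norm (theta_term \<alpha> \<tau> w n)) summable_on UNIV"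
  by (rule summable_on_comparison_test[OF summable_on_cmult_right[OF summable_exp_neg_abs_int]])
     (use norm_theta_term_le[OF assms order.refl] in auto)

lemma theta_term_sum_holomorphic:
  assumes "Im \<tau> > 0" shows "(\<lambda>w. \<Sum>\<^sub>\<infinity>n. theta_term \<alpha> \<tau> w n) holomorphic_on UNIV"
proof -
  have "(\<lambda>w. \<Sum>\<^sub>\<infinity>n. theta_term \<alpha> \<tau> w n) holomorphic_on ball z 1" for z
  proof (rule holomorphic_uniform_limit)
    show "uniform_limit (cball z 1) (\<lambda>X w. \<Sum>n\<in>X. theta_term \<alpha> \<tau> w n)
        (\<lambda>w. \<Sum>\<^sub>\<infinity>n. theta_term \<alpha> \<tau> w n) (finite_subsets_at_top UNIV)"
    proof (rule Weierstrass_m_test_general)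
      fix n w assume "w \<in> cball z 1"
      then have "\<bar>Im w - Im z\<bar> \<le> 1"
        using abs_Im_le_cmod[of "z - w"] by (simp add: dist_norm abs_minus_commute)
      then have "\<bar>Im w\<bar> \<le> \<bar>Im z\<bar> + 1" by linarith
      then show "norm (theta_term \<alpha> \<tau> w n) \<le>
        exp ((2 * pi * (\<bar>Im z\<bar> + 1) + 1)\<^sup>2 / (4 * pi * Im \<tau>) + \<bar>\<alpha>\<bar>) * exp (- \<bar>real_of_int n\<bar>)"
        by (rule norm_theta_term_le[OF assms])
    qed (intro summable_on_cmult_right summable_exp_neg_abs_int)
    show "\<forall>\<^sub>F X in finite_subsets_at_top UNIV.
       continuous_on (cball z 1) (\<lambda>w. \<Sum>n\<in>X. theta_term \<alpha> \<tau> w n) \<and>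
       (\<lambda>w. \<Sum>n\<in>X. theta_term \<alpha> \<tau> w n) holomorphic_on ball z 1"
      unfolding theta_term_def
      by (intro always_eventually allI conjI continuous_intros holomorphic_intros)
  qed auto
  then have "(\<lambda>w. \<Sum>\<^sub>\<infinity>n. theta_term \<alpha> \<tau> w n) field_differentiable at z" for z
    by (rule holomorphic_on_imp_differentiable_at[of _ "ball z 1"]) auto
  then show ?thesis by (simp add: holomorphic_on_def)
qed

locale lattice =
  fixes \<tau> :: complex
  assumes Re_tau: "Re \<tau> = 0" and Im_tau: "Im \<tau> > 0"
begin

abbreviation th :: "complex \<Rightarrow> complex" where "th z \<equiv> theta 0 0 z \<tau>"

lemma cnj_tau: "cnj \<tau> = - \<tau>"
  using Re_tau by (simp add: complex_eq_iff)

lemma theta_holomorphic [holomorphic_intros]: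
  assumes "f holomorphic_on A" shows "(\<lambda>z. theta a b (f z) \<tau>) holomorphic_on A"
proof -
  have "(\<lambda>w. \<Sum>\<^sub>\<infinity>n. theta_term (a / 2) \<tau> w n) \<circ> (\<lambda>z. of_nat b / 2 + f z) holomorphic_on A"
    by (rule holomorphic_on_compose_gen[OF _ theta_term_sum_holomorphic[OF Im_tau]])
       (auto intro!: holomorphic_intros assms)
  then show ?thesis by (simp add: theta_eq_term o_def)
qed

lemma theta_continuous [continuous_intros]:
  assumes "continuous_on A f" shows "continuous_on A (\<lambda>z. theta a b (f z) \<tau>)"
proof -
  have "(\<lambda>z. theta a b z \<tau>) holomorphic_on UNIV" by (intro holomorphic_intros)
  then have "continuous_on UNIV (\<lambda>z. theta a b z \<tau>)" by (rule holomorphic_on_imp_continuous_on)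
  from continuous_on_compose2[OF this assms] show ?thesis by simp
qed

lemma th_even: "th (- z) = th z"
proof -
  have "theta_term 0 \<tau> (- z) n = theta_term 0 \<tau> z (- n)" for n
    by (simp add: theta_term_def)
  then have "th (- z) = (\<Sum>\<^sub>\<infinity>n. theta_term 0 \<tau> z (- n))"
    by (simp add: theta_eq_term)
  also have "\<dots> = (\<Sum>\<^sub>\<infinity>n. theta_term 0 \<tau> z n)"
    by (rule infsum_reindex_bij_betw) (rule bij_uminus)
  finally show ?thesis by (simp add: theta_eq_term)
qed

lemma exp_2pi_int: "exp (2 * of_real pi * \<i> * of_int n) = 1"
  using exp_integer_2pi[of "of_int n"] by (simp add: mult_ac)

lemma th_1: "th (z + 1) = th z"
proof -
  have "theta_term 0 \<tau> (z + 1) n = theta_term 0 \<tau> z n" for n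
    using exp_2pi_int[of n] by (simp add: theta_term_def ring_distribs exp_add)
  then show ?thesis by (simp add: theta_eq_term)
qed

lemma th_tau: "th (z + \<tau>) = exp (- (of_real pi * \<i> * (\<tau> + 2 * z))) * th z"
proof -
  have "th (z + \<tau>) = (\<Sum>\<^sub>\<infinity>n. exp (- (of_real pi * \<i> * (\<tau> + 2 * z))) * theta_term 0 \<tau> z (n + 1))"
    by (simp add: theta_eq_term theta_term_def exp_add[symmetric] power2_eq_square algebra_simps)
  also have "\<dots> = exp (- (of_real pi * \<i> * (\<tau> + 2 * z))) * (\<Sum>\<^sub>\<infinity>n. theta_term 0 \<tau> z (n + 1))"
    by (rule infsum_cmult_right')
  also have "(\<Sum>\<^sub>\<infinity>n. theta_term 0 \<tau> z (n + 1)) = (\<Sum>\<^sub>\<infinity>n. theta_term 0 \<tau> z n)"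
    by (rule infsum_reindex_bij_betw) (rule bij_betwI[of _ _ _ "\<lambda>n. n - 1"], auto)
  finally show ?thesis by (simp add: theta_eq_term)
qed

lemma th_cnj: "cnj (th z) = th (cnj z)"
proof -
  have "cnj (theta_term 0 \<tau> z n) = theta_term 0 \<tau> (- cnj z) n" for n
    by (simp add: theta_term_def exp_cnj cnj_tau)
  then have "cnj (th z) = th (- cnj z)"
    by (simp add: theta_eq_term flip: infsum_cnj)
  then show ?thesis by (simp add: th_even)
qed

lemma theta01_eq: "theta 0 1 z \<tau> = th (z + 1/2)"
  by (simp add: theta_eq_term add.commute)

lemma theta10_eq: "theta 1 0 z \<tau> = exp (of_real pi * \<i> * (\<tau> / 4 + z)) * th (z + \<tau>/2)"
proof -
  have "theta_term (1/2) \<tau> z n = exp (of_real pi * \<i> * (\<tau> / 4 + z)) * theta_term 0 \<tau> (z + \<tau>/2) n" for n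
    by (simp add: theta_term_def exp_add[symmetric] power2_eq_square field_simps)
  then show ?thesis by (simp add: theta_eq_term infsum_cmult_right')
qed

lemma theta11_shift: "theta 1 1 z \<tau> = theta 1 0 (z + 1/2) \<tau>"
  by (simp add: theta_eq_term add.commute)

lemma theta11_eq: "theta 1 1 z \<tau> = exp (of_real pi * \<i> * (\<tau> / 4 + z + 1/2)) * th (z + (1 + \<tau>)/2)"
  by (simp add: theta11_shift theta10_eq add.assoc add_divide_distrib del: One_nat_def)

lemma th_0_nz: "th 0 \<noteq> 0"
proof -
  have T: "theta_term 0 \<tau> 0 n = of_real (exp (- (pi * Im \<tau> * (real_of_int n)\<^sup>2)))" for n
  proof -
    have "of_real pi * \<i> * (of_int n)\<^sup>2 * \<tau> = of_real (- (pi * Im \<tau> * (real_of_int n)\<^sup>2))"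
      using Re_tau by (simp add: complex_eq_iff power2_eq_square)
    then show ?thesis by (simp add: theta_term_def exp_of_real[symmetric])
  qed
  have summ: "(\<lambda>n::int. exp (- (pi * Im \<tau> * (real_of_int n)\<^sup>2))) summable_on UNIV"
    using theta_term_abs_summable[OF Im_tau, of 0 0] by (simp add: T)
  from summ have "(\<Sum>\<^sub>\<infinity>n\<in>{0::int}. exp (- (pi * Im \<tau> * (real_of_int n)\<^sup>2))) \<le>
        (\<Sum>\<^sub>\<infinity>n::int. exp (- (pi * Im \<tau> * (real_of_int n)\<^sup>2)))"
    by (intro infsum_mono2) auto
  then have "(\<Sum>\<^sub>\<infinity>n::int. exp (- (pi * Im \<tau> * (real_of_int n)\<^sup>2))) \<noteq> 0" by simp
  moreover have "th 0 = of_real (\<Sum>\<^sub>\<infinity>n::int. exp (- (pi * Im \<tau> * (real_of_int n)\<^sup>2)))"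
  proof -
    have "theta_term 0 \<tau> 0 = (\<lambda>n. of_real (exp (- (pi * Im \<tau> * (real_of_int n)\<^sup>2))))"
      using T by (rule ext)
    then show ?thesis
      using infsumI[OF has_sum_of_real[OF has_sum_infsum[OF summ]]] by (simp add: theta_eq_term)
  qed
  ultimately show ?thesis by simp
qed

end

text \<open>Sites and indices are counted from \<open>1\<close>, which must not be rewritten to \<open>Suc 0\<close>.\<close>

declare One_nat_def [simp del]

subsection \<open>Bilinear relations between theta functions\<close>

lemma infsum_times:
  fixes f g :: "'a \<Rightarrow> complex"
  assumes f: "(\<lambda>x. norm (f x)) summable_on UNIV" and g: "(\<lambda>x. norm (g x)) summable_on UNIV"
  shows "(\<lambda>(x, y). f x * g y) summable_on UNIV \<times> UNIV"
    and "infsum f UNIV * infsum g UNIV = (\<Sum>\<^sub>\<infinity>(x, y)\<in>UNIV \<times> UNIV. f x * g y)"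
proof -
  have "(\<lambda>p. norm (case p of (x, y) \<Rightarrow> f x * g y)) summable_on UNIV \<times> UNIV"
  proof (subst Infinite_Sum.abs_summable_on_Sigma_iff, intro conjI ballI)
    show "(\<lambda>y. norm (case (x, y) of (x, y) \<Rightarrow> f x * g y)) summable_on UNIV" for x
      using g by (simp add: norm_mult summable_on_cmult_right)
    show "(\<lambda>x. norm (\<Sum>\<^sub>\<infinity>y. norm (case (x, y) of (x, y) \<Rightarrow> f x * g y))) summable_on UNIV"
      using f by (simp add: norm_mult infsum_cmult_right' abs_mult summable_on_cmult_left)
  qed
  then show S: "(\<lambda>(x, y). f x * g y) summable_on UNIV \<times> UNIV" by (rule abs_summable_summable)
  have "infsum f UNIV * infsum g UNIV = (\<Sum>\<^sub>\<infinity>x. \<Sum>\<^sub>\<infinity>y. f x * g y)"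
    by (simp add: infsum_cmult_left' infsum_cmult_right')
  also have "\<dots> = (\<Sum>\<^sub>\<infinity>(x, y)\<in>UNIV \<times> UNIV. f x * g y)"
    by (rule infsum_Sigma'_banach) (rule S)
  finally show "infsum f UNIV * infsum g UNIV = (\<Sum>\<^sub>\<infinity>(x, y)\<in>UNIV \<times> UNIV. f x * g y)" .
qed

lemma int_pairs_by_parity:
  "(UNIV :: (int \<times> int) set) = range (\<lambda>(A, B). (A + B, A - B)) \<union> range (\<lambda>(A, B). (A + B + 1, A - B))"
proof -
  have "(n, k) \<in> range (\<lambda>(A, B). (A + B, A - B)) \<union> range (\<lambda>(A, B). (A + B + 1, A - B))" for n k :: int
  proof (cases "even (n + k)")
    case True
    then have "(n, k) = (\<lambda>(A, B). (A + B, A - B)) ((n + k) div 2, (n - k) div 2)"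
      by (auto elim!: evenE simp: algebra_simps) presburger+
    then show ?thesis by blast
  next
    case False
    then have "(n, k) = (\<lambda>(A, B). (A + B + 1, A - B)) ((n + k - 1) div 2, (n - k - 1) div 2)"
      by auto presburger+
    then show ?thesis by blast
  qed
  then show ?thesis by auto
qed

lemma entire_eventually_nonzero:
  assumes "f holomorphic_on UNIV" "f p \<noteq> (0::complex)"
  shows "eventually (\<lambda>w. f w \<noteq> 0) (at z)"
  using non_zero_neighbour_alt[OF assms(1) _ _ _ _ assms(2), of z] by (simp add: connected_UNIV)

context lattice
begin

interpretation half: lattice "\<tau> / 2"
  by unfold_locales (use Re_tau Im_tau in auto)

abbreviation t0 where "t0 x \<equiv> theta 0 0 x (\<tau> / 2)"
abbreviation t1 where "t1 x \<equiv> theta 0 1 x (\<tau> / 2)"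

text \<open>
  In the double series for the left-hand side the pair \<open>(n, k)\<close> is \<open>(A + B, A - B)\<close> or
  \<open>(A + B + 1, A - B)\<close>, according to the parity of \<open>n + k\<close>, and \<open>n\<^sup>2 + k\<^sup>2\<close> at modulus
  \<open>\<tau>/2\<close> becomes a sum of two squares at modulus \<open>\<tau>\<close>.
\<close>

lemma t0_t0: "t0 x * t0 y = th (x + y) * th (x - y) + theta 1 0 (x + y) \<tau> * theta 1 0 (x - y) \<tau>"
proof -
  let ?f = "\<lambda>x. theta_term 0 (\<tau> / 2) x"
  let ?g0 = "\<lambda>(A, B). (A + B, A - B) :: int \<times> int" and ?g1 = "\<lambda>(A, B). (A + B + 1, A - B) :: int \<times> int"
  let ?F = "\<lambda>(n, k). ?f x n * ?f y k"
  have abs: "(\<lambda>n. norm (theta_term \<alpha> \<sigma> w n)) summable_on UNIV" if "Im \<sigma> > 0" for \<alpha> \<sigma> w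
    using that by (rule theta_term_abs_summable)
  note abs1 = abs[OF Im_tau] and abs2 = abs[OF half.Im_tau]
  have S: "?F summable_on UNIV" using infsum_times(1)[OF abs2 abs2] by simp
  have inj: "inj ?g0" "inj ?g1" by (auto simp: inj_def)
  have disj: "range ?g0 \<inter> range ?g1 = {}" by auto presburger
  have e0: "?F (?g0 p) = (case p of (A, B) \<Rightarrow> theta_term 0 \<tau> (x + y) A * theta_term 0 \<tau> (x - y) B)" for p
  proof (cases p)
    case (Pair A B)
    have "(of_int (A + B))\<^sup>2 * (\<tau> / 2) + (of_int (A - B))\<^sup>2 * (\<tau> / 2)
       = (of_int A)\<^sup>2 * \<tau> + (of_int B)\<^sup>2 * \<tau>"
      by (simp add: power2_eq_square field_simps)
    moreover have "of_int (A + B) * x + of_int (A - B) * y = of_int A * (x + y) + of_int B * (x - y)"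
      by (simp add: field_simps)
    ultimately have "of_real pi * \<i> * (of_int (A + B))\<^sup>2 * (\<tau> / 2) + 2 * of_real pi * \<i> * of_int (A + B) * x
        + (of_real pi * \<i> * (of_int (A - B))\<^sup>2 * (\<tau> / 2) + 2 * of_real pi * \<i> * of_int (A - B) * y)
       = of_real pi * \<i> * (of_int A)\<^sup>2 * \<tau> + 2 * of_real pi * \<i> * of_int A * (x + y)
        + (of_real pi * \<i> * (of_int B)\<^sup>2 * \<tau> + 2 * of_real pi * \<i> * of_int B * (x - y))"
      by algebra
    then show ?thesis by (simp add: Pair theta_term_def exp_add[symmetric])
  qed
  have e1: "?F (?g1 p) = (case p of (A, B) \<Rightarrow> theta_term (1/2) \<tau> (x + y) A * theta_term (1/2) \<tau> (x - y) B)" for p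
  proof (cases p)
    case (Pair A B)
    have "(of_int (A + B + 1))\<^sup>2 * (\<tau> / 2) + (of_int (A - B))\<^sup>2 * (\<tau> / 2)
       = (1 / 2 + of_int A)\<^sup>2 * \<tau> + (1 / 2 + of_int B)\<^sup>2 * \<tau>"
      by (simp add: power2_eq_square field_simps)
    moreover have "of_int (A + B + 1) * x + of_int (A - B) * y
       = (1 / 2 + of_int A) * (x + y) + (1 / 2 + of_int B) * (x - y)"
      by (simp add: field_simps)
    ultimately have "of_real pi * \<i> * (of_int (A + B + 1))\<^sup>2 * (\<tau> / 2) + 2 * of_real pi * \<i> * of_int (A + B + 1) * x
        + (of_real pi * \<i> * (of_int (A - B))\<^sup>2 * (\<tau> / 2) + 2 * of_real pi * \<i> * of_int (A - B) * y)
       = of_real pi * \<i> * (1 / 2 + of_int A)\<^sup>2 * \<tau> + 2 * of_real pi * \<i> * (1 / 2 + of_int A) * (x + y)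
        + (of_real pi * \<i> * (1 / 2 + of_int B)\<^sup>2 * \<tau> + 2 * of_real pi * \<i> * (1 / 2 + of_int B) * (x - y))"
      by algebra
    then show ?thesis by (simp add: Pair theta_term_def exp_add[symmetric])
  qed
  have "t0 x * t0 y = infsum ?F UNIV"
    using infsum_times(2)[OF abs2 abs2] by (simp add: theta_eq_term)
  also have "\<dots> = infsum ?F (range ?g0) + infsum ?F (range ?g1)"
    by (subst int_pairs_by_parity, rule infsum_Un_disjoint)
       (auto intro: summable_on_subset_banach[OF S] simp: disj)
  also have "infsum ?F (range ?g0) = infsum (\<lambda>p. ?F (?g0 p)) UNIV"
    by (subst infsum_reindex[OF inj(1)]) (simp add: o_def)
  also have "infsum ?F (range ?g1) = infsum (\<lambda>p. ?F (?g1 p)) UNIV"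
    by (subst infsum_reindex[OF inj(2)]) (simp add: o_def)
  finally show ?thesis
    unfolding e0 e1 using infsum_times(2)[OF abs1 abs1, of 0 "x + y" 0 "x - y"]
       infsum_times(2)[OF abs1 abs1, of "1/2" "x + y" "1/2" "x - y"]
    by (simp add: theta_eq_term)
qed

lemma t1_eq: "t1 x = t0 (x + 1/2)" by (rule half.theta01_eq)

lemma t1_shift: "t1 (x + 1/2) = t0 x"
proof -
  have "x + 1/2 + 1/2 = x + 1" by simp
  then show ?thesis by (simp only: t1_eq half.th_1)
qed

lemma theta10_1: "theta 1 0 (z + 1) \<tau> = - theta 1 0 z \<tau>"
proof -
  have "z + 1 + \<tau>/2 = z + \<tau>/2 + 1" by simp
  then have "th (z + 1 + \<tau>/2) = th (z + \<tau>/2)" by (simp only: th_1)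
  then show ?thesis by (simp add: theta10_eq ring_distribs exp_add)
qed

lemma theta10_minus_half: "theta 1 0 (z - 1/2) \<tau> = - theta 1 1 z \<tau>"
proof -
  have "z + 1/2 = z - 1/2 + 1" by simp
  then have "theta 1 1 z \<tau> = - theta 1 0 (z - 1/2) \<tau>" by (simp only: theta11_shift theta10_1)
  then show ?thesis by simp
qed

lemma t0_t1: "t0 x * t1 y = theta 0 1 (x + y) \<tau> * theta 0 1 (x - y) \<tau> - theta 1 1 (x + y) \<tau> * theta 1 1 (x - y) \<tau>"
proof -
  have "th (x - y - 1/2) = theta 0 1 (x - y) \<tau>"
  proof -
    have "x - y + 1/2 = x - y - 1/2 + 1" by simp
    then show ?thesis by (simp only: theta01_eq th_1)
  qed
  then show ?thesis
    using t0_t0[of x "y + 1/2"] theta10_minus_half[of "x - y"]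
    by (simp add: t1_eq theta01_eq theta11_shift diff_diff_eq add.assoc)
qed

lemma t1_t0: "t1 x * t0 y = theta 0 1 (x + y) \<tau> * theta 0 1 (x - y) \<tau> + theta 1 1 (x + y) \<tau> * theta 1 1 (x - y) \<tau>"
  using t0_t0[of "x + 1/2" y]
  by (simp add: t1_eq theta01_eq theta11_shift add_diff_eq algebra_simps)

lemma t1_t1: "t1 x * t1 y = th (x + y) * th (x - y) - theta 1 0 (x + y) \<tau> * theta 1 0 (x - y) \<tau>"
  using t0_t0[of "x + 1/2" "y + 1/2"] th_1[of "x + y"] theta10_1[of "x + y"]
  by (simp add: t1_eq algebra_simps)

abbreviation sg :: "complex \<Rightarrow> complex" where "sg \<equiv> br \<tau>"

lemma sg_eq_th: "sg z = exp (of_real pi * \<i> * (\<tau> / 4 + z + 1/2)) * th (z + (1 + \<tau>)/2)"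
  unfolding br_def by (rule theta11_eq)

lemma sg_holomorphic [holomorphic_intros]:
  assumes "f holomorphic_on A" shows "(\<lambda>z. sg (f z)) holomorphic_on A"
  unfolding br_def by (intro holomorphic_intros assms)

lemma sg_continuous [continuous_intros]:
  assumes "continuous_on A f" shows "continuous_on A (\<lambda>z. sg (f z))"
  unfolding br_def by (intro continuous_intros assms)

lemma plucker: "2 * (sg (x + y) * sg (x - y)) = t1 x * t0 y - t0 x * t1 y"
  unfolding t1_t0 t0_t1 br_def by simp

lemma exp_pi_i: "exp (of_real pi * \<i>) = -1"
  using exp_pi_i by simp

lemma sg_1: "sg (z + 1) = - sg z"
  using theta10_1[of "z + 1/2"] by (simp add: br_def theta11_shift algebra_simps)

lemma sg_tau: "sg (z + \<tau>) = - exp (- (of_real pi * \<i> * (\<tau> + 2 * z))) * sg z"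
proof -
  have "sg (z + \<tau>) = exp (of_real pi * \<i> * (\<tau> / 4 + (z + \<tau>) + 1/2)) * th ((z + (1 + \<tau>)/2) + \<tau>)"
    by (simp add: sg_eq_th algebra_simps)
  also have "\<dots> = exp (of_real pi * \<i> * (\<tau> / 4 + (z + \<tau>) + 1/2)) *
     exp (- (of_real pi * \<i> * (\<tau> + 2 * (z + (1 + \<tau>)/2)))) * th (z + (1 + \<tau>)/2)"
    by (simp only: th_tau mult.assoc)
  also have "exp (of_real pi * \<i> * (\<tau> / 4 + (z + \<tau>) + 1/2)) * exp (- (of_real pi * \<i> * (\<tau> + 2 * (z + (1 + \<tau>)/2))))
      = exp (- (of_real pi * \<i>)) * (exp (- (of_real pi * \<i> * (\<tau> + 2 * z))) * exp (of_real pi * \<i> * (\<tau> / 4 + z + 1/2)))"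
    by (simp only: exp_add[symmetric]) (rule arg_cong[of _ _ exp], simp add: field_simps)
  finally show ?thesis by (simp add: sg_eq_th exp_minus exp_pi_i mult.assoc)
qed

lemma sg_odd: "sg (- z) = - sg z"
proof -
  have "sg z = exp (of_real pi * \<i> * (\<tau> / 4 + z + 1/2)) * th (((z - (1 + \<tau>)/2) + 1) + \<tau>)"
    by (simp add: sg_eq_th field_simps)
  also have "\<dots> = exp (of_real pi * \<i> * (\<tau> / 4 + z + 1/2)) *
     exp (- (of_real pi * \<i> * (\<tau> + 2 * (z - (1 + \<tau>)/2 + 1)))) * th (- (- z + (1 + \<tau>)/2))"
    by (simp only: th_tau th_1) simp
  also have "\<dots> = exp (of_real pi * \<i> * (\<tau> / 4 + z + 1/2)) *
     exp (- (of_real pi * \<i> * (\<tau> + 2 * (z - (1 + \<tau>)/2 + 1)))) * th (- z + (1 + \<tau>)/2)"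
    by (simp only: th_even)
  also have "exp (of_real pi * \<i> * (\<tau> / 4 + z + 1/2)) * exp (- (of_real pi * \<i> * (\<tau> + 2 * (z - (1 + \<tau>)/2 + 1))))
      = exp (- (of_real pi * \<i>)) * exp (of_real pi * \<i> * (\<tau> / 4 + - z + 1/2))"
    by (simp only: exp_add[symmetric]) (rule arg_cong[of _ _ exp], simp add: field_simps)
  finally show ?thesis by (simp add: sg_eq_th exp_minus exp_pi_i mult.assoc)
qed

lemma sg_0: "sg 0 = 0" using sg_odd[of 0] by simp

lemma sg_not_zero: "sg (- ((1 + \<tau>)/2)) \<noteq> 0"
  by (simp add: sg_eq_th th_0_nz)

text \<open>
  The left-hand side of \<open>plucker\<close> is a \<open>2 \<times> 2\<close> minor of the vectors \<open>(t0, t1)\<close>; the three-term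
  identity of Weierstrass is the Pluecker relation for four such vectors.
\<close>

lemma weierstrass:
  "sg (x + y) * sg (x - y) * (sg (z + w) * sg (z - w)) =
     sg (x + z) * sg (x - z) * (sg (y + w) * sg (y - w)) - sg (x + w) * sg (x - w) * (sg (y + z) * sg (y - z))"
proof -
  have W: "sg (x + y) * sg (x - y) = (t1 x * t0 y - t0 x * t1 y) / 2" for x y
    unfolding plucker[symmetric] by simp
  show ?thesis unfolding W by (simp add: field_simps)
qed

lemma t0_t1_nonzero: "t0 x \<noteq> 0 \<or> t1 x \<noteq> 0"
proof (rule ccontr)
  assume "\<not> ?thesis"
  then have z: "sg (x + y) * sg (x - y) = 0" for y using plucker[of x y] by simp
  have "eventually (\<lambda>y. sg (x + y) \<noteq> 0) (at 0)"
    by (rule entire_eventually_nonzero[where p = "- ((1 + \<tau>)/2) - x"]) (auto intro!: holomorphic_intros simp: sg_not_zero)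
  moreover have "eventually (\<lambda>y. sg (x - y) \<noteq> 0) (at 0)"
    by (rule entire_eventually_nonzero[where p = "(1 + \<tau>)/2 + x"]) (auto intro!: holomorphic_intros simp: sg_not_zero)
  ultimately have "eventually (\<lambda>y. False) (at (0::complex))"
    by eventually_elim (use z in auto)
  then show False by simp
qed

end

subsection \<open>The zeros of the odd theta function\<close>

lemma entire_derivative_zero_constant:
  assumes "\<And>z. (f has_field_derivative 0) (at z)"
  shows "f z = (f w :: complex)"
  using has_field_derivative_zero_constant[of UNIV f] assms by (metis UNIV_I convex_UNIV)

context lattice
begin

interpretation half: lattice "\<tau> / 2"
  by unfold_locales (use Re_tau Im_tau in auto)

lemma doubly_periodic_shift:
  assumes "\<And>z. f (z + 1) = f z" "\<And>z. f (z + \<tau>) = f z"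
  shows "f (z + of_int n + of_int j * \<tau>) = f z"
proof -
  have a: "f (z + of_int n) = f z" for z n
  proof (induction n rule: int_induct[where k = 0])
    case (step1 i)
    then show ?case using assms(1)[of "z + of_int i"] by (simp add: add.assoc)
  next
    case (step2 i)
    then show ?case using assms(1)[of "z + of_int (i - 1)"] by (simp add: add.assoc)
  qed simp
  have b: "f (z + of_int n * \<tau>) = f z" for z n
  proof (induction n rule: int_induct[where k = 0])
    case (step1 i)
    then show ?case using assms(2)[of "z + of_int i * \<tau>"] by (simp add: algebra_simps)
  next
    case (step2 i)
    then show ?case using assms(2)[of "z + of_int (i - 1) * \<tau>"] by (simp add: algebra_simps)
  qed simp
  show ?thesis by (simp only: a b)
qed

lemma elliptic_entire_constant:
  assumes hol: "f holomorphic_on UNIV" and per: "\<And>z. f (z + 1) = f z" "\<And>z. f (z + \<tau>) = f z"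
  shows "f z = f w"
proof -
  define R where "R = cbox 0 (Complex 1 (Im \<tau>))"
  have "f z \<in> f ` R" for z
  proof -
    define j where "j = \<lfloor>Im z / Im \<tau>\<rfloor>"
    define n where "n = \<lfloor>Re z\<rfloor>"
    define z' where "z' = z - of_int n - of_int j * \<tau>"
    have "of_int j * Im \<tau> \<le> Im z" "Im z \<le> (of_int j + 1) * Im \<tau>"
      using of_int_floor_le[of "Im z / Im \<tau>"] real_of_int_floor_add_one_ge[of "Im z / Im \<tau>"]
      unfolding j_def pos_le_divide_eq[OF Im_tau] pos_divide_le_eq[OF Im_tau] by auto
    moreover have "of_int n \<le> Re z" "Re z \<le> of_int n + 1" unfolding n_def by linarith+
    ultimately have "z' \<in> R"
      by (simp add: z'_def R_def in_cbox_complex_iff Re_tau algebra_simps)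
    moreover have "f z = f z'"
      using doubly_periodic_shift[OF per, of z' n j] by (simp add: z'_def algebra_simps)
    ultimately show ?thesis by blast
  qed
  then have "range f \<subseteq> f ` R" by blast
  moreover have "bounded (f ` R)"
    using holomorphic_on_imp_continuous_on[OF hol]
    by (intro compact_imp_bounded compact_continuous_image) (auto simp: R_def intro: continuous_on_subset)
  ultimately have "bounded (range f)" by (rule bounded_subset[rotated])
  with hol have "f constant_on UNIV" by (rule Liouville_theorem)
  then show ?thesis unfolding constant_on_def by auto
qed

lemma sg_lattice_shift: "\<exists>a b. \<forall>z. sg (z + of_int n + of_int j * \<tau>) = exp (a + b * z) * sg z"
proof -
  have one: "\<exists>a b. \<forall>z. sg (z + of_int n) = exp (a + b * z) * sg z" for n
  proof (induction n rule: int_induct[where k = 0])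
    case base
    show ?case by (rule exI[of _ 0], rule exI[of _ 0]) simp
  next
    case (step1 i)
    then obtain a b where "\<forall>z. sg (z + of_int i) = exp (a + b * z) * sg z" by blast
    then have "sg (z + of_int (i + 1)) = exp ((a + of_real pi * \<i>) + b * z) * sg z" for z
      using sg_1[of "z + of_int i"] exp_pi_i by (simp add: exp_add add.assoc)
    then show ?case by blast
  next
    case (step2 i)
    then obtain a b where "\<forall>z. sg (z + of_int i) = exp (a + b * z) * sg z" by blast
    then have "sg (z + of_int (i - 1)) = exp ((a + of_real pi * \<i>) + b * z) * sg z" for z
      using sg_1[of "z + of_int (i - 1)"] exp_pi_i by (simp add: exp_add add.assoc)
    then show ?case by blast
  qed
  have two: "\<exists>a b. \<forall>z. sg (z + of_int n * \<tau>) = exp (a + b * z) * sg z" for n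
  proof (induction n rule: int_induct[where k = 0])
    case base
    show ?case by (rule exI[of _ 0], rule exI[of _ 0]) simp
  next
    case (step1 i)
    then obtain a b where ab: "sg (z + of_int i * \<tau>) = exp (a + b * z) * sg z" for z by blast
    have "sg (z + of_int (i + 1) * \<tau>) =
       exp ((a + of_real pi * \<i> - of_real pi * \<i> * (\<tau> + 2 * of_int i * \<tau>)) + (b - 2 * of_real pi * \<i>) * z) * sg z" for z
    proof -
      have "sg (z + of_int (i + 1) * \<tau>) = exp (of_real pi * \<i>) * exp (- (of_real pi * \<i> * (\<tau> + 2 * (z + of_int i * \<tau>)))) * (exp (a + b * z) * sg z)"
      proof -
        have sh: "z + of_int (i + 1) * \<tau> = z + of_int i * \<tau> + \<tau>" by (simp add: algebra_simps)
        show ?thesis unfolding sh sg_tau ab exp_pi_i by simp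
      qed
      also have "\<dots> = exp (of_real pi * \<i>) * exp (- (of_real pi * \<i> * (\<tau> + 2 * (z + of_int i * \<tau>)))) * exp (a + b * z) * sg z"
        by (simp only: mult.assoc)
      finally show ?thesis by (simp only: exp_add[symmetric]) (simp add: algebra_simps)
    qed
    then show ?case by blast
  next
    case (step2 i)
    then obtain a b where ab: "sg (z + of_int i * \<tau>) = exp (a + b * z) * sg z" for z by blast
    have "sg (z + of_int (i - 1) * \<tau>) =
       exp ((a - of_real pi * \<i> + of_real pi * \<i> * (\<tau> + 2 * of_int (i - 1) * \<tau>)) + (b + 2 * of_real pi * \<i>) * z) * sg z" for z
    proof -
      define w where "w = z + of_int (i - 1) * \<tau>"
      define e where "e = - (of_real pi * \<i>) + of_real pi * \<i> * (\<tau> + 2 * w)"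
      have "exp (a + b * z) * sg z = sg (w + \<tau>)" unfolding w_def ab[symmetric] by (simp add: algebra_simps)
      also have "\<dots> = exp (- e) * sg w"
        unfolding sg_tau e_def by (simp add: exp_add exp_diff exp_minus exp_pi_i divide_inverse mult.commute)
      finally have "sg w = exp e * (exp (a + b * z) * sg z)" by (simp add: exp_minus)
      also have "\<dots> = exp (e + (a + b * z)) * sg z" by (simp add: exp_add)
      finally show ?thesis by (simp add: w_def e_def algebra_simps)
    qed
    then show ?case by blast
  qed
  obtain a b where ab: "sg (z + of_int n) = exp (a + b * z) * sg z" for z using one by blast
  obtain c d where cd: "sg (z + of_int j * \<tau>) = exp (c + d * z) * sg z" for z using two by blast
  have "sg (z + of_int n + of_int j * \<tau>) = exp ((c + d * of_int n + a) + (d + b) * z) * sg z" for z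
    unfolding cd ab by (simp add: exp_add algebra_simps)
  then show ?thesis by blast
qed

lemma sg_zero_lattice: "sg (of_int n + of_int j * \<tau>) = 0"
  using sg_lattice_shift[of n j] by (metis add_0 mult_zero_right sg_0)

text \<open>
  If \<open>[z\<^sub>0] = 0\<close>, the Pluecker minors say that the vectors \<open>(t0, t1)\<close> at \<open>x + z\<^sub>0\<close> and at \<open>x\<close> are
  proportional for every \<open>x\<close>. The factor of proportionality is entire without zeros and has elliptic
  logarithmic derivative, so it is exponential, and comparing its multipliers with those of \<open>t0\<close>
  and \<open>t1\<close> forces \<open>z\<^sub>0\<close> into the lattice.
\<close>

lemma sg_zero_imp_lattice:
  assumes "sg z0 = 0" shows "\<exists>n j :: int. z0 = of_int n + of_int j * \<tau>"
proof -
  have cross: "t1 (x + z0) * t0 x = t0 (x + z0) * t1 x" for x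
    using plucker[of "x + z0" x] assms by (simp add: add.commute)
  define \<rho> where "\<rho> x = (if t0 x \<noteq> 0 then t0 (x + z0) / t0 x else t1 (x + z0) / t1 x)" for x
  have rho: "\<rho> x * t0 x = t0 (x + z0)" "\<rho> x * t1 x = t1 (x + z0)" for x
    using cross[of x] t0_t1_nonzero[of x] by (auto simp: \<rho>_def field_simps)
  have rho_unique: "c = \<rho> x" if "c * t0 x = t0 (x + z0)" "c * t1 x = t1 (x + z0)" for c x
    using that rho[of x] t0_t1_nonzero[of x] by (metis mult_cancel_right)
  have rho_nz: "\<rho> x \<noteq> 0" for x
    using rho[of x] t0_t1_nonzero[of "x + z0"] by auto
  have hol0: "(\<lambda>x. t0 x) holomorphic_on A" "(\<lambda>x. t1 x) holomorphic_on A"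
     "(\<lambda>x. t0 (x + z0)) holomorphic_on A" "(\<lambda>x. t1 (x + z0)) holomorphic_on A" for A
    by (intro half.theta_holomorphic holomorphic_intros)+
  have rho_hol: "\<rho> holomorphic_on UNIV"
  proof -
    have "\<rho> field_differentiable at x" for x
    proof -
      have op: "open {y. t0 y \<noteq> 0}" "open {y. t1 y \<noteq> 0}"
        using hol0(1,2)[of UNIV, THEN holomorphic_on_imp_continuous_on]
        by (auto intro!: open_Collect_neq continuous_intros)
      have "(\<lambda>y. t0 (y + z0) / t0 y) holomorphic_on {y. t0 y \<noteq> 0}"
           "(\<lambda>y. t1 (y + z0) / t1 y) holomorphic_on {y. t1 y \<noteq> 0}"
        by (auto intro!: holomorphic_on_divide hol0)
      moreover have "\<rho> y = t0 (y + z0) / t0 y" if "t0 y \<noteq> 0" for y using that by (simp add: \<rho>_def)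
      moreover have "\<rho> y = t1 (y + z0) / t1 y" if "t1 y \<noteq> 0" for y
        using that rho(2)[of y] by (simp add: field_simps)
      ultimately have "\<rho> holomorphic_on {y. t0 y \<noteq> 0}" "\<rho> holomorphic_on {y. t1 y \<noteq> 0}"
        by (auto elim!: holomorphic_transform)
      then show ?thesis
        using t0_t1_nonzero[of x] op by (auto intro: holomorphic_on_imp_differentiable_at)
    qed
    then show ?thesis by (simp add: holomorphic_on_def)
  qed
  have rho_half: "\<rho> (x + 1/2) = \<rho> x" for x
  proof (rule rho_unique[symmetric])
    show "\<rho> x * t0 (x + 1/2) = t0 (x + 1/2 + z0)"
      using rho(2)[of x] by (simp add: t1_eq add.assoc add.commute[of _ z0])
    have "t1 (x + 1/2 + z0) = t0 (x + z0)" using t1_shift[of "x + z0"] by (simp add: algebra_simps)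
    then show "\<rho> x * t1 (x + 1/2) = t1 (x + 1/2 + z0)"
      using rho(1)[of x] by (simp only: t1_shift)
  qed
  define q where "q = exp (- (2 * of_real pi * \<i> * z0))"
  have rho_tau: "\<rho> (x + \<tau>/2) = q * \<rho> x" for x
  proof (rule rho_unique[symmetric])
    define E where "E y = exp (- (of_real pi * \<i> * (\<tau> / 2 + 2 * y)))" for y
    have E: "E (x + z0) = q * E x" by (simp add: E_def q_def exp_add[symmetric] algebra_simps)
    have t0: "t0 (y + \<tau>/2) = E y * t0 y" for y unfolding E_def by (rule half.th_tau)
    have t1: "t1 (y + \<tau>/2) = - E y * t1 y" for y
    proof -
      have "t1 (y + \<tau>/2) = t0 (y + 1/2 + \<tau>/2)" by (simp add: t1_eq algebra_simps)
      also have "\<dots> = E (y + 1/2) * t1 y" by (simp only: t0 t1_eq)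
      also have "E (y + 1/2) = - E y"
      proof -
        have "E (y + 1/2) = exp (- (of_real pi * \<i>)) * E y"
          by (simp only: E_def exp_add[symmetric]) (simp add: algebra_simps)
        then show ?thesis by (simp add: exp_minus exp_pi_i)
      qed
      finally show ?thesis .
    qed
    have sh: "x + \<tau>/2 + z0 = x + z0 + \<tau>/2" by simp
    show "q * \<rho> x * t0 (x + \<tau>/2) = t0 (x + \<tau>/2 + z0)"
      unfolding sh t0 E rho(1)[symmetric] by simp
    show "q * \<rho> x * t1 (x + \<tau>/2) = t1 (x + \<tau>/2 + z0)"
      unfolding sh t1 E rho(2)[symmetric] by simp
  qed
  have D: "(\<rho> has_field_derivative deriv \<rho> x) (at x)" for x
    using rho_hol holomorphic_derivI by blast
  define L where "L x = deriv \<rho> x / \<rho> x" for x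
  have L_hol: "L holomorphic_on UNIV"
    unfolding L_def using rho_nz by (intro holomorphic_intros rho_hol) auto
  have L_half: "L (x + 1/2) = L x" for x
  proof -
    have "((\<lambda>x. \<rho> (x + 1/2)) has_field_derivative deriv \<rho> (x + 1/2)) (at x)"
      using D[of "x + 1/2"] by (simp add: DERIV_shift)
    then have "deriv \<rho> (x + 1/2) = deriv \<rho> x"
      unfolding rho_half by (rule DERIV_unique[OF _ D])
    then show ?thesis by (simp add: L_def rho_half)
  qed
  have L_tau: "L (x + \<tau>/2) = L x" for x
  proof -
    have "((\<lambda>x. \<rho> (x + \<tau>/2)) has_field_derivative deriv \<rho> (x + \<tau>/2)) (at x)"
      using D[of "x + \<tau>/2"] by (simp add: DERIV_shift)
    moreover have "((\<lambda>x. \<rho> (x + \<tau>/2)) has_field_derivative q * deriv \<rho> x) (at x)"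
      unfolding rho_tau by (rule DERIV_cmult[OF D])
    ultimately have "deriv \<rho> (x + \<tau>/2) = q * deriv \<rho> x" by (rule DERIV_unique)
    then show ?thesis by (simp add: L_def rho_tau q_def)
  qed
  define k where "k = L 0"
  have "L x = k" for x
    unfolding k_def
  proof (rule elliptic_entire_constant[OF L_hol])
    show "L (z + 1) = L z" for z using L_half[of z] L_half[of "z + 1/2"] by (simp add: add.assoc)
    show "L (z + \<tau>) = L z" for z using L_tau[of z] L_tau[of "z + \<tau>/2"] by (simp add: add.assoc)
  qed
  then have D': "(\<rho> has_field_derivative k * \<rho> x) (at x)" for x
    using D[of x] rho_nz[of x] by (metis L_def nonzero_eq_divide_eq)
  have "((\<lambda>x. \<rho> x * exp (- (k * x))) has_field_derivative 0) (at x)" for x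
    by (rule derivative_eq_intros D' refl | simp)+
  then have "\<rho> x * exp (- (k * x)) = \<rho> 0 * exp (- (k * 0))" for x
    by (rule entire_derivative_zero_constant)
  then have "\<rho> x * exp (- (k * x)) = \<rho> 0" for x by simp
  then have rho_exp: "\<rho> x = \<rho> 0 * exp (k * x)" for x
  proof -
    have "\<rho> x = \<rho> x * exp (- (k * x)) * exp (k * x)" by (simp add: exp_minus)
    also have "\<rho> x * exp (- (k * x)) = \<rho> 0" by fact
    finally show ?thesis .
  qed
  have "exp (k / 2) = 1" using rho_half[of 0] rho_exp[of "1/2"] rho_nz[of 0] by simp
  then obtain n :: int where n: "k / 2 = \<i> * (of_int (2 * n) * pi)"
    unfolding exp_eq_1 by (auto simp: complex_eq_iff)
  have "exp (k * (\<tau> / 2)) = q" using rho_tau[of 0] rho_exp[of "\<tau>/2"] rho_nz[of 0] by simp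
  then obtain m :: int where m: "k * (\<tau> / 2) = - (2 * of_real pi * \<i> * z0) + (of_int (2 * m) * pi) * \<i>"
    unfolding q_def exp_eq by auto
  have "(2 * of_real pi * \<i>) * z0 = (2 * of_real pi * \<i>) * (of_int m + of_int (- n) * \<tau>)"
  proof -
    have "k = 4 * of_real pi * \<i> * of_int n" using n by (simp add: field_simps)
    then show ?thesis using m by (simp add: field_simps)
  qed
  then have "z0 = of_int m + of_int (- n) * \<tau>"
    by (simp only: mult_cancel_left) (auto simp del: of_int_minus)
  then show ?thesis by blast
qed

lemma sg_zero_iff: "sg z = 0 \<longleftrightarrow> (\<exists>n j :: int. z = of_int n + of_int j * \<tau>)"
  using sg_zero_imp_lattice sg_zero_lattice by blast

text \<open>
  A double zero at the origin would kill the Wronskian of \<open>t0\<close> and \<open>t1\<close>, making their quotient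
  locally constant and all the minors zero.
\<close>

lemma deriv_sg_0: "deriv sg 0 \<noteq> 0"
proof
  assume d0: "deriv sg 0 = 0"
  have hol: "sg holomorphic_on UNIV" by (intro holomorphic_intros)
  have Ds: "(sg has_field_derivative deriv sg x) (at x)" for x using hol holomorphic_derivI by blast
  have hol0: "(\<lambda>x. t0 x) holomorphic_on UNIV" "(\<lambda>x. t1 x) holomorphic_on UNIV"
    by (intro half.theta_holomorphic holomorphic_intros)+
  have D0: "(t0 has_field_derivative deriv t0 x) (at x)" and D1: "(t1 has_field_derivative deriv t1 x) (at x)" for x
    using hol0[THEN holomorphic_derivI, OF open_UNIV] by auto
  have W: "deriv t1 y * t0 y = deriv t0 y * t1 y" for y
  proof -
    have "((\<lambda>x. t1 x * t0 y - t0 x * t1 y) has_field_derivative (deriv t1 y * t0 y - deriv t0 y * t1 y)) (at y)"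
      by (intro derivative_intros DERIV_cmult_right D0 D1)
    moreover have "((\<lambda>x. 2 * (sg (x + y) * sg (x - y))) has_field_derivative
        2 * (deriv sg (y + y) * sg (y - y) + deriv sg (y - y) * sg (y + y))) (at y)"
    proof -
      have a: "((\<lambda>x. sg (x + y)) has_field_derivative deriv sg (y + y)) (at y)"
        by (rule iffD1[OF DERIV_shift Ds])
      have b: "((\<lambda>x. sg (x - y)) has_field_derivative deriv sg (y - y)) (at y)"
        using iffD1[OF DERIV_shift Ds[of "y + - y"]] by simp
      show ?thesis by (rule DERIV_cmult[OF DERIV_mult[OF a b]])
    qed
    ultimately have "deriv t1 y * t0 y - deriv t0 y * t1 y = 2 * (deriv sg (y + y) * sg (y - y) + deriv sg (y - y) * sg (y + y))"
      unfolding plucker by (rule DERIV_unique)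
    then show ?thesis using d0 by (simp add: sg_0)
  qed
  obtain y where y: "t0 y \<noteq> 0"
    using half.th_0_nz by blast
  have "open {y. t0 y \<noteq> 0}"
    using hol0(1)[THEN holomorphic_on_imp_continuous_on] by (auto intro!: open_Collect_neq continuous_intros)
  then obtain e where e: "e > 0" "ball y e \<subseteq> {y. t0 y \<noteq> 0}" using y by (metis mem_Collect_eq openE)
  have "((\<lambda>x. t1 x / t0 x) has_field_derivative 0) (at x within ball y e)" if "x \<in> ball y e" for x
  proof -
    have "((\<lambda>x. t1 x / t0 x) has_field_derivative (deriv t1 x * t0 x - t1 x * deriv t0 x) / (t0 x * t0 x)) (at x)"
      by (rule DERIV_divide[OF D1 D0]) (use that e in auto)
    then show ?thesis using W[of x] by (simp add: has_field_derivative_at_within mult.commute)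
  qed
  then have "\<exists>c. \<forall>x\<in>ball y e. t1 x / t0 x = c"
    by (rule has_field_derivative_zero_constant[OF convex_ball])
  then obtain c where c: "\<And>x. x \<in> ball y e \<Longrightarrow> t1 x / t0 x = c" by blast
  have z: "sg (x + y) * sg (x - y) = 0" if "x \<in> ball y e" for x
  proof -
    have "t1 x / t0 x = t1 y / t0 y" using c[OF that] c[of y] e by simp
    then have "t1 x * t0 y - t0 x * t1 y = 0" using that e y by (auto simp: field_simps)
    then show ?thesis unfolding plucker[symmetric] by simp
  qed
  have "eventually (\<lambda>x. sg (x + y) \<noteq> 0) (at y)"
    by (rule entire_eventually_nonzero[where p = "- ((1 + \<tau>)/2) - y"]) (auto intro!: holomorphic_intros simp: sg_not_zero)
  moreover have "eventually (\<lambda>x. sg (x - y) \<noteq> 0) (at y)"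
    by (rule entire_eventually_nonzero[where p = "- ((1 + \<tau>)/2) + y"]) (auto intro!: holomorphic_intros simp: sg_not_zero)
  moreover have "eventually (\<lambda>x. x \<in> ball y e) (at y)"
    using e by (intro eventually_at_in_open') auto
  ultimately have "eventually (\<lambda>y. False) (at y)"
    by eventually_elim (use z in auto)
  then show False by simp
qed

lemma deriv_sg_nonzero:
  assumes "sg z = 0" shows "deriv sg z \<noteq> 0"
proof -
  obtain n j :: int where z: "z = of_int n + of_int j * \<tau>" using assms sg_zero_iff by blast
  obtain a b where ab: "sg (w + of_int n + of_int j * \<tau>) = exp (a + b * w) * sg w" for w
    using sg_lattice_shift[of n j] by blast
  have hol: "sg holomorphic_on UNIV" by (intro holomorphic_intros)
  have Ds: "(sg has_field_derivative deriv sg x) (at x)" for x using hol holomorphic_derivI by blast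
  have "((\<lambda>w. sg (w + z)) has_field_derivative deriv sg z) (at 0)"
    using iffD1[OF DERIV_shift Ds[of "0 + z"]] by simp
  moreover have "((\<lambda>w. exp (a + b * w) * sg w) has_field_derivative exp (a + b * 0) * deriv sg 0) (at 0)"
    by (rule derivative_eq_intros Ds refl | simp add: sg_0)+
  moreover have "(\<lambda>w. sg (w + z)) = (\<lambda>w. exp (a + b * w) * sg w)"
    by (simp add: z ab[symmetric] add.assoc)
  ultimately have "deriv sg z = exp (a + b * 0) * deriv sg 0" by (metis DERIV_unique)
  then show ?thesis using deriv_sg_0 by simp
qed

end

subsection \<open>Dividing entire functions\<close>

lemma entire_cancel:
  assumes "h1 holomorphic_on UNIV" "h2 holomorphic_on UNIV" "d holomorphic_on UNIV" "d p \<noteq> (0::complex)"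
    and eq: "\<And>z. h1 z * d z = h2 z * d z"
  shows "h1 = h2"
proof
  fix z
  have ev: "eventually (\<lambda>w. h1 w = h2 w) (at z)"
    using entire_eventually_nonzero[OF assms(3,4), of z] by eventually_elim (use eq in auto)
  have "h1 \<midarrow>z\<rightarrow> h1 z" "h2 \<midarrow>z\<rightarrow> h2 z"
    using assms(1,2)[THEN holomorphic_on_imp_continuous_on]
    by (auto simp: continuous_on_eq_continuous_at isCont_def)
  then show "h1 z = h2 z"
    using tendsto_cong[OF ev, of "h1 z"] LIM_unique by blast
qed

text \<open>Near a simple zero of the denominator, numerator and denominator are both divided by \<open>z - z\<^sub>0\<close>.\<close>

lemma entire_quotient:
  assumes g: "g holomorphic_on UNIV" and d: "d holomorphic_on UNIV" "d p \<noteq> (0::complex)"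
    and simple: "\<And>z. d z = 0 \<Longrightarrow> deriv d z \<noteq> 0" and zero: "\<And>z. d z = 0 \<Longrightarrow> g z = 0"
  shows "remove_sings (\<lambda>z. g z / d z) holomorphic_on UNIV"
    and "remove_sings (\<lambda>z. g z / d z) z * d z = g z"
proof -
  define h where "h z = (if d z = 0 then deriv g z / deriv d z else g z / d z)" for z
  have nz: "eventually (\<lambda>w. d w \<noteq> 0) (at z)" for z by (rule entire_eventually_nonzero[OF d])
  have "h field_differentiable at z" for z
  proof -
    obtain r where r: "r > 0" "\<And>w. w \<in> ball z r - {z} \<Longrightarrow> d w \<noteq> 0"
      using nz[of z] unfolding eventually_at by (auto simp: dist_commute)
    define G where "G w = (if w = z then deriv g z else (g w - g z) / (w - z))" for w
    define D where "D w = (if w = z then deriv d z else (d w - d z) / (w - z))" for w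
    have G: "G holomorphic_on ball z r" and D: "D holomorphic_on ball z r"
      unfolding G_def D_def using r by (intro pole_lemma holomorphic_on_subset[OF g] holomorphic_on_subset[OF d(1)]; simp)+
    have dn: "d field_differentiable at z" and gn: "g field_differentiable at z"
      using d g by (auto simp: holomorphic_on_def)
    show ?thesis
    proof (cases "d z = 0")
      case True
      then have "h w = G w / D w" if "w \<in> ball z r" for w
        using that zero r(2)[of w] by (auto simp: h_def G_def D_def field_simps)
      moreover have "D w \<noteq> 0" if "w \<in> ball z r" for w
        using that True simple[of z] r(2)[of w] by (auto simp: D_def)
      then have "(\<lambda>w. G w / D w) holomorphic_on ball z r"
        using G D by (intro holomorphic_on_divide) auto
      ultimately have "h holomorphic_on ball z r" by (elim holomorphic_transform) auto
      then show ?thesis using r by (intro holomorphic_on_imp_differentiable_at) auto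
    next
      case False
      have "open {w. d w \<noteq> 0}"
        using d(1)[THEN holomorphic_on_imp_continuous_on] by (auto intro!: open_Collect_neq continuous_intros)
      moreover have "h holomorphic_on {w. d w \<noteq> 0}"
      proof (rule holomorphic_transform)
        show "(\<lambda>w. g w / d w) holomorphic_on {w. d w \<noteq> 0}"
          by (intro holomorphic_on_divide holomorphic_on_subset[OF g] holomorphic_on_subset[OF d(1)]) auto
      qed (simp add: h_def)
      ultimately show ?thesis using False by (intro holomorphic_on_imp_differentiable_at) auto
    qed
  qed
  then have h: "h holomorphic_on UNIV" by (simp add: holomorphic_on_def)
  have "remove_sings (\<lambda>z. g z / d z) z = h z" for z
  proof (rule remove_sings_eqI)
    have "h \<midarrow>z\<rightarrow> h z"
      using h[THEN holomorphic_on_imp_continuous_on] by (auto simp: continuous_on_eq_continuous_at isCont_def)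
    moreover have "eventually (\<lambda>w. h w = g w / d w) (at z)"
      using nz[of z] by eventually_elim (simp add: h_def)
    ultimately show "(\<lambda>z. g z / d z) \<midarrow>z\<rightarrow> h z" by (rule Lim_transform_eventually)
  qed
  then have eq: "remove_sings (\<lambda>z. g z / d z) = h" by blast
  show "remove_sings (\<lambda>z. g z / d z) holomorphic_on UNIV" unfolding eq by (rule h)
  show "remove_sings (\<lambda>z. g z / d z) z * d z = g z" unfolding eq by (simp add: h_def zero)
qed

section \<open>The representation of the Sklyanin algebra\<close>

definition linear_operator_on :: "(complex \<Rightarrow> complex) set \<Rightarrow> ((complex \<Rightarrow> complex) \<Rightarrow> (complex \<Rightarrow> complex)) \<Rightarrow> bool" where
  "linear_operator_on V A \<longleftrightarrow> (\<forall>f\<in>V. A f \<in> V) \<and>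
     (\<forall>f\<in>V. \<forall>g\<in>V. \<forall>a b. A (\<lambda>z. a * f z + b * g z) = (\<lambda>z. a * A f z + b * A g z))"

context lattice
begin

lemma sg_minus_1: "sg (z - 1) = - sg z" using sg_1[of "z - 1"] by simp

lemma sg_minus_tau: "sg (z - \<tau>) = - exp (of_real pi * \<i> * (2 * z - \<tau>)) * sg z"
proof -
  have "sg z = - exp (- (of_real pi * \<i> * (2 * z - \<tau>))) * sg (z - \<tau>)"
    using sg_tau[of "z - \<tau>"] by (simp add: algebra_simps)
  then show ?thesis by (simp add: exp_minus)
qed

lemma sg_cnj: "cnj (sg z) = sg (cnj z)"
proof -
  have "th (cnj z + (1 + \<tau>)/2) = exp (- (of_real pi * \<i> * (2 * cnj z + 1))) * th (cnj z + (1 - \<tau>)/2)"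
  proof -
    have sh: "cnj z + (1 + \<tau>)/2 = cnj z + (1 - \<tau>)/2 + \<tau>" by (simp add: field_simps)
    have "\<tau> + 2 * (cnj z + (1 - \<tau>)/2) = 2 * cnj z + 1" by (simp add: field_simps)
    then show ?thesis by (simp only: sh th_tau)
  qed
  then have "sg (cnj z) = exp (of_real pi * \<i> * (\<tau> / 4 + cnj z + 1/2)) * exp (- (of_real pi * \<i> * (2 * cnj z + 1))) * th (cnj z + (1 - \<tau>)/2)"
    by (simp add: sg_eq_th)
  also have "\<dots> = exp (- (of_real pi * \<i> * (- \<tau> / 4 + cnj z + 1/2))) * th (cnj z + (1 - \<tau>)/2)"
    by (simp only: exp_add[symmetric]) (simp add: algebra_simps)
  also have "\<dots> = cnj (sg z)"
    by (simp add: sg_eq_th exp_cnj th_cnj cnj_tau)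
  finally show ?thesis ..
qed

abbreviation thc :: "nat \<Rightarrow> complex \<Rightarrow> complex" where "thc a z \<equiv> theta_comp a z \<tau>"

lemma thc_simps: "thc 0 z = sg z" "thc 1 z = sg (z - 1/2)" "thc 2 z = th z" "thc 3 z = th (z + 1/2)"
  "thc (Suc 0) z = sg (z - 1/2)"
proof -
  have "thc (Suc 0) z = theta 1 0 z \<tau>" by (simp add: theta_comp_def)
  also have "\<dots> = sg (z - 1/2)" by (simp add: br_def theta11_shift)
  finally show *: "thc (Suc 0) z = sg (z - 1/2)" .
  then show "thc 1 z = sg (z - 1/2)" by (simp add: One_nat_def)
qed (simp_all add: theta_comp_def br_def theta01_eq numeral_2_eq_2 numeral_3_eq_3)

lemma le_3_iff: "a \<le> (3::nat) \<longleftrightarrow> a = 0 \<or> a = 1 \<or> a = 2 \<or> a = 3"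
  by linarith

text \<open>
  The parity of \<open>\<theta>\<^sub>1\<^sub>1\<close>, \<open>\<theta>\<^sub>1\<^sub>0\<close>, \<open>\<theta>\<^sub>0\<^sub>0\<close>, \<open>\<theta>\<^sub>0\<^sub>1\<close>.
\<close>

definition par :: "nat \<Rightarrow> complex" where "par a = (if a = 0 then -1 else 1)"

lemma thc_holomorphic [holomorphic_intros]:
  assumes "a \<le> 3" "f holomorphic_on A" shows "(\<lambda>z. thc a (f z)) holomorphic_on A"
  using assms unfolding le_3_iff by (auto simp: thc_simps intro!: holomorphic_intros)

lemma thc_minus: assumes "a \<le> 3" shows "thc a (- z) = par a * thc a z"
proof -
  have "sg (- z - 1/2) = sg (z - 1/2)"
    using sg_odd[of "z + 1/2"] sg_1[of "z - 1/2"] by (simp add: algebra_simps)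
  moreover have "th (- z + 1/2) = th (z + 1/2)"
    using th_even[of "z - 1/2"] th_1[of "z - 1/2"] by (simp add: algebra_simps)
  ultimately show ?thesis
    using assms unfolding le_3_iff by (elim disjE) (simp_all add: thc_simps par_def sg_odd th_even)
qed

lemma thc_cnj: assumes "a \<le> 3" shows "cnj (thc a z) = thc a (cnj z)"
  using assms unfolding le_3_iff by (elim disjE) (simp_all add: thc_simps sg_cnj th_cnj)

lemma thc_2: assumes "a \<le> 3" shows "thc a (z + 2) = thc a z"
proof -
  have "sg (z + 2) = sg z" "th (z + 2) = th z" for z
    using sg_1[of "z + 1"] sg_1[of z] th_1[of "z + 1"] th_1[of z] by (simp_all add: add.assoc)
  then have "sg (z + 2 - 1/2) = sg (z - 1/2)" "th (z + 2 + 1/2) = th (z + 1/2)" "sg (z + 2) = sg z" "th (z + 2) = th z"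
    by (metis add_diff_eq add.commute add.left_commute)+
  then show ?thesis
    using assms unfolding le_3_iff by (elim disjE) (simp_all only: thc_simps)
qed

lemma thc_2tau: assumes "a \<le> 3" shows "thc a (z + 2 * \<tau>) = exp (- (4 * of_real pi * \<i> * (\<tau> + z))) * thc a z"
proof -
  have e: "exp (- (of_real pi * \<i> * (\<tau> + 2 * (z + \<tau>)))) * exp (- (of_real pi * \<i> * (\<tau> + 2 * z))) = exp (- (4 * of_real pi * \<i> * (\<tau> + z)))" for z
    by (simp only: exp_add[symmetric]) (simp add: algebra_simps)
  have s: "sg (z + 2 * \<tau>) = exp (- (4 * of_real pi * \<i> * (\<tau> + z))) * sg z"
      and t: "th (z + 2 * \<tau>) = exp (- (4 * of_real pi * \<i> * (\<tau> + z))) * th z" for z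
    using sg_tau[of "z + \<tau>"] sg_tau[of z] th_tau[of "z + \<tau>"] th_tau[of z]
    by (simp_all add: add.assoc e[symmetric])
  have h: "exp (- (4 * of_real pi * \<i> * (\<tau> + (z - 1/2)))) = exp (- (4 * of_real pi * \<i> * (\<tau> + z)))" for z
  proof -
    have "exp (- (4 * of_real pi * \<i> * (\<tau> + (z - 1/2)))) = exp (2 * of_real pi * \<i> * of_int 1) * exp (- (4 * of_real pi * \<i> * (\<tau> + z)))"
      by (simp only: exp_add[symmetric]) (simp add: algebra_simps)
    then show ?thesis unfolding exp_2pi_int by simp
  qed
  have h': "exp (- (4 * of_real pi * \<i> * (\<tau> + (z + 1/2)))) = exp (- (4 * of_real pi * \<i> * (\<tau> + z)))" for z
    using h[of "z + 1/2"] by simp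
  have "z + 2 * \<tau> - 1/2 = z - 1/2 + 2 * \<tau>" "z + 2 * \<tau> + 1/2 = z + 1/2 + 2 * \<tau>" by simp_all
  then show ?thesis
    using assms unfolding le_3_iff by (elim disjE) (simp_all only: thc_simps s t h h')
qed

lemma sg_2_not_zero: "sg (2 * (- ((1 + \<tau>)/4))) \<noteq> 0"
proof -
  have "2 * (- ((1 + \<tau>)/4)) = - ((1 + \<tau>)/2)" by (simp add: field_simps)
  then show ?thesis by (simp only: sg_not_zero) simp
qed

end

locale sklyanin = lattice +
  fixes \<eta> :: real and m :: nat
begin

abbreviation V where "V \<equiv> Theta_space \<tau> m"

lemma V_I:
  assumes "f holomorphic_on UNIV" "\<And>z. f (z + 1) = f z" "\<And>z. f (- z) = f z"
    "\<And>z. f (z + \<tau>) = exp (- 4 * spin m * of_real pi * \<i> * (2 * z + \<tau>)) * f z"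
  shows "f \<in> V"
  using assms by (simp add: Theta_space_def)

lemma V_D:
  assumes "f \<in> V"
  shows "f holomorphic_on UNIV" "f (z + 1) = f z" "f (- z) = f z"
    "f (z + \<tau>) = exp (- 4 * spin m * of_real pi * \<i> * (2 * z + \<tau>)) * f z"
  using assms by (auto simp: Theta_space_def)

lemma V_holomorphic: "f \<in> V \<Longrightarrow> g holomorphic_on A \<Longrightarrow> (\<lambda>z. f (g z)) holomorphic_on A"
  using holomorphic_on_compose_gen[of g A f UNIV] V_D(1)[of f] by (auto simp: o_def)

lemma V_lin: assumes "f \<in> V" "g \<in> V" shows "(\<lambda>z. a * f z + b * g z) \<in> V"
proof (rule V_I)
  show "(\<lambda>z. a * f z + b * g z) holomorphic_on UNIV"
    by (intro holomorphic_intros V_D(1) assms)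
qed (simp_all add: V_D[OF assms(1)] V_D[OF assms(2)] algebra_simps)

lemma V_zero: "(\<lambda>z. 0) \<in> V" by (rule V_I) auto

lemma V_sum: assumes "\<And>i. i \<in> I \<Longrightarrow> f i \<in> V" shows "(\<lambda>z. \<Sum>i\<in>I. f i z) \<in> V"
  using assms
proof (induction I rule: infinite_finite_induct)
  case (insert x F)
  then show ?case using V_lin[of "f x" "\<lambda>z. \<Sum>i\<in>F. f i z" 1 1] by simp
qed (auto simp: V_zero)

lemma V_scale: "f \<in> V \<Longrightarrow> (\<lambda>z. a * f z) \<in> V" using V_lin[of f f a 0] by simp

lemma br_pair_eq: "br_pair \<tau> \<eta> k a z = (\<Prod>j<k. sg (z + a + 2 * of_nat j * of_real \<eta>) * sg (- z + a + 2 * of_nat j * of_real \<eta>))"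
  by (simp add: br_pair_def br_fac_def prod.distrib)

lemma br_pair_in_V: "br_pair \<tau> \<eta> m a \<in> V"
proof (rule V_I)
  let ?a = "\<lambda>j. a + 2 * of_nat j * of_real \<eta>"
  show "br_pair \<tau> \<eta> m a holomorphic_on UNIV"
    unfolding br_pair_eq[abs_def] by (intro holomorphic_intros)
  fix z
  show "br_pair \<tau> \<eta> m a (- z) = br_pair \<tau> \<eta> m a z"
    unfolding br_pair_eq by (rule prod.cong) (auto simp: mult.commute)
  show "br_pair \<tau> \<eta> m a (z + 1) = br_pair \<tau> \<eta> m a z"
    unfolding br_pair_eq
  proof (rule prod.cong)
    fix j
    show "sg (z + 1 + a + 2 * of_nat j * of_real \<eta>) * sg (- (z + 1) + a + 2 * of_nat j * of_real \<eta>) =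
       sg (z + a + 2 * of_nat j * of_real \<eta>) * sg (- z + a + 2 * of_nat j * of_real \<eta>)"
      using sg_1[of "z + ?a j"] sg_minus_1[of "- z + ?a j"] by (simp add: algebra_simps)
  qed simp
  define E where "E = exp (- 2 * of_real pi * \<i> * (2 * z + \<tau>))"
  have "br_pair \<tau> \<eta> m a (z + \<tau>) = (\<Prod>j<m. E * (sg (z + a + 2 * of_nat j * of_real \<eta>) * sg (- z + a + 2 * of_nat j * of_real \<eta>)))"
    unfolding br_pair_eq
  proof (rule prod.cong)
    fix j
    have f1: "sg (z + \<tau> + a + 2 * of_nat j * of_real \<eta>) = - exp (- (of_real pi * \<i> * (\<tau> + 2 * (z + ?a j)))) * sg (z + ?a j)"
      using sg_tau[of "z + ?a j"] by (simp add: add_ac)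
    have f2: "sg (- (z + \<tau>) + a + 2 * of_nat j * of_real \<eta>) = - exp (of_real pi * \<i> * (2 * (- z + ?a j) - \<tau>)) * sg (- z + ?a j)"
      using sg_minus_tau[of "- z + ?a j"] by (simp add: algebra_simps)
    have f3: "exp (- (of_real pi * \<i> * (\<tau> + 2 * (z + ?a j)))) * exp (of_real pi * \<i> * (2 * (- z + ?a j) - \<tau>)) = E"
      unfolding E_def by (simp only: exp_add[symmetric]) (simp add: algebra_simps)
    show "sg (z + \<tau> + a + 2 * of_nat j * of_real \<eta>) * sg (- (z + \<tau>) + a + 2 * of_nat j * of_real \<eta>) =
       E * (sg (z + a + 2 * of_nat j * of_real \<eta>) * sg (- z + a + 2 * of_nat j * of_real \<eta>))"
      proof -
      have "- z + a + 2 * of_nat j * of_real \<eta> = - z + ?a j" "z + a + 2 * of_nat j * of_real \<eta> = z + ?a j" by simp_all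
      then show ?thesis unfolding f1 f2 f3[symmetric] by (simp only:) simp
    qed
  qed simp
  also have "\<dots> = E ^ m * br_pair \<tau> \<eta> m a z"
    by (simp only: prod.distrib br_pair_eq) simp
  also have "E ^ m = exp (- 4 * spin m * of_real pi * \<i> * (2 * z + \<tau>))"
    by (simp add: E_def exp_of_nat_mult[symmetric] algebra_simps)
  finally show "br_pair \<tau> \<eta> m a (z + \<tau>) = exp (- 4 * spin m * of_real pi * \<i> * (2 * z + \<tau>)) * br_pair \<tau> \<eta> m a z" .
qed

abbreviation h\<eta> :: complex where "h\<eta> \<equiv> of_real \<eta>"

text \<open>The first summand of the numerator of \<open>\<rho>(S\<^sup>a)f\<close>; the second one is its reflection.\<close>

definition rep_half :: "nat \<Rightarrow> (complex \<Rightarrow> complex) \<Rightarrow> complex \<Rightarrow> complex" where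
  "rep_half a f z = s_fun \<tau> \<eta> a (z - spin m * h\<eta>) * f (z + h\<eta>)"

abbreviation "rep \<equiv> sklyanin_rep \<tau> \<eta> m"

lemma rep_eq: assumes "f \<in> V"
  shows "rep a f = remove_sings (\<lambda>z. (rep_half a f z - rep_half a f (- z)) / sg (2 * z))"
proof -
  have "f (z - h\<eta>) = f (- z + h\<eta>)" for z using V_D(3)[OF assms, of "z - h\<eta>"] by simp
  then show ?thesis by (simp add: sklyanin_rep_def rep_half_def br_def)
qed

lemma rep_half_1: assumes "f \<in> V" "a \<le> 3" shows "rep_half a f (z + 1) = rep_half a f z"
  using V_D(2)[OF assms(1), of "z + h\<eta>"] thc_2[OF assms(2), of "2 * (z - spin m * h\<eta>)"]
  by (simp add: rep_half_def s_fun_def algebra_simps)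

lemma rep_half_tau: assumes "f \<in> V" "a \<le> 3"
  shows "rep_half a f (z + \<tau>) = exp (- (2 * of_nat (m + 2) * of_real pi * \<i> * (2 * z + \<tau>))) * rep_half a f z"
proof -
  have "rep_half a f (z + \<tau>) = s_fun \<tau> \<eta> a (z + \<tau> - spin m * h\<eta>) * f (z + h\<eta> + \<tau>)"
    by (simp add: rep_half_def add_ac)
  also have "f (z + h\<eta> + \<tau>) = exp (- 4 * spin m * of_real pi * \<i> * (2 * (z + h\<eta>) + \<tau>)) * f (z + h\<eta>)"
    by (rule V_D(4)[OF assms(1)])
  also have "s_fun \<tau> \<eta> a (z + \<tau> - spin m * h\<eta>) =
     exp (- (4 * of_real pi * \<i> * (\<tau> + 2 * (z - spin m * h\<eta>)))) * s_fun \<tau> \<eta> a (z - spin m * h\<eta>)"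
    using thc_2tau[OF assms(2), of "2 * (z - spin m * h\<eta>)"] by (simp add: s_fun_def algebra_simps)
  also have "exp (- (4 * of_real pi * \<i> * (\<tau> + 2 * (z - spin m * h\<eta>)))) * s_fun \<tau> \<eta> a (z - spin m * h\<eta>) *
       (exp (- 4 * spin m * of_real pi * \<i> * (2 * (z + h\<eta>) + \<tau>)) * f (z + h\<eta>)) =
     (exp (- (4 * of_real pi * \<i> * (\<tau> + 2 * (z - spin m * h\<eta>)))) * exp (- 4 * spin m * of_real pi * \<i> * (2 * (z + h\<eta>) + \<tau>))) *
       rep_half a f z" by (simp add: rep_half_def)
  also have "exp (- (4 * of_real pi * \<i> * (\<tau> + 2 * (z - spin m * h\<eta>)))) * exp (- 4 * spin m * of_real pi * \<i> * (2 * (z + h\<eta>) + \<tau>)) =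
      exp (- (2 * of_nat (m + 2) * of_real pi * \<i> * (2 * z + \<tau>)))"
    by (simp only: exp_add[symmetric]) (simp add: algebra_simps)
  finally show ?thesis .
qed

lemma rep_half_lattice: assumes "f \<in> V" "a \<le> 3"
  shows "rep_half a f (z + of_int n + of_int j * \<tau>) =
    exp (- (2 * of_nat (m + 2) * of_real pi * \<i> * of_int j * (2 * z + of_int j * \<tau>))) * rep_half a f z"
proof -
  have one: "rep_half a f (z + of_int n) = rep_half a f z" for z n
  proof (induction n rule: int_induct[where k = 0])
    case (step1 i)
    then show ?case using rep_half_1[OF assms, of "z + of_int i"] by (simp add: add.assoc)
  next
    case (step2 i)
    then show ?case using rep_half_1[OF assms, of "z + of_int (i - 1)"] by (simp add: add.assoc)
  qed simp
  let ?e = "\<lambda>z j. exp (- (2 * of_nat (m + 2) * of_real pi * \<i> * of_int j * (2 * z + of_int j * \<tau>)))"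
  let ?e1 = "\<lambda>z. exp (- (2 * of_nat (m + 2) * of_real pi * \<i> * (2 * z + \<tau>)))"
  have comb: "?e1 (z + of_int i * \<tau>) * ?e z i = ?e z (i + 1)" for z i
    by (simp only: exp_add[symmetric]) (simp add: algebra_simps)
  have two: "rep_half a f (z + of_int j * \<tau>) = ?e z j * rep_half a f z" for z
  proof (induction j rule: int_induct[where k = 0])
    case (step1 i)
    have "rep_half a f (z + of_int (i + 1) * \<tau>) = rep_half a f (z + of_int i * \<tau> + \<tau>)" by (simp add: algebra_simps)
    also have "\<dots> = ?e1 (z + of_int i * \<tau>) * (?e z i * rep_half a f z)" by (simp only: rep_half_tau[OF assms] step1)
    finally show ?case by (simp only: mult.assoc[symmetric] comb)
  next
    case (step2 i)
    have "rep_half a f (z + of_int i * \<tau>) = rep_half a f (z + of_int (i - 1) * \<tau> + \<tau>)" by (simp add: algebra_simps)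
    also have "\<dots> = ?e1 (z + of_int (i - 1) * \<tau>) * rep_half a f (z + of_int (i - 1) * \<tau>)" by (simp only: rep_half_tau[OF assms])
    finally have "?e1 (z + of_int (i - 1) * \<tau>) * rep_half a f (z + of_int (i - 1) * \<tau>) =
       ?e1 (z + of_int (i - 1) * \<tau>) * (?e z (i - 1) * rep_half a f z)"
      using step2 comb[of z "i - 1"] by (simp add: mult.assoc[symmetric])
    then show ?case by (simp only: mult_cancel_left exp_not_eq_zero simp_thms)
  qed simp
  have "rep_half a f (z + of_int n + of_int j * \<tau>) = rep_half a f (z + of_int j * \<tau> + of_int n)" by (simp add: add_ac)
  then show ?thesis by (simp only: one two)
qed

text \<open>
  Where \<open>2z\<close> is a lattice point, \<open>z\<close> and \<open>-z\<close> differ by a period, and the multiplier of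
  \<open>rep_half\<close> for this period is \<open>1\<close>. Hence the numerator vanishes at all the zeros of the denominator,
  which are simple.
\<close>

lemma rep_spec:
  assumes f: "f \<in> V" and a: "a \<le> 3"
  shows "rep a f \<in> V" and "rep a f z * sg (2 * z) = rep_half a f z - rep_half a f (- z)"
proof -
  define g where "g z = rep_half a f z - rep_half a f (- z)" for z
  have gh: "g holomorphic_on UNIV"
    unfolding g_def rep_half_def s_fun_def by (intro holomorphic_intros V_holomorphic[OF f] a)
  have dh: "(\<lambda>z. sg (2 * z)) holomorphic_on UNIV" by (intro holomorphic_intros)
  have dnz: "sg (2 * (- ((1 + \<tau>)/4))) \<noteq> 0" by (rule sg_2_not_zero)
  have deriv_d: "deriv (\<lambda>z. sg (2 * z)) z = 2 * deriv sg (2 * z)" for z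
  proof -
    have hol: "sg holomorphic_on UNIV" by (intro holomorphic_intros)
    then have "(sg has_field_derivative deriv sg (2 * z)) (at (2 * z))" using holomorphic_derivI by blast
    then have "((\<lambda>z. sg (2 * z)) has_field_derivative deriv sg (2 * z) * 2) (at z)"
      by (rule DERIV_chain2) (auto intro!: derivative_eq_intros)
    then show ?thesis by (simp add: DERIV_imp_deriv mult.commute)
  qed
  have g0: "g z = 0" if z0: "sg (2 * z) = 0" for z
  proof -
    obtain n j :: int where nj: "2 * z = of_int n + of_int j * \<tau>" using z0 unfolding sg_zero_iff by blast
    have "rep_half a f z = rep_half a f (- z + of_int n + of_int j * \<tau>)"
    proof -
      have "z = - z + 2 * z" by simp
      also have "\<dots> = - z + of_int n + of_int j * \<tau>" by (simp only: nj add.assoc)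
      finally show ?thesis by (rule arg_cong)
    qed
    also have "\<dots> = exp (- (2 * of_nat (m + 2) * of_real pi * \<i> * of_int j * (2 * (- z) + of_int j * \<tau>))) * rep_half a f (- z)"
      by (rule rep_half_lattice[OF f a])
    also have "2 * (- z) + of_int j * \<tau> = - of_int n" using nj by (simp add: algebra_simps)
    also have "- (2 * of_nat (m + 2) * of_real pi * \<i> * of_int j * (- of_int n)) = 2 * of_real pi * \<i> * of_int (int (m + 2) * j * n)"
      by (simp add: algebra_simps)
    finally show ?thesis unfolding exp_2pi_int by (simp add: g_def)
  qed
  have rep: "rep a f = remove_sings (\<lambda>z. g z / sg (2 * z))"
    unfolding g_def by (rule rep_eq[OF f])
  note q = entire_quotient[OF gh dh dnz, folded rep]
  have hol: "rep a f holomorphic_on UNIV" and mul: "rep a f z * sg (2 * z) = g z" for z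
    using q deriv_sg_nonzero g0 by (auto simp: deriv_d)
  show "rep a f z * sg (2 * z) = rep_half a f z - rep_half a f (- z)" using mul by (simp add: g_def)
  have hol': "(\<lambda>z. rep a f (h z)) holomorphic_on UNIV" if "h holomorphic_on UNIV" for h
    using holomorphic_on_compose_gen[OF that hol] by (auto simp: o_def)
  show "rep a f \<in> V"
  proof (rule V_I)
    show "rep a f holomorphic_on UNIV" by (rule hol)
    have "(\<lambda>z. rep a f (z + 1)) = rep a f"
    proof (rule entire_cancel[OF _ hol dh dnz])
      fix z
      have "rep a f (z + 1) * sg (2 * (z + 1)) = rep a f z * sg (2 * z)"
        unfolding mul g_def using rep_half_1[OF f a, of z] rep_half_1[OF f a, of "- z - 1"] by simp
      moreover have "sg (2 * (z + 1)) = sg (2 * z)"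
        using thc_2[of 0 "2 * z"] by (simp add: thc_simps algebra_simps)
      ultimately show "rep a f (z + 1) * sg (2 * z) = rep a f z * sg (2 * z)" by simp
    qed (intro hol' holomorphic_intros)
    then show "rep a f (z + 1) = rep a f z" for z by metis
    have "(\<lambda>z. rep a f (- z)) = rep a f"
    proof (rule entire_cancel[OF _ hol dh dnz])
      fix z
      have "rep a f (- z) * sg (2 * (- z)) = - (rep a f z * sg (2 * z))"
        unfolding mul g_def by simp
      then show "rep a f (- z) * sg (2 * z) = rep a f z * sg (2 * z)" by (simp add: sg_odd)
    qed (intro hol' holomorphic_intros)
    then show "rep a f (- z) = rep a f z" for z by metis
    let ?E = "\<lambda>z. exp (- 4 * spin m * of_real pi * \<i> * (2 * z + \<tau>))"
    have "(\<lambda>z. rep a f (z + \<tau>)) = (\<lambda>z. ?E z * rep a f z)"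
    proof (rule entire_cancel[OF _ _ dh dnz])
      fix z
      let ?K = "exp (- (2 * of_nat (m + 2) * of_real pi * \<i> * (2 * z + \<tau>)))"
      have "rep_half a f (- (z + \<tau>)) = rep_half a f (- z + of_int 0 + of_int (-1) * \<tau>)" by simp
      also have "\<dots> = ?K * rep_half a f (- z)"
        by (subst rep_half_lattice[OF f a]) (simp add: algebra_simps)
      finally have R: "rep_half a f (- (z + \<tau>)) = ?K * rep_half a f (- z)" .
      have "rep a f (z + \<tau>) * sg (2 * (z + \<tau>)) = ?K * (rep a f z * sg (2 * z))"
        unfolding mul g_def R rep_half_tau[OF f a] by (simp only: right_diff_distrib)
      moreover have "sg (2 * (z + \<tau>)) = exp (- (4 * of_real pi * \<i> * (\<tau> + 2 * z))) * sg (2 * z)"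
        using thc_2tau[of 0 "2 * z"] by (simp add: thc_simps algebra_simps)
      ultimately have "exp (- (4 * of_real pi * \<i> * (\<tau> + 2 * z))) * (rep a f (z + \<tau>) * sg (2 * z)) = ?K * (rep a f z * sg (2 * z))"
        by (simp add: mult_ac)
      also have "?K = exp (- (4 * of_real pi * \<i> * (\<tau> + 2 * z))) * ?E z"
        by (simp only: exp_add[symmetric]) (simp add: algebra_simps)
      finally show "rep a f (z + \<tau>) * sg (2 * z) = ?E z * rep a f z * sg (2 * z)"
        by (simp add: mult.assoc)
    qed (intro hol' hol holomorphic_intros)+
    then show "rep a f (z + \<tau>) = ?E z * rep a f z" for z by metis
  qed
qed

lemma entire_sg2_cancel:
  assumes "h1 holomorphic_on UNIV" "h2 holomorphic_on UNIV" "\<And>z. h1 z * sg (2 * z) = h2 z * sg (2 * z)"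
  shows "h1 = h2"
proof (rule entire_cancel[OF assms(1,2) _ _ assms(3)])
  show "(\<lambda>z. sg (2 * z)) holomorphic_on UNIV" by (intro holomorphic_intros)
  show "sg (2 * (- ((1 + \<tau>)/4))) \<noteq> 0" by (rule sg_2_not_zero)
qed

lemma rep_linear: assumes "a \<le> 3" shows "linear_operator_on V (rep a)"
  unfolding linear_operator_on_def
proof (intro conjI ballI allI)
  show "f \<in> V \<Longrightarrow> rep a f \<in> V" for f by (rule rep_spec[OF _ assms])
  fix f g b c assume f: "f \<in> V" and g: "g \<in> V"
  show "rep a (\<lambda>z. b * f z + c * g z) = (\<lambda>z. b * rep a f z + c * rep a g z)"
  proof (rule entire_sg2_cancel)
    show "rep a (\<lambda>z. b * f z + c * g z) holomorphic_on UNIV"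
      by (rule V_D(1)[OF rep_spec(1)[OF V_lin[OF f g] assms]])
    show "(\<lambda>z. b * rep a f z + c * rep a g z) holomorphic_on UNIV"
      by (intro holomorphic_intros V_D(1)[OF rep_spec(1)[OF f assms]] V_D(1)[OF rep_spec(1)[OF g assms]])
    fix z
    show "rep a (\<lambda>z. b * f z + c * g z) z * sg (2 * z) = (b * rep a f z + c * rep a g z) * sg (2 * z)"
      using rep_spec(2)[OF f assms, of z] rep_spec(2)[OF g assms, of z]
      unfolding rep_spec(2)[OF V_lin[OF f g] assms]
      by (simp add: ring_distribs mult.assoc) (simp add: rep_half_def algebra_simps)
  qed
qed

end

subsection \<open>Operators on tensor powers\<close>

lemma linear_operator_on_sum:
  assumes A: "linear_operator_on V A" and zero: "(\<lambda>z. 0) \<in> V"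
    and lin: "\<And>f g a b. f \<in> V \<Longrightarrow> g \<in> V \<Longrightarrow> (\<lambda>z. a * f z + b * g z) \<in> V"
    and f: "\<And>i. i \<in> I \<Longrightarrow> f i \<in> V"
  shows "A (\<lambda>w. \<Sum>i\<in>I. c i * f i w) = (\<lambda>w. \<Sum>i\<in>I. c i * A (f i) w)"
    and "(\<lambda>w. \<Sum>i\<in>I. c i * f i w) \<in> V"
proof -
  have A2: "\<forall>f\<in>V. \<forall>g\<in>V. \<forall>a b. A (\<lambda>z. a * f z + b * g z) = (\<lambda>z. a * A f z + b * A g z)"
    using A unfolding linear_operator_on_def by blast
  from spec[OF spec[OF bspec[OF bspec[OF A2 zero] zero], of 0], of 0]
  have A0: "A (\<lambda>z. 0) = (\<lambda>z. 0)" by simp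
  have "A (\<lambda>w. \<Sum>i\<in>I. c i * f i w) = (\<lambda>w. \<Sum>i\<in>I. c i * A (f i) w) \<and> (\<lambda>w. \<Sum>i\<in>I. c i * f i w) \<in> V"
    using f
  proof (induction I rule: infinite_finite_induct)
    case (insert x F)
    let ?g = "\<lambda>w. \<Sum>i\<in>F. c i * f i w"
    have IH: "A ?g = (\<lambda>w. \<Sum>i\<in>F. c i * A (f i) w)" "?g \<in> V" using insert by auto
    have fx: "f x \<in> V" using insert by auto
    have "A (\<lambda>w. c x * f x w + 1 * ?g w) = (\<lambda>w. c x * A (f x) w + 1 * A ?g w)"
      by (rule spec[OF spec[OF bspec[OF bspec[OF A2 fx] IH(2)]]])
    moreover have "(\<lambda>w. c x * f x w + 1 * ?g w) \<in> V" by (rule lin[OF fx IH(2)])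
    ultimately show ?case using insert IH by simp
  qed (auto simp: A0 zero)
  then show "A (\<lambda>w. \<Sum>i\<in>I. c i * f i w) = (\<lambda>w. \<Sum>i\<in>I. c i * A (f i) w)"
    and "(\<lambda>w. \<Sum>i\<in>I. c i * f i w) \<in> V" by auto
qed

primrec path_matrix :: "(nat \<Rightarrow> 2 \<Rightarrow> 2 \<Rightarrow> complex) \<Rightarrow> nat \<Rightarrow> 2 \<Rightarrow> 2 \<Rightarrow> complex" where
  "path_matrix X 0 \<alpha> \<beta> = (if \<alpha> = \<beta> then 1 else 0)"
| "path_matrix X (Suc n) \<alpha> \<beta> = (\<Sum>\<gamma>\<in>UNIV. X (Suc n) \<alpha> \<gamma> * path_matrix X n \<gamma> \<beta>)"

lemma path_matrix_cong:
  "(\<And>i. i \<in> {1..n} \<Longrightarrow> X i = Y i) \<Longrightarrow> path_matrix X n = path_matrix Y n"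
  by (induction n) (auto simp: fun_eq_iff)

text \<open>
  A chain of column vectors, each mapped by its factor to a multiple of the next one, turns the
  product of noncommuting matrices into a product of scalars; the same for rows.
\<close>

lemma path_matrix_column:
  assumes "\<And>n \<alpha>. n \<in> {1..N} \<Longrightarrow> (\<Sum>\<beta>\<in>UNIV. X n \<alpha> \<beta> * v (n - 1) \<beta>) = c n * v n \<alpha>"
  shows "n \<le> N \<Longrightarrow> (\<Sum>\<beta>\<in>UNIV. path_matrix X n \<alpha> \<beta> * v 0 \<beta>) = (\<Prod>i=1..n. c i) * v n \<alpha>"
proof (induction n arbitrary: \<alpha>)
  case (Suc n)
  have "(\<Sum>\<beta>\<in>UNIV. path_matrix X (Suc n) \<alpha> \<beta> * v 0 \<beta>) = (\<Sum>\<gamma>\<in>UNIV. X (Suc n) \<alpha> \<gamma> * (\<Sum>\<beta>\<in>UNIV. path_matrix X n \<gamma> \<beta> * v 0 \<beta>))"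
    by (simp add: sum_2 algebra_simps)
  also have "\<dots> = (\<Prod>i=1..n. c i) * (\<Sum>\<gamma>\<in>UNIV. X (Suc n) \<alpha> \<gamma> * v n \<gamma>)"
    using Suc by (simp add: sum_distrib_left mult_ac)
  also have "\<dots> = (\<Prod>i=1..Suc n. c i) * v (Suc n) \<alpha>"
    using assms[of "Suc n" \<alpha>] Suc.prems by (simp add: mult_ac)
  finally show ?case .
qed (simp add: sum_2; metis exhaust_2 zero_neq_one)

lemma path_matrix_row:
  assumes "\<And>n \<beta>. n \<in> {1..N} \<Longrightarrow> (\<Sum>\<alpha>\<in>UNIV. v n \<alpha> * X n \<alpha> \<beta>) = c n * v (n - 1) \<beta>"
  shows "n \<le> N \<Longrightarrow> (\<Sum>\<alpha>\<in>UNIV. v n \<alpha> * path_matrix X n \<alpha> \<beta>) = (\<Prod>i=1..n. c i) * v 0 \<beta>"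
proof (induction n)
  case (Suc n)
  have "(\<Sum>\<alpha>\<in>UNIV. v (Suc n) \<alpha> * path_matrix X (Suc n) \<alpha> \<beta>) = (\<Sum>\<gamma>\<in>UNIV. (\<Sum>\<alpha>\<in>UNIV. v (Suc n) \<alpha> * X (Suc n) \<alpha> \<gamma>) * path_matrix X n \<gamma> \<beta>)"
    by (simp add: sum_2 algebra_simps)
  also have "\<dots> = c (Suc n) * (\<Sum>\<gamma>\<in>UNIV. v n \<gamma> * path_matrix X n \<gamma> \<beta>)"
    using assms[of "Suc n"] Suc.prems by (simp add: sum_distrib_left mult_ac)
  also have "\<dots> = (\<Prod>i=1..Suc n. c i) * v 0 \<beta>"
    using Suc by (simp add: mult_ac)
  finally show ?case .
qed (simp add: sum_2; metis exhaust_2 zero_neq_one)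

text \<open>A column eigenvector and the row orthogonal to it carry the two eigenvalues of a \<open>2 \<times> 2\<close> matrix.\<close>

lemma trace_2_eq_eigenvalues:
  fixes M :: "2 \<Rightarrow> 2 \<Rightarrow> complex"
  assumes col: "\<And>\<alpha>. (\<Sum>\<beta>\<in>UNIV. M \<alpha> \<beta> * v \<beta>) = c * v \<alpha>"
    and row: "\<And>\<beta>. (\<Sum>\<alpha>\<in>UNIV. w \<alpha> * M \<alpha> \<beta>) = d * w \<beta>"
    and w: "w 1 = - v 2" "w 2 = v 1" and nz: "v 1 \<noteq> 0 \<or> v 2 \<noteq> 0"
  shows "(\<Sum>\<alpha>\<in>UNIV. M \<alpha> \<alpha>) = c + d"
proof -
  have e: "M 1 1 * v 1 + M 1 2 * v 2 = c * v 1" "M 2 1 * v 1 + M 2 2 * v 2 = c * v 2"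
    "- v 2 * M 1 1 + v 1 * M 2 1 = - d * v 2" "- v 2 * M 1 2 + v 1 * M 2 2 = d * v 1"
    using col[of 1] col[of 2] row[of 1] row[of 2] by (simp_all add: sum_2 w)
  have "(M 1 1 + M 2 2) * v 1 = (c + d) * v 1" using e(1,4) by algebra
  moreover have "(M 1 1 + M 2 2) * v 2 = (c + d) * v 2" using e(2,3) by algebra
  ultimately show ?thesis using nz by (auto simp: sum_2)
qed

text \<open>The trace of a product of matrices as a sum over closed paths of indices.\<close>

abbreviation cyc_pred :: "nat \<Rightarrow> (nat \<Rightarrow> 'b) \<Rightarrow> nat \<Rightarrow> 'b" where
  "cyc_pred N p n \<equiv> (if n = 1 then p N else p (n - 1))"

lemma path_matrix_sum_paths:
  "path_matrix X (Suc n) \<alpha> \<beta> = (\<Sum>p\<in>{1..Suc n} \<rightarrow>\<^sub>E UNIV. if p (Suc n) = \<alpha> then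
     (\<Prod>i=1..Suc n. X i (p i) (if i = 1 then \<beta> else p (i - 1))) else 0)"
proof (induction n arbitrary: \<alpha>)
  case 0
  have "(\<Sum>p\<in>{1..Suc 0} \<rightarrow>\<^sub>E UNIV. if p (Suc 0) = \<alpha> then (\<Prod>i=1..Suc 0. X i (p i) (if i = 1 then \<beta> else p (i - 1))) else 0)
     = (\<Sum>y\<in>(UNIV :: 2 set). if y = \<alpha> then X 1 y \<beta> else 0)"
    by (rule sum.reindex_bij_witness[of _ "\<lambda>y. (\<lambda>x. undefined)(1 := y)" "\<lambda>p. p 1"])
       (auto simp: One_nat_def PiE_iff extensional_def fun_eq_iff)
  then show ?case by (simp add: One_nat_def if_distrib cong: if_cong)
next
  case (Suc n)
  let ?S = "{1..Suc n} \<rightarrow>\<^sub>E (UNIV :: 2 set)"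
  let ?N = "Suc (Suc n)"
  have ins: "{1..?N} = insert ?N {1..Suc n}" by auto
  have inj: "inj_on (\<lambda>(y, g). g(?N := y)) (UNIV \<times> ?S)"
    by (rule inj_combinator) simp
  have "(\<Sum>p\<in>{1..?N} \<rightarrow>\<^sub>E UNIV. if p ?N = \<alpha> then (\<Prod>i=1..?N. X i (p i) (if i = 1 then \<beta> else p (i - 1))) else 0)
      = (\<Sum>(y, g)\<in>UNIV \<times> ?S. if y = \<alpha> then X ?N y (g (Suc n)) * (\<Prod>i=1..Suc n. X i (g i) (if i = 1 then \<beta> else g (i - 1))) else 0)"
    unfolding ins PiE_insert_eq
  proof (subst sum.reindex[OF inj], rule sum.cong[OF refl], clarify)
    fix y g assume "g \<in> ?S"
    have "(\<Prod>i\<in>insert ?N {1..Suc n}. X i ((g(?N := y)) i) (if i = 1 then \<beta> else (g(?N := y)) (i - 1)))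
      = X ?N y (g (Suc n)) * (\<Prod>i=1..Suc n. X i ((g(?N := y)) i) (if i = 1 then \<beta> else (g(?N := y)) (i - 1)))"
      by (subst prod.insert) auto
    also have "(\<Prod>i=1..Suc n. X i ((g(?N := y)) i) (if i = 1 then \<beta> else (g(?N := y)) (i - 1))) =
       (\<Prod>i=1..Suc n. X i (g i) (if i = 1 then \<beta> else g (i - 1)))"
      by (rule prod.cong) auto
    finally show "((\<lambda>p. if p ?N = \<alpha> then \<Prod>i\<in>insert ?N {1..Suc n}. X i (p i) (if i = 1 then \<beta> else p (i - 1)) else 0) \<circ> (\<lambda>(y, g). g(?N := y))) (y, g)
       = (if y = \<alpha> then X ?N y (g (Suc n)) * (\<Prod>i=1..Suc n. X i (g i) (if i = 1 then \<beta> else g (i - 1))) else 0)"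
      by (simp only: comp_def case_prod_conv fun_upd_same)
  qed
  also have "\<dots> = (\<Sum>g\<in>?S. X ?N \<alpha> (g (Suc n)) * (\<Prod>i=1..Suc n. X i (g i) (if i = 1 then \<beta> else g (i - 1))))"
    by (subst sum.cartesian_product[symmetric], subst sum.swap) simp
  also have "\<dots> = (\<Sum>g\<in>?S. \<Sum>\<gamma>\<in>UNIV. if g (Suc n) = \<gamma> then X ?N \<alpha> \<gamma> * (\<Prod>i=1..Suc n. X i (g i) (if i = 1 then \<beta> else g (i - 1))) else 0)"
    by simp
  also have "\<dots> = (\<Sum>\<gamma>\<in>UNIV. X ?N \<alpha> \<gamma> * (\<Sum>g\<in>?S. if g (Suc n) = \<gamma> then \<Prod>i=1..Suc n. X i (g i) (if i = 1 then \<beta> else g (i - 1)) else 0))"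
    by (subst sum.swap) (simp only: sum_distrib_left if_distrib[of "\<lambda>x. _ * x"] mult_zero_right)
  finally show ?case using Suc by simp
qed

lemma path_matrix_trace:
  assumes "N > 0"
  shows "(\<Sum>\<alpha>\<in>UNIV. path_matrix X N \<alpha> \<alpha>) = (\<Sum>p\<in>{1..N} \<rightarrow>\<^sub>E UNIV. \<Prod>n=1..N. X n (p n) (cyc_pred N p n))"
proof -
  obtain n where N: "N = Suc n" using assms by (cases N) auto
  have "(\<Sum>\<alpha>\<in>UNIV. path_matrix X N \<alpha> \<alpha>) = (\<Sum>p\<in>{1..N} \<rightarrow>\<^sub>E UNIV. \<Sum>\<alpha>\<in>UNIV. if p N = \<alpha> then
     (\<Prod>i=1..N. X i (p i) (if i = 1 then \<alpha> else p (i - 1))) else 0)"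
    unfolding N path_matrix_sum_paths by (rule sum.swap)
  then show ?thesis by simp
qed

lemma prod_cyc_pred:
  fixes g :: "'b \<Rightarrow> 'c :: comm_monoid_mult"
  assumes "N > 0"
  shows "(\<Prod>n=1..N. g (cyc_pred N p n)) = (\<Prod>n=1..N. g (p n))"
proof -
  obtain n where N: "N = Suc n" using assms by (cases N) auto
  have "(\<Prod>n=1..N. g (cyc_pred N p n)) = g (p N) * (\<Prod>n=Suc 1..N. g (p (n - 1)))"
    using assms by (subst prod.atLeast_Suc_atMost) (auto intro!: prod.cong)
  also have "(\<Prod>n=Suc 1..N. g (p (n - 1))) = (\<Prod>n=1..n. g (p n))"
    unfolding N by (subst prod.shift_bounds_cl_Suc_ivl) simp
  finally show ?thesis by (simp add: N mult.commute)
qed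

context sklyanin
begin

lemma linear_V_sum:
  assumes A: "linear_operator_on V A" and f: "\<And>i. i \<in> I \<Longrightarrow> f i \<in> V"
  shows "A (\<lambda>w. \<Sum>i\<in>I. c i * f i w) = (\<lambda>w. \<Sum>i\<in>I. c i * A (f i) w)"
  using linear_operator_on_sum(1)[OF A V_zero V_lin f] .

text \<open>
  The entries of the matrix \<open>L(u)\<close>.
\<close>

definition lop :: "complex \<Rightarrow> 2 \<Rightarrow> 2 \<Rightarrow> (complex \<Rightarrow> complex) \<Rightarrow> complex \<Rightarrow> complex" where
  "lop u \<alpha> \<beta> f = (\<lambda>z. \<Sum>a=0..3. W_fun \<tau> \<eta> a u * pauli a $ \<alpha> $ \<beta> * rep a f z)"

lemma lop_linear: "linear_operator_on V (lop u \<alpha> \<beta>)"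
  unfolding linear_operator_on_def
proof (intro conjI ballI allI)
  fix f assume f: "f \<in> V"
  have "(\<lambda>z. W_fun \<tau> \<eta> a u * pauli a $ \<alpha> $ \<beta> * rep a f z) \<in> V" if "a \<in> {0..3}" for a
    using that rep_spec(1)[OF f] by (intro V_scale) auto
  then show "lop u \<alpha> \<beta> f \<in> V" unfolding lop_def by (intro V_sum) auto
next
  fix f g b c assume f: "f \<in> V" and g: "g \<in> V"
  have "rep a (\<lambda>z. b * f z + c * g z) = (\<lambda>z. b * rep a f z + c * rep a g z)" if "a \<in> {0..3}" for a
    using rep_linear[of a] that f g unfolding linear_operator_on_def by auto
  then show "lop u \<alpha> \<beta> (\<lambda>z. b * f z + c * g z) = (\<lambda>z. b * lop u \<alpha> \<beta> f z + c * lop u \<alpha> \<beta> g z)"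
    unfolding lop_def by (auto simp: sum_distrib_left sum.distrib[symmetric] algebra_simps intro!: sum.cong)
qed

lemma L_op_eq: "L_op \<tau> \<eta> m n u F = (\<lambda>\<alpha> z. \<Sum>\<beta>\<in>UNIV. op_at n (lop u \<alpha> \<beta>) (F \<beta>) z)"
  unfolding L_op_def lop_def op_at_def by (intro ext sum.swap)

lemma monodromy_pure_sum:
  assumes \<phi>: "\<And>j n. j \<in> J \<Longrightarrow> n \<in> {1..N} \<Longrightarrow> \<phi> j n \<in> V"
  shows "n \<le> N \<Longrightarrow> monodromy \<tau> \<eta> m n u (\<lambda>\<beta> z. \<Sum>j\<in>J. d j \<beta> * pure_tensor N (\<phi> j) z) \<alpha> z =
    (\<Sum>j\<in>J. (\<Sum>\<beta>\<in>UNIV. path_matrix (\<lambda>i \<alpha> \<beta>. lop u \<alpha> \<beta> (\<phi> j i) (z i)) n \<alpha> \<beta> * d j \<beta>) * (\<Prod>i=Suc n..N. \<phi> j i (z i)))"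
proof (induction n arbitrary: \<alpha> z)
  case 0
  then show ?case
    by (auto intro!: sum.cong simp: pure_tensor_def One_nat_def if_distrib[of "\<lambda>x. x * _"] cong: if_cong)
next
  case (Suc n)
  let ?M = "\<lambda>j n z \<alpha> \<beta>. path_matrix (\<lambda>i \<alpha> \<beta>. lop u \<alpha> \<beta> (\<phi> j i) (z i)) n \<alpha> \<beta>"
  let ?G = "monodromy \<tau> \<eta> m n u (\<lambda>\<beta> z. \<Sum>j\<in>J. d j \<beta> * pure_tensor N (\<phi> j) z)"
  have G: "?G \<gamma> (z(Suc n := w)) = (\<Sum>j\<in>J. ((\<Sum>\<beta>\<in>UNIV. ?M j n z \<gamma> \<beta> * d j \<beta>) * (\<Prod>i=Suc (Suc n)..N. \<phi> j i (z i))) * \<phi> j (Suc n) w)" for \<gamma> w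
  proof -
    have "?M j n (z(Suc n := w)) = ?M j n z" for j by (rule path_matrix_cong) auto
    moreover have "(\<Prod>i=Suc n..N. \<phi> j i ((z(Suc n := w)) i)) = \<phi> j (Suc n) w * (\<Prod>i=Suc (Suc n)..N. \<phi> j i (z i))" for j
      using Suc.prems by (subst prod.atLeast_Suc_atMost) (auto intro!: prod.cong)
    ultimately show ?thesis using Suc by (auto intro!: sum.cong)
  qed
  have "op_at (Suc n) (lop u \<alpha> \<gamma>) (?G \<gamma>) z = (\<Sum>j\<in>J. ((\<Sum>\<beta>\<in>UNIV. ?M j n z \<gamma> \<beta> * d j \<beta>) * (\<Prod>i=Suc (Suc n)..N. \<phi> j i (z i))) * lop u \<alpha> \<gamma> (\<phi> j (Suc n)) (z (Suc n)))" for \<gamma>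
    unfolding op_at_def G by (subst linear_V_sum[OF lop_linear]) (use \<phi> Suc.prems in auto)
  then have "monodromy \<tau> \<eta> m (Suc n) u (\<lambda>\<beta> z. \<Sum>j\<in>J. d j \<beta> * pure_tensor N (\<phi> j) z) \<alpha> z =
     (\<Sum>\<gamma>\<in>UNIV. \<Sum>j\<in>J. ((\<Sum>\<beta>\<in>UNIV. ?M j n z \<gamma> \<beta> * d j \<beta>) * (\<Prod>i=Suc (Suc n)..N. \<phi> j i (z i))) * lop u \<alpha> \<gamma> (\<phi> j (Suc n)) (z (Suc n)))"
    by (simp add: L_op_eq)
  also have "\<dots> = (\<Sum>j\<in>J. (\<Sum>\<beta>\<in>UNIV. ?M j (Suc n) z \<alpha> \<beta> * d j \<beta>) * (\<Prod>i=Suc (Suc n)..N. \<phi> j i (z i)))"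
    by (subst sum.swap) (auto intro!: sum.cong simp: sum_2 algebra_simps)
  finally show ?case .
qed

lemma transfer_pure_sum:
  assumes \<phi>: "\<And>j n. j \<in> J \<Longrightarrow> n \<in> {1..N} \<Longrightarrow> \<phi> j n \<in> V"
  shows "transfer \<tau> \<eta> m N u (\<lambda>z. \<Sum>j\<in>J. c j * pure_tensor N (\<phi> j) z) z =
    (\<Sum>j\<in>J. c j * (\<Sum>\<alpha>\<in>UNIV. path_matrix (\<lambda>i \<alpha> \<beta>. lop u \<alpha> \<beta> (\<phi> j i) (z i)) N \<alpha> \<alpha>))"
proof -
  have e: "(\<lambda>\<beta>. if \<beta> = \<alpha> then (\<lambda>z. \<Sum>j\<in>J. c j * pure_tensor N (\<phi> j) z) else (\<lambda>_. 0)) =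
     (\<lambda>\<beta> z. \<Sum>j\<in>J. (if \<beta> = \<alpha> then c j else 0) * pure_tensor N (\<phi> j) z)" for \<alpha> :: 2
    by (auto simp: fun_eq_iff)
  have "monodromy \<tau> \<eta> m N u (\<lambda>\<beta> z. \<Sum>j\<in>J. (if \<beta> = \<alpha> then c j else 0) * pure_tensor N (\<phi> j) z) \<alpha> z =
    (\<Sum>j\<in>J. (\<Sum>\<beta>\<in>UNIV. path_matrix (\<lambda>i \<alpha> \<beta>. lop u \<alpha> \<beta> (\<phi> j i) (z i)) N \<alpha> \<beta> * (if \<beta> = \<alpha> then c j else 0)) * (\<Prod>i=Suc N..N. \<phi> j i (z i)))" for \<alpha>
    by (rule monodromy_pure_sum[OF _ order.refl]) (rule \<phi>)
  then show ?thesis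
    unfolding transfer_def e
    by (simp only:) (subst sum.swap, simp add: sum_distrib_left mult_ac if_distrib[of "\<lambda>x. _ * x"] if_distrib[of "\<lambda>x. x * _"] cong: if_cong)
qed

lemma op_tensor_power_pure_sum:
  assumes A: "linear_operator_on V A" and \<phi>: "\<And>j n. j \<in> J \<Longrightarrow> n \<in> {1..N} \<Longrightarrow> \<phi> j n \<in> V"
  shows "op_tensor_power N A (\<lambda>z. \<Sum>j\<in>J. c j * pure_tensor N (\<phi> j) z) = (\<lambda>z. \<Sum>j\<in>J. c j * pure_tensor N (\<lambda>n. A (\<phi> j n)) z)"
proof -
  have *: "n \<le> N \<Longrightarrow> op_tensor_power n A (\<lambda>z. \<Sum>j\<in>J. c j * pure_tensor N (\<phi> j) z) z =
    (\<Sum>j\<in>J. c j * ((\<Prod>i=1..n. A (\<phi> j i) (z i)) * (\<Prod>i=Suc n..N. \<phi> j i (z i))))" for n z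
  proof (induction n arbitrary: z)
    case 0
    then show ?case by (simp add: pure_tensor_def One_nat_def)
  next
    case (Suc n)
    let ?G = "op_tensor_power n A (\<lambda>z. \<Sum>j\<in>J. c j * pure_tensor N (\<phi> j) z)"
    have G: "?G (z(Suc n := w)) = (\<Sum>j\<in>J. (c j * ((\<Prod>i=1..n. A (\<phi> j i) (z i)) * (\<Prod>i=Suc (Suc n)..N. \<phi> j i (z i)))) * \<phi> j (Suc n) w)" for w
    proof -
      have "(\<Prod>i=1..n. A (\<phi> j i) ((z(Suc n := w)) i)) = (\<Prod>i=1..n. A (\<phi> j i) (z i))" for j
        by (rule prod.cong) auto
      moreover have "(\<Prod>i=Suc n..N. \<phi> j i ((z(Suc n := w)) i)) = \<phi> j (Suc n) w * (\<Prod>i=Suc (Suc n)..N. \<phi> j i (z i))" for j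
        using Suc.prems by (subst prod.atLeast_Suc_atMost) (auto intro!: prod.cong)
      ultimately show ?thesis using Suc by (auto intro!: sum.cong)
    qed
    have "op_tensor_power (Suc n) A (\<lambda>z. \<Sum>j\<in>J. c j * pure_tensor N (\<phi> j) z) z =
       (\<Sum>j\<in>J. (c j * ((\<Prod>i=1..n. A (\<phi> j i) (z i)) * (\<Prod>i=Suc (Suc n)..N. \<phi> j i (z i)))) * A (\<phi> j (Suc n)) (z (Suc n)))"
      unfolding op_tensor_power.simps o_def op_at_def G
      by (subst linear_V_sum[OF A]) (use \<phi> Suc.prems in auto)
    then show ?case by (simp add: mult_ac)
  qed
  show ?thesis by (rule ext, subst *[OF order.refl]) (simp add: pure_tensor_def)
qed

abbreviation H where "H N \<equiv> tensor_power N V"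

lemma tensor_power_I:
  fixes M :: nat
  shows "(\<And>j n. j < M \<Longrightarrow> n \<in> {1..N} \<Longrightarrow> \<phi> j n \<in> V) \<Longrightarrow> (\<lambda>z. \<Sum>j<M. pure_tensor N (\<phi> j) z) \<in> H N"
  unfolding tensor_power_def by (rule CollectI, rule exI[of _ M], rule exI[of _ \<phi>]) auto

lemma tensor_power_pure: assumes "\<And>n. n \<in> {1..N} \<Longrightarrow> f n \<in> V" shows "pure_tensor N f \<in> H N"
  using tensor_power_I[of "Suc 0" N "\<lambda>_. f"] assms by (simp add: lessThan_Suc)

lemma tensor_power_zero: "(\<lambda>z. 0) \<in> H N"
  using tensor_power_I[of 0 N "\<lambda>_ _ _. 0"] by simp

lemma tensor_power_E:
  assumes "F \<in> H N"
  obtains M :: nat and \<phi> where "\<forall>j\<in>{..<M}. \<forall>n\<in>{1..N}. \<phi> j n \<in> V"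
    "F = (\<lambda>z. \<Sum>j<M. 1 * pure_tensor N (\<phi> j) z)"
proof -
  have "\<exists>(M :: nat) \<phi>. (\<forall>j<M. \<forall>n\<in>{1..N}. \<phi> j n \<in> V) \<and> F = (\<lambda>z. \<Sum>j<M. pure_tensor N (\<phi> j) z)"
    using assms unfolding tensor_power_def by (rule CollectD)
  then show ?thesis by (elim exE conjE) (rule that, auto)
qed

lemma tensor_power_add:
  assumes "F \<in> H N" "G \<in> H N" shows "(\<lambda>z. F z + G z) \<in> H N"
proof -
  obtain M :: nat and \<phi> where F: "\<forall>j\<in>{..<M}. \<forall>n\<in>{1..N}. \<phi> j n \<in> V" "F = (\<lambda>z. \<Sum>j<M. 1 * pure_tensor N (\<phi> j) z)"
    by (rule tensor_power_E[OF assms(1)]) (rule that)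
  obtain M' :: nat and \<psi> where G: "\<forall>j\<in>{..<M'}. \<forall>n\<in>{1..N}. \<psi> j n \<in> V" "G = (\<lambda>z. \<Sum>j<M'. 1 * pure_tensor N (\<psi> j) z)"
    by (rule tensor_power_E[OF assms(2)]) (rule that)
  define \<xi> where "\<xi> j = (if j < M then \<phi> j else \<psi> (j - M))" for j
  have "(\<lambda>z. \<Sum>j<M + M'. pure_tensor N (\<xi> j) z) \<in> H N"
    by (rule tensor_power_I) (use F G in \<open>auto simp: \<xi>_def\<close>)
  moreover have "(\<Sum>j<M + M'. pure_tensor N (\<xi> j) z) = F z + G z" for z
  proof -
    have "(\<Sum>j<M + M'. pure_tensor N (\<xi> j) z) = (\<Sum>j<M. pure_tensor N (\<xi> j) z) + (\<Sum>j=M..<M + M'. pure_tensor N (\<xi> j) z)"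
      using sum.atLeastLessThan_concat[of 0 M "M + M'" "\<lambda>j. pure_tensor N (\<xi> j) z"] by (simp add: lessThan_atLeast0)
    also have "(\<Sum>j=M..<M + M'. pure_tensor N (\<xi> j) z) = (\<Sum>j<M'. pure_tensor N (\<xi> (j + M)) z)"
      using sum.shift_bounds_nat_ivl[of "\<lambda>j. pure_tensor N (\<xi> j) z" 0 M M'] by (simp add: lessThan_atLeast0 add.commute)
    finally show ?thesis by (simp add: \<xi>_def F(2) G(2))
  qed
  ultimately show ?thesis by simp
qed

lemma tensor_power_scale:
  assumes "N > 0" "F \<in> H N" shows "(\<lambda>z. c * F z) \<in> H N"
proof -
  obtain M :: nat and \<phi> where F: "\<forall>j\<in>{..<M}. \<forall>n\<in>{1..N}. \<phi> j n \<in> V" "F = (\<lambda>z. \<Sum>j<M. 1 * pure_tensor N (\<phi> j) z)"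
    by (rule tensor_power_E[OF assms(2)]) (rule that)
  define \<xi> where "\<xi> j n = (if n = 1 then (\<lambda>z. c * \<phi> j 1 z) else \<phi> j n)" for j n
  have "(\<lambda>z. \<Sum>j<M. pure_tensor N (\<xi> j) z) \<in> H N"
    by (rule tensor_power_I) (use F assms V_scale in \<open>auto simp: \<xi>_def\<close>)
  moreover have "pure_tensor N (\<xi> j) z = c * pure_tensor N (\<phi> j) z" for j z
  proof -
    have "{1..N} = insert 1 {2..N}" using assms by auto
    then show ?thesis by (simp add: pure_tensor_def \<xi>_def)
  qed
  ultimately show ?thesis by (simp add: F(2) sum_distrib_left)
qed

lemma tensor_power_lin:
  assumes "N > 0" "F \<in> H N" "G \<in> H N" shows "(\<lambda>z. a * F z + b * G z) \<in> H N"
  using assms by (intro tensor_power_add tensor_power_scale)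

lemma tensor_power_sum:
  assumes "N > 0" "\<And>i. i \<in> I \<Longrightarrow> F i \<in> H N" shows "(\<lambda>z. \<Sum>i\<in>I. c i * F i z) \<in> H N"
  using assms(2)
proof (induction I rule: infinite_finite_induct)
  case (insert x I)
  then show ?case using tensor_power_add[OF tensor_power_scale[OF assms(1), of "F x" "c x"], of "\<lambda>z. \<Sum>i\<in>I. c i * F i z"]
    by simp
qed (auto simp: tensor_power_zero)

lemma transfer_pure:
  assumes "N > 0" "\<And>n. n \<in> {1..N} \<Longrightarrow> f n \<in> V"
  shows "transfer \<tau> \<eta> m N u (pure_tensor N f) = (\<lambda>z. \<Sum>p\<in>{1..N} \<rightarrow>\<^sub>E UNIV.
    pure_tensor N (\<lambda>n. lop u (p n) (cyc_pred N p n) (f n)) z)"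
proof
  fix z
  have "transfer \<tau> \<eta> m N u (\<lambda>z. \<Sum>j\<in>{0::nat}. 1 * pure_tensor N f z) z =
     (\<Sum>j\<in>{0::nat}. 1 * (\<Sum>\<alpha>\<in>UNIV. path_matrix (\<lambda>i \<alpha> \<beta>. lop u \<alpha> \<beta> (f i) (z i)) N \<alpha> \<alpha>))"
    by (rule transfer_pure_sum) (use assms in auto)
  then have "transfer \<tau> \<eta> m N u (pure_tensor N f) z = (\<Sum>\<alpha>\<in>UNIV. path_matrix (\<lambda>i \<alpha> \<beta>. lop u \<alpha> \<beta> (f i) (z i)) N \<alpha> \<alpha>)"
    by simp
  then show "transfer \<tau> \<eta> m N u (pure_tensor N f) z = (\<Sum>p\<in>{1..N} \<rightarrow>\<^sub>E UNIV.
    pure_tensor N (\<lambda>n. lop u (p n) (cyc_pred N p n) (f n)) z)"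
    unfolding path_matrix_trace[OF assms(1)] by (simp only: pure_tensor_def)
qed

lemma transfer_sum:
  assumes \<phi>: "\<And>j n. j \<in> J \<Longrightarrow> n \<in> {1..N} \<Longrightarrow> \<phi> j n \<in> V"
  shows "transfer \<tau> \<eta> m N u (\<lambda>z. \<Sum>j\<in>J. c j * pure_tensor N (\<phi> j) z) =
    (\<lambda>z. \<Sum>j\<in>J. c j * transfer \<tau> \<eta> m N u (pure_tensor N (\<phi> j)) z)"
proof
  fix z
  have "transfer \<tau> \<eta> m N u (pure_tensor N (\<phi> j)) z = (\<Sum>\<alpha>\<in>UNIV. path_matrix (\<lambda>i \<alpha> \<beta>. lop u \<alpha> \<beta> (\<phi> j i) (z i)) N \<alpha> \<alpha>)" if "j \<in> J" for j
    using transfer_pure_sum[of "{0::nat}" N "\<lambda>_. \<phi> j" u "\<lambda>_. 1" z] \<phi> that by simp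
  then show "transfer \<tau> \<eta> m N u (\<lambda>z. \<Sum>j\<in>J. c j * pure_tensor N (\<phi> j) z) z = (\<Sum>j\<in>J. c j * transfer \<tau> \<eta> m N u (pure_tensor N (\<phi> j)) z)"
    by (subst transfer_pure_sum[of J N \<phi>]) (auto intro!: sum.cong \<phi>)
qed

lemma transfer_in_H:
  assumes "N > 0" "F \<in> H N" shows "transfer \<tau> \<eta> m N u F \<in> H N"
proof -
  obtain M :: nat and \<phi> where \<phi>': "\<forall>j\<in>{..<M}. \<forall>n\<in>{1..N}. \<phi> j n \<in> V" and F: "F = (\<lambda>z. \<Sum>j<M. 1 * pure_tensor N (\<phi> j) z)"
    by (rule tensor_power_E[OF assms(2)]) (rule that)
  note \<phi> = \<phi>'[rule_format]
  have "transfer \<tau> \<eta> m N u (pure_tensor N (\<phi> j)) \<in> H N" if "j < M" for j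
  proof -
    have "(\<lambda>z. \<Sum>p\<in>{1..N} \<rightarrow>\<^sub>E UNIV. 1 * pure_tensor N (\<lambda>n. lop u (p n) (cyc_pred N p n) (\<phi> j n)) z) \<in> H N"
      by (intro tensor_power_sum tensor_power_pure assms)
         (use \<phi> that lop_linear in \<open>auto simp: linear_operator_on_def\<close>)
    then show ?thesis using \<phi> that by (subst transfer_pure[OF assms(1)]) auto
  qed
  then have "(\<lambda>z. \<Sum>j<M. 1 * transfer \<tau> \<eta> m N u (pure_tensor N (\<phi> j)) z) \<in> H N"
    by (intro tensor_power_sum assms) auto
  then show ?thesis unfolding F by (subst transfer_sum[of _ N \<phi>]) (rule \<phi>)
qed

lemma op_tensor_power_in_H:
  assumes "N > 0" "linear_operator_on V A" "F \<in> H N" shows "op_tensor_power N A F \<in> H N"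
proof -
  obtain M :: nat and \<phi> where \<phi>': "\<forall>j\<in>{..<M}. \<forall>n\<in>{1..N}. \<phi> j n \<in> V" and F: "F = (\<lambda>z. \<Sum>j<M. 1 * pure_tensor N (\<phi> j) z)"
    by (rule tensor_power_E[OF assms(3)]) (rule that)
  note \<phi> = \<phi>'[rule_format]
  have "(\<lambda>z. \<Sum>j<M. 1 * pure_tensor N (\<lambda>n. A (\<phi> j n)) z) \<in> H N"
    by (intro tensor_power_sum tensor_power_pure assms) (use \<phi> assms(2) in \<open>auto simp: linear_operator_on_def\<close>)
  then show ?thesis unfolding F by (subst op_tensor_power_pure_sum[OF assms(2), of _ N \<phi>]) (rule \<phi>)
qed

end

section \<open>The first functional relation\<close>

context lattice
begin

interpretation half: lattice "\<tau> / 2"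
  by unfold_locales (use Re_tau Im_tau in auto)

text \<open>
  The gauge vectors: \<open>a(x)\<close> is a column, and \<open>b(x)\<close> the row orthogonal to it.
\<close>

definition avec :: "complex \<Rightarrow> 2 \<Rightarrow> complex" where "avec x \<alpha> = (if \<alpha> = 1 then t0 x else - t1 x)"
definition bvec :: "complex \<Rightarrow> 2 \<Rightarrow> complex" where "bvec x \<alpha> = (if \<alpha> = 1 then t1 x else t0 x)"

lemma bvec_avec: "(\<Sum>\<beta>\<in>UNIV. bvec x \<beta> * avec y \<beta>) = 2 * (sg (x + y) * sg (x - y))"
  unfolding plucker by (simp add: sum_2 avec_def bvec_def)

lemma avec_nonzero: "avec x 1 \<noteq> 0 \<or> avec x 2 \<noteq> 0"
  using t0_t1_nonzero[of x] by (auto simp: avec_def)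

lemma bvec_eq_avec: "bvec x 1 = - avec x 2" "bvec x 2 = avec x 1"
  by (auto simp: avec_def bvec_def)

lemma avec_even: "avec (- x) = avec x" and bvec_even: "bvec (- x) = bvec x"
proof -
  have "t0 (- x) = t0 x" by (rule half.th_even)
  moreover have "t1 (- x) = t1 x"
  proof -
    have "t1 (- x) = t0 (- (x - 1/2))" by (simp add: t1_eq)
    also have "\<dots> = t0 (x - 1/2)" by (rule half.th_even)
    also have "\<dots> = t0 (x - 1/2 + 1)" by (rule half.th_1[symmetric])
    also have "x - 1/2 + 1 = x + 1/2" by simp
    finally show ?thesis by (simp only: t1_eq)
  qed
  ultimately show "avec (- x) = avec x" "bvec (- x) = bvec x" by (auto simp: avec_def bvec_def fun_eq_iff)
qed

lemma avec_int: "avec (x + of_int n) = avec x" and bvec_int: "bvec (x + of_int n) = bvec x"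
proof -
  have t0: "t0 (x + of_int n) = t0 x" for x
  proof (induction n rule: int_induct[where k = 0])
    case (step1 i)
    then show ?case using half.th_1[of "x + of_int i"] by (simp add: add.assoc)
  next
    case (step2 i)
    then show ?case using half.th_1[of "x + of_int (i - 1)"] by (simp add: add.assoc)
  qed simp
  then have "t1 (x + of_int n) = t1 x" using t0[of "x + 1/2"] by (simp add: t1_eq add_ac)
  with t0[of x] show "avec (x + of_int n) = avec x" "bvec (x + of_int n) = bvec x" by (auto simp: avec_def bvec_def fun_eq_iff)
qed

lemma avec_three_term:
  "avec q \<alpha> * (sg (y + y') * sg (y - y')) = avec y \<alpha> * (sg (q + y') * sg (q - y')) - avec y' \<alpha> * (sg (q + y) * sg (q - y))"
proof -
  have W: "sg (x + y) * sg (x - y) = (t1 x * t0 y - t0 x * t1 y) / 2" for x y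
    unfolding plucker[symmetric] by simp
  show ?thesis unfolding W by (simp add: avec_def field_simps)
qed

lemma bvec_three_term:
  "bvec q \<alpha> * (sg (y + y') * sg (y - y')) = bvec y \<alpha> * (sg (q + y') * sg (q - y')) - bvec y' \<alpha> * (sg (q + y) * sg (q - y))"
proof -
  have W: "sg (x + y) * sg (x - y) = (t1 x * t0 y - t0 x * t1 y) / 2" for x y
    unfolding plucker[symmetric] by simp
  show ?thesis unfolding W by (simp add: bvec_def field_simps)
qed

text \<open>
  The weights \<open>\<theta>\<^sub>a(u) \<theta>\<^sub>a(v)\<close> assemble to a matrix of rank one; this makes the product structure of
  the eigenfunctions below possible.
\<close>

definition c_fac :: "nat \<Rightarrow> complex" where "c_fac a = (if a = 2 then \<i> else 1)"

lemma pauli_theta_rank_one: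
  "(\<Sum>a=0..3. c_fac a * thc a u * thc a v * pauli a $ \<alpha> $ \<beta>) = avec ((u - v) / 2) \<alpha> * bvec ((u + v) / 2) \<beta>"
proof -
  have s: "{0..3} = {0, 1, 2, 3 :: nat}" by auto
  have p: "pauli 0 $ 1 $ 1 = 1" "pauli 0 $ 1 $ 2 = 0" "pauli 0 $ 2 $ 1 = 0" "pauli 0 $ 2 $ 2 = 1"
    "pauli 1 $ 1 $ 1 = 0" "pauli 1 $ 1 $ 2 = 1" "pauli 1 $ 2 $ 1 = 1" "pauli 1 $ 2 $ 2 = 0"
    "pauli 2 $ 1 $ 1 = 0" "pauli 2 $ 1 $ 2 = - \<i>" "pauli 2 $ 2 $ 1 = \<i>" "pauli 2 $ 2 $ 2 = 0"
    "pauli 3 $ 1 $ 1 = 1" "pauli 3 $ 1 $ 2 = 0" "pauli 3 $ 2 $ 1 = 0" "pauli 3 $ 2 $ 2 = - 1"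
    by (simp_all add: pauli_def numeral_3_eq_3 numeral_2_eq_2 One_nat_def)
  have t: "thc 0 z = theta 1 1 z \<tau>" "thc 1 z = theta 1 0 z \<tau>" "thc 2 z = theta 0 0 z \<tau>" "thc 3 z = theta 0 1 z \<tau>" for z
    by (simp_all add: theta_comp_def numeral_3_eq_3 numeral_2_eq_2 One_nat_def)
  have uv: "(u + v) / 2 + (u - v) / 2 = u" "(u + v) / 2 - (u - v) / 2 = v" by (simp_all add: field_simps)
  have *: "t0 ((u - v) / 2) * t1 ((u + v) / 2) = thc 3 u * thc 3 v + thc 0 u * thc 0 v"
    "t1 ((u - v) / 2) * t0 ((u + v) / 2) = thc 3 u * thc 3 v - thc 0 u * thc 0 v"
    "t0 ((u - v) / 2) * t0 ((u + v) / 2) = thc 2 u * thc 2 v + thc 1 u * thc 1 v"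
    "t1 ((u - v) / 2) * t1 ((u + v) / 2) = thc 2 u * thc 2 v - thc 1 u * thc 1 v"
    using t1_t0[of "(u + v) / 2" "(u - v) / 2"] t0_t1[of "(u + v) / 2" "(u - v) / 2"]
      t0_t0[of "(u + v) / 2" "(u - v) / 2"] t1_t1[of "(u + v) / 2" "(u - v) / 2"]
    unfolding uv t by (simp_all only: mult.commute)
  consider "\<alpha> = 1" "\<beta> = 1" | "\<alpha> = 1" "\<beta> = 2" | "\<alpha> = 2" "\<beta> = 1" | "\<alpha> = 2" "\<beta> = 2"
    using exhaust_2[of \<alpha>] exhaust_2[of \<beta>] by blast
  moreover have "\<i> * x * y * \<i> = - (x * y)" for x y
  proof -
    have "\<i> * x * y * \<i> = (\<i> * \<i>) * (x * y)" by (simp only: mult_ac)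
    then show ?thesis by simp
  qed
  ultimately show ?thesis
    by cases (simp_all add: s p c_fac_def avec_def bvec_def *)
qed

lemma th_zero_iff: "th z = 0 \<longleftrightarrow> sg (z - (1 + \<tau>)/2) = 0"
  using sg_eq_th[of "z - (1 + \<tau>)/2"] by simp

lemma sg_real_nonzero: assumes "0 < \<bar>x\<bar>" "\<bar>x\<bar> < 1" shows "sg (of_real x) \<noteq> 0"
proof
  assume "sg (of_real x) = 0"
  then obtain n j :: int where nj: "of_real x = of_int n + of_int j * \<tau>" unfolding sg_zero_iff by blast
  then have "j = 0" "x = of_int n" using Im_tau Re_tau by (auto simp: complex_eq_iff)
  with assms show False by auto
qed

lemma th_real_nonzero: "th (of_real x) \<noteq> 0"
proof
  assume "th (of_real x) = 0"
  then obtain n j :: int where nj: "of_real x - (1 + \<tau>)/2 = of_int n + of_int j * \<tau>" unfolding th_zero_iff sg_zero_iff by blast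
  then have "- Im \<tau> / 2 = of_int j * Im \<tau>" by (auto simp: complex_eq_iff)
  then have "(2 * real_of_int j + 1) * Im \<tau> = 0" by (simp add: algebra_simps)
  then have "2 * real_of_int j + 1 = 0" using Im_tau by simp
  then have "- 1 = 2 * j" by linarith
  then show False by presburger
qed

end

context sklyanin
begin

abbreviation "phi \<equiv> br_pair \<tau> \<eta> m"

text \<open>
  Translating \<open>z\<close> by \<open>\<eta>\<close> and translating the parameter by \<open>\<plusminus>\<eta>\<close> change a single one of the factors
  of the product; the neighbouring factors take each other's place.
\<close>

lemma phi_shift_minus:
  "sg (z + c - h\<eta>) * phi c (z + h\<eta>) = phi (c - h\<eta>) z * sg (z + c - h\<eta> + 2 * of_nat m * h\<eta>)"
proof -
  let ?f = "\<lambda>j. sg (z + c - h\<eta> + 2 * of_nat j * h\<eta>)" and ?g = "\<Prod>j<m. sg (- z + (c - h\<eta>) + 2 * of_nat j * h\<eta>)"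
  have "phi c (z + h\<eta>) = (\<Prod>j<m. ?f (Suc j)) * ?g"
    unfolding br_pair_eq prod.distrib by (intro arg_cong2[of _ _ _ _ "(*)"] prod.cong) (simp_all add: algebra_simps)
  moreover have "phi (c - h\<eta>) z = (\<Prod>j<m. ?f j) * ?g"
    unfolding br_pair_eq prod.distrib by (intro arg_cong2[of _ _ _ _ "(*)"] prod.cong) (simp_all add: algebra_simps)
  moreover have "?f 0 * (\<Prod>j<m. ?f (Suc j)) = (\<Prod>j<m. ?f j) * ?f m"
    by (rule trans[OF prod.lessThan_Suc_shift[symmetric] prod.lessThan_Suc])
  ultimately show ?thesis by (simp add: mult_ac)
qed

lemma phi_shift_plus:
  "sg (- z + c - h\<eta> + 2 * of_nat m * h\<eta>) * phi c (z + h\<eta>) = phi (c + h\<eta>) z * sg (- z + c - h\<eta>)"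
proof -
  let ?f = "\<lambda>j. sg (- z + c - h\<eta> + 2 * of_nat j * h\<eta>)" and ?g = "\<Prod>j<m. sg (z + (c + h\<eta>) + 2 * of_nat j * h\<eta>)"
  have "phi c (z + h\<eta>) = ?g * (\<Prod>j<m. ?f j)"
    unfolding br_pair_eq prod.distrib by (intro arg_cong2[of _ _ _ _ "(*)"] prod.cong) (simp_all add: algebra_simps)
  moreover have "phi (c + h\<eta>) z = ?g * (\<Prod>j<m. ?f (Suc j))"
    unfolding br_pair_eq prod.distrib by (intro arg_cong2[of _ _ _ _ "(*)"] prod.cong) (simp_all add: algebra_simps)
  moreover have "?f 0 * (\<Prod>j<m. ?f (Suc j)) = (\<Prod>j<m. ?f j) * ?f m"
    by (rule trans[OF prod.lessThan_Suc_shift[symmetric] prod.lessThan_Suc])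
  ultimately show ?thesis by (simp add: mult_ac)
qed

lemma phi_minus: "phi c (- z) = phi c z"
  using V_D(3)[OF br_pair_in_V] .

end

locale sklyanin_small = sklyanin +
  assumes m_pos: "m > 0" and eta_le: "\<bar>\<eta>\<bar> \<le> 1 / (2 * (real m + 1))"
begin

lemma eta_bound: "\<bar>\<eta>\<bar> < 1 / 2"
proof -
  have "1 / (2 * (real m + 1)) < 1 / 2" using m_pos by (simp add: field_simps)
  with eta_le show ?thesis by linarith
qed

end

locale sklyanin_nonzero = sklyanin_small + assumes eta_nz: "\<eta> \<noteq> 0"
begin

lemma thc_eta_nonzero: assumes "a \<le> 3" shows "thc a h\<eta> \<noteq> 0"
proof -
  have "sg h\<eta> \<noteq> 0" using eta_nz eta_bound by (intro sg_real_nonzero) auto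
  moreover have "sg (h\<eta> - 1/2) \<noteq> 0"
    using sg_real_nonzero[of "\<eta> - 1/2"] eta_bound by auto
  moreover have "th h\<eta> \<noteq> 0" by (rule th_real_nonzero)
  moreover have "th (h\<eta> + 1/2) \<noteq> 0" using th_real_nonzero[of "\<eta> + 1/2"] by simp
  ultimately show ?thesis using assms unfolding le_3_iff by (elim disjE) (simp_all add: thc_simps)
qed

lemma lop_spec:
  assumes f: "f \<in> V"
  shows "lop u \<alpha> \<beta> f z * sg (2 * z) =
     avec (u / 2 - z + spin m * h\<eta>) \<alpha> * bvec (u / 2 + z - spin m * h\<eta>) \<beta> * f (z + h\<eta>)
   - avec (u / 2 + z + spin m * h\<eta>) \<alpha> * bvec (u / 2 - z - spin m * h\<eta>) \<beta> * f (- z + h\<eta>)"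
proof -
  have W: "W_fun \<tau> \<eta> a u * pauli a $ \<alpha> $ \<beta> * rep_half a f z =
    c_fac a * thc a u * thc a (2 * (z - spin m * h\<eta>)) * pauli a $ \<alpha> $ \<beta> * f (z + h\<eta>)" if "a \<in> {0..3}" for a z
    using thc_eta_nonzero[of a] that by (simp add: W_fun_def rep_half_def s_fun_def c_fac_def)
  have "lop u \<alpha> \<beta> f z * sg (2 * z) = (\<Sum>a=0..3. W_fun \<tau> \<eta> a u * pauli a $ \<alpha> $ \<beta> * (rep a f z * sg (2 * z)))"
    by (simp add: lop_def sum_distrib_right sum_distrib_left mult_ac)
  also have "\<dots> = (\<Sum>a=0..3. W_fun \<tau> \<eta> a u * pauli a $ \<alpha> $ \<beta> * (rep_half a f z - rep_half a f (- z)))"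
    using rep_spec(2)[OF f] by (intro sum.cong) auto
  also have "\<dots> = (\<Sum>a=0..3. W_fun \<tau> \<eta> a u * pauli a $ \<alpha> $ \<beta> * rep_half a f z)
      - (\<Sum>a=0..3. W_fun \<tau> \<eta> a u * pauli a $ \<alpha> $ \<beta> * rep_half a f (- z))"
    by (simp only: right_diff_distrib sum_subtractf)
  also have "\<dots> = (\<Sum>a=0..3. c_fac a * thc a u * thc a (2 * (z - spin m * h\<eta>)) * pauli a $ \<alpha> $ \<beta>) * f (z + h\<eta>)
     - (\<Sum>a=0..3. c_fac a * thc a u * thc a (2 * (- z - spin m * h\<eta>)) * pauli a $ \<alpha> $ \<beta>) * f (- z + h\<eta>)"
    by (simp only: W sum_distrib_right cong: sum.cong)
  moreover have "(u - 2 * (z - spin m * h\<eta>)) / 2 = u / 2 - z + spin m * h\<eta>"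
    "(u + 2 * (z - spin m * h\<eta>)) / 2 = u / 2 + z - spin m * h\<eta>"
    "(u - 2 * (- z - spin m * h\<eta>)) / 2 = u / 2 + z + spin m * h\<eta>"
    "(u + 2 * (- z - spin m * h\<eta>)) / 2 = u / 2 - z - spin m * h\<eta>"
    by (simp_all add: field_simps)
  ultimately show ?thesis unfolding pauli_theta_rank_one by (simp only:)
qed

text \<open>
  By the rank-one formula both relations are three-term identities for the vectors. Together they give
  the triangular form of \<open>L(u)\<close> on the product functions: the column \<open>a(g)\<close> goes to a multiple of
  \<open>a(g + 2l\<eta>)\<close>, and the orthogonal row \<open>b(g + 2l\<eta>)\<close> to a multiple of \<open>b(g)\<close>, with the argument of
  the product function shifted by \<open>-\<eta>\<close> and \<open>\<eta>\<close>, respectively.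
\<close>

lemma lop_column:
  assumes c: "c = g + u / 2 - spin m * h\<eta> + h\<eta>"
  shows "(\<Sum>\<beta>\<in>UNIV. lop u \<alpha> \<beta> (phi c) z * avec g \<beta>) =
    2 * sg (u + of_nat m * h\<eta>) * phi (c - h\<eta>) z * avec (g + of_nat m * h\<eta>) \<alpha>"
proof -
  have hol: "lop u \<alpha> \<beta> (phi c) holomorphic_on UNIV" for \<beta>
    using lop_linear br_pair_in_V V_D(1) unfolding linear_operator_on_def by blast
  have "(\<lambda>z. \<Sum>\<beta>\<in>UNIV. lop u \<alpha> \<beta> (phi c) z * avec g \<beta>) =
    (\<lambda>z. 2 * sg (u + of_nat m * h\<eta>) * phi (c - h\<eta>) z * avec (g + of_nat m * h\<eta>) \<alpha>)"
  proof (rule entire_sg2_cancel)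
    show "(\<lambda>z. \<Sum>\<beta>\<in>UNIV. lop u \<alpha> \<beta> (phi c) z * avec g \<beta>) holomorphic_on UNIV"
      by (intro holomorphic_intros hol)
    show "(\<lambda>z. 2 * sg (u + of_nat m * h\<eta>) * phi (c - h\<eta>) z * avec (g + of_nat m * h\<eta>) \<alpha>) holomorphic_on UNIV"
      by (intro holomorphic_intros V_D(1)[OF br_pair_in_V])
    fix z
    define q where "q = g + of_nat m * h\<eta>"
    define y1 where "y1 = u / 2 - z + spin m * h\<eta>"
    define y2 where "y2 = u / 2 + z + spin m * h\<eta>"
    define x1 where "x1 = u / 2 + z - spin m * h\<eta>"
    define x2 where "x2 = u / 2 - z - spin m * h\<eta>"
    have s1: "sg (x1 + g) * phi c (z + h\<eta>) = phi (c - h\<eta>) z * sg (q + y2)"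
      using phi_shift_minus[of z c] by (simp add: c x1_def q_def y2_def algebra_simps)
    have s2: "sg (x2 + g) * phi c (- z + h\<eta>) = phi (c - h\<eta>) z * sg (q + y1)"
      using phi_shift_minus[of "- z" c] by (simp add: c x2_def q_def y1_def phi_minus algebra_simps)
    have d1: "sg (x1 - g) = - sg (q - y2)" and d2: "sg (x2 - g) = - sg (q - y1)"
      using sg_odd[of "q - y2"] sg_odd[of "q - y1"] by (simp_all add: x1_def x2_def q_def y1_def y2_def algebra_simps)
    have y: "sg (y1 + y2) * sg (y1 - y2) = - sg (u + of_nat m * h\<eta>) * sg (2 * z)"
      using sg_odd[of "2 * z"] by (simp add: y1_def y2_def algebra_simps)
    have "(\<Sum>\<beta>\<in>UNIV. lop u \<alpha> \<beta> (phi c) z * avec g \<beta>) * sg (2 * z) = (\<Sum>\<beta>\<in>UNIV. (lop u \<alpha> \<beta> (phi c) z * sg (2 * z)) * avec g \<beta>)"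
      by (simp add: sum_distrib_right sum_distrib_left mult_ac)
    also have "\<dots> = avec y1 \<alpha> * phi c (z + h\<eta>) * (\<Sum>\<beta>\<in>UNIV. bvec x1 \<beta> * avec g \<beta>)
        - avec y2 \<alpha> * phi c (- z + h\<eta>) * (\<Sum>\<beta>\<in>UNIV. bvec x2 \<beta> * avec g \<beta>)"
      unfolding lop_spec[OF br_pair_in_V] x1_def[symmetric] x2_def[symmetric] y1_def[symmetric] y2_def[symmetric]
      by (simp add: sum_2 algebra_simps)
    also have "\<dots> = 2 * (avec y1 \<alpha> * (sg (x1 + g) * phi c (z + h\<eta>)) * sg (x1 - g)
        - avec y2 \<alpha> * (sg (x2 + g) * phi c (- z + h\<eta>)) * sg (x2 - g))"
      unfolding bvec_avec by (simp add: algebra_simps)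
    also have "\<dots> = - 2 * phi (c - h\<eta>) z * (avec y1 \<alpha> * (sg (q + y2) * sg (q - y2)) - avec y2 \<alpha> * (sg (q + y1) * sg (q - y1)))"
      unfolding s1 s2 d1 d2 by (simp add: algebra_simps)
    also have "\<dots> = 2 * sg (u + of_nat m * h\<eta>) * phi (c - h\<eta>) z * avec q \<alpha> * sg (2 * z)"
      unfolding avec_three_term[symmetric] y by (simp add: algebra_simps)
    finally show "(\<Sum>\<beta>\<in>UNIV. lop u \<alpha> \<beta> (phi c) z * avec g \<beta>) * sg (2 * z) =
       2 * sg (u + of_nat m * h\<eta>) * phi (c - h\<eta>) z * avec (g + of_nat m * h\<eta>) \<alpha> * sg (2 * z)"
      unfolding q_def .
  qed
  then show ?thesis by metis
qed

lemma lop_row: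
  assumes c: "c = g + u / 2 - spin m * h\<eta> + h\<eta>"
  shows "(\<Sum>\<alpha>\<in>UNIV. bvec (g + of_nat m * h\<eta>) \<alpha> * lop u \<alpha> \<beta> (phi c) z) =
    2 * sg (u - of_nat m * h\<eta>) * phi (c + h\<eta>) z * bvec g \<beta>"
proof -
  have hol: "lop u \<alpha> \<beta> (phi c) holomorphic_on UNIV" for \<alpha>
    using lop_linear br_pair_in_V V_D(1) unfolding linear_operator_on_def by blast
  have "(\<lambda>z. \<Sum>\<alpha>\<in>UNIV. bvec (g + of_nat m * h\<eta>) \<alpha> * lop u \<alpha> \<beta> (phi c) z) =
    (\<lambda>z. 2 * sg (u - of_nat m * h\<eta>) * phi (c + h\<eta>) z * bvec g \<beta>)"
  proof (rule entire_sg2_cancel)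
    show "(\<lambda>z. \<Sum>\<alpha>\<in>UNIV. bvec (g + of_nat m * h\<eta>) \<alpha> * lop u \<alpha> \<beta> (phi c) z) holomorphic_on UNIV"
      by (intro holomorphic_intros hol)
    show "(\<lambda>z. 2 * sg (u - of_nat m * h\<eta>) * phi (c + h\<eta>) z * bvec g \<beta>) holomorphic_on UNIV"
      by (intro holomorphic_intros V_D(1)[OF br_pair_in_V])
    fix z
    define q where "q = g + of_nat m * h\<eta>"
    define y1 where "y1 = u / 2 - z + spin m * h\<eta>"
    define y2 where "y2 = u / 2 + z + spin m * h\<eta>"
    define x1 where "x1 = u / 2 + z - spin m * h\<eta>"
    define x2 where "x2 = u / 2 - z - spin m * h\<eta>"
    have s1: "sg (q + y1) * phi c (z + h\<eta>) = phi (c + h\<eta>) z * sg (g + x2)"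
      using phi_shift_plus[of z c] by (simp add: c x2_def q_def y1_def algebra_simps)
    have s2: "sg (q + y2) * phi c (- z + h\<eta>) = phi (c + h\<eta>) z * sg (g + x1)"
      using phi_shift_plus[of "- z" c] by (simp add: c x1_def q_def y2_def phi_minus algebra_simps)
    have d1: "sg (q - y1) = sg (g - x2)" and d2: "sg (q - y2) = sg (g - x1)"
      by (simp_all add: x1_def x2_def q_def y1_def y2_def algebra_simps)
    have y: "sg (x1 + x2) * sg (x1 - x2) = sg (u - of_nat m * h\<eta>) * sg (2 * z)"
      by (simp add: x1_def x2_def algebra_simps)
    have "(\<Sum>\<alpha>\<in>UNIV. bvec q \<alpha> * lop u \<alpha> \<beta> (phi c) z) * sg (2 * z) = (\<Sum>\<alpha>\<in>UNIV. bvec q \<alpha> * (lop u \<alpha> \<beta> (phi c) z * sg (2 * z)))"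
      by (simp add: sum_distrib_right sum_distrib_left mult_ac)
    also have "\<dots> = bvec x1 \<beta> * phi c (z + h\<eta>) * (\<Sum>\<beta>\<in>UNIV. bvec q \<beta> * avec y1 \<beta>)
        - bvec x2 \<beta> * phi c (- z + h\<eta>) * (\<Sum>\<beta>\<in>UNIV. bvec q \<beta> * avec y2 \<beta>)"
      unfolding lop_spec[OF br_pair_in_V] x1_def[symmetric] x2_def[symmetric] y1_def[symmetric] y2_def[symmetric]
      by (simp add: sum_2 algebra_simps)
    also have "\<dots> = 2 * (bvec x1 \<beta> * (sg (q + y1) * phi c (z + h\<eta>)) * sg (q - y1)
        - bvec x2 \<beta> * (sg (q + y2) * phi c (- z + h\<eta>)) * sg (q - y2))"
      unfolding bvec_avec by (simp add: algebra_simps)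
    also have "\<dots> = 2 * phi (c + h\<eta>) z * (bvec x1 \<beta> * (sg (g + x2) * sg (g - x2)) - bvec x2 \<beta> * (sg (g + x1) * sg (g - x1)))"
      unfolding s1 s2 d1 d2 by (simp add: algebra_simps)
    also have "\<dots> = 2 * sg (u - of_nat m * h\<eta>) * phi (c + h\<eta>) z * bvec g \<beta> * sg (2 * z)"
      unfolding bvec_three_term[symmetric] y by (simp add: algebra_simps)
    finally show "(\<Sum>\<alpha>\<in>UNIV. bvec (g + of_nat m * h\<eta>) \<alpha> * lop u \<alpha> \<beta> (phi c) z) * sg (2 * z) =
       2 * sg (u - of_nat m * h\<eta>) * phi (c + h\<eta>) z * bvec g \<beta> * sg (2 * z)"
      unfolding q_def .
  qed
  then show ?thesis by metis
qed

end

text \<open>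
  All nonzero entries \<open>S\<^sup>i\<^sub>j\<close> have the same form; \<open>step r i j\<close> is the sign of \<open>f\<^sub>\<plusminus>\<close>, or \<open>0\<close> for the
  vanishing entries. The boundary entries are reflected steps.
\<close>

definition step :: "nat \<Rightarrow> nat \<Rightarrow> nat \<Rightarrow> int" where
  "step r i j = (if i = j + 1 then 1 else if j = i + 1 then - 1 else if i = 1 \<and> j = 1 then - 1
     else if i = r \<and> j = r then 1 else 0)"

lemma step_cases:
  assumes "i \<in> {1..r}" "j \<in> {1..r}"
  obtains "step r i j = 0" | "step r i j = 1" "i = j + 1" | "step r i j = 1" "i = r" "j = r"
    | "step r i j = - 1" "j = i + 1" | "step r i j = - 1" "i = 1" "j = 1"
proof -
  consider "i = j + 1" | "j = i + 1" | "i \<noteq> j + 1" "j \<noteq> i + 1" "i = 1" "j = 1"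
    | "i \<noteq> j + 1" "j \<noteq> i + 1" "\<not> (i = 1 \<and> j = 1)" "i = r" "j = r"
    | "i \<noteq> j + 1" "j \<noteq> i + 1" "\<not> (i = 1 \<and> j = 1)" "\<not> (i = r \<and> j = r)" by blast
  then show ?thesis
  proof cases
    case 1
    then have "step r i j = 1" by (simp add: step_def)
    then show ?thesis using 1 that(2) by blast
  next
    case 2
    then have "step r i j = - 1" by (simp add: step_def)
    then show ?thesis using 2 that(4) by blast
  next
    case 3
    then have "step r i j = - 1" unfolding step_def by simp
    then show ?thesis using 3 that(5) by blast
  next
    case 4
    then have "step r i j = 1" unfolding step_def by simp
    then show ?thesis using 4 that(3) by blast
  next
    case 5
    then have "step r i j = 0" unfolding step_def by simp
    then show ?thesis by (rule that(1))
  qed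
qed

context sklyanin
begin

definition lam :: "nat \<Rightarrow> complex" where "lam j = (2 * of_nat j - 1) * spin m * h\<eta>"

abbreviation "Svec r t \<equiv> S_vec \<tau> \<eta> m r t"

text \<open>The parameter of the product function for a step of sign \<open>s\<close> from \<open>j\<close>.\<close>

definition S_par :: "int \<Rightarrow> nat \<Rightarrow> complex \<Rightarrow> complex" where
  "S_par s j u = of_int s * lam j + u / 2 - spin m * h\<eta> + h\<eta>"

lemma S_vec_eq: "Svec r t i j u k = (\<lambda>z. if step r i j = 0 then 0 else t k j * phi (S_par (step r i j) j u) z)"
proof
  fix z
  have e: "(of_int s * (2 * (2 * of_nat j - 1) * spin m * h\<eta>) + u) / 2 + (- spin m + 1) * h\<eta> = S_par s j u" for s :: int and j
    by (simp add: S_par_def lam_def field_simps)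
  show "Svec r t i j u k z = (if step r i j = 0 then 0 else t k j * phi (S_par (step r i j) j u) z)"
    using e[of "- 1" j] e[of 1 j] e[of "- 1" 1] e[of 1 r]
    by (auto simp: S_vec_def step_def f_fun_def)
qed

lemma S_vec_in_V: "Svec r t i j u k \<in> V"
  unfolding S_vec_eq by (cases "step r i j = 0") (auto simp: V_zero intro!: V_scale br_pair_in_V)

abbreviation "QR N r t \<equiv> Q_R \<tau> \<eta> m N r t"

lemma Q_R_in_H:
  assumes "N > 0" shows "QR N r t u v \<in> H N"
proof -
  have "(\<lambda>z. \<Sum>i\<in>{1..N} \<rightarrow>\<^sub>E {1..r}. 1 * pure_tensor N (\<lambda>n. Svec r t (i n) (cyc_pred N i n) u (k n)) z) \<in> H N" for k
    by (intro tensor_power_sum tensor_power_pure S_vec_in_V assms)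
  then show ?thesis unfolding Q_R_def by (intro tensor_power_sum[OF assms]) simp
qed

text \<open>\<open>Q\<^sub>R\<close> as one linear combination of products, on which operators act factor by factor.\<close>

lemma Q_R_eq_sum:
  "QR N r t u v = (\<lambda>z. \<Sum>(k, i)\<in>index_set N m \<times> ({1..N} \<rightarrow>\<^sub>E {1..r}). v k *
     pure_tensor N (\<lambda>n. Svec r t (i n) (cyc_pred N i n) u (k n)) z)"
  unfolding Q_R_def by (simp add: sum.cartesian_product[symmetric] sum_distrib_left)

lemma cyc_pred_in: "N > 0 \<Longrightarrow> i \<in> {1..N} \<rightarrow>\<^sub>E A \<Longrightarrow> n \<in> {1..N} \<Longrightarrow> cyc_pred N i n \<in> A"
proof (cases "n = 1")
  case False
  assume "i \<in> {1..N} \<rightarrow>\<^sub>E A" "n \<in> {1..N}"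
  moreover from this False have "n - 1 \<in> {1..N}" by auto
  ultimately show ?thesis using False by (auto simp: PiE_iff)
qed (auto simp: PiE_iff)

lemma op_tensor_power_QR:
  assumes "N > 0" "linear_operator_on V A"
    and eq: "\<And>k i. i \<in> {1..N} \<rightarrow>\<^sub>E {1..r} \<Longrightarrow> pure_tensor N (\<lambda>n. A (Svec r t (i n) (cyc_pred N i n) u (k n))) =
      (\<lambda>z. C * pure_tensor N (\<lambda>n. Svec r t (i n) (cyc_pred N i n) u' (k n)) z)"
  shows "op_tensor_power N A (QR N r t u v) = (\<lambda>z. C * QR N r t u' v z)"
proof -
  let ?J = "index_set N m \<times> ({1..N} \<rightarrow>\<^sub>E {1..r})"
  have "op_tensor_power N A (QR N r t u v) = (\<lambda>z. \<Sum>p\<in>?J. v (fst p) *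
     pure_tensor N (\<lambda>n. A (Svec r t (snd p n) (cyc_pred N (snd p) n) u (fst p n))) z)"
    unfolding Q_R_eq_sum case_prod_unfold
    by (rule op_tensor_power_pure_sum[OF assms(2)]) (rule S_vec_in_V)
  also have "\<dots> = (\<lambda>z. \<Sum>p\<in>?J. v (fst p) * (C * pure_tensor N (\<lambda>n. Svec r t (snd p n) (cyc_pred N (snd p) n) u' (fst p n)) z))"
    by (intro ext sum.cong refl arg_cong2[of _ _ _ _ "(*)"], subst eq) auto
  finally show ?thesis
    unfolding Q_R_eq_sum case_prod_unfold by (simp add: sum_distrib_left mult_ac)
qed

lemma U1_linear: "linear_operator_on V (U1_op m)"
  unfolding linear_operator_on_def
proof (intro conjI ballI allI)
  fix f assume f: "f \<in> V"
  have "(\<lambda>z. f (z + 1/2)) \<in> V"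
  proof (rule V_I)
    show "(\<lambda>z. f (z + 1/2)) holomorphic_on UNIV" by (intro V_holomorphic[OF f] holomorphic_intros)
    show "f (z + 1 + 1/2) = f (z + 1/2)" for z using V_D(2)[OF f, of "z + 1/2"] by (simp add: add_ac)
    show "f (- z + 1/2) = f (z + 1/2)" for z using V_D(2)[OF f, of "z - 1/2"] V_D(3)[OF f, of "z - 1/2"] by (simp add: algebra_simps)
    have "exp (- 4 * spin m * of_real pi * \<i> * (2 * (z + 1/2) + \<tau>)) = exp (2 * of_real pi * \<i> * of_int (- int m)) * exp (- 4 * spin m * of_real pi * \<i> * (2 * z + \<tau>))" for z
      by (simp only: exp_add[symmetric]) (simp add: algebra_simps)
    then have e: "exp (- 4 * spin m * of_real pi * \<i> * (2 * (z + 1/2) + \<tau>)) = exp (- 4 * spin m * of_real pi * \<i> * (2 * z + \<tau>))" for z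
      unfolding exp_2pi_int by simp
    show "f (z + \<tau> + 1/2) = exp (- 4 * spin m * of_real pi * \<i> * (2 * z + \<tau>)) * f (z + 1/2)" for z
      using V_D(4)[OF f, of "z + 1/2"] unfolding e by (simp add: add_ac)
  qed
  then show "U1_op m f \<in> V" unfolding U1_op_def by (rule V_scale)
qed (auto simp: U1_op_def algebra_simps)

lemma U3_linear: "linear_operator_on V (U3_op \<tau> m)"
  unfolding linear_operator_on_def
proof (intro conjI ballI allI)
  fix f assume f: "f \<in> V"
  let ?l = "of_real pi * \<i> * spin m"
  have "(\<lambda>z. exp (?l * (4 * z + \<tau>)) * f (z + \<tau>/2)) \<in> V"
  proof (rule V_I)
    show "(\<lambda>z. exp (?l * (4 * z + \<tau>)) * f (z + \<tau>/2)) holomorphic_on UNIV"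
      by (intro holomorphic_intros V_holomorphic[OF f])
    fix z
    have e1: "exp (?l * (4 * (z + 1) + \<tau>)) = exp (2 * of_real pi * \<i> * of_int (int m)) * exp (?l * (4 * z + \<tau>))"
      by (simp only: exp_add[symmetric]) (simp add: field_simps)
    show "exp (?l * (4 * (z + 1) + \<tau>)) * f (z + 1 + \<tau>/2) = exp (?l * (4 * z + \<tau>)) * f (z + \<tau>/2)"
    proof -
      have "z + 1 + \<tau>/2 = z + \<tau>/2 + 1" by simp
      then have "f (z + 1 + \<tau>/2) = f (z + \<tau>/2)" by (simp only: V_D(2)[OF f])
      then show ?thesis by (simp only: e1 exp_2pi_int mult_1_left)
    qed
    have "f (z + \<tau>/2) = f (z - \<tau>/2 + \<tau>)" by (rule arg_cong[of _ _ f]) (simp add: field_simps)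
    also have "\<dots> = exp (- 4 * spin m * of_real pi * \<i> * (2 * (z - \<tau>/2) + \<tau>)) * f (- (- z + \<tau>/2))"
      by (simp only: V_D(4)[OF f]) simp
    finally have "f (z + \<tau>/2) = exp (- 4 * spin m * of_real pi * \<i> * (2 * (z - \<tau>/2) + \<tau>)) * f (- z + \<tau>/2)"
      by (simp only: V_D(3)[OF f])
    then have "exp (?l * (4 * z + \<tau>)) * f (z + \<tau>/2) = (exp (?l * (4 * z + \<tau>)) * exp (- 4 * spin m * of_real pi * \<i> * (2 * (z - \<tau>/2) + \<tau>))) * f (- z + \<tau>/2)"
      by simp
    also have "exp (?l * (4 * z + \<tau>)) * exp (- 4 * spin m * of_real pi * \<i> * (2 * (z - \<tau>/2) + \<tau>)) = exp (?l * (4 * - z + \<tau>))"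
      by (simp only: exp_add[symmetric]) (simp add: field_simps)
    finally show "exp (?l * (4 * - z + \<tau>)) * f (- z + \<tau>/2) = exp (?l * (4 * z + \<tau>)) * f (z + \<tau>/2)" ..
    have "f (z + \<tau> + \<tau>/2) = exp (- 4 * spin m * of_real pi * \<i> * (2 * (z + \<tau>/2) + \<tau>)) * f (z + \<tau>/2)"
      using V_D(4)[OF f, of "z + \<tau>/2"] by (simp add: add_ac)
    then have "exp (?l * (4 * (z + \<tau>) + \<tau>)) * f (z + \<tau> + \<tau>/2) =
       (exp (?l * (4 * (z + \<tau>) + \<tau>)) * exp (- 4 * spin m * of_real pi * \<i> * (2 * (z + \<tau>/2) + \<tau>))) * f (z + \<tau>/2)"
      by simp
    also have "exp (?l * (4 * (z + \<tau>) + \<tau>)) * exp (- 4 * spin m * of_real pi * \<i> * (2 * (z + \<tau>/2) + \<tau>)) =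
       exp (- 4 * spin m * of_real pi * \<i> * (2 * z + \<tau>)) * exp (?l * (4 * z + \<tau>))"
      by (simp only: exp_add[symmetric]) (rule arg_cong[of _ _ exp], simp add: field_simps)
    finally show "exp (?l * (4 * (z + \<tau>) + \<tau>)) * f (z + \<tau> + \<tau>/2) =
       exp (- 4 * spin m * of_real pi * \<i> * (2 * z + \<tau>)) * (exp (?l * (4 * z + \<tau>)) * f (z + \<tau>/2))"
      by (simp only: mult.assoc)
  qed
  then have "(\<lambda>z. exp ?l * (exp (?l * (4 * z + \<tau>)) * f (z + \<tau>/2))) \<in> V" by (rule V_scale)
  then show "U3_op \<tau> m f \<in> V" unfolding U3_op_def by (simp only: mult.assoc)
qed (auto simp: U3_op_def algebra_simps)

lemma exp_minus_pi_m: "exp (- (of_real pi * \<i> * of_nat m)) = (- 1) ^ m"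
proof -
  have "exp (- (of_real pi * \<i> * of_nat m)) = exp (- (of_real pi * \<i>)) ^ m"
    by (simp add: exp_of_nat_mult[symmetric] mult_ac)
  also have "exp (- (of_real pi * \<i>)) = - 1" by (simp add: exp_minus exp_pi_i)
  finally show ?thesis .
qed

lemma U1_phi: "U1_op m (phi c) z = exp (- (of_real pi * \<i> * spin m)) * phi (c + 1/2) z"
proof -
  have "phi (c + 1/2) z = (\<Prod>j<m. - 1 * (sg (z + 1/2 + c + 2 * of_nat j * h\<eta>) * sg (- (z + 1/2) + c + 2 * of_nat j * h\<eta>)))"
    unfolding br_pair_eq
  proof (rule prod.cong)
    fix j
    show "sg (z + (c + 1/2) + 2 * of_nat j * h\<eta>) * sg (- z + (c + 1/2) + 2 * of_nat j * h\<eta>) =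
      - 1 * (sg (z + 1/2 + c + 2 * of_nat j * h\<eta>) * sg (- (z + 1/2) + c + 2 * of_nat j * h\<eta>))"
      using sg_1[of "- (z + 1/2) + c + 2 * of_nat j * h\<eta>"] by (simp add: algebra_simps)
  qed simp
  also have "\<dots> = (- 1) ^ m * phi c (z + 1/2)" by (simp only: prod.distrib br_pair_eq) simp
  finally have "phi (c + 1/2) z = exp (- (of_real pi * \<i> * of_nat m)) * phi c (z + 1/2)" by (simp only: exp_minus_pi_m)
  then have "phi c (z + 1/2) = exp (of_real pi * \<i> * of_nat m) * phi (c + 1/2) z" by (simp add: exp_minus)
  moreover have "exp (of_real pi * \<i> * of_nat m) = exp (- (of_real pi * \<i> * of_nat m))"
    using exp_minus_pi_m by (simp add: exp_minus) (metis inverse_inverse_eq power_inverse inverse_minus_eq inverse_1)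
  ultimately have "U1_op m (phi c) z = (exp (of_real pi * \<i> * spin m) * exp (- (of_real pi * \<i> * of_nat m))) * phi (c + 1/2) z"
    by (simp add: U1_op_def)
  also have "exp (of_real pi * \<i> * spin m) * exp (- (of_real pi * \<i> * of_nat m)) = exp (- (of_real pi * \<i> * spin m))"
    by (simp only: exp_add[symmetric]) (simp add: field_simps)
  finally show ?thesis .
qed

lemma sum_of_nat_lessThan: "(\<Sum>j<n. 2 * of_nat j * x) = of_nat n * (of_nat n - 1) * (x :: complex)"
  by (induction n) (simp_all add: algebra_simps)

lemma U3_phi: "U3_op \<tau> m (phi c) z =
  exp (of_real pi * \<i> * spin m * (\<tau> - 1) + 2 * of_real pi * \<i> * of_nat m * (c + (of_nat m - 1) * h\<eta>)) * phi (c + \<tau>/2) z"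
proof -
  let ?a = "\<lambda>j. c + 2 * of_nat j * h\<eta>"
  have "phi (c + \<tau>/2) z = (\<Prod>j<m. exp (of_real pi * \<i> + 2 * of_real pi * \<i> * (z - ?a j)) * (sg (z + \<tau>/2 + c + 2 * of_nat j * h\<eta>) * sg (- (z + \<tau>/2) + c + 2 * of_nat j * h\<eta>)))"
    unfolding br_pair_eq
  proof (rule prod.cong)
    fix j
    have "sg (- z + (c + \<tau>/2) + 2 * of_nat j * h\<eta>) = sg (- (z + \<tau>/2) + c + 2 * of_nat j * h\<eta> + \<tau>)"
      by (simp add: algebra_simps)
    also have "\<dots> = exp (of_real pi * \<i>) * exp (- (of_real pi * \<i> * (\<tau> + 2 * (- (z + \<tau>/2) + c + 2 * of_nat j * h\<eta>)))) * sg (- (z + \<tau>/2) + c + 2 * of_nat j * h\<eta>)"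
      unfolding sg_tau exp_pi_i by simp
    also have "exp (of_real pi * \<i>) * exp (- (of_real pi * \<i> * (\<tau> + 2 * (- (z + \<tau>/2) + c + 2 * of_nat j * h\<eta>)))) = exp (of_real pi * \<i> + 2 * of_real pi * \<i> * (z - ?a j))"
      by (simp only: exp_add[symmetric]) (simp add: algebra_simps)
    finally show "sg (z + (c + \<tau>/2) + 2 * of_nat j * h\<eta>) * sg (- z + (c + \<tau>/2) + 2 * of_nat j * h\<eta>) =
      exp (of_real pi * \<i> + 2 * of_real pi * \<i> * (z - ?a j)) * (sg (z + \<tau>/2 + c + 2 * of_nat j * h\<eta>) * sg (- (z + \<tau>/2) + c + 2 * of_nat j * h\<eta>))"
      by (simp add: add_ac mult_ac)
  qed simp
  also have "\<dots> = (\<Prod>j<m. exp (of_real pi * \<i> + 2 * of_real pi * \<i> * (z - ?a j))) * phi c (z + \<tau>/2)" by (simp only: prod.distrib br_pair_eq)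
  also have "(\<Prod>j<m. exp (of_real pi * \<i> + 2 * of_real pi * \<i> * (z - ?a j))) = exp (\<Sum>j<m. of_real pi * \<i> + 2 * of_real pi * \<i> * (z - ?a j))"
    by (simp add: exp_sum)
  also have "(\<Sum>j<m. of_real pi * \<i> + 2 * of_real pi * \<i> * (z - ?a j)) = of_real pi * \<i> * of_nat m + 2 * of_real pi * \<i> * of_nat m * (z - (c + (of_nat m - 1) * h\<eta>))"
  proof -
    have "(\<Sum>j<m. z - ?a j) = of_nat m * (z - c) - (\<Sum>j<m. 2 * of_nat j * h\<eta>)"
      by (simp add: sum_subtractf sum.distrib algebra_simps)
    then have "(\<Sum>j<m. z - ?a j) = of_nat m * (z - (c + (of_nat m - 1) * h\<eta>))"
      unfolding sum_of_nat_lessThan by (simp add: algebra_simps)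
    then show ?thesis by (simp only: sum.distrib sum_distrib_left[symmetric] sum_constant card_lessThan) (simp add: mult_ac)
  qed
  finally have "phi (c + \<tau>/2) z = exp (of_real pi * \<i> * of_nat m + 2 * of_real pi * \<i> * of_nat m * (z - (c + (of_nat m - 1) * h\<eta>))) * phi c (z + \<tau>/2)" .
  then have "exp (of_real pi * \<i> * spin m * (\<tau> - 1) + 2 * of_real pi * \<i> * of_nat m * (c + (of_nat m - 1) * h\<eta>)) * phi (c + \<tau>/2) z
     = (exp (of_real pi * \<i> * spin m * (\<tau> - 1) + 2 * of_real pi * \<i> * of_nat m * (c + (of_nat m - 1) * h\<eta>)) *
      exp (of_real pi * \<i> * of_nat m + 2 * of_real pi * \<i> * of_nat m * (z - (c + (of_nat m - 1) * h\<eta>)))) * phi c (z + \<tau>/2)"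
    by simp
  also have "exp (of_real pi * \<i> * spin m * (\<tau> - 1) + 2 * of_real pi * \<i> * of_nat m * (c + (of_nat m - 1) * h\<eta>)) *
      exp (of_real pi * \<i> * of_nat m + 2 * of_real pi * \<i> * of_nat m * (z - (c + (of_nat m - 1) * h\<eta>)))
     = exp (of_real pi * \<i> * spin m) * exp (of_real pi * \<i> * spin m * (4 * z + \<tau>))"
    by (simp only: exp_add[symmetric]) (simp add: field_simps)
  finally show ?thesis by (simp add: U3_op_def)
qed

lemma U1_S_vec: "U1_op m (Svec r t i j u k) = (\<lambda>z. exp (- (of_real pi * \<i> * spin m)) * Svec r t i j (u + 1) k z)"
proof (cases "step r i j = 0")
  case False
  have "S_par s j (u + 1) = S_par s j u + 1/2" for s by (simp add: S_par_def field_simps)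
  then show ?thesis using False U1_phi by (simp add: S_vec_eq U1_op_def fun_eq_iff)
qed (simp add: S_vec_eq U1_op_def)

end

text \<open>The rationality of \<open>\<eta>\<close> closes the chain of steps at its upper end.\<close>

locale sklyanin_rational = sklyanin_small +
  fixes r :: nat and r' :: int
  assumes r_pos: "r > 0" and eta_rational: "real m * \<eta> * real r = of_int r'"
begin

lemma eta_rational_complex: "of_nat m * h\<eta> * of_nat r = of_int r'"
  using arg_cong[OF eta_rational, of complex_of_real] by simp

text \<open>
  On a product function \<open>U\<^sub>3\<close> acts with a multiplier that depends on the step. The part
  that does so is \<open>v(i)/v(j)\<close> for a step from \<open>j\<close> to \<open>i\<close>, and cancels along closed paths.
\<close>

definition v_tel :: "nat \<Rightarrow> complex" where
  "v_tel j = exp (of_real pi * \<i> * of_nat m * (of_nat m * h\<eta> * (of_nat j * (of_nat j - 1))))"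

lemma v_tel_step:
  assumes "i \<in> {1..r}" "j \<in> {1..r}" "step r i j \<noteq> 0"
  shows "exp (2 * of_real pi * \<i> * of_nat m * (of_int (step r i j) * lam j + spin m * h\<eta>)) = v_tel i / v_tel j"
proof -
  let ?P = "of_real pi * \<i> * of_nat m * (of_nat m * h\<eta>) :: complex"
  have v: "v_tel i = exp (?P * (of_nat i * (of_nat i - 1)))" for i by (simp add: v_tel_def mult_ac)
  have lhs: "2 * of_real pi * \<i> * of_nat m * (of_int s * lam j + spin m * h\<eta>) = ?P * (of_int s * (2 * of_nat j - 1) + 1)" for s
    by (simp add: lam_def field_simps)
  show ?thesis
    using assms(1,2)
  proof (cases rule: step_cases)
    case 2
    then show ?thesis unfolding lhs v exp_diff[symmetric] by (simp add: algebra_simps)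
  next
    case 3
    have "?P * (of_int 1 * (2 * of_nat r - 1) + 1) = 2 * of_real pi * \<i> * of_nat m * (of_nat m * h\<eta> * of_nat r)"
      by (simp add: field_simps)
    also have "\<dots> = 2 * of_real pi * \<i> * of_int (int m * r')"
      unfolding eta_rational_complex by simp
    finally show ?thesis using 3 unfolding lhs by (simp only: exp_2pi_int) (simp add: v)
  next
    case 4
    then show ?thesis unfolding lhs v exp_diff[symmetric] by (simp add: algebra_simps)
  next
    case 5
    then show ?thesis unfolding lhs v exp_diff[symmetric] by simp
  qed (use assms in auto)
qed

lemma U3_S_vec:
  assumes "i \<in> {1..r}" "j \<in> {1..r}"
  shows "U3_op \<tau> m (Svec r t i j u k) = (\<lambda>z. exp (of_real pi * \<i> * spin m * (\<tau> - 1) + 2 * of_real pi * \<i> * spin m * u) * (v_tel i / v_tel j) * Svec r t i j (u + \<tau>) k z)"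
proof (cases "step r i j = 0")
  case False
  define s where "s = step r i j"
  have par: "S_par s j (u + \<tau>) = S_par s j u + \<tau>/2" by (simp add: S_par_def field_simps)
  have "of_real pi * \<i> * spin m * (\<tau> - 1) + 2 * of_real pi * \<i> * of_nat m * (S_par s j u + (of_nat m - 1) * h\<eta>) =
     (of_real pi * \<i> * spin m * (\<tau> - 1) + 2 * of_real pi * \<i> * spin m * u) + 2 * of_real pi * \<i> * of_nat m * (of_int s * lam j + spin m * h\<eta>)"
    by (simp add: S_par_def field_simps)
  then have e: "exp (of_real pi * \<i> * spin m * (\<tau> - 1) + 2 * of_real pi * \<i> * of_nat m * (S_par s j u + (of_nat m - 1) * h\<eta>)) =
     exp (of_real pi * \<i> * spin m * (\<tau> - 1) + 2 * of_real pi * \<i> * spin m * u) * (v_tel i / v_tel j)"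
    using v_tel_step[OF assms False] by (simp only: exp_add s_def)
  have "U3_op \<tau> m (\<lambda>z. t k j * phi (S_par s j u) z) = (\<lambda>z. t k j * U3_op \<tau> m (phi (S_par s j u)) z)"
    by (simp add: U3_op_def fun_eq_iff)
  then show ?thesis using False
    by (simp only: S_vec_eq s_def[symmetric] if_False U3_phi e par) (simp only: mult_ac)
qed (simp add: S_vec_eq U3_op_def)

lemma v_tel_nonzero: "v_tel j \<noteq> 0" by (simp add: v_tel_def)

lemma U1_Q_R:
  assumes "N > 0"
  shows "op_tensor_power N (U1_op m) (QR N r t u v) = (\<lambda>z. exp (- (of_real pi * \<i> * spin m)) ^ N * QR N r t (u + 1) v z)"
  by (rule op_tensor_power_QR[OF assms U1_linear]) (simp add: pure_tensor_def U1_S_vec prod.distrib fun_eq_iff)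

lemma U3_Q_R:
  assumes "N > 0"
  shows "op_tensor_power N (U3_op \<tau> m) (QR N r t u v) =
    (\<lambda>z. exp (of_real pi * \<i> * spin m * (\<tau> - 1) + 2 * of_real pi * \<i> * spin m * u) ^ N * QR N r t (u + \<tau>) v z)"
proof (rule op_tensor_power_QR[OF assms U3_linear])
  fix k :: "nat \<Rightarrow> nat" and i assume i: "i \<in> {1..N} \<rightarrow>\<^sub>E {1..r}"
  let ?C = "exp (of_real pi * \<i> * spin m * (\<tau> - 1) + 2 * of_real pi * \<i> * spin m * u)"
  have v: "(\<Prod>n=1..N. v_tel (i n)) / (\<Prod>n=1..N. v_tel (cyc_pred N i n)) = 1"
    unfolding prod_cyc_pred[OF assms] using v_tel_nonzero by simp
  show "pure_tensor N (\<lambda>n. U3_op \<tau> m (Svec r t (i n) (cyc_pred N i n) u (k n))) =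
     (\<lambda>z. ?C ^ N * pure_tensor N (\<lambda>n. Svec r t (i n) (cyc_pred N i n) (u + \<tau>) (k n)) z)"
  proof
    fix z
    have "pure_tensor N (\<lambda>n. U3_op \<tau> m (Svec r t (i n) (cyc_pred N i n) u (k n))) z =
       (\<Prod>n=1..N. ?C * (v_tel (i n) / v_tel (cyc_pred N i n)) * Svec r t (i n) (cyc_pred N i n) (u + \<tau>) (k n) (z n))"
      unfolding pure_tensor_def
    proof (rule prod.cong)
      fix n assume n: "n \<in> {1..N}"
      then have "i n \<in> {1..r}" using i by (auto simp: PiE_iff)
      then show "U3_op \<tau> m (Svec r t (i n) (cyc_pred N i n) u (k n)) (z n) =
        ?C * (v_tel (i n) / v_tel (cyc_pred N i n)) * Svec r t (i n) (cyc_pred N i n) (u + \<tau>) (k n) (z n)"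
        using cyc_pred_in[OF assms i n] by (subst U3_S_vec) simp_all
    qed simp
    also have "\<dots> = ?C ^ N * ((\<Prod>n=1..N. v_tel (i n)) / (\<Prod>n=1..N. v_tel (cyc_pred N i n))) * pure_tensor N (\<lambda>n. Svec r t (i n) (cyc_pred N i n) (u + \<tau>) (k n)) z"
      by (simp only: prod.distrib prod_dividef pure_tensor_def prod_constant card_atLeastAtMost) simp
    finally show "pure_tensor N (\<lambda>n. U3_op \<tau> m (Svec r t (i n) (cyc_pred N i n) u (k n))) z =
       ?C ^ N * pure_tensor N (\<lambda>n. Svec r t (i n) (cyc_pred N i n) (u + \<tau>) (k n)) z"
      unfolding v by simp
  qed
qed

text \<open>
  The gauge vectors are even and have period \<open>1\<close>. Hence they do not see the reflections at the two
  ends of the chain: \<open>\<lambda>\<^sub>0 = -\<lambda>\<^sub>1\<close>, and \<open>\<lambda>\<^sub>r\<^sub>+\<^sub>1 = -\<lambda>\<^sub>r\<close> up to an integer.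
\<close>

lemma step_vec:
  assumes "i \<in> {1..r}" "j \<in> {1..r}" "step r i j \<noteq> 0"
  shows "avec (of_int (step r i j) * lam j) = avec (lam j)" "bvec (of_int (step r i j) * lam j) = bvec (lam j)"
    "avec (of_int (step r i j) * lam j + of_nat m * h\<eta>) = avec (lam i)"
    "bvec (of_int (step r i j) * lam j + of_nat m * h\<eta>) = bvec (lam i)"
proof -
  have "step r i j = 1 \<or> step r i j = - 1" using assms by (cases rule: step_cases[OF assms(1,2)]) auto
  then show "avec (of_int (step r i j) * lam j) = avec (lam j)" "bvec (of_int (step r i j) * lam j) = bvec (lam j)"
    by (auto simp: avec_even bvec_even)
  have up: "of_int 1 * lam r + of_nat m * h\<eta> = - lam r + of_int (2 * r')"
  proof -
    have "2 * lam r = 2 * (of_nat m * h\<eta> * of_nat r) - of_nat m * h\<eta>" by (simp add: lam_def field_simps)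
    then show ?thesis unfolding eta_rational_complex by (simp add: algebra_simps)
  qed
  have "avec (of_int (step r i j) * lam j + of_nat m * h\<eta>) = avec (lam i) \<and> bvec (of_int (step r i j) * lam j + of_nat m * h\<eta>) = bvec (lam i)"
    using assms(1,2)
  proof (cases rule: step_cases)
    case 2
    then have "of_int (step r i j) * lam j + of_nat m * h\<eta> = lam i" by (simp add: lam_def field_simps)
    then show ?thesis by simp
  next
    case 3
    then have e: "of_int (step r i j) * lam j + of_nat m * h\<eta> = - lam i + of_int (2 * r')" using up by simp
    show ?thesis unfolding e avec_int bvec_int avec_even bvec_even by simp
  next
    case 4
    then have e: "of_int (step r i j) * lam j + of_nat m * h\<eta> = - lam i" by (simp add: lam_def field_simps)
    show ?thesis unfolding e avec_even bvec_even by simp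
  next
    case 5
    then have "of_int (step r i j) * lam j + of_nat m * h\<eta> = lam i" by (simp add: lam_def field_simps)
    then show ?thesis by simp
  qed (use assms in auto)
  then show "avec (of_int (step r i j) * lam j + of_nat m * h\<eta>) = avec (lam i)"
    "bvec (of_int (step r i j) * lam j + of_nat m * h\<eta>) = bvec (lam i)" by auto
qed

end

locale sklyanin_main = sklyanin_rational + sklyanin_nonzero
begin

lemma lop_S_vec:
  assumes "i \<in> {1..r}" "j \<in> {1..r}"
  shows "(\<Sum>\<beta>\<in>UNIV. lop u \<alpha> \<beta> (Svec r t i j u k) z * avec (lam j) \<beta>) =
      2 * sg (u + of_nat m * h\<eta>) * Svec r t i j (u - 2 * h\<eta>) k z * avec (lam i) \<alpha>"
    and "(\<Sum>\<alpha>\<in>UNIV. bvec (lam i) \<alpha> * lop u \<alpha> \<beta> (Svec r t i j u k) z) =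
      2 * sg (u - of_nat m * h\<eta>) * Svec r t i j (u + 2 * h\<eta>) k z * bvec (lam j) \<beta>"
proof -
  define s where "s = step r i j"
  have lop: "lop u \<alpha> \<beta> (\<lambda>z. c * f z) z = c * lop u \<alpha> \<beta> f z" if "f \<in> V" for c f \<alpha> \<beta>
    using linear_V_sum[OF lop_linear, of "{0::nat}" "\<lambda>_. f" u \<alpha> \<beta> "\<lambda>_. c"] that by (simp add: fun_eq_iff)
  have lop0: "lop u \<alpha> \<beta> (\<lambda>z. 0) z = 0" for \<alpha> \<beta> using lop[OF V_zero, of \<alpha> \<beta> 0] by simp
  have par: "S_par s j (u - 2 * h\<eta>) = S_par s j u - h\<eta>" "S_par s j (u + 2 * h\<eta>) = S_par s j u + h\<eta>" by (simp_all add: S_par_def field_simps)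
  show "(\<Sum>\<beta>\<in>UNIV. lop u \<alpha> \<beta> (Svec r t i j u k) z * avec (lam j) \<beta>) =
      2 * sg (u + of_nat m * h\<eta>) * Svec r t i j (u - 2 * h\<eta>) k z * avec (lam i) \<alpha>"
  proof (cases "s = 0")
    case True
    then show ?thesis by (simp add: S_vec_eq s_def lop0)
  next
    case False
    then have "(\<Sum>\<beta>\<in>UNIV. lop u \<alpha> \<beta> (Svec r t i j u k) z * avec (lam j) \<beta>) =
       t k j * (\<Sum>\<beta>\<in>UNIV. lop u \<alpha> \<beta> (phi (S_par s j u)) z * avec (of_int s * lam j) \<beta>)"
      using step_vec(1)[OF assms] by (simp add: S_vec_eq s_def lop br_pair_in_V sum_distrib_left mult_ac)
    also have "\<dots> = t k j * (2 * sg (u + of_nat m * h\<eta>) * phi (S_par s j u - h\<eta>) z * avec (of_int s * lam j + of_nat m * h\<eta>) \<alpha>)"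
      by (subst lop_column) (simp_all add: S_par_def)
    finally show ?thesis using False step_vec(3)[OF assms] by (simp add: S_vec_eq s_def[symmetric] par)
  qed
  show "(\<Sum>\<alpha>\<in>UNIV. bvec (lam i) \<alpha> * lop u \<alpha> \<beta> (Svec r t i j u k) z) =
      2 * sg (u - of_nat m * h\<eta>) * Svec r t i j (u + 2 * h\<eta>) k z * bvec (lam j) \<beta>"
  proof (cases "s = 0")
    case True
    then show ?thesis by (simp add: S_vec_eq s_def lop0)
  next
    case False
    then have "(\<Sum>\<alpha>\<in>UNIV. bvec (lam i) \<alpha> * lop u \<alpha> \<beta> (Svec r t i j u k) z) =
       t k j * (\<Sum>\<alpha>\<in>UNIV. bvec (of_int s * lam j + of_nat m * h\<eta>) \<alpha> * lop u \<alpha> \<beta> (phi (S_par s j u)) z)"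
      using step_vec(4)[OF assms] by (simp add: S_vec_eq s_def lop br_pair_in_V sum_distrib_left mult_ac)
    also have "\<dots> = t k j * (2 * sg (u - of_nat m * h\<eta>) * phi (S_par s j u + h\<eta>) z * bvec (of_int s * lam j) \<beta>)"
      by (subst lop_row) (simp_all add: S_par_def)
    finally show ?thesis using False step_vec(2)[OF assms] by (simp add: S_vec_eq s_def[symmetric] par)
  qed
qed

abbreviation "TT N \<equiv> transfer \<tau> \<eta> m N"

text \<open>
  Along a closed path the gauge vector with which a site ends is the one with which the next site
  begins. So the trace is the sum of the two eigenvalues, which are products over the sites.
\<close>

lemma transfer_pure_S_vec:
  assumes N: "N > 0" and i: "i \<in> {1..N} \<rightarrow>\<^sub>E {1..r}"
  shows "TT N u (pure_tensor N (\<lambda>n. Svec r t (i n) (cyc_pred N i n) u (k n))) =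
   (\<lambda>z. h_fun \<tau> \<eta> m N (- 1) u * pure_tensor N (\<lambda>n. Svec r t (i n) (cyc_pred N i n) (u - 2 * h\<eta>) (k n)) z
      + h_fun \<tau> \<eta> m N 1 u * pure_tensor N (\<lambda>n. Svec r t (i n) (cyc_pred N i n) (u + 2 * h\<eta>) (k n)) z)"
proof
  fix z
  let ?S = "\<lambda>u n. Svec r t (i n) (cyc_pred N i n) u (k n)"
  define i' where "i' n = (if n = 0 then i N else i n)" for n
  define X where "X n \<alpha> \<beta> = lop u \<alpha> \<beta> (?S u n) (z n)" for n \<alpha> \<beta>
  define c where "c n = 2 * sg (u + of_nat m * h\<eta>) * ?S (u - 2 * h\<eta>) n (z n)" for n
  define d where "d n = 2 * sg (u - of_nat m * h\<eta>) * ?S (u + 2 * h\<eta>) n (z n)" for n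
  have cp1: "cyc_pred N i n = i' (n - 1)" and cp2: "i n = i' n" if "n \<in> {1..N}" for n
    using that by (auto simp: i'_def)
  have cp3: "i' n \<in> {1..r}" if "n \<in> {1..N}" for n
    using that i by (auto simp: i'_def PiE_iff)
  have cp4: "i' (n - 1) \<in> {1..r}" if "n \<in> {1..N}" for n
    using cyc_pred_in[OF N i that] cp1[OF that] by simp
  have X1: "(\<Sum>\<beta>\<in>UNIV. X n \<alpha> \<beta> * avec (lam (i' (n - 1))) \<beta>) = c n * avec (lam (i' n)) \<alpha>" if "n \<in> {1..N}" for n \<alpha>
    unfolding X_def c_def cp1[OF that] cp2[OF that] by (rule lop_S_vec(1)[OF cp3[OF that] cp4[OF that]])
  have X2: "(\<Sum>\<alpha>\<in>UNIV. bvec (lam (i' n)) \<alpha> * X n \<alpha> \<beta>) = d n * bvec (lam (i' (n - 1))) \<beta>" if "n \<in> {1..N}" for n \<beta>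
    unfolding X_def d_def cp1[OF that] cp2[OF that] by (rule lop_S_vec(2)[OF cp3[OF that] cp4[OF that]])
  have i'0: "i' 0 = i' N" using N by (simp add: i'_def)
  have "TT N u (pure_tensor N (?S u)) z = (\<Sum>\<alpha>\<in>UNIV. path_matrix X N \<alpha> \<alpha>)"
    unfolding transfer_pure[OF N S_vec_in_V] path_matrix_trace[OF N] pure_tensor_def X_def ..
  also have "\<dots> = (\<Prod>n=1..N. c n) + (\<Prod>n=1..N. d n)"
  proof (rule trace_2_eq_eigenvalues[where M = "path_matrix X N" and v = "avec (lam (i' N))" and w = "bvec (lam (i' N))"])
    show "(\<Sum>\<beta>\<in>UNIV. path_matrix X N \<alpha> \<beta> * avec (lam (i' N)) \<beta>) = (\<Prod>n=1..N. c n) * avec (lam (i' N)) \<alpha>" for \<alpha>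
      using path_matrix_column[of N X "\<lambda>n. avec (lam (i' n))" c N \<alpha>] X1 i'0 by simp
    show "(\<Sum>\<alpha>\<in>UNIV. bvec (lam (i' N)) \<alpha> * path_matrix X N \<alpha> \<beta>) = (\<Prod>n=1..N. d n) * bvec (lam (i' N)) \<beta>" for \<beta>
      using path_matrix_row[of N "\<lambda>n. bvec (lam (i' n))" X d N \<beta>] X2 i'0 by simp
  qed (rule bvec_eq_avec avec_nonzero)+
  also have "\<dots> = (2 * sg (u + of_nat m * h\<eta>)) ^ N * pure_tensor N (?S (u - 2 * h\<eta>)) z + (2 * sg (u - of_nat m * h\<eta>)) ^ N * pure_tensor N (?S (u + 2 * h\<eta>)) z"
    unfolding c_def d_def pure_tensor_def by (simp only: prod.distrib prod_constant card_atLeastAtMost) simp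
  finally show "TT N u (pure_tensor N (?S u)) z = h_fun \<tau> \<eta> m N (- 1) u * pure_tensor N (?S (u - 2 * h\<eta>)) z
      + h_fun \<tau> \<eta> m N 1 u * pure_tensor N (?S (u + 2 * h\<eta>)) z"
    by (simp add: h_fun_def)
qed

theorem transfer_Q_R:
  assumes N: "N > 0"
  shows "TT N u (QR N r t u v) = (\<lambda>z. h_fun \<tau> \<eta> m N (- 1) u * QR N r t (u - 2 * h\<eta>) v z + h_fun \<tau> \<eta> m N 1 u * QR N r t (u + 2 * h\<eta>) v z)"
proof -
  let ?J = "index_set N m \<times> ({1..N} \<rightarrow>\<^sub>E {1..r})"
  let ?S = "\<lambda>u p n. Svec r t (snd p n) (cyc_pred N (snd p) n) u (fst p n)"
  have "TT N u (QR N r t u v) = (\<lambda>z. \<Sum>p\<in>?J. v (fst p) * TT N u (pure_tensor N (?S u p)) z)"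
    unfolding Q_R_eq_sum case_prod_unfold by (rule transfer_sum) (rule S_vec_in_V)
  also have "\<dots> = (\<lambda>z. \<Sum>p\<in>?J. v (fst p) * (h_fun \<tau> \<eta> m N (- 1) u * pure_tensor N (?S (u - 2 * h\<eta>) p) z
      + h_fun \<tau> \<eta> m N 1 u * pure_tensor N (?S (u + 2 * h\<eta>) p) z))"
    by (intro ext sum.cong refl arg_cong2[of _ _ _ _ "(*)"], subst transfer_pure_S_vec[OF N]) auto
  finally show ?thesis
    unfolding Q_R_eq_sum case_prod_unfold by (simp add: sum_distrib_left ring_distribs sum.distrib mult_ac)
qed

end

section \<open>Integration over the period rectangle\<close>

lemma integral_periodic_shift:
  fixes f :: "real \<Rightarrow> complex"
  assumes f: "continuous_on UNIV f" and per: "\<And>x. f (x + p) = f x" and p: "p > 0"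
  shows "integral {0..p} (\<lambda>x. f (x + a)) = integral {0..p} f"
proof -
  define n where "n = \<lfloor>a / p\<rfloor>"
  define b where "b = a - of_int n * p"
  have "of_int n \<le> a / p" "a / p < of_int n + 1" unfolding n_def by linarith+
  then have b: "0 \<le> b" "b \<le> p" using p by (auto simp: b_def field_simps)
  have perZ: "f (x + of_int k * p) = f x" for x k
  proof (induction k rule: int_induct[where k = 0])
    case (step1 i)
    then show ?case using per[of "x + of_int i * p"] by (simp add: algebra_simps)
  next
    case (step2 i)
    then show ?case using per[of "x + of_int (i - 1) * p"] by (simp add: algebra_simps)
  qed simp
  have int: "f integrable_on {c..d}" for c d
    by (rule integrable_continuous_real) (rule continuous_on_subset[OF f], simp)
  have sh: "integral {c..d} (\<lambda>x. f (x + e)) = integral {c + e..d + e} f" for c d e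
    using integral_shift_Icc_real[of c d f e] by (simp add: o_def add.commute)
  have "f (x + a) = f (x + b)" for x
    using perZ[of "x + b" n] by (simp add: b_def algebra_simps)
  then have "integral {0..p} (\<lambda>x. f (x + a)) = integral {b..p + b} f" using sh[of 0 p b] by simp
  also have "\<dots> = integral {b..p} f + integral {p..p + b} f"
    by (rule Henstock_Kurzweil_Integration.integral_combine[symmetric]) (use b int in auto)
  also have "integral {p..p + b} f = integral {0..b} f"
    using sh[of 0 b p] per by (simp add: add.commute)
  also have "integral {b..p} f + integral {0..b} f = integral {0..p} f"
    using Henstock_Kurzweil_Integration.integral_combine[of 0 b p f] b int by (simp add: add.commute)
  finally show ?thesis .
qed

lemma integral_periodic_reflect:
  fixes f :: "real \<Rightarrow> complex"
  assumes "\<And>x. f (x + p) = f x"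
  shows "integral {0..p} (\<lambda>x. f (- x)) = integral {0..p} f"
proof -
  have "integral {0..p} (\<lambda>x. f (- x)) = integral {- p..- 0} f"
    using Henstock_Kurzweil_Integration.integral_reflect_real[where a = 0 and b = p and f = "\<lambda>x. f (- x)"] by simp
  also have "\<dots> = integral {- p..- 0} (f \<circ> (+) p)" using assms by (simp add: o_def add.commute)
  also have "\<dots> = integral {0..p} f" by (subst integral_shift_Icc_real) simp
  finally show ?thesis .
qed

text \<open>
  A contour shift for a periodic function: its primitive has a constant increment over a period.
\<close>

lemma integral_periodic_holomorphic_shift:
  fixes h :: "complex \<Rightarrow> complex"
  assumes S: "convex S" "open S" "h holomorphic_on S" and shift: "\<And>\<zeta>. \<zeta> \<in> S \<Longrightarrow> \<zeta> + \<i> * of_real p \<in> S"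
    and per: "\<And>\<zeta>. \<zeta> \<in> S \<Longrightarrow> h (\<zeta> + \<i> * of_real p) = h \<zeta>" and p: "p > 0"
    and s: "\<And>y. y \<in> {0..p} \<Longrightarrow> of_real s + \<i> * of_real y \<in> S" "\<And>y. y \<in> {0..p} \<Longrightarrow> of_real s' + \<i> * of_real y \<in> S"
  shows "integral {0..p} (\<lambda>y. h (of_real s + \<i> * of_real y)) = integral {0..p} (\<lambda>y. h (of_real s' + \<i> * of_real y))"
proof -
  obtain P where P: "\<And>\<zeta>. \<zeta> \<in> S \<Longrightarrow> (P has_field_derivative h \<zeta>) (at \<zeta> within S)"
    using holomorphic_convex_primitive'[OF S] by blast
  have P': "(P has_field_derivative h \<zeta>) (at \<zeta>)" if "\<zeta> \<in> S" for \<zeta>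
    using P[OF that] at_within_open[OF that S(2)] by simp
  have "((\<lambda>\<zeta>. P (\<zeta> + \<i> * of_real p) - P \<zeta>) has_field_derivative 0) (at \<zeta> within S)" if "\<zeta> \<in> S" for \<zeta>
  proof -
    have "((\<lambda>\<zeta>. P (\<zeta> + \<i> * of_real p)) has_field_derivative h (\<zeta> + \<i> * of_real p)) (at \<zeta>)"
      by (rule iffD1[OF DERIV_shift P'[OF shift[OF that]]])
    from DERIV_diff[OF this P'[OF that]] show ?thesis
      by (simp add: per[OF that] has_field_derivative_at_within)
  qed
  then have "\<exists>c. \<forall>\<zeta>\<in>S. P (\<zeta> + \<i> * of_real p) - P \<zeta> = c"
    by (rule has_field_derivative_zero_constant[OF S(1)])
  then obtain c where c: "\<And>\<zeta>. \<zeta> \<in> S \<Longrightarrow> P (\<zeta> + \<i> * of_real p) - P \<zeta> = c" by blast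
  have R: "integral {0..p} (\<lambda>y. h (of_real s + \<i> * of_real y)) = - \<i> * c"
    if s: "\<And>y. y \<in> {0..p} \<Longrightarrow> of_real s + \<i> * of_real y \<in> S" for s :: real
  proof -
    have "((\<lambda>y. h (of_real s + \<i> * of_real y)) has_integral
        (- \<i> * P (of_real s + \<i> * of_real p) - - \<i> * P (of_real s + \<i> * of_real 0))) {0..p}"
    proof (rule fundamental_theorem_of_calculus)
      fix y assume y: "y \<in> {0..p}"
      have "((\<lambda>y. of_real s + \<i> * of_real y) has_vector_derivative \<i>) (at y within {0..p})"
        by (auto intro!: derivative_eq_intros)
      then have "((P \<circ> (\<lambda>y. of_real s + \<i> * of_real y)) has_vector_derivative \<i> * h (of_real s + \<i> * of_real y)) (at y within {0..p})"
        using P'[OF s[OF y], THEN has_field_derivative_at_within] by (rule field_vector_diff_chain_within)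
      from has_vector_derivative_mult_right[OF this, of "- \<i>"]
      show "((\<lambda>y. - \<i> * P (of_real s + \<i> * of_real y)) has_vector_derivative h (of_real s + \<i> * of_real y)) (at y within {0..p})"
        by (simp add: o_def)
    qed (use p in simp)
    then have "integral {0..p} (\<lambda>y. h (of_real s + \<i> * of_real y)) = - \<i> * (P (of_real s + \<i> * of_real p) - P (of_real s + \<i> * of_real 0))"
      by (simp only: integral_unique right_diff_distrib)
    then show ?thesis using c[OF s[of 0]] p by simp
  qed
  have "integral {0..p} (\<lambda>y. h (of_real s + \<i> * of_real y)) = - \<i> * c" by (rule R) (rule s(1))
  moreover have "integral {0..p} (\<lambda>y. h (of_real s' + \<i> * of_real y)) = - \<i> * c" by (rule R) (rule s(2))
  ultimately show ?thesis by simp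
qed

context lattice
begin

definition dint :: "(complex \<Rightarrow> complex) \<Rightarrow> complex" where
  "dint G = integral {0..1} (\<lambda>x. integral {0..Im \<tau>} (\<lambda>y. G (Complex x y)))"

definition torus_fun :: "(complex \<Rightarrow> complex) \<Rightarrow> bool" where
  "torus_fun G \<longleftrightarrow> continuous_on UNIV G \<and> (\<forall>z. G (z + 1) = G z \<and> G (z + \<tau>) = G z)"

lemma Complex_continuous [continuous_intros]:
  assumes "continuous_on A f" "continuous_on A g"
  shows "continuous_on A (\<lambda>x. Complex (f x) (g x))"
  unfolding Complex_eq by (intro continuous_intros assms)

lemma dint_inner_continuous:
  fixes G :: "complex \<Rightarrow> complex"
  assumes "continuous_on UNIV G"
  shows "continuous_on A (\<lambda>x. integral {0..Im \<tau>} (\<lambda>y. G (Complex x y)))"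
proof -
  have "continuous_on (A \<times> cbox 0 (Im \<tau>)) (\<lambda>(x, y). G (Complex x y))"
    unfolding case_prod_unfold
    by (rule continuous_on_compose2[OF assms]) (auto intro!: continuous_intros)
  from integral_continuous_on_param[OF this] show ?thesis by simp
qed

lemma continuous_on_Complex:
  fixes G :: "complex \<Rightarrow> complex"
  assumes "continuous_on UNIV G" shows "continuous_on A (\<lambda>y. G (Complex x y))"
  by (rule continuous_on_compose2[OF assms]) (auto intro!: continuous_intros)

lemma inner_integrable:
  fixes G :: "complex \<Rightarrow> complex"
  assumes "continuous_on UNIV G" shows "(\<lambda>y. G (Complex x y)) integrable_on {a..b}"
  by (intro integrable_continuous_real continuous_on_Complex assms)

lemma dint_lin:
  assumes "continuous_on UNIV G" "continuous_on UNIV G'"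
  shows "dint (\<lambda>z. a * G z + b * G' z) = a * dint G + b * dint G'"
proof -
  let ?I = "\<lambda>G x. integral {0..Im \<tau>} (\<lambda>y. G (Complex x y))"
  have I: "?I G integrable_on {0..1}" "?I G' integrable_on {0..1}"
    by (intro integrable_continuous_real dint_inner_continuous assms)+
  have "dint (\<lambda>z. a * G z + b * G' z) = integral {0..1} (\<lambda>x. a * ?I G x + b * ?I G' x)"
    unfolding dint_def
  proof (rule arg_cong[of _ _ "integral {0..1}"], rule ext)
    fix x
    have "(\<lambda>y. a * G (Complex x y)) integrable_on {0..Im \<tau>}" "(\<lambda>y. b * G' (Complex x y)) integrable_on {0..Im \<tau>}"
      by (intro integrable_on_mult_right; rule inner_integrable[OF assms(1)] inner_integrable[OF assms(2)])+
    then show "integral {0..Im \<tau>} (\<lambda>y. a * G (Complex x y) + b * G' (Complex x y)) = a * ?I G x + b * ?I G' x"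
      by (subst integral_add) auto
  qed
  also have "\<dots> = a * dint G + b * dint G'"
    unfolding dint_def
    by (subst integral_add) (auto intro!: integrable_on_mult_right I)
  finally show ?thesis .
qed

lemma dint_cmult: "continuous_on UNIV G \<Longrightarrow> dint (\<lambda>z. a * G z) = a * dint G"
  using dint_lin[of G G a 0] by simp

lemma dint_sum:
  assumes "\<And>i. i \<in> I \<Longrightarrow> continuous_on UNIV (G i)"
  shows "dint (\<lambda>z. \<Sum>i\<in>I. c i * G i z) = (\<Sum>i\<in>I. c i * dint (G i))"
  using assms
proof (induction I rule: infinite_finite_induct)
  case (insert x F)
  have "continuous_on UNIV (\<lambda>z. \<Sum>i\<in>F. c i * G i z)" using insert by (intro continuous_intros) auto
  then show ?case using dint_lin[of "G x" "\<lambda>z. \<Sum>i\<in>F. c i * G i z" "c x" 1] insert by simp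
qed (simp_all add: dint_def)

lemma torus_inner:
  assumes "torus_fun G"
  shows "G (Complex (x + 1) y) = G (Complex x y)" "G (Complex x (y + Im \<tau>)) = G (Complex x y)"
proof -
  have "Complex (x + 1) y = Complex x y + 1" "Complex x (y + Im \<tau>) = Complex x y + \<tau>"
    using Re_tau by (auto simp: complex_eq_iff)
  then show "G (Complex (x + 1) y) = G (Complex x y)" "G (Complex x (y + Im \<tau>)) = G (Complex x y)"
    using assms by (simp_all add: torus_fun_def)
qed

lemma dint_shift: assumes "torus_fun G" shows "dint (\<lambda>z. G (z + w)) = dint G"
proof -
  have c: "continuous_on UNIV G" using assms by (simp add: torus_fun_def)
  have cw: "Complex x y + w = Complex (x + Re w) (y + Im w)" for x y by (simp add: complex_eq_iff)
  have "integral {0..Im \<tau>} (\<lambda>y. G (Complex x y + w)) = integral {0..Im \<tau>} (\<lambda>y. G (Complex (x + Re w) y))" for x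
    unfolding cw using integral_periodic_shift[of "\<lambda>y. G (Complex (x + Re w) y)" "Im \<tau>" "Im w"] Im_tau torus_inner(2)[OF assms]
      continuous_on_Complex[OF c] by simp
  then have "dint (\<lambda>z. G (z + w)) = integral {0..1} (\<lambda>x. integral {0..Im \<tau>} (\<lambda>y. G (Complex (x + Re w) y)))"
    by (simp add: dint_def)
  also have "\<dots> = dint G"
    unfolding dint_def by (rule integral_periodic_shift) (auto intro!: dint_inner_continuous c simp: torus_inner(1)[OF assms])
  finally show ?thesis .
qed

lemma dint_cnj_reflect: assumes "torus_fun G" shows "dint (\<lambda>z. G (cnj z)) = dint G"
proof -
  have "integral {0..Im \<tau>} (\<lambda>y. G (Complex x (- y))) = integral {0..Im \<tau>} (\<lambda>y. G (Complex x y))" for x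
    by (rule integral_periodic_reflect) (rule torus_inner(2)[OF assms])
  moreover have "cnj (Complex x y) = Complex x (- y)" for x y by (simp add: complex_eq_iff)
  ultimately show ?thesis by (simp add: dint_def)
qed

lemma dint_reflect: assumes "torus_fun G" shows "dint (\<lambda>z. G (- z)) = dint G"
proof -
  have "Complex (- x) (- y) = - Complex x y" for x y by (simp add: complex_eq_iff)
  then have "dint (\<lambda>z. G (- z)) = integral {0..1} (\<lambda>x. integral {0..Im \<tau>} (\<lambda>y. G (Complex (- x) (- y))))"
    by (simp add: dint_def)
  also have "\<dots> = integral {0..1} (\<lambda>x. integral {0..Im \<tau>} (\<lambda>y. G (Complex (- x) y)))"
    using integral_periodic_reflect[of "\<lambda>y. G (Complex (- x) y)" "Im \<tau>" for x] torus_inner(2)[OF assms] by simp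
  also have "\<dots> = dint G"
    unfolding dint_def by (rule integral_periodic_reflect) (simp add: torus_inner(1)[OF assms])
  finally show ?thesis .
qed

text \<open>The zeros of \<open>\<theta>\<^sub>0\<^sub>0\<close> have real part in \<open>1/2 + \<int>\<close>.\<close>

lemma th_strip_nonzero: assumes "\<bar>Re w\<bar> < 1/2" shows "th w \<noteq> 0"
proof
  assume "th w = 0"
  then obtain n j :: int where nj: "w - (1 + \<tau>)/2 = of_int n + of_int j * \<tau>" unfolding th_zero_iff sg_zero_iff by blast
  then have "Re w - 1/2 = of_int n" using Re_tau by (auto simp: complex_eq_iff)
  with assms have "real_of_int (- 1) < real_of_int n" "real_of_int n < real_of_int 0" by simp_all
  then show False unfolding of_int_less_iff by simp
qed

lemma thc_real_zero:
  assumes "a \<le> 3" "thc a (of_real x) = 0" shows "\<exists>n :: int. 2 * x = of_int n"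
proof -
  have sg: "\<exists>n :: int. x = of_int n" if z: "sg (of_real x) = 0" for x
  proof -
    obtain n j :: int where nj: "of_real x = of_int n + of_int j * \<tau>" using z unfolding sg_zero_iff by blast
    then have "j = 0" "x = of_int n" using Im_tau Re_tau by (auto simp: complex_eq_iff)
    then show ?thesis by blast
  qed
  consider "sg (of_real x) = 0" | "sg (of_real (x - 1/2)) = 0"
    using assms th_real_nonzero[of x] th_real_nonzero[of "x + 1/2"] unfolding le_3_iff
    by (elim disjE) (simp_all add: thc_simps)
  then show ?thesis
  proof cases
    case 1
    then obtain n where "x = real_of_int n" using sg by blast
    then have "2 * x = real_of_int (2 * n)" by simp
    then show ?thesis by blast
  next
    case 2
    then obtain n where "x - 1/2 = real_of_int n" using sg by blast
    then have "2 * x = real_of_int (2 * n + 1)" by simp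
    then show ?thesis by blast
  qed
qed

text \<open>
  The three-term identities behind the self-adjointness of \<open>\<rho>(S\<^sup>a)\<close>. They arise from a single
  instance of \<open>weierstrass\<close> by shifting the arguments by half periods.
\<close>

definition dual_char :: "nat \<Rightarrow> nat" where "dual_char a = (if a = 0 then 2 else if a = 1 then 3 else if a = 2 then 0 else 1)"
definition kap :: "nat \<Rightarrow> complex" where "kap a = (if a = 0 then - 1 else if a = 2 then - \<i> else 1)"

lemma three_term_sg:
  "sg (2 * w) * sg (2 * Z - k) * sg (Z + w + k) * sg (Z + w) - sg (2 * w + k) * sg (2 * Z) * sg (Z + w - k) * sg (Z + w)
   = - (sg (2 * (Z + w)) * sg k * sg (Z - w - k) * sg (Z - w))"
proof -
  have h: "x / 2 + x / 2 = x" "(x + y) / 2 = x / 2 + y / 2" "(x - y) / 2 = x / 2 - y / 2" for x y :: complex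
    by (simp_all add: field_simps)
  have "sg (2 * w) * sg (2 * Z - k) * (sg (Z + w + k) * sg (Z + w)) - sg (Z + w) * sg (Z + w - k) * (sg (2 * w + k) * sg (2 * Z)) =
    sg (2 * (Z + w)) * sg (- k) * (sg (w - Z + k) * sg (w - Z))"
    using weierstrass[of "w + Z - k/2" "Z + w + k/2" "w - Z + k/2" "k/2"]
    by (simp add: algebra_simps)
  moreover have "sg (- k) = - sg k" "sg (w - Z + k) = - sg (Z - w - k)" "sg (w - Z) = - sg (Z - w)"
    using sg_odd[of k] sg_odd[of "Z - w - k"] sg_odd[of "Z - w"] by (simp_all add: algebra_simps)
  ultimately show ?thesis by (simp add: algebra_simps)
qed

lemma sg_minus_omega: "sg (y - (1 + \<tau>)/2) = exp (of_real pi * \<i> * (y - \<tau>/4)) * th y"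
proof -
  have "\<tau> / 4 + (y - (1 + \<tau>)/2) + 1/2 = y - \<tau>/4" "y - (1 + \<tau>)/2 + (1 + \<tau>)/2 = y" by (simp_all add: field_simps)
  then show ?thesis by (simp only: sg_eq_th)
qed

lemma sg_plus_omega: "sg (y + (1 + \<tau>)/2) = - exp (of_real pi * \<i> * (- y - \<tau>/4)) * th y"
proof -
  have "sg (y + (1 + \<tau>)/2) = - sg (- (y + (1 + \<tau>)/2))" by (simp only: sg_odd minus_minus)
  also have "- (y + (1 + \<tau>)/2) = - y - (1 + \<tau>)/2" by simp
  finally show ?thesis unfolding sg_minus_omega th_even by simp
qed

lemma three_term_0:
  "sg (2 * w) * sg (2 * Z - k) * th (Z + w + k) * th (Z + w) - sg (2 * w + k) * sg (2 * Z) * th (Z + w - k) * th (Z + w)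
   = - (sg (2 * (Z + w)) * sg k * th (Z - w - k) * th (Z - w))"
proof -
  have T: "th (x + y) * th (x - y) = (t0 x * t0 y + t1 x * t1 y) / 2" for x y
    unfolding t0_t0 t1_t1 by simp
  have W: "sg (x + y) * sg (x - y) = (t1 x * t0 y - t0 x * t1 y) / 2" for x y
    unfolding plucker[symmetric] by simp
  define p q s r where "p = Z + w - k/2" and "q = Z + w + k/2" and "s = w - Z + k/2" and "r = k/2"
  have neg: "sg (- x) = - sg x" "th (- x) = th x" for x by (rule sg_odd th_even)+
  have "sg (2 * w) * sg (2 * Z - k) = sg (p + s) * sg (p - s)" "th (Z + w + k) * th (Z + w) = th (q + r) * th (q - r)"
    "sg (2 * w + k) * sg (2 * Z) = sg (q + s) * sg (q - s)" "th (Z + w - k) * th (Z + w) = th (p + r) * th (p - r)"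
    "sg (2 * (Z + w)) * sg k = sg (q + p) * sg (q - p)" "th (Z - w - k) * th (Z - w) = th (s + r) * th (s - r)"
    using th_even[of "s + r"] th_even[of "s - r"]
    by (simp_all add: p_def q_def s_def r_def algebra_simps)
  then have "sg (2 * w) * sg (2 * Z - k) * (th (Z + w + k) * th (Z + w)) - sg (2 * w + k) * sg (2 * Z) * (th (Z + w - k) * th (Z + w))
   = - (sg (2 * (Z + w)) * sg k * (th (Z - w - k) * th (Z - w)))"
    by (simp only: T W) (simp add: field_simps)
  then show ?thesis by (simp only: mult.assoc)
qed

lemma three_term_2:
  "- (sg (2 * w) * th (2 * Z - k) * th (Z + w + k) * sg (Z + w)) + th (2 * w + k) * sg (2 * Z) * th (Z + w - k) * sg (Z + w)
   = sg (2 * (Z + w)) * th k * th (Z - w - k) * sg (Z - w)"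
proof -
  let ?o = "(1 + \<tau>)/2"
  define e where "e x = exp (of_real pi * \<i> * (x - \<tau>/4))" for x
  define E where "E = exp (of_real pi * \<i> * (2 * k - (Z - w) - \<tau>/2))"
  have s: "sg (2 * Z - (k - ?o)) = - e (- (2 * Z - k)) * th (2 * Z - k)"
     "sg (Z + w + (k - ?o)) = e (Z + w + k) * th (Z + w + k)"
     "sg (2 * w + (k - ?o)) = e (2 * w + k) * th (2 * w + k)"
     "sg (Z + w - (k - ?o)) = - e (- (Z + w - k)) * th (Z + w - k)"
     "sg (k - ?o) = e k * th k" "sg (Z - w - (k - ?o)) = - e (- (Z - w - k)) * th (Z - w - k)"
    using sg_plus_omega[of "2 * Z - k"] sg_minus_omega[of "Z + w + k"] sg_minus_omega[of "2 * w + k"]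
      sg_plus_omega[of "Z + w - k"] sg_minus_omega[of k] sg_plus_omega[of "Z - w - k"]
    unfolding e_def by (simp_all only: diff_diff_eq2 add_diff_eq diff_add_eq)
  have exps: "e (- (2 * Z - k)) * e (Z + w + k) = E" "e (2 * w + k) * e (- (Z + w - k)) = E" "e k * e (- (Z - w - k)) = E"
    unfolding e_def E_def by (simp_all only: exp_add[symmetric]) (rule arg_cong[of _ _ exp], simp add: field_simps)+
  have "E * (- (sg (2 * w) * th (2 * Z - k) * th (Z + w + k) * sg (Z + w)) + th (2 * w + k) * sg (2 * Z) * th (Z + w - k) * sg (Z + w))
     = - (sg (2 * w) * (e (- (2 * Z - k)) * e (Z + w + k)) * th (2 * Z - k) * th (Z + w + k) * sg (Z + w))
       + (e (2 * w + k) * e (- (Z + w - k))) * th (2 * w + k) * sg (2 * Z) * th (Z + w - k) * sg (Z + w)"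
    unfolding exps by (simp add: algebra_simps)
  also have "\<dots> = sg (2 * (Z + w)) * (e k * e (- (Z - w - k))) * th k * th (Z - w - k) * sg (Z - w)"
    using three_term_sg[of w Z "k - ?o"] unfolding s by (simp add: mult_ac)
  also have "\<dots> = E * (sg (2 * (Z + w)) * th k * th (Z - w - k) * sg (Z - w))"
    unfolding exps by (simp add: mult_ac)
  finally show ?thesis by (simp add: E_def)
qed

lemma three_term_theta:
  assumes "a \<le> 3"
  shows "c_fac a * thc a (2 * Z - k) * sg (2 * w) * th (Z + w + k) * thc (dual_char a) (Z + w)
    + cnj (c_fac a) * thc a (- 2 * w - k) * sg (2 * Z) * th (Z + w - k) * thc (dual_char a) (Z + w)
    = kap a * sg (2 * (Z + w)) * thc a k * th (Z - w - k) * thc (dual_char a) (Z - w)"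
proof -
  have s1: "sg (2 * (x + 1/2)) = - sg (2 * x)" for x using sg_1[of "2 * x"] by (simp add: algebra_simps)
  have h1: "th (x + 1/2 + (y + 1/2)) = th (x + y)" for x y using th_1[of "x + y"] by (simp add: algebra_simps)
  have h2: "th (x + 1/2 - (y - 1/2)) = th (x - y)" for x y using th_1[of "x - y"] by (simp add: algebra_simps)
  have h3: "th (x - 1/2) = th (x + 1/2)" for x using th_1[of "x - 1/2"] by (simp add: algebra_simps)
  have s3: "sg (x - 1/2) = - sg (x + 1/2)" for x using sg_1[of "x - 1/2"] by (simp add: algebra_simps)
  have par: "thc a (- 2 * w - k) = par a * thc a (2 * w + k)"
    using thc_minus[OF assms, of "2 * w + k"] by simp
  have d: "dual_char 0 = 2" "dual_char 1 = 3" "dual_char 2 = 0" "dual_char 3 = 1" by (simp_all add: dual_char_def)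
  have a1: "sg (2 * (Z + 1/2) - (k - 1/2)) = sg (2 * Z - k - 1/2)"
    using thc_2[of 0 "2 * Z - k - 1/2"] by (simp add: thc_simps algebra_simps)
  have a2: "Z + 1/2 + w + (k - 1/2) = Z + w + k" "Z + 1/2 + w = Z + w + 1/2" "2 * w + (k - 1/2) = 2 * w + k - 1/2"
    "Z + 1/2 - w = Z - w + 1/2" "Z + w + 1/2 - (k + 1/2) = Z + w - k" "Z - w + 1/2 - (k + 1/2) = Z - w - k"
    "2 * w + (k + 1/2) = 2 * w + k + 1/2" "2 * (Z + 1/2) - (k + 1/2) = 2 * Z - k + 1/2"
    by (simp_all add: algebra_simps)
  have a3: "Z + 1/2 + w + (k + 1/2) = (Z + w) + 1/2 + (k + 1/2)" by simp
  consider "a = 0" | "a = 1" | "a = 2" | "a = 3" using assms unfolding le_3_iff by blast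
  then show ?thesis
  proof cases
    case 1
    then show ?thesis using three_term_0[of w Z k] unfolding par
      by (simp add: d thc_simps c_fac_def kap_def par_def mult_ac)
  next
    case 2
    have "sg (2 * w) * sg (2 * Z - k - 1/2) * th (Z + w + k) * th (Z + w + 1/2) + sg (2 * w + k - 1/2) * sg (2 * Z) * th (Z + w - k) * th (Z + w + 1/2)
      = sg (2 * (Z + w)) * sg (k - 1/2) * th (Z - w - k) * th (Z - w + 1/2)"
      using three_term_0[of w "Z + 1/2" "k - 1/2"] unfolding a1 a2 s1 h2 by (simp add: add.assoc)
    then show ?thesis using 2 unfolding par
      by (simp add: d thc_simps c_fac_def kap_def par_def mult_ac)
  next
    case 3
    have "- \<i> * (- (sg (2 * w) * th (2 * Z - k) * th (Z + w + k) * sg (Z + w)) + th (2 * w + k) * sg (2 * Z) * th (Z + w - k) * sg (Z + w))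
      = - \<i> * (sg (2 * (Z + w)) * th k * th (Z - w - k) * sg (Z - w))" by (simp only: three_term_2)
    then show ?thesis using 3 unfolding par
      by (simp add: d thc_simps c_fac_def kap_def par_def algebra_simps)
  next
    case 4
    have "- (sg (2 * w) * th (2 * Z - k + 1/2) * th (Z + w + k) * sg (Z + w + 1/2)) - th (2 * w + k + 1/2) * sg (2 * Z) * th (Z + w - k) * sg (Z + w + 1/2)
      = - (sg (2 * (Z + w)) * th (k + 1/2) * th (Z - w - k) * sg (Z - w + 1/2))"
      using three_term_2[of w "Z + 1/2" "k + 1/2"] unfolding a3 h1 a2 s1 by simp
    then show ?thesis using 4 unfolding par
      by (simp add: d thc_simps(2-) s3 c_fac_def kap_def par_def mult_ac)
  qed
qed

end

section \<open>The Sklyanin form\<close>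

context sklyanin
begin

definition den :: "complex \<Rightarrow> complex" where
  "den v = (\<Prod>j=0..m+1. th (v + (2 * of_nat j - of_nat m - 1) * h\<eta>))"

abbreviation "mu \<equiv> sklyanin_mu \<tau> \<eta> m"
abbreviation "form \<equiv> sklyanin_form \<tau> \<eta> m"

lemma mu_eq: "mu z w = sg (2 * z) * sg (2 * w) / (den (z + w) * den (z - w))"
  by (simp add: sklyanin_mu_def den_def prod.distrib br_def)

lemma form_eq: "form f g = dint (\<lambda>z. cnj (f z) * g z * mu z (cnj z))"
  by (simp add: sklyanin_form_def dint_def Let_def)

lemma sum_centered: "(\<Sum>j=0..n. (2 * of_nat j - of_nat n) * x) = (0 :: complex)"
proof -
  have "(\<Sum>j=0..n. (2 * of_nat j - of_nat n) * x) = (\<Sum>j=0..n. 2 * of_nat j * x - of_nat n * x)"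
    by (rule sum.cong) (simp_all add: algebra_simps)
  also have "\<dots> = 2 * (\<Sum>j=0..n. of_nat j) * x - of_nat (n + 1) * of_nat n * x"
    by (simp add: sum_subtractf sum_distrib_left sum_distrib_right mult_ac)
  also have "2 * (\<Sum>j=0..n. of_nat j :: complex) = of_nat n * (of_nat n + 1)"
    by (rule double_gauss_sum)
  finally show ?thesis by (simp add: algebra_simps)
qed

text \<open>Products of shifted theta functions over a string centred at the origin.\<close>

definition string :: "nat \<Rightarrow> complex \<Rightarrow> complex" where
  "string n v = (\<Prod>j=0..n. th (v + (2 * of_nat j - of_nat n) * h\<eta>))"

lemma den_eq: "den v = string (m + 1) v"
  unfolding den_def string_def by (simp add: diff_diff_eq)

lemma string_even: "string n (- v) = string n v"
proof -
  have "string n (- v) = (\<Prod>j=0..n. th (- v + (2 * of_nat (n - j) - of_nat n) * h\<eta>))"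
    unfolding string_def by (rule prod.reindex_bij_witness[of _ "\<lambda>j. n - j" "\<lambda>j. n - j"]) auto
  also have "\<dots> = (\<Prod>j=0..n. th (- (v + (2 * of_nat j - of_nat n) * h\<eta>)))"
    by (rule prod.cong) (auto simp: of_nat_diff algebra_simps)
  finally show ?thesis by (simp only: th_even string_def)
qed

lemma string_1: "string n (v + 1) = string n v"
proof -
  have "v + 1 + c = v + c + 1" for c :: complex by simp
  then show ?thesis unfolding string_def by (simp only: th_1)
qed

lemma string_tau: "string n (v + \<tau>) = exp (- (of_nat (n + 1) * (of_real pi * \<i> * (\<tau> + 2 * v)))) * string n v"
proof -
  let ?c = "\<lambda>j. (2 * of_nat j - of_nat n) * h\<eta>"
  have "string n (v + \<tau>) = (\<Prod>j=0..n. exp (- (of_real pi * \<i> * (\<tau> + 2 * (v + ?c j)))) * th (v + ?c j))"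
    unfolding string_def
  proof (rule prod.cong)
    fix j
    have "v + \<tau> + ?c j = v + ?c j + \<tau>" by simp
    then show "th (v + \<tau> + ?c j) = exp (- (of_real pi * \<i> * (\<tau> + 2 * (v + ?c j)))) * th (v + ?c j)" by (simp only: th_tau)
  qed simp
  also have "\<dots> = exp (\<Sum>j=0..n. - (of_real pi * \<i> * (\<tau> + 2 * (v + ?c j)))) * string n v"
    by (simp only: prod.distrib string_def exp_sum finite_atLeastAtMost)
  also have "(\<Sum>j=0..n. - (of_real pi * \<i> * (\<tau> + 2 * (v + ?c j)))) = (\<Sum>j=0..n. - (of_real pi * \<i> * (\<tau> + 2 * v)) - 2 * of_real pi * \<i> * ?c j)"
    by (rule sum.cong) (simp_all add: algebra_simps)
  also have "\<dots> = - (of_nat (n + 1) * (of_real pi * \<i> * (\<tau> + 2 * v))) - 2 * of_real pi * \<i> * (\<Sum>j=0..n. ?c j)"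
    by (simp only: sum_subtractf sum_distrib_left[symmetric] sum_constant card_atLeastAtMost) simp
  finally show ?thesis unfolding sum_centered by simp
qed

lemma string_nonzero:
  assumes "\<bar>Re v\<bar> + real n * \<bar>\<eta>\<bar> < 1/2" shows "string n v \<noteq> 0"
proof -
  have "th (v + (2 * of_nat j - of_nat n) * h\<eta>) \<noteq> 0" if "j \<in> {0..n}" for j
  proof (rule th_strip_nonzero)
    have "\<bar>2 * real j - real n\<bar> \<le> real n" using that by auto
    then have "\<bar>(2 * real j - real n) * \<eta>\<bar> \<le> real n * \<bar>\<eta>\<bar>" by (simp add: abs_mult mult_right_mono)
    moreover have "Re (v + (2 * of_nat j - of_nat n) * h\<eta>) = Re v + (2 * real j - real n) * \<eta>" by simp
    ultimately show "\<bar>Re (v + (2 * of_nat j - of_nat n) * h\<eta>)\<bar> < 1/2" using assms by linarith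
  qed
  then show ?thesis by (simp add: string_def)
qed

lemma string_real_nonzero: "string n (of_real x) \<noteq> 0"
proof -
  have "th (of_real x + (2 * of_nat j - of_nat n) * h\<eta>) \<noteq> 0" for j
    using th_real_nonzero[of "x + (2 * real j - real n) * \<eta>"] by simp
  then show ?thesis by (simp add: string_def)
qed

lemma string_holomorphic [holomorphic_intros]:
  assumes "f holomorphic_on A" shows "(\<lambda>z. string n (f z)) holomorphic_on A"
  unfolding string_def by (intro holomorphic_intros assms)

lemma string_continuous [continuous_intros]:
  assumes "continuous_on A f" shows "continuous_on A (\<lambda>z. string n (f z))"
  unfolding string_def by (intro continuous_intros assms)

text \<open>Shifting by \<open>\<plusminus>\<eta>\<close> splits off one end of the string.\<close>

lemma string_Suc_shift:
  "string (Suc n) (v - h\<eta>) = th (v - (of_nat n + 2) * h\<eta>) * string n v"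
  "string (Suc n) (v + h\<eta>) = th (v + (of_nat n + 2) * h\<eta>) * string n v"
proof -
  have "string (Suc n) (v - h\<eta>) = th (v - h\<eta> + (0 - of_nat (Suc n)) * h\<eta>) * (\<Prod>j=Suc 0..Suc n. th (v - h\<eta> + (2 * of_nat j - of_nat (Suc n)) * h\<eta>))"
    unfolding string_def by (subst prod.atLeast_Suc_atMost) auto
  also have "(\<Prod>j=Suc 0..Suc n. th (v - h\<eta> + (2 * of_nat j - of_nat (Suc n)) * h\<eta>)) = string n v"
    unfolding string_def by (subst prod.shift_bounds_cl_Suc_ivl) (rule prod.cong, auto simp: algebra_simps)
  also have "v - h\<eta> + (0 - of_nat (Suc n)) * h\<eta> = v - (of_nat n + 2) * h\<eta>" by (simp add: algebra_simps)
  finally show "string (Suc n) (v - h\<eta>) = th (v - (of_nat n + 2) * h\<eta>) * string n v" .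
  have "string (Suc n) (v + h\<eta>) = (\<Prod>j=0..n. th (v + h\<eta> + (2 * of_nat j - of_nat (Suc n)) * h\<eta>)) * th (v + h\<eta> + (2 * of_nat (Suc n) - of_nat (Suc n)) * h\<eta>)"
    unfolding string_def by (rule prod.atLeast0_atMost_Suc)
  also have "(\<Prod>j=0..n. th (v + h\<eta> + (2 * of_nat j - of_nat (Suc n)) * h\<eta>)) = string n v"
    unfolding string_def by (rule prod.cong) (auto simp: algebra_simps)
  also have "v + h\<eta> + (2 * of_nat (Suc n) - of_nat (Suc n)) * h\<eta> = v + (of_nat n + 2) * h\<eta>" by (simp add: algebra_simps)
  finally show "string (Suc n) (v + h\<eta>) = th (v + (of_nat n + 2) * h\<eta>) * string n v" by (simp only: mult.commute)
qed

text \<open>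
  In the integrand of the form, \<open>cnj (f z)\<close> is the value of \<open>cs f\<close> at \<open>w = cnj z\<close>; thus the integrand
  is the restriction to \<open>w = cnj z\<close> of a meromorphic function of \<open>z\<close> and \<open>w\<close>.
\<close>

definition cs :: "(complex \<Rightarrow> complex) \<Rightarrow> complex \<Rightarrow> complex" where "cs f w = cnj (f (cnj w))"

lemma cs_in_V: assumes f: "f \<in> V" shows "cs f \<in> V"
proof (rule V_I)
  show "cs f holomorphic_on UNIV"
    using holomorphic_on_compose_cnj_cnj[OF holomorphic_on_subset[OF V_D(1)[OF f] subset_UNIV], of UNIV]
    by (simp add: cs_def[abs_def] o_def)
  fix z
  show "cs f (z + 1) = cs f z" "cs f (- z) = cs f z" by (simp_all add: cs_def V_D[OF f])
  have "f (cnj z) = f (cnj z - \<tau> + \<tau>)" by simp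
  also have "\<dots> = exp (- 4 * spin m * of_real pi * \<i> * (2 * (cnj z - \<tau>) + \<tau>)) * f (cnj z - \<tau>)" by (rule V_D(4)[OF f])
  finally have "cs f z = exp (- (- 4 * spin m * of_real pi * \<i> * (2 * z + \<tau>))) * cs f (z + \<tau>)"
    by (simp add: cs_def exp_cnj cnj_tau algebra_simps)
  then show "cs f (z + \<tau>) = exp (- 4 * spin m * of_real pi * \<i> * (2 * z + \<tau>)) * cs f z"
    by (simp add: exp_minus)
qed

end

locale sklyanin_strict = sklyanin_small + assumes eta_less: "\<bar>\<eta>\<bar> < 1 / (2 * (real m + 1))"
begin

lemma eta_string: "(real m + 1) * \<bar>\<eta>\<bar> < 1/2"
  using eta_less by (simp add: field_simps)

lemma den_nonzero: "den (z + cnj z) \<noteq> 0" "den (z - cnj z) \<noteq> 0"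
proof -
  have "z + cnj z = of_real (2 * Re z)" by (simp add: complex_eq_iff)
  then show "den (z + cnj z) \<noteq> 0" unfolding den_eq by (simp only: string_real_nonzero simp_thms)
  show "den (z - cnj z) \<noteq> 0" unfolding den_eq by (rule string_nonzero) (use eta_string in \<open>simp add: add.commute\<close>)
qed

lemma mu_continuous [continuous_intros]: "continuous_on A (\<lambda>z. mu z (cnj z))"
  unfolding mu_eq using den_nonzero unfolding den_eq by (intro continuous_intros) auto

lemma sg_2_shift: "sg (2 * (z + 1)) = sg (2 * z)" "sg (2 * (z + \<tau>)) = exp (- (4 * of_real pi * \<i> * (\<tau> + 2 * z))) * sg (2 * z)"
  using thc_2[of 0 "2 * z"] thc_2tau[of 0 "2 * z"] by (simp_all add: thc_simps ring_distribs)

lemma mu_half: "mu (z + 1/2) (w + 1/2) = mu z w"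
proof -
  have "sg (2 * (x + 1/2)) = - sg (2 * x)" for x using sg_1[of "2 * x"] by (simp add: ring_distribs)
  moreover have "z + 1/2 + (w + 1/2) = z + w + 1" "z + 1/2 - (w + 1/2) = z - w" by simp_all
  ultimately show ?thesis by (simp only: mu_eq den_eq string_1) simp
qed

lemma mu_half_tau: "mu (z + \<tau>/2) (w - \<tau>/2) = exp (of_nat m * (of_real pi * \<i> * (\<tau> + 2 * (z - w)))) * mu z w"
proof -
  have a: "sg (2 * (z + \<tau>/2)) = - exp (- (of_real pi * \<i> * (\<tau> + 4 * z))) * sg (2 * z)"
    using sg_tau[of "2 * z"] by (simp add: ring_distribs)
  have b: "sg (2 * (w - \<tau>/2)) = - exp (of_real pi * \<i> * (4 * w - \<tau>)) * sg (2 * w)"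
    using sg_minus_tau[of "2 * w"] by (simp add: ring_distribs)
  have c: "z + \<tau>/2 + (w - \<tau>/2) = z + w" "z + \<tau>/2 - (w - \<tau>/2) = z - w + \<tau>" by simp_all
  have e: "exp (- (of_real pi * \<i> * (\<tau> + 4 * z))) * exp (of_real pi * \<i> * (4 * w - \<tau>)) =
    exp (of_nat m * (of_real pi * \<i> * (\<tau> + 2 * (z - w)))) * exp (- (of_nat (m + 1 + 1) * (of_real pi * \<i> * (\<tau> + 2 * (z - w)))))"
    by (simp only: exp_add[symmetric]) (rule arg_cong[of _ _ exp], simp add: algebra_simps)
  have "mu (z + \<tau>/2) (w - \<tau>/2) = (exp (- (of_real pi * \<i> * (\<tau> + 4 * z))) * exp (of_real pi * \<i> * (4 * w - \<tau>))) * (sg (2 * z) * sg (2 * w)) /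
      (exp (- (of_nat (m + 1 + 1) * (of_real pi * \<i> * (\<tau> + 2 * (z - w))))) * (den (z + w) * den (z - w)))"
    unfolding mu_eq den_eq a b c string_tau by (simp add: mult_ac)
  then show ?thesis unfolding e by (simp add: mu_eq)
qed

lemma form_torus:
  assumes f: "f \<in> V" and g: "g \<in> V" shows "torus_fun (\<lambda>z. cnj (f z) * g z * mu z (cnj z))"
  unfolding torus_fun_def
proof (intro conjI allI)
  have "continuous_on UNIV f" "continuous_on UNIV g"
    using V_D(1)[OF f] V_D(1)[OF g] by (auto intro: holomorphic_on_imp_continuous_on)
  then show "continuous_on UNIV (\<lambda>z. cnj (f z) * g z * mu z (cnj z))" by (intro continuous_intros)
  fix z
  have "mu (z + 1) (cnj (z + 1)) = mu z (cnj z)"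
    using mu_half[of "z + 1/2" "cnj z + 1/2"] mu_half[of z "cnj z"] by (simp add: add.assoc)
  then show "cnj (f (z + 1)) * g (z + 1) * mu (z + 1) (cnj (z + 1)) = cnj (f z) * g z * mu z (cnj z)"
    by (simp add: V_D[OF f] V_D[OF g])
  let ?e = "\<lambda>z. exp (of_nat m * (of_real pi * \<i> * (\<tau> + 2 * z)))"
  have "mu (z + \<tau>) (cnj z - \<tau>) = mu (z + \<tau>/2 + \<tau>/2) (cnj z - \<tau>/2 - \<tau>/2)"
    by (intro arg_cong2[of _ _ _ _ mu]) (simp_all add: field_simps)
  also have "\<dots> = ?e (z + \<tau>/2 - (cnj z - \<tau>/2)) * (?e (z - cnj z) * mu z (cnj z))" by (simp only: mu_half_tau)
  finally have m: "mu (z + \<tau>) (cnj (z + \<tau>)) = ?e (z + \<tau>/2 - (cnj z - \<tau>/2)) * (?e (z - cnj z) * mu z (cnj z))"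
    by (simp add: cnj_tau)
  have c: "cnj (f (z + \<tau>)) = exp (4 * spin m * of_real pi * \<i> * (2 * cnj z - \<tau>)) * cnj (f z)"
    by (simp add: V_D(4)[OF f] exp_cnj cnj_tau)
  have "exp (4 * spin m * of_real pi * \<i> * (2 * cnj z - \<tau>)) * exp (- 4 * spin m * of_real pi * \<i> * (2 * z + \<tau>))
      * ?e (z + \<tau>/2 - (cnj z - \<tau>/2)) * ?e (z - cnj z) = exp 0"
    by (simp only: exp_add[symmetric]) (rule arg_cong[of _ _ exp], simp add: field_simps)
  then have "exp (4 * spin m * of_real pi * \<i> * (2 * cnj z - \<tau>)) * exp (- 4 * spin m * of_real pi * \<i> * (2 * z + \<tau>))
      * ?e (z + \<tau>/2 - (cnj z - \<tau>/2)) * ?e (z - cnj z) * (cnj (f z) * g z * mu z (cnj z)) = cnj (f z) * g z * mu z (cnj z)"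
    by simp
  then show "cnj (f (z + \<tau>)) * g (z + \<tau>) * mu (z + \<tau>) (cnj (z + \<tau>)) = cnj (f z) * g z * mu z (cnj z)"
    unfolding c m V_D(4)[OF g] by (simp only: mult_ac)
qed

lemma form_integrand_continuous:
  "f \<in> V \<Longrightarrow> g \<in> V \<Longrightarrow> continuous_on UNIV (\<lambda>z. cnj (f z) * g z * mu z (cnj z))"
  using form_torus by (simp add: torus_fun_def)

lemma form_lin:
  assumes "f \<in> V" "g \<in> V" "h \<in> V"
  shows "form (\<lambda>z. a * f z + b * g z) h = cnj a * form f h + cnj b * form g h"
    and "form h (\<lambda>z. a * f z + b * g z) = a * form h f + b * form h g"
proof -
  have "form (\<lambda>z. a * f z + b * g z) h = dint (\<lambda>z. cnj a * (cnj (f z) * h z * mu z (cnj z)) + cnj b * (cnj (g z) * h z * mu z (cnj z)))"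
    unfolding form_eq by (rule arg_cong[of _ _ dint]) (simp add: fun_eq_iff algebra_simps)
  also have "\<dots> = cnj a * form f h + cnj b * form g h"
    unfolding form_eq by (intro dint_lin form_integrand_continuous assms)
  finally show "form (\<lambda>z. a * f z + b * g z) h = cnj a * form f h + cnj b * form g h" .
  have "form h (\<lambda>z. a * f z + b * g z) = dint (\<lambda>z. a * (cnj (h z) * f z * mu z (cnj z)) + b * (cnj (h z) * g z * mu z (cnj z)))"
    unfolding form_eq by (rule arg_cong[of _ _ dint]) (simp add: fun_eq_iff algebra_simps)
  also have "\<dots> = a * form h f + b * form h g"
    unfolding form_eq by (intro dint_lin form_integrand_continuous assms)
  finally show "form h (\<lambda>z. a * f z + b * g z) = a * form h f + b * form h g" .
qed

lemma form_U1:
  assumes f: "f \<in> V" and g: "g \<in> V"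
  shows "form (U1_op m f) g = exp (- (2 * of_real pi * \<i> * spin m)) * form f (U1_op m g)"
proof -
  let ?J = "\<lambda>z. cnj (f z) * U1_op m g z * mu z (cnj z)"
  have J: "torus_fun ?J" using U1_linear f g by (intro form_torus) (auto simp: linear_operator_on_def)
  have "form f (U1_op m g) = dint (\<lambda>z. ?J (z + 1/2))" unfolding form_eq by (rule dint_shift[OF J, symmetric])
  also have "(\<lambda>z. ?J (z + 1/2)) = (\<lambda>z. exp (2 * of_real pi * \<i> * spin m) * (cnj (U1_op m f z) * g z * mu z (cnj z)))"
  proof
    fix z
    have e: "exp (of_real pi * \<i> * spin m) = exp (2 * of_real pi * \<i> * spin m) * cnj (exp (of_real pi * \<i> * spin m))"
      by (simp add: exp_cnj exp_add[symmetric] field_simps)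
    have "mu (z + 1/2) (cnj (z + 1/2)) = mu z (cnj z)" using mu_half[of z "cnj z"] by simp
    moreover have "U1_op m g (z + 1/2) = exp (of_real pi * \<i> * spin m) * g z"
      by (simp add: U1_op_def add.assoc V_D[OF g])
    ultimately show "?J (z + 1/2) = exp (2 * of_real pi * \<i> * spin m) * (cnj (U1_op m f z) * g z * mu z (cnj z))"
      using e by (simp add: U1_op_def mult_ac)
  qed
  also have "dint \<dots> = exp (2 * of_real pi * \<i> * spin m) * form (U1_op m f) g"
    unfolding form_eq using U1_linear f g by (intro dint_cmult form_integrand_continuous) (auto simp: linear_operator_on_def)
  finally show ?thesis by (simp add: exp_minus)
qed

lemma form_U3:
  assumes f: "f \<in> V" and g: "g \<in> V"
  shows "form (U3_op \<tau> m f) g = exp (- (2 * of_real pi * \<i> * spin m)) * form f (U3_op \<tau> m g)"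
proof -
  let ?J = "\<lambda>z. cnj (f z) * U3_op \<tau> m g z * mu z (cnj z)"
  let ?l = "of_real pi * \<i> * spin m"
  have J: "torus_fun ?J" using U3_linear f g by (intro form_torus) (auto simp: linear_operator_on_def)
  have "form f (U3_op \<tau> m g) = dint (\<lambda>z. ?J (z + \<tau>/2))" unfolding form_eq by (rule dint_shift[OF J, symmetric])
  also have "(\<lambda>z. ?J (z + \<tau>/2)) = (\<lambda>z. exp (2 * of_real pi * \<i> * spin m) * (cnj (U3_op \<tau> m f z) * g z * mu z (cnj z)))"
  proof
    fix z
    have m: "mu (z + \<tau>/2) (cnj (z + \<tau>/2)) = exp (of_nat m * (of_real pi * \<i> * (\<tau> + 2 * (z - cnj z)))) * mu z (cnj z)"
      using mu_half_tau[of z "cnj z"] by (simp add: cnj_tau)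
    have "z + \<tau>/2 + \<tau>/2 = z + \<tau>" by simp
    then have g': "U3_op \<tau> m g (z + \<tau>/2) = exp ?l * exp (?l * (4 * (z + \<tau>/2) + \<tau>)) * (exp (- 4 * spin m * of_real pi * \<i> * (2 * z + \<tau>)) * g z)"
      by (simp only: U3_op_def V_D(4)[OF g])
    have f': "cnj (U3_op \<tau> m f z) = exp (- ?l) * exp (- ?l * (4 * cnj z - \<tau>)) * cnj (f (z + \<tau>/2))"
      by (simp add: U3_op_def exp_cnj cnj_tau)
    have "exp ?l * exp (?l * (4 * (z + \<tau>/2) + \<tau>)) * exp (- 4 * spin m * of_real pi * \<i> * (2 * z + \<tau>)) * exp (of_nat m * (of_real pi * \<i> * (\<tau> + 2 * (z - cnj z))))
      = exp (2 * of_real pi * \<i> * spin m) * exp (- ?l) * exp (- ?l * (4 * cnj z - \<tau>))"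
      by (simp only: exp_add[symmetric]) (rule arg_cong[of _ _ exp], simp add: field_simps)
    then have "(exp ?l * exp (?l * (4 * (z + \<tau>/2) + \<tau>)) * exp (- 4 * spin m * of_real pi * \<i> * (2 * z + \<tau>)) * exp (of_nat m * (of_real pi * \<i> * (\<tau> + 2 * (z - cnj z)))))
        * (cnj (f (z + \<tau>/2)) * g z * mu z (cnj z))
      = (exp (2 * of_real pi * \<i> * spin m) * exp (- ?l) * exp (- ?l * (4 * cnj z - \<tau>))) * (cnj (f (z + \<tau>/2)) * g z * mu z (cnj z))"
      by (simp only:)
    then show "?J (z + \<tau>/2) = exp (2 * of_real pi * \<i> * spin m) * (cnj (U3_op \<tau> m f z) * g z * mu z (cnj z))"
      unfolding m g' f' by (simp only: mult_ac)
  qed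
  also have "dint \<dots> = exp (2 * of_real pi * \<i> * spin m) * form (U3_op \<tau> m f) g"
    unfolding form_eq using U3_linear f g by (intro dint_cmult form_integrand_continuous) (auto simp: linear_operator_on_def)
  finally show ?thesis by (simp add: exp_minus)
qed

end

subsection \<open>Self-adjointness of the generators\<close>

context sklyanin_strict
begin

text \<open>
  Half of the integrand of \<open>\<langle>f, \<rho>(S\<^sup>a) g\<rangle>\<close> as a function of the two independent variables \<open>z\<close> and
  \<open>w = cnj z\<close>; the other half is its reflection. \<open>adj_right\<close> plays the same role for
  \<open>\<langle>\<rho>(S\<^sup>a) f, g\<rangle>\<close>. It is made from the other summand of the numerator, so that translating \<open>z\<close> and \<open>w\<close>
  leads to the same values of \<open>f\<close> and \<open>g\<close> in both.
\<close>

definition adj_left where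
  "adj_left a f g z w = cs f w * rep_half a g z * sg (2 * w) / (den (z + w) * den (z - w))"

definition adj_right where
  "adj_right a f g z w = - (cs (rep_half a f) (- w) * g z * sg (2 * z) / (den (z + w) * den (z - w)))"

lemma den_period:
  "den (z + 1 + (w + 1)) = den (z + w)" "den (z + 1 - (w + 1)) = den (z - w)"
  "den (z + \<tau> + (w - \<tau>)) = den (z + w)"
  "den (z + \<tau> - (w - \<tau>)) = exp (- (of_nat (m + 2) * (of_real pi * \<i> * (4 * \<tau> + 4 * (z - w))))) * den (z - w)"
proof -
  have "z + 1 + (w + 1) = z + w + 1 + 1" by simp
  then show "den (z + 1 + (w + 1)) = den (z + w)" unfolding den_eq by (simp only: string_1)
  have "den (z + \<tau> - (w - \<tau>)) = den (z - w + \<tau> + \<tau>)" by (rule arg_cong[of _ _ den]) simp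
  also have "\<dots> = (exp (- (of_nat (m + 1 + 1) * (of_real pi * \<i> * (\<tau> + 2 * (z - w + \<tau>))))) * exp (- (of_nat (m + 1 + 1) * (of_real pi * \<i> * (\<tau> + 2 * (z - w)))))) * den (z - w)"
    unfolding den_eq string_tau by (simp only: mult.assoc)
  also have "exp (- (of_nat (m + 1 + 1) * (of_real pi * \<i> * (\<tau> + 2 * (z - w + \<tau>))))) * exp (- (of_nat (m + 1 + 1) * (of_real pi * \<i> * (\<tau> + 2 * (z - w)))))
     = exp (- (of_nat (m + 2) * (of_real pi * \<i> * (4 * \<tau> + 4 * (z - w)))))"
    by (simp only: exp_add[symmetric]) (rule arg_cong[of _ _ exp], simp add: algebra_simps)
  finally show "den (z + \<tau> - (w - \<tau>)) = exp (- (of_nat (m + 2) * (of_real pi * \<i> * (4 * \<tau> + 4 * (z - w))))) * den (z - w)" .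
qed simp_all

lemma V_minus_tau: assumes "f \<in> V" shows "f (w - \<tau>) = exp (2 * of_nat m * (of_real pi * \<i> * (2 * w - \<tau>))) * f w"
proof -
  have "f w = f (w - \<tau> + \<tau>)" by simp
  also have "\<dots> = exp (- (2 * of_nat m * (of_real pi * \<i> * (2 * w - \<tau>)))) * f (w - \<tau>)"
    unfolding V_D(4)[OF assms] by (simp add: algebra_simps)
  finally show ?thesis by (simp add: exp_minus)
qed

lemma sg_2_minus_tau: "sg (2 * (w - \<tau>)) = exp (4 * of_real pi * \<i> * (2 * w - \<tau>)) * sg (2 * w)"
proof -
  have "sg (2 * w) = exp (- (4 * of_real pi * \<i> * (2 * w - \<tau>))) * sg (2 * (w - \<tau>))"
    using sg_2_shift(2)[of "w - \<tau>"] by (simp add: algebra_simps)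
  then show ?thesis by (simp add: exp_minus)
qed

lemma V_continuous: "f \<in> V \<Longrightarrow> continuous_on A h \<Longrightarrow> continuous_on A (\<lambda>z. f (h z))"
  using V_D(1)[of f] by (metis continuous_on_compose2 holomorphic_on_imp_continuous_on subset_UNIV)

lemma rep_half_continuous: "f \<in> V \<Longrightarrow> a \<le> 3 \<Longrightarrow> continuous_on A h \<Longrightarrow> continuous_on A (\<lambda>z. rep_half a f (h z))"
proof -
  assume f: "f \<in> V" and a: "a \<le> 3" and h: "continuous_on A h"
  have "rep_half a f holomorphic_on UNIV"
    unfolding rep_half_def[abs_def] s_fun_def by (intro holomorphic_intros V_holomorphic[OF f] a)
  then have "continuous_on UNIV (rep_half a f)" by (rule holomorphic_on_imp_continuous_on)
  then show ?thesis using continuous_on_compose2[OF _ h] by blast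
qed

lemma adj_left_torus:
  assumes f: "f \<in> V" and g: "g \<in> V" and a: "a \<le> 3"
  shows "torus_fun (\<lambda>z. adj_left a f g z (cnj z))"
  unfolding torus_fun_def
proof (intro conjI allI)
  show "continuous_on UNIV (\<lambda>z. adj_left a f g z (cnj z))"
    unfolding adj_left_def den_eq using den_nonzero unfolding den_eq
    by (intro continuous_intros V_continuous[OF cs_in_V[OF f]] rep_half_continuous[OF g a]) auto
  fix z
  show "adj_left a f g (z + 1) (cnj (z + 1)) = adj_left a f g z (cnj z)"
    by (simp only: adj_left_def den_period V_D(2)[OF cs_in_V[OF f]] rep_half_1[OF g a] complex_cnj_add complex_cnj_one sg_2_shift(1))
  have "exp (2 * of_nat m * (of_real pi * \<i> * (2 * w - \<tau>))) * exp (- (2 * of_nat (m + 2) * of_real pi * \<i> * (2 * z + \<tau>))) * exp (4 * of_real pi * \<i> * (2 * w - \<tau>))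
     = exp (- (of_nat (m + 2) * (of_real pi * \<i> * (4 * \<tau> + 4 * (z - w)))))" for w
    by (simp only: exp_add[symmetric]) (rule arg_cong[of _ _ exp], simp add: algebra_simps)
  then have "adj_left a f g (z + \<tau>) (w - \<tau>) = adj_left a f g z w" for w
    unfolding adj_left_def den_period V_minus_tau[OF cs_in_V[OF f]] rep_half_tau[OF g a] sg_2_minus_tau
    by (simp add: frac_eq_eq divide_simps) (simp add: mult_ac)
  then show "adj_left a f g (z + \<tau>) (cnj (z + \<tau>)) = adj_left a f g z (cnj z)" by (simp add: cnj_tau)
qed

lemma cs_rep_half: "a \<le> 3 \<Longrightarrow> cs (rep_half a f) w = cnj (c_fac a) * thc a h\<eta> * thc a (2 * (w - spin m * h\<eta>)) * cs f (w + h\<eta>)"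
  by (simp add: cs_def rep_half_def s_fun_def c_fac_def thc_cnj)

lemma adj_right_torus:
  assumes f: "f \<in> V" and g: "g \<in> V" and a: "a \<le> 3"
  shows "torus_fun (\<lambda>z. adj_right a f g z (cnj z))"
  unfolding torus_fun_def
proof (intro conjI allI)
  have "continuous_on UNIV (\<lambda>z. cs (rep_half a f) (- cnj z))"
    unfolding cs_def by (intro continuous_intros rep_half_continuous[OF f a])
  then show "continuous_on UNIV (\<lambda>z. adj_right a f g z (cnj z))"
    unfolding adj_right_def den_eq using den_nonzero unfolding den_eq
    by (intro continuous_intros V_continuous[OF g]) auto
  fix z
  have "cs (rep_half a f) (- (w + 1)) = cs (rep_half a f) (- w)" for w
    using rep_half_1[OF f a, of "- cnj w - 1"] by (simp add: cs_def)
  then show "adj_right a f g (z + 1) (cnj (z + 1)) = adj_right a f g z (cnj z)"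
    by (simp only: adj_right_def den_period V_D(2)[OF g] complex_cnj_add complex_cnj_one sg_2_shift(1))
  have c: "cs (rep_half a f) (- (w - \<tau>)) = exp (- (2 * of_nat (m + 2) * of_real pi * \<i> * (\<tau> - 2 * w))) * cs (rep_half a f) (- w)" for w
  proof -
    have "rep_half a f (cnj (- (w - \<tau>))) = rep_half a f (- cnj w + of_int 0 + of_int (- 1) * \<tau>)"
      by (rule arg_cong[of _ _ "rep_half a f"]) (simp add: cnj_tau algebra_simps)
    also have "\<dots> = exp (2 * of_nat (m + 2) * of_real pi * \<i> * (- 2 * cnj w - \<tau>)) * rep_half a f (- cnj w)"
      unfolding rep_half_lattice[OF f a]
      by (rule arg_cong2[of _ _ _ _ "(*)"], rule arg_cong[of _ _ exp]) (simp_all add: algebra_simps)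
    finally have "cs (rep_half a f) (- (w - \<tau>)) = cnj (exp (2 * of_nat (m + 2) * of_real pi * \<i> * (- 2 * cnj w - \<tau>))) * cs (rep_half a f) (- w)"
      by (simp add: cs_def)
    also have "cnj (exp (2 * of_nat (m + 2) * of_real pi * \<i> * (- 2 * cnj w - \<tau>))) = exp (- (2 * of_nat (m + 2) * of_real pi * \<i> * (\<tau> - 2 * w)))"
      unfolding exp_cnj by (rule arg_cong[of _ _ exp]) (simp add: cnj_tau algebra_simps)
    finally show ?thesis .
  qed
  have "exp (- (2 * of_nat (m + 2) * of_real pi * \<i> * (\<tau> - 2 * w))) * exp (- 4 * spin m * of_real pi * \<i> * (2 * z + \<tau>)) * exp (- (4 * of_real pi * \<i> * (\<tau> + 2 * z)))
     = exp (- (of_nat (m + 2) * (of_real pi * \<i> * (4 * \<tau> + 4 * (z - w)))))" for w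
    by (simp only: exp_add[symmetric]) (rule arg_cong[of _ _ exp], simp add: field_simps)
  then have "adj_right a f g (z + \<tau>) (w - \<tau>) = adj_right a f g z w" for w
    unfolding adj_right_def den_period V_D(4)[OF g] c sg_2_shift(2)
    by (simp add: frac_eq_eq divide_simps) (simp add: mult_ac)
  then show "adj_right a f g (z + \<tau>) (cnj (z + \<tau>)) = adj_right a f g z (cnj z)" by (simp add: cnj_tau)
qed

lemma torus_continuous: "torus_fun G \<Longrightarrow> continuous_on A h \<Longrightarrow> continuous_on A (\<lambda>z. G (h z))"
  unfolding torus_fun_def using continuous_on_compose2[of UNIV G A h] by auto

lemma torus_shift: assumes "torus_fun G" shows "torus_fun (\<lambda>z. G (z + w))"
proof -
  have "z + 1 + w = z + w + 1" "z + \<tau> + w = z + w + \<tau>" for z by simp_all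
  then show ?thesis
    using assms torus_continuous[OF assms continuous_on_add[OF continuous_on_id continuous_on_const]]
    unfolding torus_fun_def by (simp only:) simp
qed

lemma torus_lin: "torus_fun G \<Longrightarrow> torus_fun G' \<Longrightarrow> torus_fun (\<lambda>z. a * G z + b * G' z)"
  unfolding torus_fun_def using continuous_on_add[OF continuous_on_mult[OF continuous_on_const] continuous_on_mult[OF continuous_on_const]] by auto

lemma den_even: "den (- v) = den v" unfolding den_eq by (rule string_even)

lemma form_rep_halves:
  assumes f: "f \<in> V" and g: "g \<in> V" and a: "a \<le> 3"
  shows "form f (rep a g) = 2 * dint (\<lambda>z. adj_left a f g z (cnj z))"
    and "form (rep a f) g = 2 * dint (\<lambda>z. adj_right a f g z (cnj z))"
proof -
  have neg: "den (- z + - w) = den (z + w)" "den (- z - - w) = den (z - w)" "sg (2 * (- w)) = - sg (2 * w)" for z w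
    using den_even[of "z + w"] den_even[of "z - w"] sg_odd[of "2 * w"] by simp_all
  have "cnj (f z) * rep a g z * mu z (cnj z) = 1 * adj_left a f g z (cnj z) + 1 * adj_left a f g (- z) (cnj (- z))" for z
  proof -
    have "cnj (f z) * rep a g z * mu z (cnj z) = cs f (cnj z) * (rep a g z * sg (2 * z)) * sg (2 * cnj z) / (den (z + cnj z) * den (z - cnj z))"
      by (simp add: mu_eq cs_def)
    then show ?thesis
      unfolding rep_spec(2)[OF g a] by (simp only: adj_left_def complex_cnj_minus neg V_D(3)[OF cs_in_V[OF f]]) (simp add: diff_divide_distrib left_diff_distrib right_diff_distrib)
  qed
  then have "form f (rep a g) = dint (\<lambda>z. 1 * adj_left a f g z (cnj z) + 1 * adj_left a f g (- z) (cnj (- z)))"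
    unfolding form_eq by (simp only:)
  also have "\<dots> = 1 * dint (\<lambda>z. adj_left a f g z (cnj z)) + 1 * dint (\<lambda>z. adj_left a f g (- z) (cnj (- z)))"
    by (intro dint_lin torus_continuous[OF adj_left_torus[OF assms] continuous_on_id]
      torus_continuous[OF adj_left_torus[OF assms] continuous_on_minus[OF continuous_on_id]])
  also have "dint (\<lambda>z. adj_left a f g (- z) (cnj (- z))) = dint (\<lambda>z. adj_left a f g z (cnj z))"
    by (rule dint_reflect) (rule adj_left_torus[OF assms])
  finally show "form f (rep a g) = 2 * dint (\<lambda>z. adj_left a f g z (cnj z))" by simp
  have "cnj (rep a f z) * g z * mu z (cnj z) = 1 * adj_right a f g z (cnj z) + 1 * adj_right a f g (- z) (cnj (- z))" for z
  proof -
    have "cnj (rep a f z) * g z * mu z (cnj z) = cnj (rep a f z * sg (2 * z)) * g z * sg (2 * z) / (den (z + cnj z) * den (z - cnj z))"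
      by (simp add: mu_eq sg_cnj)
    then show ?thesis
      unfolding rep_spec(2)[OF f a] by (simp only: adj_right_def complex_cnj_minus neg V_D(3)[OF g] cs_def) (simp add: diff_divide_distrib left_diff_distrib right_diff_distrib)
  qed
  then have "form (rep a f) g = dint (\<lambda>z. 1 * adj_right a f g z (cnj z) + 1 * adj_right a f g (- z) (cnj (- z)))"
    unfolding form_eq by (simp only:)
  also have "\<dots> = 1 * dint (\<lambda>z. adj_right a f g z (cnj z)) + 1 * dint (\<lambda>z. adj_right a f g (- z) (cnj (- z)))"
    by (intro dint_lin torus_continuous[OF adj_right_torus[OF assms] continuous_on_id]
      torus_continuous[OF adj_right_torus[OF assms] continuous_on_minus[OF continuous_on_id]])
  also have "dint (\<lambda>z. adj_right a f g (- z) (cnj (- z))) = dint (\<lambda>z. adj_right a f g z (cnj z))"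
    by (rule dint_reflect) (rule adj_right_torus[OF assms])
  finally show "form (rep a f) g = 2 * dint (\<lambda>z. adj_right a f g z (cnj z))" by simp
qed

text \<open>
  In the variables \<open>X = (z + w)/2\<close> and \<open>\<zeta> = (z - w)/2\<close> the difference of the two half-integrands, the second one
  shifted by \<open>\<eta>\<close>, factorizes; its only poles in \<open>\<zeta>\<close> come from a string of length \<open>m + 1\<close>. Each
  summand alone has an additional pole, which the contour shift below may have to cross.
\<close>

definition k\<eta> :: complex where "k\<eta> = (of_nat m + 2) * h\<eta>"

definition adj_const :: "nat \<Rightarrow> complex \<Rightarrow> complex" where
  "adj_const a X = thc a h\<eta> * kap a * sg (4 * X) * thc a k\<eta> /
     (thc (dual_char a) (2 * X) * string m (2 * X) * th (2 * X - k\<eta>) * th (2 * X + k\<eta>))"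

definition adj_diff where
  "adj_diff a f g X \<zeta> = cs f (X - \<zeta>) * g (X + \<zeta>) * adj_const a X * thc (dual_char a) (2 * \<zeta>) / string m (2 * \<zeta>)"

lemma adj_left_minus_right:
  assumes f: "f \<in> V" and a: "a \<le> 3" and nz: "thc (dual_char a) (2 * X) \<noteq> 0" "th (2 * \<zeta> - k\<eta>) \<noteq> 0" "string m (2 * \<zeta>) \<noteq> 0"
      "string m (2 * X) \<noteq> 0" "th (2 * X - k\<eta>) \<noteq> 0" "th (2 * X + k\<eta>) \<noteq> 0"
  shows "adj_left a f g (X + \<zeta> - h\<eta>) (X - \<zeta>) - adj_right a f g (X + \<zeta>) (X - \<zeta> + h\<eta>) = adj_diff a f g X \<zeta>"
proof -
  define Z w where "Z = X + \<zeta>" and "w = X - \<zeta>"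
  have Zw: "2 * X = Z + w" "2 * \<zeta> = Z - w" "4 * X = 2 * (Z + w)" by (simp_all add: Z_def w_def)
  have d: "den (Z - h\<eta> + w) = th (Z + w - k\<eta>) * string m (Z + w)" "den (Z - h\<eta> - w) = th (Z - w - k\<eta>) * string m (Z - w)"
    "den (Z + (w + h\<eta>)) = th (Z + w + k\<eta>) * string m (Z + w)" "den (Z - (w + h\<eta>)) = th (Z - w - k\<eta>) * string m (Z - w)"
  proof -
    have e: "Z - h\<eta> + w = Z + w - h\<eta>" "Z - h\<eta> - w = Z - w - h\<eta>" "Z + (w + h\<eta>) = Z + w + h\<eta>" "Z - (w + h\<eta>) = Z - w - h\<eta>" by simp_all
    show "den (Z - h\<eta> + w) = th (Z + w - k\<eta>) * string m (Z + w)" "den (Z - h\<eta> - w) = th (Z - w - k\<eta>) * string m (Z - w)"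
      "den (Z + (w + h\<eta>)) = th (Z + w + k\<eta>) * string m (Z + w)" "den (Z - (w + h\<eta>)) = th (Z - w - k\<eta>) * string m (Z - w)"
      unfolding e den_eq Suc_eq_plus1[symmetric] string_Suc_shift k\<eta>_def by simp_all
  qed
  have rg: "rep_half a g (Z - h\<eta>) = c_fac a * thc a h\<eta> * thc a (2 * Z - k\<eta>) * g Z"
    by (simp add: rep_half_def s_fun_def c_fac_def k\<eta>_def) (simp add: algebra_simps)
  have rf: "cs (rep_half a f) (- (w + h\<eta>)) = cnj (c_fac a) * thc a h\<eta> * thc a (- 2 * w - k\<eta>) * cs f w"
  proof -
    have "cs f (- (w + h\<eta>) + h\<eta>) = cs f w" using V_D(3)[OF cs_in_V[OF f], of w] by simp
    moreover have "2 * (- (w + h\<eta>) - spin m * h\<eta>) = - 2 * w - k\<eta>" by (simp add: k\<eta>_def algebra_simps)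
    ultimately show ?thesis unfolding cs_rep_half[OF a] by (simp only:)
  qed
  let ?b = "thc (dual_char a)"
  define N where "N = c_fac a * thc a (2 * Z - k\<eta>) * sg (2 * w) * th (Z + w + k\<eta>)
     + cnj (c_fac a) * thc a (- 2 * w - k\<eta>) * sg (2 * Z) * th (Z + w - k\<eta>)"
  have "N * ?b (Z + w) = kap a * sg (2 * (Z + w)) * thc a k\<eta> * th (Z - w - k\<eta>) * ?b (Z - w)"
    using three_term_theta[OF a, of Z k\<eta> w] unfolding N_def distrib_right .
  then have N: "N = kap a * sg (2 * (Z + w)) * thc a k\<eta> * th (Z - w - k\<eta>) * ?b (Z - w) / ?b (Z + w)"
    using nz(1) unfolding Zw by (simp add: eq_divide_eq)
  note nz' = nz[unfolded Zw]
  have "adj_left a f g (Z - h\<eta>) w - adj_right a f g Z (w + h\<eta>) =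
     cs f w * g Z * thc a h\<eta> * N / (string m (Z + w) * string m (Z - w) * th (Z + w + k\<eta>) * th (Z + w - k\<eta>) * th (Z - w - k\<eta>))"
    unfolding adj_left_def adj_right_def d rg rf N_def using nz' by (simp add: divide_simps) (simp add: algebra_simps)
  also have "\<dots> = adj_diff a f g X \<zeta>"
    unfolding N adj_diff_def adj_const_def Zw using nz' by (simp add: Z_def[symmetric] w_def[symmetric] mult_ac)
  finally show ?thesis by (simp add: Z_def w_def)
qed

lemma adj_diff_period:
  assumes f: "f \<in> V" and g: "g \<in> V" and a: "a \<le> 3"
  shows "adj_diff a f g X (\<zeta> + \<tau>) = adj_diff a f g X \<zeta>" "adj_diff a f g (X + 1) \<zeta> = adj_diff a f g X \<zeta>"
    "adj_diff a f g (- X) (- \<zeta>) = - adj_diff a f g X \<zeta>"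
proof -
  have b: "dual_char a \<le> 3" by (simp add: dual_char_def)
  have t: "thc (dual_char a) (2 * (\<zeta> + \<tau>)) = exp (- (4 * of_real pi * \<i> * (\<tau> + 2 * \<zeta>))) * thc (dual_char a) (2 * \<zeta>)"
    using thc_2tau[OF b, of "2 * \<zeta>"] by (simp add: ring_distribs)
  have s: "string m (2 * (\<zeta> + \<tau>)) = exp (- (of_nat (m + 1) * (of_real pi * \<i> * (\<tau> + 2 * (2 * \<zeta> + \<tau>))))) * (exp (- (of_nat (m + 1) * (of_real pi * \<i> * (\<tau> + 2 * (2 * \<zeta>))))) * string m (2 * \<zeta>))"
  proof -
    have "2 * (\<zeta> + \<tau>) = 2 * \<zeta> + \<tau> + \<tau>" by simp
    then show ?thesis by (simp only: string_tau)
  qed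
  have f': "cs f (X - (\<zeta> + \<tau>)) = exp (2 * of_nat m * (of_real pi * \<i> * (2 * (X - \<zeta>) - \<tau>))) * cs f (X - \<zeta>)"
    using V_minus_tau[OF cs_in_V[OF f], of "X - \<zeta>"] by (simp add: algebra_simps)
  have g': "g (X + (\<zeta> + \<tau>)) = exp (- 4 * spin m * of_real pi * \<i> * (2 * (X + \<zeta>) + \<tau>)) * g (X + \<zeta>)"
    using V_D(4)[OF g, of "X + \<zeta>"] by (simp add: add_ac)
  have "exp (2 * of_nat m * (of_real pi * \<i> * (2 * (X - \<zeta>) - \<tau>))) * exp (- 4 * spin m * of_real pi * \<i> * (2 * (X + \<zeta>) + \<tau>)) * exp (- (4 * of_real pi * \<i> * (\<tau> + 2 * \<zeta>)))
    = exp (- (of_nat (m + 1) * (of_real pi * \<i> * (\<tau> + 2 * (2 * \<zeta> + \<tau>))))) * exp (- (of_nat (m + 1) * (of_real pi * \<i> * (\<tau> + 2 * (2 * \<zeta>)))))"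
    by (simp only: exp_add[symmetric]) (rule arg_cong[of _ _ exp], simp add: field_simps)
  then show "adj_diff a f g X (\<zeta> + \<tau>) = adj_diff a f g X \<zeta>"
    unfolding adj_diff_def t s f' g' by (simp add: frac_eq_eq divide_simps) (simp add: mult_ac)
  have sh: "X + 1 - \<zeta> = X - \<zeta> + 1" "X + 1 + \<zeta> = X + \<zeta> + 1" by simp_all
  have s4: "sg (4 * (X + 1)) = sg (4 * X)" using thc_2[of 0 "4 * X"] thc_2[of 0 "4 * X + 2"] by (simp add: thc_simps ring_distribs add.commute)
  have st: "string m (2 * (X + 1)) = string m (2 * X)" using string_1[of m "2 * X"] string_1[of m "2 * X + 1"] by (simp add: ring_distribs add.commute)
  have t2: "th (2 * (X + 1) + c) = th (2 * X + c)" for c using thc_2[of 2 "2 * X + c"] by (simp add: thc_simps algebra_simps)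
  have "adj_const a (X + 1) = adj_const a X"
    using thc_2[OF b, of "2 * X"] t2[of k\<eta>] t2[of "- k\<eta>"] unfolding adj_const_def s4 st by (simp add: ring_distribs)
  then show "adj_diff a f g (X + 1) \<zeta> = adj_diff a f g X \<zeta>"
    unfolding adj_diff_def sh V_D(2)[OF cs_in_V[OF f]] V_D(2)[OF g] by simp
  have pp: "par (dual_char a) * par (dual_char a) = 1" by (simp add: par_def)
  have n: "thc (dual_char a) (2 * (- x)) = par (dual_char a) * thc (dual_char a) (2 * x)" "string m (2 * (- x)) = string m (2 * x)" "sg (4 * (- x)) = - sg (4 * x)"
    "th (2 * (- x) - k\<eta>) = th (2 * x + k\<eta>)" "th (2 * (- x) + k\<eta>) = th (2 * x - k\<eta>)" for x
    using thc_minus[OF b, of "2 * x"] string_even[of m "2 * x"] sg_odd[of "4 * x"] th_even[of "2 * x + k\<eta>"] th_even[of "2 * x - k\<eta>"]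
    by simp_all
  have K: "adj_const a (- X) = - par (dual_char a) * adj_const a X"
    unfolding adj_const_def n using pp by (simp add: par_def)
  have "cs f (- X - - \<zeta>) = cs f (X - \<zeta>)" "g (- X + - \<zeta>) = g (X + \<zeta>)"
    using V_D(3)[OF cs_in_V[OF f], of "X - \<zeta>"] V_D(3)[OF g, of "X + \<zeta>"] by simp_all
  then show "adj_diff a f g (- X) (- \<zeta>) = - adj_diff a f g X \<zeta>"
    unfolding adj_diff_def K n using pp by (simp add: par_def split: if_splits)
qed

lemma tau_eq: "\<i> * of_real (Im \<tau>) = \<tau>" using Re_tau by (simp add: complex_eq_iff)

text \<open>
  By the factorization the difference of the two sides is an integral over \<open>x\<close> and \<open>y\<close> in which the
  contour of \<open>\<zeta>\<close> can be moved to the imaginary axis. There the inner integral is an odd function of \<open>x\<close>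
  of period \<open>1\<close>, and the outer integral vanishes.
\<close>

lemma rep_self_adjoint:
  assumes f: "f \<in> V" and g: "g \<in> V" and a: "a \<le> 3"
  shows "form f (rep a g) = form (rep a f) g"
proof -
  have b: "dual_char a \<le> 3" by (simp add: dual_char_def)
  let ?A = "\<lambda>z. adj_left a f g z (cnj z)" and ?B = "\<lambda>z. adj_right a f g z (cnj z)"
  note A = adj_left_torus[OF assms] and B = adj_right_torus[OF assms]
  define C where "C z = 1 * ?A z + (- 1) * ?B (z + h\<eta>)" for z
  have cB: "continuous_on UNIV (\<lambda>z. ?B (z + h\<eta>))"
    by (rule torus_continuous[OF B continuous_on_add[OF continuous_on_id continuous_on_const]])
  have C: "torus_fun C"
    unfolding C_def by (intro torus_lin A torus_shift[OF B])
  have "dint C = 1 * dint ?A + (- 1) * dint (\<lambda>z. ?B (z + h\<eta>))"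
    unfolding C_def using A cB by (intro dint_lin) (auto simp: torus_fun_def)
  also have "dint (\<lambda>z. ?B (z + h\<eta>)) = dint ?B" by (rule dint_shift[OF B])
  finally have dC: "dint C = dint ?A - dint ?B" by simp
  define F where "F x = integral {0..Im \<tau>} (\<lambda>y. adj_diff a f g (of_real x) (\<i> * of_real y))" for x
  have inner: "integral {0..Im \<tau>} (\<lambda>y. C (Complex x y - of_real (\<eta> / 2))) = F x" if nz: "thc (dual_char a) (of_real (2 * x)) \<noteq> 0" for x
  proof -
    have "C (Complex x y - of_real (\<eta> / 2)) = adj_diff a f g (of_real x) (of_real (\<eta> / 2) + \<i> * of_real y)" for y
    proof -
      let ?X = "of_real x :: complex" and ?\<zeta> = "of_real (\<eta> / 2) + \<i> * of_real y"
      have e: "Complex x y - of_real (\<eta> / 2) = ?X + ?\<zeta> - h\<eta>" "cnj (Complex x y - of_real (\<eta> / 2)) = ?X - ?\<zeta>"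
        "Complex x y - of_real (\<eta> / 2) + h\<eta> = ?X + ?\<zeta>" "cnj (Complex x y - of_real (\<eta> / 2) + h\<eta>) = ?X - ?\<zeta> + h\<eta>"
        by (simp_all add: complex_eq_iff)
      have "2 * ?\<zeta> - h\<eta> = Complex 0 y - cnj (Complex 0 y)" by (simp add: complex_eq_iff)
      then have "string (Suc m) (2 * ?\<zeta> - h\<eta>) \<noteq> 0" using den_nonzero(2)[of "Complex 0 y"] unfolding den_eq Suc_eq_plus1 by simp
      then have "th (2 * ?\<zeta> - k\<eta>) \<noteq> 0" "string m (2 * ?\<zeta>) \<noteq> 0" unfolding string_Suc_shift k\<eta>_def by auto
      moreover have "th (2 * ?X - k\<eta>) \<noteq> 0" "th (2 * ?X + k\<eta>) \<noteq> 0" "string m (2 * ?X) \<noteq> 0"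
        using th_real_nonzero[of "2 * x - (real m + 2) * \<eta>"] th_real_nonzero[of "2 * x + (real m + 2) * \<eta>"] string_real_nonzero[of m "2 * x"]
        by (simp_all add: k\<eta>_def)
      moreover have "thc (dual_char a) (2 * ?X) \<noteq> 0" using nz by simp
      ultimately show ?thesis
        unfolding C_def e(4) unfolding e(2) unfolding e(3) unfolding e(1)
        using adj_left_minus_right[OF f a, of ?X ?\<zeta> g] by simp
    qed
    moreover have "integral {0..Im \<tau>} (\<lambda>y. adj_diff a f g (of_real x) (of_real (\<eta> / 2) + \<i> * of_real y)) =
       integral {0..Im \<tau>} (\<lambda>y. adj_diff a f g (of_real x) (of_real 0 + \<i> * of_real y))"
    proof (rule integral_periodic_holomorphic_shift)
      define \<sigma> where "\<sigma> = (1/2 - real m * \<bar>\<eta>\<bar>) / 2"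
      let ?S = "{\<zeta>. Re \<zeta> > - \<sigma>} \<inter> {\<zeta>. Re \<zeta> < \<sigma>}"
      have \<sigma>: "\<bar>\<eta> / 2\<bar> < \<sigma>" "0 < \<sigma>" using eta_string unfolding \<sigma>_def by (auto simp: algebra_simps)
      show "convex ?S" by (intro convex_Int convex_halfspace_Re_gt convex_halfspace_Re_lt)
      show "open ?S" by (intro open_Int open_halfspace_Re_gt open_halfspace_Re_lt)
      have "string m (2 * \<zeta>) \<noteq> 0" if "\<zeta> \<in> ?S" for \<zeta>
      proof (rule string_nonzero)
        have "\<bar>Re \<zeta>\<bar> < \<sigma>" using that by auto
        then show "\<bar>Re (2 * \<zeta>)\<bar> + real m * \<bar>\<eta>\<bar> < 1/2" by (simp add: \<sigma>_def)
      qed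
      then show "adj_diff a f g (of_real x) holomorphic_on ?S"
        unfolding adj_diff_def[abs_def] by (intro holomorphic_intros V_holomorphic[OF cs_in_V[OF f]] V_holomorphic[OF g] b) auto
      show "\<zeta> + \<i> * of_real (Im \<tau>) \<in> ?S" if "\<zeta> \<in> ?S" for \<zeta> using that by simp
      show "adj_diff a f g (of_real x) (\<zeta> + \<i> * of_real (Im \<tau>)) = adj_diff a f g (of_real x) \<zeta>" for \<zeta>
        unfolding tau_eq by (rule adj_diff_period(1)[OF assms])
      show "of_real (\<eta> / 2) + \<i> * of_real y \<in> ?S" "of_real 0 + \<i> * of_real y \<in> ?S" for y
        using \<sigma> by (auto simp: abs_less_iff)
    qed (rule Im_tau)
    ultimately show ?thesis by (simp add: F_def)
  qed
  have Fodd: "F (- x) = - F x" for x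
  proof -
    have "F (- x) = integral {0..Im \<tau>} (\<lambda>y. - adj_diff a f g (of_real x) (\<i> * of_real (- y)))"
      unfolding F_def using adj_diff_period(3)[OF assms, of "of_real x" "\<i> * of_real (- y)" for y] by simp
    also have "\<dots> = - integral {0..Im \<tau>} (\<lambda>y. adj_diff a f g (of_real x) (\<i> * of_real (- y)))" by simp
    also have "integral {0..Im \<tau>} (\<lambda>y. adj_diff a f g (of_real x) (\<i> * of_real (- y))) = F x"
      unfolding F_def
    proof (rule integral_periodic_reflect)
      fix y
      have "\<i> * of_real (y + Im \<tau>) = \<i> * of_real y + \<tau>" using tau_eq by (simp add: distrib_left)
      then show "adj_diff a f g (of_real x) (\<i> * of_real (y + Im \<tau>)) = adj_diff a f g (of_real x) (\<i> * of_real y)"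
        by (simp only: adj_diff_period(1)[OF assms])
    qed
    finally show ?thesis .
  qed
  have Fper: "F (x + 1) = F x" for x
    unfolding F_def using adj_diff_period(2)[OF assms, of "of_real x"] by simp
  have "dint C = dint (\<lambda>z. C (z + of_real (- \<eta> / 2)))" by (rule dint_shift[OF C, symmetric])
  also have "\<dots> = integral {0..1} (\<lambda>x. integral {0..Im \<tau>} (\<lambda>y. C (Complex x y - of_real (\<eta> / 2))))"
    by (simp add: dint_def)
  also have "\<dots> = integral {0..1} F"
  proof (rule integral_spike[symmetric])
    let ?N = "{x \<in> {0..1}. thc (dual_char a) (of_real (2 * x)) = 0}"
    have "?N \<subseteq> (\<lambda>n. real_of_int n / 4) ` {0..4}"
    proof
      fix x assume x: "x \<in> ?N"
      then obtain n :: int where n: "2 * (2 * x) = of_int n" using thc_real_zero[OF b] by blast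
      then have "x = real_of_int n / 4" "n \<in> {0..4}" using x by auto
      then show "x \<in> (\<lambda>n. real_of_int n / 4) ` {0..4}" by blast
    qed
    then have "finite ?N" by (rule finite_subset) auto
    then show "negligible ?N" by (rule negligible_finite)
    show "integral {0..Im \<tau>} (\<lambda>y. C (Complex x y - of_real (\<eta> / 2))) = F x" if "x \<in> {0..1} - ?N" for x
      by (rule inner) (use that in auto)
  qed
  also have "\<dots> = 0"
  proof -
    have "integral {0..1} F = integral {0..1} (\<lambda>x. F (- x))"
      by (rule integral_periodic_reflect[symmetric]) (rule Fper)
    then have "integral {0..1} F = - integral {0..1} F" unfolding Fodd by simp
    then show ?thesis by simp
  qed
  finally show ?thesis unfolding form_rep_halves[OF assms] using dC by simp
qed

end

subsection \<open>Adjoints on the tensor power\<close>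

context sklyanin_strict
begin

definition sgn2 :: "2 \<Rightarrow> complex" where "sgn2 \<alpha> = (if \<alpha> = 1 then 1 else - 1)"
definition flip2 :: "2 \<Rightarrow> 2" where "flip2 \<alpha> = (if \<alpha> = 1 then 2 else 1)"

lemma flip2_flip2: "flip2 (flip2 \<alpha>) = \<alpha>" using exhaust_2[of \<alpha>] by (auto simp: flip2_def)

lemma sgn2_sgn2: "sgn2 \<alpha> * sgn2 \<alpha> = 1" by (simp add: sgn2_def)

lemma pauli_cnj:
  assumes "a \<le> 3"
  shows "cnj (pauli a $ \<alpha> $ \<beta>) = - par a * sgn2 \<alpha> * sgn2 \<beta> * pauli a $ flip2 \<alpha> $ flip2 \<beta>"
proof -
  have p: "pauli 0 $ 1 $ 1 = 1" "pauli 0 $ 1 $ 2 = 0" "pauli 0 $ 2 $ 1 = 0" "pauli 0 $ 2 $ 2 = 1"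
    "pauli 1 $ 1 $ 1 = 0" "pauli 1 $ 1 $ 2 = 1" "pauli 1 $ 2 $ 1 = 1" "pauli 1 $ 2 $ 2 = 0"
    "pauli 2 $ 1 $ 1 = 0" "pauli 2 $ 1 $ 2 = - \<i>" "pauli 2 $ 2 $ 1 = \<i>" "pauli 2 $ 2 $ 2 = 0"
    "pauli 3 $ 1 $ 1 = 1" "pauli 3 $ 1 $ 2 = 0" "pauli 3 $ 2 $ 1 = 0" "pauli 3 $ 2 $ 2 = - 1"
    by (simp_all add: pauli_def numeral_3_eq_3 numeral_2_eq_2 One_nat_def)
  show ?thesis
    using assms exhaust_2[of \<alpha>] exhaust_2[of \<beta>] unfolding le_3_iff
    by (elim disjE) (simp_all add: p par_def sgn2_def flip2_def)
qed

text \<open>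
  \<open>\<sigma>\<^sup>2 \<sigma>\<^sup>a \<sigma>\<^sup>2\<close> is the transpose of \<open>\<plusminus>\<sigma>\<^sup>a\<close>; with the parity of \<open>W\<^sub>a\<close> this turns the adjoint of the
  entries of \<open>L(u)\<close> into entries of \<open>L(-cnj u)\<close>.
\<close>

lemma form_lop:
  assumes f: "f \<in> V" and g: "g \<in> V"
  shows "form (lop u \<alpha> \<beta> f) g = - sgn2 \<alpha> * sgn2 \<beta> * form f (lop (- cnj u) (flip2 \<alpha>) (flip2 \<beta>) g)"
proof -
  have W: "cnj (W_fun \<tau> \<eta> a u * pauli a $ \<alpha> $ \<beta>) = - sgn2 \<alpha> * sgn2 \<beta> * (W_fun \<tau> \<eta> a (- cnj u) * pauli a $ flip2 \<alpha> $ flip2 \<beta>)" if "a \<in> {0..3}" for a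
  proof -
    have a: "a \<le> 3" using that by simp
    show ?thesis by (simp add: W_fun_def thc_cnj[OF a] thc_minus[OF a] pauli_cnj[OF a])
  qed
  have V_rep: "rep a f \<in> V" "rep a g \<in> V" if "a \<in> {0..3}" for a using rep_spec(1) f g that by auto
  have left: "form (\<lambda>z. \<Sum>a\<in>A. c a * rep a f z) g = (\<Sum>a\<in>A. cnj (c a) * form (rep a f) g)" if "finite A" "A \<subseteq> {0..3}" for A c
    using that
  proof (induction A)
    case empty
    then show ?case by (simp add: form_eq dint_def)
  next
    case (insert x A)
    have "(\<lambda>z. \<Sum>a\<in>A. c a * rep a f z) \<in> V" using insert V_rep by (intro V_sum V_scale) auto
    then show ?case using insert V_rep[of x] form_lin(1)[of "rep x f" "\<lambda>z. \<Sum>a\<in>A. c a * rep a f z" g "c x" 1] g by simp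
  qed
  have right: "form f (\<lambda>z. \<Sum>a\<in>A. c a * rep a g z) = (\<Sum>a\<in>A. c a * form f (rep a g))" if "finite A" "A \<subseteq> {0..3}" for A c
    using that
  proof (induction A)
    case empty
    then show ?case by (simp add: form_eq dint_def)
  next
    case (insert x A)
    have "(\<lambda>z. \<Sum>a\<in>A. c a * rep a g z) \<in> V" using insert V_rep by (intro V_sum V_scale) auto
    then show ?case using insert V_rep[of x] form_lin(2)[of "rep x g" "\<lambda>z. \<Sum>a\<in>A. c a * rep a g z" f "c x" 1] f by simp
  qed
  have "form (lop u \<alpha> \<beta> f) g = (\<Sum>a=0..3. cnj (W_fun \<tau> \<eta> a u * pauli a $ \<alpha> $ \<beta>) * form (rep a f) g)"
    unfolding lop_def by (rule left) auto
  also have "\<dots> = (\<Sum>a=0..3. - sgn2 \<alpha> * sgn2 \<beta> * (W_fun \<tau> \<eta> a (- cnj u) * pauli a $ flip2 \<alpha> $ flip2 \<beta> * form f (rep a g)))"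
  proof (rule sum.cong)
    fix a :: nat assume a: "a \<in> {0..3}"
    then have "form (rep a f) g = form f (rep a g)" using rep_self_adjoint[OF f g, of a] by simp
    then show "cnj (W_fun \<tau> \<eta> a u * pauli a $ \<alpha> $ \<beta>) * form (rep a f) g = - sgn2 \<alpha> * sgn2 \<beta> * (W_fun \<tau> \<eta> a (- cnj u) * pauli a $ flip2 \<alpha> $ flip2 \<beta> * form f (rep a g))"
      unfolding W[OF a] by (simp only: mult.assoc)
  qed simp
  also have "\<dots> = - sgn2 \<alpha> * sgn2 \<beta> * form f (lop (- cnj u) (flip2 \<alpha>) (flip2 \<beta>) g)"
    unfolding lop_def by (subst right) (auto simp: sum_distrib_left)
  finally show ?thesis .
qed

text \<open>A tensor form exists: integrate over all variables, one after the other.\<close>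

primrec iterated_int :: "nat \<Rightarrow> ((nat \<Rightarrow> complex) \<Rightarrow> complex) \<Rightarrow> complex" where
  "iterated_int 0 \<Xi> = \<Xi> (\<lambda>_. 0)"
| "iterated_int (Suc n) \<Xi> = iterated_int n (\<lambda>z. dint (\<lambda>w. \<Xi> (z(Suc n := w)) * mu w (cnj w)))"

lemma iterated_int_sum:
  assumes "\<And>j n. j \<in> J \<Longrightarrow> n \<in> {1..N} \<Longrightarrow> continuous_on UNIV (\<phi> j n)"
  shows "iterated_int N (\<lambda>z. \<Sum>j\<in>J. c j * (\<Prod>n=1..N. \<phi> j n (z n))) = (\<Sum>j\<in>J. c j * (\<Prod>n=1..N. dint (\<lambda>w. \<phi> j n w * mu w (cnj w))))"
  using assms
proof (induction N arbitrary: c)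
  case (Suc N)
  let ?d = "\<lambda>j n. dint (\<lambda>w. \<phi> j n w * mu w (cnj w))"
  have "dint (\<lambda>w. (\<Sum>j\<in>J. c j * (\<Prod>n=1..Suc N. \<phi> j n ((z(Suc N := w)) n))) * mu w (cnj w)) =
     (\<Sum>j\<in>J. (c j * ?d j (Suc N)) * (\<Prod>n=1..N. \<phi> j n (z n)))" for z
  proof -
    have p: "(\<Prod>n=1..Suc N. \<phi> j n ((z(Suc N := w)) n)) = (\<Prod>n=1..N. \<phi> j n (z n)) * \<phi> j (Suc N) w" for j w
      by (simp add: prod.cl_ivl_Suc)
    have "dint (\<lambda>w. (\<Sum>j\<in>J. c j * (\<Prod>n=1..Suc N. \<phi> j n ((z(Suc N := w)) n))) * mu w (cnj w)) =
       dint (\<lambda>w. \<Sum>j\<in>J. (c j * (\<Prod>n=1..N. \<phi> j n (z n))) * (\<phi> j (Suc N) w * mu w (cnj w)))"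
      unfolding p by (simp add: sum_distrib_right mult.assoc)
    also have "\<dots> = (\<Sum>j\<in>J. (c j * (\<Prod>n=1..N. \<phi> j n (z n))) * ?d j (Suc N))"
      by (rule dint_sum) (intro continuous_intros Suc.prems, auto)
    finally show ?thesis by (simp add: mult_ac)
  qed
  then have "iterated_int (Suc N) (\<lambda>z. \<Sum>j\<in>J. c j * (\<Prod>n=1..Suc N. \<phi> j n (z n))) = iterated_int N (\<lambda>z. \<Sum>j\<in>J. (c j * ?d j (Suc N)) * (\<Prod>n=1..N. \<phi> j n (z n)))"
    by simp
  also have "\<dots> = (\<Sum>j\<in>J. (c j * ?d j (Suc N)) * (\<Prod>n=1..N. ?d j n))"
    by (rule Suc.IH) (use Suc.prems in auto)
  finally show ?case by (simp add: mult_ac)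
qed simp

definition tform0 where "tform0 N F G = iterated_int N (\<lambda>z. cnj (F z) * G z)"

lemma tform0_sum:
  assumes \<phi>: "\<And>j n. j \<in> J \<Longrightarrow> n \<in> {1..N} \<Longrightarrow> \<phi> j n \<in> V" and \<psi>: "\<And>k n. k \<in> K \<Longrightarrow> n \<in> {1..N} \<Longrightarrow> \<psi> k n \<in> V"
  shows "tform0 N (\<lambda>z. \<Sum>j\<in>J. a j * pure_tensor N (\<phi> j) z) (\<lambda>z. \<Sum>k\<in>K. b k * pure_tensor N (\<psi> k) z) =
    (\<Sum>j\<in>J. \<Sum>k\<in>K. cnj (a j) * b k * (\<Prod>n=1..N. form (\<phi> j n) (\<psi> k n)))"
proof -
  have "tform0 N (\<lambda>z. \<Sum>j\<in>J. a j * pure_tensor N (\<phi> j) z) (\<lambda>z. \<Sum>k\<in>K. b k * pure_tensor N (\<psi> k) z) =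
     iterated_int N (\<lambda>z. \<Sum>p\<in>J \<times> K. (cnj (a (fst p)) * b (snd p)) * (\<Prod>n=1..N. cnj (\<phi> (fst p) n (z n)) * \<psi> (snd p) n (z n)))"
    unfolding tform0_def
  proof (rule arg_cong[of _ _ "iterated_int N"], rule ext)
    fix z
    have "cnj (\<Sum>j\<in>J. a j * pure_tensor N (\<phi> j) z) * (\<Sum>k\<in>K. b k * pure_tensor N (\<psi> k) z) =
      (\<Sum>j\<in>J. \<Sum>k\<in>K. (cnj (a j) * b k) * (\<Prod>n=1..N. cnj (\<phi> j n (z n)) * \<psi> k n (z n)))"
      unfolding cnj_sum sum_product by (intro sum.cong refl) (simp add: pure_tensor_def prod.distrib)
    then show "cnj (\<Sum>j\<in>J. a j * pure_tensor N (\<phi> j) z) * (\<Sum>k\<in>K. b k * pure_tensor N (\<psi> k) z) =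
      (\<Sum>p\<in>J \<times> K. (cnj (a (fst p)) * b (snd p)) * (\<Prod>n=1..N. cnj (\<phi> (fst p) n (z n)) * \<psi> (snd p) n (z n)))"
      unfolding sum.cartesian_product case_prod_unfold .
  qed
  also have "\<dots> = (\<Sum>p\<in>J \<times> K. (cnj (a (fst p)) * b (snd p)) * (\<Prod>n=1..N. dint (\<lambda>w. cnj (\<phi> (fst p) n w) * \<psi> (snd p) n w * mu w (cnj w))))"
    by (rule iterated_int_sum[where \<phi> = "\<lambda>p n w. cnj (\<phi> (fst p) n w) * \<psi> (snd p) n w"])
       (auto intro!: continuous_intros V_continuous[OF \<phi>] V_continuous[OF \<psi>])
  finally show ?thesis by (simp add: form_eq sum.cartesian_product case_prod_unfold)
qed

lemma tform0_is_tensor_form: "is_tensor_form N V form (tform0 N)"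
  unfolding is_tensor_form_def sesquilinear_on_def
proof (intro conjI ballI allI impI)
  fix F G Hh :: "(nat \<Rightarrow> complex) \<Rightarrow> complex" and a b :: complex assume "F \<in> H N" "G \<in> H N" "Hh \<in> H N"
  obtain M :: nat and \<phi> where \<phi>': "\<forall>j\<in>{..<M}. \<forall>n\<in>{1..N}. \<phi> j n \<in> V" and F: "F = (\<lambda>z. \<Sum>j<M. 1 * pure_tensor N (\<phi> j) z)"
    by (rule tensor_power_E[OF \<open>F \<in> H N\<close>]) (rule that)
  obtain M1 :: nat and \<psi> where \<psi>': "\<forall>j\<in>{..<M1}. \<forall>n\<in>{1..N}. \<psi> j n \<in> V" and G: "G = (\<lambda>z. \<Sum>j<M1. 1 * pure_tensor N (\<psi> j) z)"
    by (rule tensor_power_E[OF \<open>G \<in> H N\<close>]) (rule that)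
  obtain M2 :: nat and \<theta> where \<theta>': "\<forall>j\<in>{..<M2}. \<forall>n\<in>{1..N}. \<theta> j n \<in> V" and Hh: "Hh = (\<lambda>z. \<Sum>j<M2. 1 * pure_tensor N (\<theta> j) z)"
    by (rule tensor_power_E[OF \<open>Hh \<in> H N\<close>]) (rule that)
  define c where "c x = (case x of Inl j \<Rightarrow> a | Inr k \<Rightarrow> b)" for x :: "nat + nat"
  define \<xi> where "\<xi> x = (case x of Inl j \<Rightarrow> \<phi> j | Inr k \<Rightarrow> \<psi> k)" for x :: "nat + nat"
  have \<xi>: "\<xi> x n \<in> V" if "x \<in> {..<M} <+> {..<M1}" "n \<in> {1..N}" for x n
    using that \<phi>' \<psi>' by (auto simp: \<xi>_def)
  have comb: "(\<lambda>z. a * F z + b * G z) = (\<lambda>z. \<Sum>x\<in>{..<M} <+> {..<M1}. c x * pure_tensor N (\<xi> x) z)"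
    by (subst sum.Plus) (auto simp: F G c_def \<xi>_def sum_distrib_left)
  show "tform0 N (\<lambda>x. a * F x + b * G x) Hh = cnj a * tform0 N F Hh + cnj b * tform0 N G Hh"
    unfolding comb unfolding F G Hh
    by (subst (1 2 3) tform0_sum) (use \<xi> \<phi>' \<psi>' \<theta>' in \<open>auto simp: sum.Plus c_def \<xi>_def sum_distrib_left\<close>)
  show "tform0 N Hh (\<lambda>x. a * F x + b * G x) = a * tform0 N Hh F + b * tform0 N Hh G"
    unfolding comb unfolding F G Hh
    by (subst (1 2 3) tform0_sum) (use \<xi> \<phi>' \<psi>' \<theta>' in \<open>auto simp: sum.Plus c_def \<xi>_def sum_distrib_left sum.distrib\<close>)
next
  fix f g :: "nat \<Rightarrow> complex \<Rightarrow> complex" assume fg: "\<forall>n\<in>{1..N}. f n \<in> V \<and> g n \<in> V"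
  then show "tform0 N (pure_tensor N f) (pure_tensor N g) = (\<Prod>n=1..N. form (f n) (g n))"
    using tform0_sum[of "{0::nat}" N "\<lambda>_. f" "{0::nat}" "\<lambda>_. g" "\<lambda>_. 1" "\<lambda>_. 1"] by simp
qed

abbreviation "tform N \<equiv> tensor_form N V form"

lemma tform_is_tensor_form: "is_tensor_form N V form (tform N)"
  unfolding tensor_form_def by (rule someI[where P = "is_tensor_form N V form"]) (rule tform0_is_tensor_form)

lemma tform_pure:
  "(\<And>n. n \<in> {1..N} \<Longrightarrow> f n \<in> V) \<Longrightarrow> (\<And>n. n \<in> {1..N} \<Longrightarrow> g n \<in> V) \<Longrightarrow> tform N (pure_tensor N f) (pure_tensor N g) = (\<Prod>n=1..N. form (f n) (g n))"
  using tform_is_tensor_form[of N] unfolding is_tensor_form_def by blast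

lemma tform_lin:
  assumes "F \<in> H N" "G \<in> H N" "E \<in> H N"
  shows "tform N (\<lambda>x. a * F x + b * G x) E = cnj a * tform N F E + cnj b * tform N G E"
    "tform N E (\<lambda>x. a * F x + b * G x) = a * tform N E F + b * tform N E G"
  using tform_is_tensor_form[of N] assms unfolding is_tensor_form_def sesquilinear_on_def by blast+

lemma tform_sum:
  assumes N: "N > 0" and F: "\<And>i. i \<in> I \<Longrightarrow> F i \<in> H N" and E: "E \<in> H N"
  shows "tform N (\<lambda>z. \<Sum>i\<in>I. c i * F i z) E = (\<Sum>i\<in>I. cnj (c i) * tform N (F i) E)"
    "tform N E (\<lambda>z. \<Sum>i\<in>I. c i * F i z) = (\<Sum>i\<in>I. c i * tform N E (F i))"
proof -
  have z: "tform N (\<lambda>z. 0) E = 0" "tform N E (\<lambda>z. 0) = 0"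
    using tform_lin[OF E E E, of 0 0] by simp_all
  have "tform N (\<lambda>z. \<Sum>i\<in>I. c i * F i z) E = (\<Sum>i\<in>I. cnj (c i) * tform N (F i) E) \<and>
    tform N E (\<lambda>z. \<Sum>i\<in>I. c i * F i z) = (\<Sum>i\<in>I. c i * tform N E (F i))"
    using F
  proof (induction I rule: infinite_finite_induct)
    case (insert x I)
    have "(\<lambda>z. \<Sum>i\<in>I. c i * F i z) \<in> H N" using insert by (intro tensor_power_sum[OF N]) auto
    then show ?case using tform_lin[of "F x" N "\<lambda>z. \<Sum>i\<in>I. c i * F i z" E "c x" 1] insert E by simp
  qed (simp_all add: z)
  then show "tform N (\<lambda>z. \<Sum>i\<in>I. c i * F i z) E = (\<Sum>i\<in>I. cnj (c i) * tform N (F i) E)"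
    "tform N E (\<lambda>z. \<Sum>i\<in>I. c i * F i z) = (\<Sum>i\<in>I. c i * tform N E (F i))" by auto
qed

text \<open>Adjointness on the tensor power needs to be checked on products only.\<close>

lemma tform_adjoint_pure:
  assumes N: "N > 0"
    and A: "\<And>(J :: nat set) \<phi>. (\<And>j n. j \<in> J \<Longrightarrow> n \<in> {1..N} \<Longrightarrow> \<phi> j n \<in> V) \<Longrightarrow>
      A (\<lambda>z. \<Sum>j\<in>J. 1 * pure_tensor N (\<phi> j) z) = (\<lambda>z. \<Sum>j\<in>J. 1 * A (pure_tensor N (\<phi> j)) z)"
    and B: "\<And>(J :: nat set) \<phi>. (\<And>j n. j \<in> J \<Longrightarrow> n \<in> {1..N} \<Longrightarrow> \<phi> j n \<in> V) \<Longrightarrow>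
      B (\<lambda>z. \<Sum>j\<in>J. 1 * pure_tensor N (\<phi> j) z) = (\<lambda>z. \<Sum>j\<in>J. 1 * B (pure_tensor N (\<phi> j)) z)"
    and AH: "\<And>F. F \<in> H N \<Longrightarrow> A F \<in> H N" and BH: "\<And>F. F \<in> H N \<Longrightarrow> B F \<in> H N"
    and pure: "\<And>f g. (\<And>n. n \<in> {1..N} \<Longrightarrow> f n \<in> V) \<Longrightarrow> (\<And>n. n \<in> {1..N} \<Longrightarrow> g n \<in> V) \<Longrightarrow>
      tform N (A (pure_tensor N f)) (pure_tensor N g) = C * tform N (pure_tensor N f) (B (pure_tensor N g))"
    and F: "F \<in> H N" and G: "G \<in> H N"
  shows "tform N (A F) G = C * tform N F (B G)"
proof -
  obtain M :: nat and \<phi> where \<phi>': "\<forall>j\<in>{..<M}. \<forall>n\<in>{1..N}. \<phi> j n \<in> V" and F: "F = (\<lambda>z. \<Sum>j<M. 1 * pure_tensor N (\<phi> j) z)"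
    by (rule tensor_power_E[OF \<open>F \<in> H N\<close>]) (rule that)
  obtain M1 :: nat and \<psi> where \<psi>': "\<forall>j\<in>{..<M1}. \<forall>n\<in>{1..N}. \<psi> j n \<in> V" and G: "G = (\<lambda>z. \<Sum>j<M1. 1 * pure_tensor N (\<psi> j) z)"
    by (rule tensor_power_E[OF \<open>G \<in> H N\<close>]) (rule that)
  note \<phi> = \<phi>'[rule_format] and \<psi> = \<psi>'[rule_format]
  have p\<phi>: "pure_tensor N (\<phi> j) \<in> H N" if "j \<in> {..<M}" for j using \<phi> that by (intro tensor_power_pure) auto
  have p\<psi>: "pure_tensor N (\<psi> j) \<in> H N" if "j \<in> {..<M1}" for j using \<psi> that by (intro tensor_power_pure) auto
  have AF: "A F = (\<lambda>z. \<Sum>j<M. 1 * A (pure_tensor N (\<phi> j)) z)" unfolding F by (rule A) (rule \<phi>)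
  have BG: "B G = (\<lambda>z. \<Sum>j<M1. 1 * B (pure_tensor N (\<psi> j)) z)" unfolding G by (rule B) (rule \<psi>)
  have "tform N (A F) G = (\<Sum>j<M. cnj 1 * tform N (A (pure_tensor N (\<phi> j))) G)"
    unfolding AF by (rule tform_sum(1)[OF N _ \<open>G \<in> H N\<close>]) (intro AH p\<phi>)
  also have "\<dots> = (\<Sum>j<M. cnj 1 * (\<Sum>k<M1. 1 * tform N (A (pure_tensor N (\<phi> j))) (pure_tensor N (\<psi> k))))"
    unfolding G by (intro sum.cong refl arg_cong2[of _ _ _ _ "(*)"] tform_sum(2)[OF N] AH p\<phi> p\<psi>) auto
  also have "\<dots> = (\<Sum>j<M. cnj 1 * (\<Sum>k<M1. 1 * (C * tform N (pure_tensor N (\<phi> j)) (B (pure_tensor N (\<psi> k))))))"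
    by (intro sum.cong refl arg_cong2[of _ _ _ _ "(*)"] pure \<phi> \<psi>)
  also have "\<dots> = C * (\<Sum>j<M. cnj 1 * (\<Sum>k<M1. 1 * tform N (pure_tensor N (\<phi> j)) (B (pure_tensor N (\<psi> k)))))"
    by (simp add: sum_distrib_left)
  also have "(\<Sum>j<M. cnj 1 * (\<Sum>k<M1. 1 * tform N (pure_tensor N (\<phi> j)) (B (pure_tensor N (\<psi> k))))) = (\<Sum>j<M. cnj 1 * tform N (pure_tensor N (\<phi> j)) (B G))"
    unfolding BG by (intro sum.cong refl arg_cong2[of _ _ _ _ "(*)"] tform_sum(2)[OF N, symmetric] BH p\<phi> p\<psi>) auto
  also have "\<dots> = tform N F (B G)"
    unfolding F by (rule tform_sum(1)[OF N _ BH[OF \<open>G \<in> H N\<close>], symmetric]) (rule p\<phi>)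
  finally show ?thesis .
qed

text \<open>
  The signs in the adjoints of the entries cancel along a closed path of indices, and exchanging the two
  values of all the indices permutes the paths.
\<close>

lemma transfer_adjoint:
  assumes N: "N > 0" and F: "F \<in> H N" and G: "G \<in> H N"
  shows "tform N (transfer \<tau> \<eta> m N u F) G = (- 1) ^ N * tform N F (transfer \<tau> \<eta> m N (- cnj u) G)"
proof (rule tform_adjoint_pure[OF N _ _ _ _ _ F G])
  fix f g :: "nat \<Rightarrow> complex \<Rightarrow> complex"
  assume f: "\<And>n. n \<in> {1..N} \<Longrightarrow> f n \<in> V" and g: "\<And>n. n \<in> {1..N} \<Longrightarrow> g n \<in> V"
  let ?P = "{1..N} \<rightarrow>\<^sub>E (UNIV :: 2 set)"
  let ?u = "- cnj u"
  have lV: "lop u \<alpha> \<beta> h \<in> V" if "h \<in> V" for u \<alpha> \<beta> h using lop_linear that by (auto simp: linear_operator_on_def)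
  have pf: "pure_tensor N f \<in> H N" and pg: "pure_tensor N g \<in> H N" using f g by (auto intro: tensor_power_pure)
  have lf: "pure_tensor N (\<lambda>n. lop u (p n) (cyc_pred N p n) (f n)) \<in> H N" for p u using f lV by (auto intro!: tensor_power_pure)
  have lg: "pure_tensor N (\<lambda>n. lop u (p n) (cyc_pred N p n) (g n)) \<in> H N" for p u using g lV by (auto intro!: tensor_power_pure)
  have "tform N (transfer \<tau> \<eta> m N u (pure_tensor N f)) (pure_tensor N g) =
     tform N (\<lambda>z. \<Sum>p\<in>?P. 1 * pure_tensor N (\<lambda>n. lop u (p n) (cyc_pred N p n) (f n)) z) (pure_tensor N g)"
    by (subst transfer_pure[OF N f]) simp_all
  also have "\<dots> = (\<Sum>p\<in>?P. cnj 1 * tform N (pure_tensor N (\<lambda>n. lop u (p n) (cyc_pred N p n) (f n))) (pure_tensor N g))"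
    by (rule tform_sum(1)[OF N lf pg])
  also have "\<dots> = (\<Sum>p\<in>?P. \<Prod>n=1..N. form (lop u (p n) (cyc_pred N p n) (f n)) (g n))"
    unfolding complex_cnj_one mult_1 by (intro sum.cong refl tform_pure lV f g)
  also have "\<dots> = (\<Sum>p\<in>?P. (- 1) ^ N * (\<Prod>n=1..N. form (f n) (lop ?u (flip2 (p n)) (flip2 (cyc_pred N p n)) (g n))))"
  proof (rule sum.cong)
    fix p
    have "(\<Prod>n=1..N. form (lop u (p n) (cyc_pred N p n) (f n)) (g n)) =
       (\<Prod>n=1..N. - 1 * (sgn2 (p n) * sgn2 (cyc_pred N p n)) * form (f n) (lop ?u (flip2 (p n)) (flip2 (cyc_pred N p n)) (g n)))"
      by (intro prod.cong refl) (simp add: form_lop[OF f g])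
    also have "\<dots> = (- 1) ^ N * ((\<Prod>n=1..N. sgn2 (p n)) * (\<Prod>n=1..N. sgn2 (cyc_pred N p n))) * (\<Prod>n=1..N. form (f n) (lop ?u (flip2 (p n)) (flip2 (cyc_pred N p n)) (g n)))"
      by (simp only: prod.distrib prod_constant card_atLeastAtMost) simp
    also have "(\<Prod>n=1..N. sgn2 (cyc_pred N p n)) = (\<Prod>n=1..N. sgn2 (p n))" by (rule prod_cyc_pred[OF N])
    also have "(\<Prod>n=1..N. sgn2 (p n)) * (\<Prod>n=1..N. sgn2 (p n)) = 1"
      by (simp only: prod.distrib[symmetric] sgn2_sgn2) simp
    finally show "(\<Prod>n=1..N. form (lop u (p n) (cyc_pred N p n) (f n)) (g n)) = (- 1) ^ N * (\<Prod>n=1..N. form (f n) (lop ?u (flip2 (p n)) (flip2 (cyc_pred N p n)) (g n)))"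
      by simp
  qed simp
  also have "\<dots> = (- 1) ^ N * (\<Sum>p\<in>?P. \<Prod>n=1..N. form (f n) (lop ?u (flip2 (p n)) (flip2 (cyc_pred N p n)) (g n)))"
    by (simp only: sum_distrib_left)
  also have "(\<Sum>p\<in>?P. \<Prod>n=1..N. form (f n) (lop ?u (flip2 (p n)) (flip2 (cyc_pred N p n)) (g n))) = (\<Sum>p\<in>?P. \<Prod>n=1..N. form (f n) (lop ?u (p n) (cyc_pred N p n) (g n)))"
  proof (rule sum.reindex_bij_witness[of _ "\<lambda>p. restrict (flip2 \<circ> p) {1..N}" "\<lambda>p. restrict (flip2 \<circ> p) {1..N}"])
    fix p assume "p \<in> ?P"
    then show "restrict (flip2 \<circ> restrict (flip2 \<circ> p) {1..N}) {1..N} = p"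
      by (auto simp: fun_eq_iff flip2_flip2 PiE_iff extensional_def restrict_def)
    then show "restrict (flip2 \<circ> restrict (flip2 \<circ> p) {1..N}) {1..N} = p" .
    show "restrict (flip2 \<circ> p) {1..N} \<in> ?P" by auto
    then show "restrict (flip2 \<circ> p) {1..N} \<in> ?P" .
    show "(\<Prod>n=1..N. form (f n) (lop ?u (restrict (flip2 \<circ> p) {1..N} n) (cyc_pred N (restrict (flip2 \<circ> p) {1..N}) n) (g n))) =
       (\<Prod>n=1..N. form (f n) (lop ?u (flip2 (p n)) (flip2 (cyc_pred N p n)) (g n)))"
      using N by (intro prod.cong refl) auto
  qed
  also have "\<dots> = (\<Sum>p\<in>?P. 1 * tform N (pure_tensor N f) (pure_tensor N (\<lambda>n. lop ?u (p n) (cyc_pred N p n) (g n))))"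
    unfolding mult_1 by (intro sum.cong refl tform_pure[symmetric] lV f g)
  also have "\<dots> = tform N (pure_tensor N f) (\<lambda>z. \<Sum>p\<in>?P. 1 * pure_tensor N (\<lambda>n. lop ?u (p n) (cyc_pred N p n) (g n)) z)"
    by (rule tform_sum(2)[OF N lg pf, symmetric])
  finally show "tform N (transfer \<tau> \<eta> m N u (pure_tensor N f)) (pure_tensor N g) = (- 1) ^ N * tform N (pure_tensor N f) (transfer \<tau> \<eta> m N ?u (pure_tensor N g))"
    by (subst transfer_pure[OF N g]) simp_all
qed (rule transfer_sum, blast | rule transfer_in_H[OF N], assumption)+

lemma op_tensor_power_pure:
  assumes "linear_operator_on V A" "\<And>n. n \<in> {1..N} \<Longrightarrow> f n \<in> V"
  shows "op_tensor_power N A (pure_tensor N f) = pure_tensor N (\<lambda>n. A (f n))"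
  using op_tensor_power_pure_sum[OF assms(1), of "{0::nat}" N "\<lambda>_. f" "\<lambda>_. 1"] assms(2) by simp

lemma op_tensor_power_adjoint:
  assumes N: "N > 0" and F: "F \<in> H N" and G: "G \<in> H N" and A: "linear_operator_on V A"
    and adj: "\<And>f g. f \<in> V \<Longrightarrow> g \<in> V \<Longrightarrow> form (A f) g = c * form f (A g)"
  shows "tform N (op_tensor_power N A F) G = c ^ N * tform N F (op_tensor_power N A G)"
proof (rule tform_adjoint_pure[OF N _ _ _ _ _ F G])
  have AV: "A f \<in> V" if "f \<in> V" for f using A that by (auto simp: linear_operator_on_def)
  fix f g :: "nat \<Rightarrow> complex \<Rightarrow> complex"
  assume f: "\<And>n. n \<in> {1..N} \<Longrightarrow> f n \<in> V" and g: "\<And>n. n \<in> {1..N} \<Longrightarrow> g n \<in> V"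
  show "tform N (op_tensor_power N A (pure_tensor N f)) (pure_tensor N g) = c ^ N * tform N (pure_tensor N f) (op_tensor_power N A (pure_tensor N g))"
  proof -
    have "tform N (pure_tensor N (\<lambda>n. A (f n))) (pure_tensor N g) = (\<Prod>n=1..N. form (A (f n)) (g n))"
      by (intro tform_pure AV f g)
    also have "\<dots> = (\<Prod>n=1..N. c * form (f n) (A (g n)))" by (intro prod.cong refl adj f g)
    also have "\<dots> = c ^ N * (\<Prod>n=1..N. form (f n) (A (g n)))" by (simp add: prod.distrib)
    also have "(\<Prod>n=1..N. form (f n) (A (g n))) = tform N (pure_tensor N f) (pure_tensor N (\<lambda>n. A (g n)))"
      by (intro tform_pure[symmetric] AV f g)
    finally show ?thesis by (subst (1 2) op_tensor_power_pure[OF A]) (use f g in auto)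
  qed
next
  fix J :: "nat set" and \<phi> :: "nat \<Rightarrow> nat \<Rightarrow> complex \<Rightarrow> complex"
  assume \<phi>: "\<And>j n. j \<in> J \<Longrightarrow> n \<in> {1..N} \<Longrightarrow> \<phi> j n \<in> V"
  show "op_tensor_power N A (\<lambda>z. \<Sum>j\<in>J. 1 * pure_tensor N (\<phi> j) z) = (\<lambda>z. \<Sum>j\<in>J. 1 * op_tensor_power N A (pure_tensor N (\<phi> j)) z)"
  proof -
    have "pure_tensor N (\<lambda>n. A (\<phi> j n)) = op_tensor_power N A (pure_tensor N (\<phi> j))" if "j \<in> J" for j
      by (rule op_tensor_power_pure[OF A, symmetric]) (rule \<phi>[OF that])
    then have "(\<lambda>z. \<Sum>j\<in>J. 1 * pure_tensor N (\<lambda>n. A (\<phi> j n)) z) = (\<lambda>z. \<Sum>j\<in>J. 1 * op_tensor_power N A (pure_tensor N (\<phi> j)) z)"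
      by (intro ext sum.cong refl) simp
    moreover have "op_tensor_power N A (\<lambda>z. \<Sum>j\<in>J. 1 * pure_tensor N (\<phi> j) z) = (\<lambda>z. \<Sum>j\<in>J. 1 * pure_tensor N (\<lambda>n. A (\<phi> j n)) z)"
      by (rule op_tensor_power_pure_sum[OF A]) (rule \<phi>)
    ultimately show ?thesis by simp
  qed
  then show "op_tensor_power N A (\<lambda>z. \<Sum>j\<in>J. 1 * pure_tensor N (\<phi> j) z) = (\<lambda>z. \<Sum>j\<in>J. 1 * op_tensor_power N A (pure_tensor N (\<phi> j)) z)" .
qed (auto intro: op_tensor_power_in_H N A)

end

section \<open>The operator \<open>Q\<^sub>L\<close>\<close>

context sklyanin_strict
begin

abbreviation "QL N r t \<equiv> Q_L \<tau> \<eta> m N r t"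

definition unit_vec :: "(nat \<Rightarrow> nat) \<Rightarrow> (nat \<Rightarrow> nat) \<Rightarrow> complex" where
  "unit_vec k = (\<lambda>k'. if k' = k then 1 else 0)"

lemma finite_index_set: "finite (index_set N m)"
  unfolding index_set_def by (intro finite_PiE) auto

lemma sum_unit_vec:
  "k \<in> index_set N m \<Longrightarrow> (\<Sum>k'\<in>index_set N m. c k' * unit_vec k k') = c k"
  "k \<in> index_set N m \<Longrightarrow> (\<Sum>k'\<in>index_set N m. unit_vec k k' * c k') = c k"
  unfolding unit_vec_def by (simp_all add: finite_index_set if_distrib[of "\<lambda>x. _ * x"] if_distrib[of "\<lambda>x. x * _"] sum.delta cong: if_cong)

lemma unit_vec_in_K: "k \<in> index_set N m \<Longrightarrow> unit_vec k \<in> coord_space N m"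
  by (auto simp: unit_vec_def coord_space_def)

lemma Q_R_expand: "QR N r t u v = (\<lambda>z. \<Sum>k\<in>index_set N m. v k * QR N r t u (unit_vec k) z)"
proof
  fix z
  let ?S = "\<lambda>k. \<Sum>i\<in>({1..N} \<rightarrow>\<^sub>E {1..r}). pure_tensor N (\<lambda>n. Svec r t (i n) (cyc_pred N i n) u (k n)) z"
  have "QR N r t u (unit_vec k) z = ?S k" if "k \<in> index_set N m" for k
    unfolding Q_R_def by (rule sum_unit_vec(2)[OF that])
  then show "QR N r t u v z = (\<Sum>k\<in>index_set N m. v k * QR N r t u (unit_vec k) z)"
    unfolding Q_R_def[of _ _ _ _ _ _ _ v] by (intro sum.cong refl) simp
qed

lemma Q_L_eq:
  assumes N: "N > 0" and F: "F \<in> H N"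
  shows "QL N r t u F = (\<lambda>k. if k \<in> index_set N m then cnj (tform N F (QR N r t (- cnj u) (unit_vec k))) else 0)" (is "_ = ?w")
  unfolding Q_L_def hermitian_adjoint_def
proof (rule the_equality)
  let ?K = "coord_space N m"
  have "coord_form N m ?w v = tform N F (QR N r t (- cnj u) v)" for v
  proof -
    have "coord_form N m ?w v = (\<Sum>k\<in>index_set N m. v k * tform N F (QR N r t (- cnj u) (unit_vec k)))"
      unfolding coord_form_def by (intro sum.cong) auto
    also have "\<dots> = tform N F (\<lambda>z. \<Sum>k\<in>index_set N m. v k * QR N r t (- cnj u) (unit_vec k) z)"
      by (rule tform_sum(2)[symmetric, OF N _ F]) (rule Q_R_in_H[OF N])
    finally show ?thesis unfolding Q_R_expand[of N r t "- cnj u" v, symmetric] .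
  qed
  then show "?w \<in> ?K \<and> (\<forall>v\<in>?K. coord_form N m ?w v = tform N F (QR N r t (- cnj u) v))"
    by (auto simp: coord_space_def)
  fix w assume w: "w \<in> ?K \<and> (\<forall>v\<in>?K. coord_form N m w v = tform N F (QR N r t (- cnj u) v))"
  show "w = ?w"
  proof
    fix k
    show "w k = ?w k"
    proof (cases "k \<in> index_set N m")
      case True
      then have "cnj (w k) = coord_form N m w (unit_vec k)" unfolding coord_form_def by (simp only: sum_unit_vec(1)[of k N "\<lambda>k. cnj (w k)"])
      also have "\<dots> = tform N F (QR N r t (- cnj u) (unit_vec k))" using w unit_vec_in_K[OF True] by blast
      finally show ?thesis using True by (metis complex_cnj_cnj)
    next
      case False
      then show ?thesis using w by (simp add: coord_space_def)
    qed
  qed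
qed

lemma Q_L_lin:
  assumes "N > 0" "F \<in> H N" "G \<in> H N"
  shows "QL N r t u (\<lambda>z. a * F z + b * G z) = (\<lambda>k. a * QL N r t u F k + b * QL N r t u G k)"
  unfolding Q_L_eq[OF assms(1,2)] Q_L_eq[OF assms(1,3)] Q_L_eq[OF assms(1) tensor_power_lin[OF assms]]
  by (simp add: tform_lin assms Q_R_in_H fun_eq_iff)

lemma exp_spin_N:
  assumes "even (N * m)" shows "exp (2 * of_real pi * \<i> * spin m) ^ N = 1" "exp (- (2 * of_real pi * \<i> * spin m)) ^ N = 1"
proof -
  obtain k where "N * m = 2 * k" using assms by (rule evenE)
  then have "of_nat N * (2 * of_real pi * \<i> * spin m) = 2 * of_real pi * \<i> * of_int (int k)"
    using arg_cong[of "N * m" "2 * k" "of_nat :: nat \<Rightarrow> complex"] unfolding of_nat_mult by simp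
  then show 1: "exp (2 * of_real pi * \<i> * spin m) ^ N = 1"
    unfolding exp_of_nat_mult[symmetric] by (simp only: exp_2pi_int)
  then show "exp (- (2 * of_real pi * \<i> * spin m)) ^ N = 1" by (simp only: exp_minus power_inverse inverse_1)
qed

lemma phi_1: "phi (c + 1) = phi c"
proof
  fix z
  have "sg (z + (c + 1) + w) = - sg (z + c + w)" "sg (- z + (c + 1) + w) = - sg (- z + c + w)" for w
    using sg_1[of "z + c + w"] sg_1[of "- z + c + w"] by (simp_all add: add_ac)
  then have "br_fac \<tau> \<eta> m (z + (c + 1)) = (- 1) ^ m * br_fac \<tau> \<eta> m (z + c)" "br_fac \<tau> \<eta> m (- z + (c + 1)) = (- 1) ^ m * br_fac \<tau> \<eta> m (- z + c)"
    unfolding br_fac_def by (simp_all add: prod_uminus)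
  then show "phi (c + 1) z = phi c z"
    unfolding br_pair_def by (simp flip: power_mult_distrib)
qed

lemma Q_R_2: "QR N r t (u + 2) = QR N r t u"
proof -
  have "S_par s j (u + 2) = S_par s j u + 1" for s j by (simp add: S_par_def field_simps)
  then have "Svec r t i j (u + 2) k = Svec r t i j u k" for i j k unfolding S_vec_eq by (simp only: phi_1)
  then show ?thesis by (intro ext) (simp only: Q_R_def)
qed

lemma Q_L_op_tensor_power:
  assumes N: "N > 0" and F: "F \<in> H N" and A: "linear_operator_on V A"
    and adj: "\<And>f g. f \<in> V \<Longrightarrow> g \<in> V \<Longrightarrow> form (A f) g = c * form f (A g)" and c: "c ^ N = 1"
    and QR: "\<And>v. op_tensor_power N A (QR N r t (- cnj u) v) = (\<lambda>z. C * QR N r t (- cnj u') v z)"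
  shows "QL N r t u (op_tensor_power N A F) = (\<lambda>k. cnj C * QL N r t u' F k)"
proof
  fix k
  have Q: "QR N r t (- cnj u) v \<in> H N" "QR N r t (- cnj u') v \<in> H N" for v by (rule Q_R_in_H[OF N])+
  have "tform N (op_tensor_power N A F) (QR N r t (- cnj u) v) = C * tform N F (QR N r t (- cnj u') v)" for v
    using tform_lin(2)[OF Q(2) Q(2) F, where a = C and b = 0]
    by (subst op_tensor_power_adjoint[OF N F Q(1) A adj]) (simp_all add: c QR)
  then show "QL N r t u (op_tensor_power N A F) k = cnj C * QL N r t u' F k"
    unfolding Q_L_eq[OF N F] Q_L_eq[OF N op_tensor_power_in_H[OF N A F]] by simp
qed

end

locale sklyanin_strict_rational = sklyanin_strict + sklyanin_rational
begin

lemma U1_Q_L: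
  assumes N: "N > 0" and F: "F \<in> H N" and ev: "even (N * m)"
  shows "QL N r t u (op_tensor_power N (U1_op m) F) = (\<lambda>k. exp (- (of_real pi * \<i> * spin m)) ^ N * QL N r t (u + 1) F k)"
proof -
  let ?C = "exp (- (of_real pi * \<i> * spin m)) ^ N"
  have C: "cnj ?C = ?C"
  proof -
    have "cnj ?C = exp (2 * of_real pi * \<i> * spin m + - (of_real pi * \<i> * spin m)) ^ N" by (simp add: exp_cnj mult_ac)
    also have "\<dots> = ?C" unfolding exp_add power_mult_distrib exp_spin_N(1)[OF ev] by simp
    finally show ?thesis .
  qed
  have "op_tensor_power N (U1_op m) (QR N r t (- cnj u) v) = (\<lambda>z. ?C * QR N r t (- cnj (u + 1)) v z)" for v
  proof -
    \<comment> \<open>conjugation reverses the shift of \<open>u\<close>; the period \<open>2\<close> restores its sign\<close>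
    have "- cnj u + 1 = - cnj (u + 1) + 2" by simp
    then show ?thesis unfolding U1_Q_R[OF N] by (simp only: Q_R_2)
  qed
  from Q_L_op_tensor_power[OF N F U1_linear form_U1 exp_spin_N(2)[OF ev] this] show ?thesis unfolding C .
qed

lemma U3_Q_L:
  assumes N: "N > 0" and F: "F \<in> H N" and ev: "even (N * m)"
  shows "QL N r t u (op_tensor_power N (U3_op \<tau> m) F) =
    (\<lambda>k. exp (of_real pi * \<i> * spin m * (\<tau> - 1) + 2 * of_real pi * \<i> * spin m * u) ^ N * QL N r t (u + \<tau>) F k)"
proof -
  let ?C = "\<lambda>u. exp (of_real pi * \<i> * spin m * (\<tau> - 1) + 2 * of_real pi * \<i> * spin m * u) ^ N"
  have C: "cnj (?C (- cnj u)) = ?C u"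
  proof -
    have "cnj (?C (- cnj u)) = exp (2 * of_real pi * \<i> * spin m + (of_real pi * \<i> * spin m * (\<tau> - 1) + 2 * of_real pi * \<i> * spin m * u)) ^ N"
      by (simp add: exp_cnj cnj_tau) (rule arg_cong[of _ _ "\<lambda>x. exp x ^ N"], simp add: field_simps)
    also have "\<dots> = ?C u" by (subst exp_add) (simp only: power_mult_distrib exp_spin_N(1)[OF ev] mult_1)
    finally show ?thesis .
  qed
  have "op_tensor_power N (U3_op \<tau> m) (QR N r t (- cnj u) v) = (\<lambda>z. ?C (- cnj u) * QR N r t (- cnj (u + \<tau>)) v z)" for v
    unfolding U3_Q_R[OF N] by (simp add: cnj_tau)
  from Q_L_op_tensor_power[OF N F U3_linear form_U3 exp_spin_N(2)[OF ev] this] show ?thesis unfolding C .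
qed

end

locale sklyanin_strict_main = sklyanin_strict_rational + sklyanin_main
begin

lemma cnj_h_fun: "cnj (h_fun \<tau> \<eta> m N s (- cnj u)) = (- 1) ^ N * h_fun \<tau> \<eta> m N (- cnj s) u"
proof -
  have "cnj (2 * sg (- cnj u - s * (2 * spin m * h\<eta>))) = (- 1) * (2 * sg (u - (- cnj s) * (2 * spin m * h\<eta>)))"
    using sg_odd[of "u + cnj s * (2 * spin m * h\<eta>)"] by (simp add: sg_cnj)
  then show ?thesis unfolding h_fun_def complex_cnj_power by (simp only: power_mult_distrib)
qed

theorem transfer_Q_L:
  assumes N: "N > 0" and F: "F \<in> H N"
  shows "QL N r t u (TT N u F) = (\<lambda>k. h_fun \<tau> \<eta> m N (- 1) u * QL N r t (u - 2 * h\<eta>) F k + h_fun \<tau> \<eta> m N 1 u * QL N r t (u + 2 * h\<eta>) F k)"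
proof
  fix k
  let ?q = "\<lambda>u. tform N F (QR N r t u (unit_vec k))"
  have Q: "QR N r t u v \<in> H N" for u v by (rule Q_R_in_H[OF N])
  have "tform N (TT N u F) (QR N r t (- cnj u) (unit_vec k)) =
     (- 1) ^ N * (h_fun \<tau> \<eta> m N (- 1) (- cnj u) * ?q (- cnj u - 2 * h\<eta>) + h_fun \<tau> \<eta> m N 1 (- cnj u) * ?q (- cnj u + 2 * h\<eta>))"
    unfolding transfer_adjoint[OF N F Q] transfer_Q_R[OF N] tform_lin(2)[OF Q Q F] ..
  then have "cnj (tform N (TT N u F) (QR N r t (- cnj u) (unit_vec k))) =
     (- 1) ^ N * ((- 1) ^ N * h_fun \<tau> \<eta> m N 1 u * cnj (?q (- cnj (u + 2 * h\<eta>))) + (- 1) ^ N * h_fun \<tau> \<eta> m N (- 1) u * cnj (?q (- cnj (u - 2 * h\<eta>))))"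
    by (simp add: cnj_h_fun)
  also have "\<dots> = (- 1) ^ N * (- 1) ^ N * (h_fun \<tau> \<eta> m N (- 1) u * cnj (?q (- cnj (u - 2 * h\<eta>))) + h_fun \<tau> \<eta> m N 1 u * cnj (?q (- cnj (u + 2 * h\<eta>))))"
    by (simp only: distrib_left mult.assoc add.commute)
  also have "(- 1) ^ N * (- 1) ^ N = (1 :: complex)" by (simp flip: power_mult_distrib)
  finally show "QL N r t u (TT N u F) k = h_fun \<tau> \<eta> m N (- 1) u * QL N r t (u - 2 * h\<eta>) F k + h_fun \<tau> \<eta> m N 1 u * QL N r t (u + 2 * h\<eta>) F k"
    unfolding Q_L_eq[OF N F] Q_L_eq[OF N transfer_in_H[OF N F]] by simp
qed

end

section \<open>Scalar products of the product functions\<close>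

subsection \<open>Even theta functions are determined by their zeros\<close>

context lattice
begin

lemma theta_zero_shift:
  assumes F: "F \<in> Theta_space \<tau> k" and w: "F w = 0" shows "F (w + of_int n + of_int j * \<tau>) = 0"
proof -
  have 1: "F (z + 1) = F z" and t: "F (z + \<tau>) = exp (- 4 * spin k * of_real pi * \<i> * (2 * z + \<tau>)) * F z" for z
    using F unfolding Theta_space_def by blast+
  have "F (w + of_int n) = 0"
  proof (induction n rule: int_induct[where k = 0])
    case (step1 i)
    then show ?case using 1[of "w + of_int i"] by (simp add: add.assoc)
  next
    case (step2 i)
    then show ?case using 1[of "w + of_int (i - 1)"] by simp
  qed (use w in simp)
  then show ?thesis
  proof (induction j rule: int_induct[where k = 0])
    case (step1 i)
    then show ?case using t[of "w + of_int n + of_int i * \<tau>"] by (simp add: ring_distribs add.assoc)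
  next
    case (step2 i)
    have "w + of_int n + of_int (i - 1) * \<tau> + \<tau> = w + of_int n + of_int i * \<tau>" by (simp add: ring_distribs)
    then have "exp (- 4 * spin k * of_real pi * \<i> * (2 * (w + of_int n + of_int (i - 1) * \<tau>) + \<tau>)) * F (w + of_int n + of_int (i - 1) * \<tau>) = 0"
      using t[of "w + of_int n + of_int (i - 1) * \<tau>"] step2 by (simp only:)
    then show ?case by (simp only: mult_eq_0_iff exp_not_eq_zero simp_thms)
  qed simp
qed

lemma theta_divide:
  assumes F: "F \<in> Theta_space \<tau> (Suc k)" and y: "F y = 0" "sg (2 * y) \<noteq> 0"
  obtains G where "G \<in> Theta_space \<tau> k" "\<And>z. F z = sg (y + z) * sg (y - z) * G z"
proof -
  interpret one: sklyanin \<tau> 0 1 by unfold_locales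
  define d where "d z = sg (y + z) * sg (y - z)" for z
  have "d = br_pair \<tau> 0 1 y" by (auto simp: fun_eq_iff d_def br_pair_def br_fac_def add.commute One_nat_def)
  then have dV: "d \<in> Theta_space \<tau> 1" using one.br_pair_in_V by simp
  note d_rules = one.V_D[OF dV]
  have hF: "F holomorphic_on UNIV" and F1: "F (z + 1) = F z" and Fe: "F (- z) = F z"
    and Ft: "F (z + \<tau>) = exp (- 4 * spin (Suc k) * of_real pi * \<i> * (2 * z + \<tau>)) * F z" for z
    using F unfolding Theta_space_def by blast+
  have "eventually (\<lambda>z. sg (y + z) \<noteq> 0) (at 0)"
    by (rule entire_eventually_nonzero[where p = "- ((1 + \<tau>)/2) - y"]) (auto intro!: holomorphic_intros simp: sg_not_zero)
  moreover have "eventually (\<lambda>z. sg (y - z) \<noteq> 0) (at 0)"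
    by (rule entire_eventually_nonzero[where p = "(1 + \<tau>)/2 + y"]) (auto intro!: holomorphic_intros simp: sg_not_zero)
  ultimately have "eventually (\<lambda>z. d z \<noteq> 0) (at 0)" unfolding d_def by eventually_elim simp
  then obtain p where p: "d p \<noteq> 0" using eventually_happens[of _ "at (0::complex)"] by auto
  have not_both: "sg (y - z) \<noteq> 0" if "sg (y + z) = 0" for z
  proof
    assume "sg (y - z) = 0"
    then obtain n j n' j' :: int where "y + z = of_int n + of_int j * \<tau>" "y - z = of_int n' + of_int j' * \<tau>"
      using \<open>sg (y + z) = 0\<close> unfolding sg_zero_iff by blast
    then have "2 * y = of_int (n + n') + of_int (j + j') * \<tau>" by (simp add: ring_distribs) (simp add: algebra_simps)
    then show False using y(2) sg_zero_iff by blast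
  qed
  have hsg: "sg holomorphic_on UNIV" by (intro holomorphic_intros)
  have Dsg: "(sg has_field_derivative deriv sg x) (at x)" for x using hsg holomorphic_derivI by blast
  have Dd: "deriv d z = deriv sg (y + z) * sg (y - z) - sg (y + z) * deriv sg (y - z)" for z
  proof (rule DERIV_imp_deriv)
    have "((\<lambda>z. sg (y + z)) has_field_derivative deriv sg (y + z) * (0 + 1)) (at z)"
      by (rule DERIV_chain2[OF Dsg]) (auto intro!: derivative_eq_intros)
    moreover have "((\<lambda>z. sg (y - z)) has_field_derivative deriv sg (y - z) * (0 - 1)) (at z)"
      by (rule DERIV_chain2[OF Dsg]) (auto intro!: derivative_eq_intros)
    ultimately show "(d has_field_derivative deriv sg (y + z) * sg (y - z) - sg (y + z) * deriv sg (y - z)) (at z)"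
      unfolding d_def[abs_def] by (auto intro!: derivative_eq_intros simp: mult_ac)
  qed
  have simple: "deriv d z \<noteq> 0" if "d z = 0" for z
  proof (cases "sg (y + z) = 0")
    case True
    then show ?thesis using not_both[OF True] deriv_sg_nonzero[OF True] unfolding Dd by simp
  next
    case False
    then have "sg (y - z) = 0" using that by (simp add: d_def)
    then show ?thesis using False deriv_sg_nonzero[of "y - z"] unfolding Dd by simp
  qed
  have zero: "F z = 0" if "d z = 0" for z
  proof -
    have "\<exists>n j :: int. z = y + of_int n + of_int j * \<tau> \<or> - z = y + of_int n + of_int j * \<tau>"
    proof (cases "sg (y + z) = 0")
      case True
      moreover have "- z - y = - (y + z)" by simp
      ultimately have "sg (- z - y) = 0" by (simp only: sg_odd neg_equal_0_iff_equal)
      then obtain n j :: int where "- z - y = of_int n + of_int j * \<tau>" unfolding sg_zero_iff by blast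
      then have "- z = y + of_int n + of_int j * \<tau>" by (simp add: algebra_simps)
      then show ?thesis by blast
    next
      case False
      then have "sg (z - y) = 0" using that sg_odd[of "y - z"] by (simp add: d_def)
      then obtain n j :: int where "z - y = of_int n + of_int j * \<tau>" unfolding sg_zero_iff by blast
      then have "z = y + of_int n + of_int j * \<tau>" by (simp add: algebra_simps)
      then show ?thesis by blast
    qed
    then show ?thesis using theta_zero_shift[OF F y(1)] Fe[of z] by metis
  qed
  define G where "G = remove_sings (\<lambda>z. F z / d z)"
  note Q = entire_quotient[OF hF one.V_D(1)[OF dV] p simple zero, folded G_def]
  have hG: "(\<lambda>z. G (f z)) holomorphic_on UNIV" if "f holomorphic_on UNIV" for f
    using holomorphic_on_compose_gen[OF that Q(1)] by (simp add: o_def)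
  have "(\<lambda>z. G (z + 1)) = G"
  proof (rule entire_cancel[OF hG Q(1) d_rules(1) p])
    show "G (z + 1) * d z = G z * d z" for z using Q(2)[of "z + 1"] Q(2)[of z] by (simp only: d_rules(2) F1)
  qed (intro holomorphic_intros)
  moreover have "(\<lambda>z. G (- z)) = G"
  proof (rule entire_cancel[OF hG Q(1) d_rules(1) p])
    show "G (- z) * d z = G z * d z" for z using Q(2)[of "- z"] Q(2)[of z] by (simp only: d_rules(3) Fe)
  qed (intro holomorphic_intros)
  moreover have "(\<lambda>z. G (z + \<tau>)) = (\<lambda>z. exp (- 4 * spin k * of_real pi * \<i> * (2 * z + \<tau>)) * G z)"
  proof (rule entire_cancel[OF hG _ d_rules(1) p])
    show "(\<lambda>z. z + \<tau>) holomorphic_on UNIV" by (intro holomorphic_intros)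
    show "(\<lambda>z. exp (- 4 * spin k * of_real pi * \<i> * (2 * z + \<tau>)) * G z) holomorphic_on UNIV" by (intro holomorphic_intros Q(1))
    fix z
    let ?e = "\<lambda>k. exp (- 4 * spin k * of_real pi * \<i> * (2 * z + \<tau>))"
    have "?e (Suc k) = ?e k * ?e 1" by (simp only: exp_add[symmetric]) (rule arg_cong[of _ _ exp], simp add: field_simps)
    then have "(G (z + \<tau>) * d z) * ?e 1 = (?e k * G z * d z) * ?e 1"
      using Q(2)[of "z + \<tau>"] Q(2)[of z] Ft[of z] d_rules(4)[of z] by (simp add: mult_ac)
    then show "G (z + \<tau>) * d z = ?e k * G z * d z" by simp
  qed
  ultimately have "G \<in> Theta_space \<tau> k" unfolding Theta_space_def using Q(1) by (auto simp: fun_eq_iff)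
  moreover have "F z = sg (y + z) * sg (y - z) * G z" for z using Q(2)[of z] by (simp add: d_def mult_ac)
  ultimately show ?thesis by (rule that)
qed

text \<open>
  Dividing by \<open>[y + z][y - z]\<close> removes a pair of zeros and lowers the degree of the theta function by
  one; what remains in the end is an entire elliptic function. The conditions on the points make all
  the zeros simple.
\<close>

lemma theta_determined_by_zeros:
  assumes "F \<in> Theta_space \<tau> k" "\<And>j. j < k \<Longrightarrow> F (y j) = 0"
    and "\<And>i j. i < k \<Longrightarrow> j < k \<Longrightarrow> sg (y i + y j) \<noteq> 0" "\<And>i j. i < j \<Longrightarrow> j < k \<Longrightarrow> sg (y j - y i) \<noteq> 0"
  shows "\<exists>\<gamma>. \<forall>z. F z = \<gamma> * (\<Prod>j<k. sg (y j + z) * sg (y j - z))"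
  using assms
proof (induction k arbitrary: F)
  case 0
  then have "F holomorphic_on UNIV" "\<And>z. F (z + 1) = F z" "\<And>z. F (z + \<tau>) = F z" by (auto simp: Theta_space_def)
  then have "F z = F 0" for z by (rule elliptic_entire_constant)
  then show ?case by (intro exI[of _ "F 0"]) simp
next
  case (Suc k)
  have "sg (2 * y k) \<noteq> 0" using Suc.prems(3)[OF lessI lessI] by (simp only: mult_2 not_False_eq_True)
  then obtain G where G: "G \<in> Theta_space \<tau> k" "\<And>z. F z = sg (y k + z) * sg (y k - z) * G z"
    by (rule theta_divide[OF Suc.prems(1) Suc.prems(2)[OF lessI]]) (rule that)
  have "\<exists>\<gamma>. \<forall>z. G z = \<gamma> * (\<Prod>j<k. sg (y j + z) * sg (y j - z))"
  proof (rule Suc.IH[OF G(1)])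
    fix j assume "j < k"
    then show "G (y j) = 0" using Suc.prems(2)[of j] Suc.prems(3)[of k j] Suc.prems(4)[of j k] G(2)[of "y j"] by auto
  qed (use Suc.prems in auto)
  then show ?case unfolding G(2) by (auto simp: mult_ac)
qed

end

subsection \<open>Dependence on the parameters\<close>

context sklyanin_strict
begin

interpretation half: lattice "\<tau> / 2"
  by unfold_locales (use Re_tau Im_tau in auto)

text \<open>
  The conjugation makes the scalar product holomorphic in both parameters.
\<close>

definition Phi :: "complex \<Rightarrow> complex \<Rightarrow> complex" where
  "Phi c' c = form (phi (cnj c')) (phi c)"

lemma phi_cnj: "cnj (phi c z) = phi (cnj c) (cnj z)"
  unfolding br_pair_eq by (simp add: sg_cnj)

text \<open>
  The substitution of \<open>cnj z\<close> for \<open>z\<close> in the integral exchanges the two product functions.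
\<close>

lemma Phi_sym: "Phi c' c = Phi c c'"
proof -
  have mu: "mu (cnj z) z = mu z (cnj z)" for z
    using den_even[of "z - cnj z"] unfolding mu_eq by (simp add: mult_ac add.commute)
  have "Phi c' c = dint (\<lambda>z. cnj (phi (cnj c') (cnj z)) * phi c (cnj z) * mu (cnj z) (cnj (cnj z)))"
    unfolding Phi_def form_eq by (rule dint_cnj_reflect[OF form_torus, symmetric]) (rule br_pair_in_V)+
  also have "\<dots> = Phi c c'"
    unfolding Phi_def form_eq by (simp add: phi_cnj mu mult_ac)
  finally show ?thesis .
qed

lemma t0_t1_power_in_V: assumes "k \<le> m" shows "(\<lambda>z. t0 z ^ k * t1 z ^ (m - k)) \<in> V"
proof (rule V_I)
  show "(\<lambda>z. t0 z ^ k * t1 z ^ (m - k)) holomorphic_on UNIV"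
    by (intro holomorphic_intros half.theta_holomorphic)
  fix z
  have t: "t0 (- z) = t0 z" "t1 (- z) = t1 z" "t0 (z + 1) = t0 z" "t1 (z + 1) = t1 z"
    using fun_cong[OF avec_even[of z], of 1] fun_cong[OF avec_even[of z], of 2]
      fun_cong[OF avec_int[of z 1], of 1] fun_cong[OF avec_int[of z 1], of 2] by (simp_all add: avec_def)
  then show "t0 (z + 1) ^ k * t1 (z + 1) ^ (m - k) = t0 z ^ k * t1 z ^ (m - k)"
    "t0 (- z) ^ k * t1 (- z) ^ (m - k) = t0 z ^ k * t1 z ^ (m - k)" by simp_all
  let ?E = "exp (- (2 * of_real pi * \<i> * (2 * z + \<tau>)))"
  have two: "t0 (x + \<tau>) = exp (- (of_real pi * \<i> * (2 * \<tau> + 4 * x))) * t0 x" for x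
  proof -
    have "t0 (x + \<tau>) = t0 (x + \<tau>/2 + \<tau>/2)" by (simp add: add.assoc)
    also have "\<dots> = exp (- (of_real pi * \<i> * (\<tau>/2 + 2 * (x + \<tau>/2)))) * (exp (- (of_real pi * \<i> * (\<tau>/2 + 2 * x))) * t0 x)"
      by (simp only: half.th_tau)
    also have "\<dots> = exp (- (of_real pi * \<i> * (2 * \<tau> + 4 * x))) * t0 x"
      unfolding mult.assoc[symmetric] exp_add[symmetric]
      by (rule arg_cong[of _ _ "\<lambda>x. exp x * _"]) (simp add: field_simps)
    finally show ?thesis .
  qed
  have "t0 (z + \<tau>) = ?E * t0 z" unfolding two by (rule arg_cong[of _ _ "\<lambda>x. exp x * _"]) (simp add: field_simps)
  moreover have "t1 (z + \<tau>) = ?E * t1 z"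
  proof -
    have "z + \<tau> + 1/2 = z + 1/2 + \<tau>" by simp
    then have "t1 (z + \<tau>) = exp (- (of_real pi * \<i> * (2 * \<tau> + 4 * (z + 1/2)))) * t1 z"
      unfolding t1_eq by (simp only: two)
    also have "exp (- (of_real pi * \<i> * (2 * \<tau> + 4 * (z + 1/2)))) = ?E * exp (2 * of_real pi * \<i> * of_int (- 1))"
      by (simp only: exp_add[symmetric]) (rule arg_cong[of _ _ exp], simp add: field_simps)
    finally show ?thesis by (simp only: exp_2pi_int mult_1_right)
  qed
  ultimately have "t0 (z + \<tau>) ^ k * t1 (z + \<tau>) ^ (m - k) = ?E ^ (k + (m - k)) * (t0 z ^ k * t1 z ^ (m - k))"
    by (simp only: power_mult_distrib power_add mult_ac)
  also have "?E ^ (k + (m - k)) = exp (- 4 * spin m * of_real pi * \<i> * (2 * z + \<tau>))"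
    using assms unfolding exp_of_nat_mult[symmetric] by (intro arg_cong[of _ _ exp]) (simp add: field_simps)
  finally show "t0 (z + \<tau>) ^ k * t1 (z + \<tau>) ^ (m - k) = exp (- 4 * spin m * of_real pi * \<i> * (2 * z + \<tau>)) * (t0 z ^ k * t1 z ^ (m - k))" .
qed

text \<open>
  Each pair of factors is a minor of two vectors \<open>(t0, t1)\<close>, one at \<open>z\<close> and one depending on \<open>c\<close>. The
  expansion separates \<open>c\<close> from the variable of integration, and so the scalar product is entire in \<open>c\<close>.
\<close>

lemma phi_expand:
  obtains A :: "nat set \<Rightarrow> complex \<Rightarrow> complex" where "\<And>X. A X holomorphic_on UNIV"
    "\<And>c z. phi c z = (\<Sum>X\<in>Pow {..<m}. A X c * (t0 z ^ card X * t1 z ^ (m - card X)))"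
proof (rule that)
  let ?p = "\<lambda>c j. t1 (c + 2 * of_nat j * h\<eta>) / 2" and ?q = "\<lambda>c j. - t0 (c + 2 * of_nat j * h\<eta>) / 2"
  show "(\<lambda>c. (\<Prod>j\<in>X. ?p c j) * (\<Prod>j\<in>{..<m}-X. ?q c j)) holomorphic_on UNIV" for X
    by (intro holomorphic_intros half.theta_holomorphic) auto
  fix c z
  have "sg (z + c + w) * sg (- z + c + w) = t1 (c + w) / 2 * t0 z + - t0 (c + w) / 2 * t1 z" for w
    using plucker[of "c + w" z] by (simp add: algebra_simps)
  then have "phi c z = (\<Prod>j<m. ?p c j * t0 z + ?q c j * t1 z)" by (simp only: br_pair_eq)
  also have "\<dots> = (\<Sum>X\<in>Pow {..<m}. (\<Prod>j\<in>X. ?p c j * t0 z) * (\<Prod>j\<in>{..<m}-X. ?q c j * t1 z))"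
    by (rule prod_add) simp
  also have "\<dots> = (\<Sum>X\<in>Pow {..<m}. ((\<Prod>j\<in>X. ?p c j) * (\<Prod>j\<in>{..<m}-X. ?q c j)) * (t0 z ^ card X * t1 z ^ (m - card X)))"
  proof (rule sum.cong)
    fix X assume "X \<in> Pow {..<m}"
    then have "card ({..<m} - X) = m - card X" by (simp add: card_Diff_subset finite_subset)
    then show "(\<Prod>j\<in>X. ?p c j * t0 z) * (\<Prod>j\<in>{..<m}-X. ?q c j * t1 z) = ((\<Prod>j\<in>X. ?p c j) * (\<Prod>j\<in>{..<m}-X. ?q c j)) * (t0 z ^ card X * t1 z ^ (m - card X))"
      by (simp only: prod.distrib prod_constant mult_ac)
  qed simp
  finally show "phi c z = (\<Sum>X\<in>Pow {..<m}. ((\<Prod>j\<in>X. ?p c j) * (\<Prod>j\<in>{..<m}-X. ?q c j)) * (t0 z ^ card X * t1 z ^ (m - card X)))" .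
qed

lemma Phi_holomorphic: "Phi c' holomorphic_on UNIV"
proof -
  obtain A :: "nat set \<Rightarrow> complex \<Rightarrow> complex" where hA: "\<And>X. A X holomorphic_on UNIV"
    and A: "\<And>c z. phi c z = (\<Sum>X\<in>Pow {..<m}. A X c * (t0 z ^ card X * t1 z ^ (m - card X)))" by (rule phi_expand) blast
  let ?B = "\<lambda>X z. t0 z ^ card X * t1 z ^ (m - card X)" and ?f = "phi (cnj c')"
  have card: "card X \<le> m" if "X \<in> Pow {..<m}" for X
    using that card_mono[of "{..<m}" X] by auto
  have "Phi c' c = (\<Sum>X\<in>Pow {..<m}. A X c * form ?f (?B X))" for c
  proof -
    have "cnj (?f z) * phi c z * mu z (cnj z) = (\<Sum>X\<in>Pow {..<m}. A X c * (cnj (?f z) * ?B X z * mu z (cnj z)))" for z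
      unfolding A[of c] sum_distrib_left sum_distrib_right by (intro sum.cong refl) (simp only: mult_ac)
    then have "Phi c' c = dint (\<lambda>z. \<Sum>X\<in>Pow {..<m}. A X c * (cnj (?f z) * ?B X z * mu z (cnj z)))"
      unfolding Phi_def form_eq by (simp only:)
    also have "\<dots> = (\<Sum>X\<in>Pow {..<m}. A X c * dint (\<lambda>z. cnj (?f z) * ?B X z * mu z (cnj z)))"
      by (rule dint_sum) (intro form_integrand_continuous br_pair_in_V t0_t1_power_in_V card)
    finally show ?thesis by (simp only: form_eq)
  qed
  then have "Phi c' = (\<lambda>c. \<Sum>X\<in>Pow {..<m}. A X c * form ?f (?B X))" by (rule ext)
  then show ?thesis by (simp only:) (intro holomorphic_intros hA)
qed

abbreviation "\<delta>\<eta> \<equiv> of_nat (m - 1) * h\<eta>"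

lemma prod_reverse: "(\<Prod>j<m. f (2 * of_nat j * h\<eta> - \<delta>\<eta>)) = (\<Prod>j<m. f (- (2 * of_nat j * h\<eta> - \<delta>\<eta>)))"
proof (rule prod.reindex_bij_witness[of _ "\<lambda>j. m - 1 - j" "\<lambda>j. m - 1 - j"])
  fix j assume "j \<in> {..<m}"
  then have j: "j \<le> m - 1" by auto
  have "- (2 * of_nat (m - 1 - j) * h\<eta> - \<delta>\<eta>) = 2 * of_nat j * h\<eta> - \<delta>\<eta>"
    unfolding of_nat_diff[OF j] by (simp add: algebra_simps)
  then show "f (- (2 * of_nat (m - 1 - j) * h\<eta> - \<delta>\<eta>)) = f (2 * of_nat j * h\<eta> - \<delta>\<eta>)"
    by (simp only:)
  show "m - 1 - (m - 1 - j) = j" "m - 1 - j \<in> {..<m}" using j m_pos by auto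
  then show "m - 1 - (m - 1 - j) = j" "m - 1 - j \<in> {..<m}" by auto
qed

text \<open>
  Up to a sign the variable and the centred parameter enter symmetrically. Hence scalar products are
  theta functions of the parameter.
\<close>

lemma phi_swap: "phi (C - \<delta>\<eta>) z = (- 1) ^ m * phi (z - \<delta>\<eta>) C"
proof -
  let ?a = "\<lambda>j. 2 * of_nat j * h\<eta> - \<delta>\<eta>"
  have "phi (C - \<delta>\<eta>) z = (\<Prod>j<m. sg (z + C + ?a j)) * (\<Prod>j<m. sg (C - z + ?a j))"
    unfolding br_pair_eq prod.distrib by (intro arg_cong2[of _ _ _ _ "(*)"] prod.cong) (simp_all add: algebra_simps)
  also have "(\<Prod>j<m. sg (C - z + ?a j)) = (\<Prod>j<m. sg (C - z + - ?a j))" by (rule prod_reverse)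
  also have "\<dots> = (\<Prod>j<m. - 1 * sg (z - C + ?a j))"
  proof (rule prod.cong)
    fix j
    show "sg (C - z + - ?a j) = - 1 * sg (z - C + ?a j)" using sg_odd[of "z - C + ?a j"] by (simp add: algebra_simps)
  qed simp
  also have "\<dots> = (- 1) ^ m * (\<Prod>j<m. sg (z - C + ?a j))" by (simp only: prod.distrib prod_constant card_lessThan)
  also have "(\<Prod>j<m. sg (z + C + ?a j)) * ((- 1) ^ m * (\<Prod>j<m. sg (z - C + ?a j))) = (- 1) ^ m * ((\<Prod>j<m. sg (z + C + ?a j)) * (\<Prod>j<m. sg (z - C + ?a j)))"
    by (simp only: mult_ac)
  also have "(\<Prod>j<m. sg (z + C + ?a j)) * (\<Prod>j<m. sg (z - C + ?a j)) = phi (z - \<delta>\<eta>) C"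
    unfolding br_pair_eq prod.distrib by (intro arg_cong2[of _ _ _ _ "(*)"] prod.cong) (simp_all add: algebra_simps)
  finally show ?thesis .
qed

lemma Phi_in_V: "(\<lambda>C. Phi c' (C - \<delta>\<eta>)) \<in> V"
proof (rule V_I)
  show "(\<lambda>C. Phi c' (C - \<delta>\<eta>)) holomorphic_on UNIV"
    using holomorphic_on_compose_gen[OF _ Phi_holomorphic[of c'], of "\<lambda>C. C - \<delta>\<eta>" UNIV] by (simp add: o_def holomorphic_intros)
  fix C
  have V: "phi c \<in> V" for c by (rule br_pair_in_V)
  have "phi (- C - \<delta>\<eta>) = phi (C - \<delta>\<eta>)" "phi (C + 1 - \<delta>\<eta>) = phi (C - \<delta>\<eta>)"
    by (rule ext, simp only: phi_swap[of "- C"] phi_swap[of "C + 1"] phi_swap[of C] V_D(2,3)[OF V])+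
  then show "Phi c' (- C - \<delta>\<eta>) = Phi c' (C - \<delta>\<eta>)" "Phi c' (C + 1 - \<delta>\<eta>) = Phi c' (C - \<delta>\<eta>)"
    unfolding Phi_def by simp_all
  let ?e = "exp (- 4 * spin m * of_real pi * \<i> * (2 * C + \<tau>))"
  have "phi (C + \<tau> - \<delta>\<eta>) = (\<lambda>z. ?e * phi (C - \<delta>\<eta>) z + 0 * phi 0 z)"
    by (rule ext, simp only: phi_swap[of "C + \<tau>"] phi_swap[of C] V_D(4)[OF V]) simp
  then show "Phi c' (C + \<tau> - \<delta>\<eta>) = ?e * Phi c' (C - \<delta>\<eta>)"
    unfolding Phi_def by (simp only: form_lin(2)[OF V V V]) simp
qed

end

subsection \<open>The difference equation and its consequences\<close>

locale sklyanin_strict_nonzero = sklyanin_strict + sklyanin_nonzero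
begin

interpretation half: lattice "\<tau> / 2"
  by unfold_locales (use Re_tau Im_tau in auto)

lemma avec_shift: "avec (x + (1 + \<tau>) / 2) \<beta> = - exp (- (of_real pi * \<i> * (\<tau> / 2 + 2 * x))) * bvec x \<beta>"
proof -
  let ?e = "\<lambda>x. exp (- (of_real pi * \<i> * (\<tau> / 2 + 2 * x)))"
  have e: "?e (x + 1/2) = - ?e x"
  proof -
    have "?e (x + 1/2) = ?e x * exp (- (of_real pi * \<i>))"
      by (simp only: exp_add[symmetric]) (rule arg_cong[of _ _ exp], simp add: field_simps)
    also have "exp (- (of_real pi * \<i>)) = - 1" by (simp only: exp_minus exp_pi_i) simp
    finally show ?thesis by simp
  qed
  have "t0 (x + (1 + \<tau>) / 2) = t0 (x + 1/2 + \<tau> / 2)" by (simp add: add_divide_distrib add.assoc)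
  then have 0: "t0 (x + (1 + \<tau>) / 2) = - ?e x * t1 x" by (simp only: half.th_tau e t1_eq)
  have "x + (1 + \<tau>) / 2 + 1/2 = x + \<tau> / 2 + 1" by (simp add: add_divide_distrib)
  then have "t1 (x + (1 + \<tau>) / 2) = t0 (x + \<tau> / 2)" by (simp only: t1_eq half.th_1)
  then have 1: "t1 (x + (1 + \<tau>) / 2) = ?e x * t0 x" by (simp only: half.th_tau)
  show ?thesis unfolding avec_def bvec_def 0 1 by simp
qed

lemma cnj_bvec: "cnj (bvec x \<beta>) = bvec (cnj x) \<beta>"
  by (simp add: bvec_def half.th_cnj t1_eq)

lemma form_sum_2:
  assumes "f 1 \<in> V" "f 2 \<in> V" "h \<in> V"
  shows "form (\<lambda>z. \<Sum>\<beta>\<in>(UNIV :: 2 set). f \<beta> z * c \<beta>) h = (\<Sum>\<beta>\<in>UNIV. cnj (c \<beta>) * form (f \<beta>) h)"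
    "form h (\<lambda>z. \<Sum>\<beta>\<in>(UNIV :: 2 set). f \<beta> z * c \<beta>) = (\<Sum>\<beta>\<in>UNIV. c \<beta> * form h (f \<beta>))"
  unfolding sum_2 using form_lin[OF assms, of "c 1" "c 2"] by (simp_all only: mult.commute)

text \<open>
  \<open>L(u)\<close> acts on the right argument with the column \<open>a(g)\<close>; its adjoint \<open>L(-cnj u)\<close> acts on the left
  argument with a column that is proportional to \<open>b(g)\<close> up to conjugation. Both actions shift a
  parameter by \<open>\<eta>\<close>, and comparing them yields a difference equation.
\<close>

lemma Phi_difference:
  assumes u: "u = c - c' + (1 - \<tau>) / 2"
  shows "sg (u + of_nat m * h\<eta>) * Phi c' (c - h\<eta>) = exp (2 * of_real pi * \<i> * of_nat m * h\<eta>) * (sg (u - of_nat m * h\<eta>) * Phi (c' - h\<eta>) c)"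
proof -
  define g where "g = c - u / 2 + spin m * h\<eta> - h\<eta>"
  define g' where "g' = cnj g + (1 + \<tau>) / 2"
  let ?f = "phi (cnj c')" and ?h = "phi c" and ?m = "of_nat m * h\<eta>"
  let ?e = "\<lambda>x. exp (of_real pi * \<i> * (2 * x - \<tau> / 2))"
  have V: "phi x \<in> V" for x by (rule br_pair_in_V)
  have lV: "lop u \<alpha> \<beta> (phi x) \<in> V" for u \<alpha> \<beta> x using lop_linear V by (auto simp: linear_operator_on_def)
  have c: "c = g + u / 2 - spin m * h\<eta> + h\<eta>" by (simp add: g_def)
  have c': "cnj c' = g' + (- cnj u) / 2 - spin m * h\<eta> + h\<eta>"
    unfolding g'_def g_def u by (simp add: cnj_tau field_simps)
  have cnj_e: "cnj (exp (- (of_real pi * \<i> * (\<tau> / 2 + 2 * cnj x)))) = ?e x" for x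
    by (simp add: exp_cnj cnj_tau)
  have left: "(\<Sum>\<beta>\<in>UNIV. avec g \<beta> * form ?f (lop u \<alpha> \<beta> ?h)) = 2 * sg (u + ?m) * avec (g + ?m) \<alpha> * Phi c' (c - h\<eta>)" for \<alpha>
  proof -
    have "(\<Sum>\<beta>\<in>UNIV. avec g \<beta> * form ?f (lop u \<alpha> \<beta> ?h)) = form ?f (\<lambda>z. \<Sum>\<beta>\<in>UNIV. lop u \<alpha> \<beta> ?h z * avec g \<beta>)"
      by (rule form_sum_2(2)[symmetric]) (rule lV V)+
    also have "(\<lambda>z. \<Sum>\<beta>\<in>UNIV. lop u \<alpha> \<beta> ?h z * avec g \<beta>) = (\<lambda>z. (2 * sg (u + ?m) * avec (g + ?m) \<alpha>) * phi (c - h\<eta>) z + 0 * phi 0 z)"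
      unfolding lop_column[OF c] by (simp add: mult_ac)
    finally show ?thesis unfolding form_lin(2)[OF V V V] Phi_def by simp
  qed
  have right: "(\<Sum>\<gamma>\<in>UNIV. cnj (avec g' \<gamma>) * form (lop (- cnj u) \<delta> \<gamma> ?f) ?h) = cnj (2 * sg (- cnj u + ?m) * avec (g' + ?m) \<delta>) * Phi (c' - h\<eta>) c" for \<delta>
  proof -
    have "(\<Sum>\<gamma>\<in>UNIV. cnj (avec g' \<gamma>) * form (lop (- cnj u) \<delta> \<gamma> ?f) ?h) = form (\<lambda>z. \<Sum>\<gamma>\<in>UNIV. lop (- cnj u) \<delta> \<gamma> ?f z * avec g' \<gamma>) ?h"
      by (rule form_sum_2(1)[symmetric]) (rule lV V)+
    also have "(\<lambda>z. \<Sum>\<gamma>\<in>UNIV. lop (- cnj u) \<delta> \<gamma> ?f z * avec g' \<gamma>) = (\<lambda>z. (2 * sg (- cnj u + ?m) * avec (g' + ?m) \<delta>) * phi (cnj c' - h\<eta>) z + 0 * phi 0 z)"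
      unfolding lop_column[OF c'] by (simp add: mult_ac)
    finally show ?thesis unfolding form_lin(1)[OF V V V] Phi_def by simp
  qed
  have swap: "sgn2 (flip2 \<alpha>) = - sgn2 \<alpha>" "sgn2 \<alpha> * bvec x (flip2 \<alpha>) = avec x \<alpha>" for \<alpha> x
    using exhaust_2[of \<alpha>] by (auto simp: sgn2_def flip2_def avec_def bvec_def)
  have key: "2 * sg (u + ?m) * avec (g + ?m) \<alpha> * Phi c' (c - h\<eta>) * ?e g = 2 * sg (u - ?m) * avec (g + ?m) \<alpha> * Phi (c' - h\<eta>) c * ?e (g + ?m)" for \<alpha>
  proof -
    have cg: "cnj (avec g' \<gamma>) = - ?e g * bvec g \<gamma>" for \<gamma>
      unfolding g'_def avec_shift using cnj_e[of g] by (simp add: cnj_bvec)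
    have cgm: "cnj (avec (g' + ?m) \<gamma>) = - ?e (g + ?m) * bvec (g + ?m) \<gamma>" for \<gamma>
    proof -
      have "g' + ?m = cnj (g + ?m) + (1 + \<tau>) / 2" by (simp add: g'_def)
      then show ?thesis unfolding avec_shift[symmetric] using avec_shift[of "cnj (g + ?m)" \<gamma>] cnj_e[of "g + ?m"]
        by (simp only: complex_cnj_mult complex_cnj_minus cnj_bvec complex_cnj_cnj)
    qed
    have "cnj (avec g' \<gamma>) * form (lop (- cnj u) (flip2 \<alpha>) \<gamma> ?f) ?h = ?e g * sgn2 \<alpha> * (avec g (flip2 \<gamma>) * form ?f (lop u \<alpha> (flip2 \<gamma>) ?h))" for \<gamma>
    proof -
      have "sgn2 \<gamma> * bvec g \<gamma> = - avec g (flip2 \<gamma>)"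
        using swap(2)[of "flip2 \<gamma>" g] swap(1)[of \<gamma>] by (simp add: flip2_flip2 minus_equation_iff)
      then have b: "bvec g \<gamma> = - sgn2 \<gamma> * avec g (flip2 \<gamma>)" using sgn2_sgn2[of \<gamma>] by algebra
      have "form (lop (- cnj u) (flip2 \<alpha>) \<gamma> ?f) ?h = sgn2 \<alpha> * sgn2 \<gamma> * form ?f (lop u \<alpha> (flip2 \<gamma>) ?h)"
        using form_lop[OF V V, of "- cnj u" "flip2 \<alpha>" \<gamma> "cnj c'" c] by (simp add: flip2_flip2 swap(1))
      then show ?thesis unfolding cg b using sgn2_sgn2[of \<gamma>] by algebra
    qed
    then have "(\<Sum>\<gamma>\<in>UNIV. cnj (avec g' \<gamma>) * form (lop (- cnj u) (flip2 \<alpha>) \<gamma> ?f) ?h) = ?e g * sgn2 \<alpha> * (\<Sum>\<gamma>\<in>UNIV. avec g (flip2 \<gamma>) * form ?f (lop u \<alpha> (flip2 \<gamma>) ?h))"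
      by (simp only: sum_distrib_left)
    also have "(\<Sum>\<gamma>\<in>UNIV. avec g (flip2 \<gamma>) * form ?f (lop u \<alpha> (flip2 \<gamma>) ?h)) = (\<Sum>\<gamma>\<in>UNIV. avec g \<gamma> * form ?f (lop u \<alpha> \<gamma> ?h))"
      by (simp add: sum_2 flip2_def add.commute)
    finally have "?e g * sgn2 \<alpha> * (2 * sg (u + ?m) * avec (g + ?m) \<alpha> * Phi c' (c - h\<eta>)) = cnj (2 * sg (- cnj u + ?m) * avec (g' + ?m) (flip2 \<alpha>)) * Phi (c' - h\<eta>) c"
      unfolding left right by simp
    also have "cnj (2 * sg (- cnj u + ?m) * avec (g' + ?m) (flip2 \<alpha>)) = 2 * sg (u - ?m) * (?e (g + ?m) * bvec (g + ?m) (flip2 \<alpha>))"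
      using sg_odd[of "u - ?m"] by (simp add: cgm sg_cnj)
    finally show ?thesis using swap(2)[of \<alpha> "g + ?m"] sgn2_sgn2[of \<alpha>] by algebra
  qed
  obtain \<alpha> where \<alpha>: "avec (g + ?m) \<alpha> \<noteq> 0" using avec_nonzero by metis
  have e: "?e (g + ?m) = ?e g * exp (2 * of_real pi * \<i> * of_nat m * h\<eta>)"
    by (simp only: exp_add[symmetric]) (rule arg_cong[of _ _ exp], simp add: field_simps)
  have "(2 * ?e g * avec (g + ?m) \<alpha>) * (sg (u + ?m) * Phi c' (c - h\<eta>)) = (2 * ?e g * avec (g + ?m) \<alpha>) * (exp (2 * of_real pi * \<i> * of_nat m * h\<eta>) * (sg (u - ?m) * Phi (c' - h\<eta>) c))"
    using key[of \<alpha>] unfolding e by (simp only: mult_ac)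
  then show ?thesis using \<alpha> by (simp only: mult_cancel_left mult_eq_0_iff exp_not_eq_zero) simp
qed

lemma sg_multiple_eta_nonzero:
  assumes "0 < k" "k \<le> 2 * m" shows "sg (of_nat k * h\<eta>) \<noteq> 0"
proof -
  have "\<bar>real k * \<eta>\<bar> \<le> real (2 * m) * \<bar>\<eta>\<bar>" using assms by (simp add: abs_mult mult_right_mono)
  also have "\<dots> < 1" using eta_less by (simp add: field_simps)
  finally have "sg (of_real (real k * \<eta>)) \<noteq> 0" using assms eta_nz by (intro sg_real_nonzero) auto
  then show ?thesis by simp
qed

text \<open>
  At \<open>u = 2l\<eta>\<close> one side of the difference equation has the factor \<open>[0]\<close>, which produces the first zero.
  The equation carries it to the next one, as long as the coefficients do not vanish.
\<close>

lemma Phi_zero: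
  assumes "j < m" "c - c' = - ((1 - \<tau>) / 2) + (of_nat m - 1 - 2 * of_nat j) * h\<eta>"
  shows "Phi c' c = 0"
  using assms
proof (induction j arbitrary: c c')
  case 0
  have u: "of_nat m * h\<eta> = (c + h\<eta>) - c' + (1 - \<tau>) / 2" using 0 by (simp add: algebra_simps)
  have "sg (of_nat (2 * m) * h\<eta>) * Phi c' c = 0"
    using Phi_difference[OF u] by (simp add: sg_0 mult.assoc)
  moreover have "sg (of_nat (2 * m) * h\<eta>) \<noteq> 0" by (rule sg_multiple_eta_nonzero) (use 0 in auto)
  ultimately show ?case by simp
next
  case (Suc j)
  have "Phi (c' - h\<eta>) (c + h\<eta>) = 0"
    by (rule Suc.IH) (use Suc.prems in \<open>auto simp: algebra_simps\<close>)
  moreover have u: "(of_nat m - 2 * of_nat (Suc j)) * h\<eta> = (c + h\<eta>) - c' + (1 - \<tau>) / 2"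
    using Suc.prems(2) by (simp add: algebra_simps)
  ultimately have "sg ((of_nat m - 2 * of_nat (Suc j)) * h\<eta> + of_nat m * h\<eta>) * Phi c' c = 0"
    using Phi_difference[OF u] by simp
  moreover have "(of_nat m - 2 * of_nat (Suc j)) * h\<eta> + of_nat m * h\<eta> = of_nat (2 * (m - Suc j)) * h\<eta>"
    using Suc.prems(1) by (simp add: of_nat_diff algebra_simps)
  ultimately show ?case using sg_multiple_eta_nonzero[of "2 * (m - Suc j)"] Suc.prems(1) by simp
qed

definition string_kernel :: "complex \<Rightarrow> complex \<Rightarrow> complex" where
  "string_kernel x y = string (m - 1) (x + y) * string (m - 1) (x - y)"

lemma string_kernel_sym: "string_kernel x y = string_kernel y x"
  using string_even[of "m - 1" "x - y"] by (simp add: string_kernel_def add.commute)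

lemma string_kernel_holomorphic: "string_kernel x holomorphic_on UNIV" "(\<lambda>x. string_kernel x y) holomorphic_on UNIV"
  unfolding string_kernel_def[abs_def] by (intro holomorphic_intros)+

definition kernel_zero :: "complex \<Rightarrow> nat \<Rightarrow> complex" where
  "kernel_zero x j = x - (1 - \<tau>) / 2 - (2 * of_nat j * h\<eta> - \<delta>\<eta>)"

text \<open>
  The zeros of the scalar product that \<open>Phi_zero\<close> provides are those of the kernel.
\<close>

lemma string_kernel_zeros: "\<exists>E. \<forall>y. (\<Prod>j<m. sg (kernel_zero x j + y) * sg (kernel_zero x j - y)) = E * string_kernel x y"
proof -
  let ?a = "\<lambda>j. 2 * of_nat j * h\<eta> - \<delta>\<eta>"
  let ?E = "\<lambda>j. exp (- (of_real pi * \<i> * (\<tau> / 2 + 2 * x - 2 * ?a j)))"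
  have sg: "sg (v - (1 - \<tau>) / 2) = exp (- (of_real pi * \<i> * (\<tau> / 4 + v))) * th v" for v
  proof -
    have "v - (1 - \<tau>) / 2 + (1 + \<tau>) / 2 = v + \<tau>" by (simp add: field_simps)
    then have "sg (v - (1 - \<tau>) / 2) = exp (of_real pi * \<i> * (\<tau> / 4 + (v - (1 - \<tau>) / 2) + 1/2)) * exp (- (of_real pi * \<i> * (\<tau> + 2 * v))) * th v"
      by (simp only: sg_eq_th th_tau mult.assoc)
    also have "exp (of_real pi * \<i> * (\<tau> / 4 + (v - (1 - \<tau>) / 2) + 1/2)) * exp (- (of_real pi * \<i> * (\<tau> + 2 * v))) = exp (- (of_real pi * \<i> * (\<tau> / 4 + v)))"
      by (simp only: exp_add[symmetric]) (rule arg_cong[of _ _ exp], simp add: field_simps)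
    finally show ?thesis .
  qed
  have str: "(\<Prod>j<m. th (v - ?a j)) = string (m - 1) v" for v
  proof -
    have "string (m - 1) v = (\<Prod>j<m. th (v + ?a j))"
      unfolding string_def using m_pos by (intro prod.cong) (auto simp: algebra_simps)
    also have "\<dots> = (\<Prod>j<m. th (v + - ?a j))" by (rule prod_reverse)
    finally show ?thesis by (simp only: diff_conv_add_uminus)
  qed
  have "sg (kernel_zero x j + y) * sg (kernel_zero x j - y) = ?E j * (th (x + y - ?a j) * th (x - y - ?a j))" for y j
  proof -
    have "kernel_zero x j + y = (x + y - ?a j) - (1 - \<tau>) / 2" "kernel_zero x j - y = (x - y - ?a j) - (1 - \<tau>) / 2"
      by (simp_all add: kernel_zero_def)
    then have "sg (kernel_zero x j + y) * sg (kernel_zero x j - y) = exp (- (of_real pi * \<i> * (\<tau> / 4 + (x + y - ?a j)))) * exp (- (of_real pi * \<i> * (\<tau> / 4 + (x - y - ?a j)))) * (th (x + y - ?a j) * th (x - y - ?a j))"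
      by (simp only: sg mult_ac)
    also have "exp (- (of_real pi * \<i> * (\<tau> / 4 + (x + y - ?a j)))) * exp (- (of_real pi * \<i> * (\<tau> / 4 + (x - y - ?a j)))) = ?E j"
      by (simp only: exp_add[symmetric]) (rule arg_cong[of _ _ exp], simp add: field_simps)
    finally show ?thesis .
  qed
  then show ?thesis
    by (intro exI[of _ "\<Prod>j<m. ?E j"] allI) (simp only: prod.distrib str string_kernel_def)
qed

text \<open>
  For these \<open>x\<close> the kernel has simple zeros in \<open>y\<close>.
\<close>

definition generic :: "complex \<Rightarrow> bool" where
  "generic x \<longleftrightarrow> (\<forall>i<m. \<forall>j<m. sg (kernel_zero x i + kernel_zero x j) \<noteq> 0)"

lemma Phi_generic:
  assumes "generic x"
  shows "\<exists>\<gamma>. \<forall>y. Phi (x - \<delta>\<eta>) (y - \<delta>\<eta>) = \<gamma> * string_kernel x y"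
proof -
  have "\<exists>\<gamma>. \<forall>y. Phi (x - \<delta>\<eta>) (y - \<delta>\<eta>) = \<gamma> * (\<Prod>j<m. sg (kernel_zero x j + y) * sg (kernel_zero x j - y))"
  proof (rule theta_determined_by_zeros[OF Phi_in_V])
    show "Phi (x - \<delta>\<eta>) (kernel_zero x j - \<delta>\<eta>) = 0" if "j < m" for j
      by (rule Phi_zero[OF that]) (use m_pos in \<open>simp add: kernel_zero_def of_nat_diff algebra_simps\<close>)
    show "sg (kernel_zero x i + kernel_zero x j) \<noteq> 0" if "i < m" "j < m" for i j using assms that by (simp add: generic_def)
    show "sg (kernel_zero x j - kernel_zero x i) \<noteq> 0" if "i < j" "j < m" for i j
    proof -
      have "kernel_zero x j - kernel_zero x i = - (of_nat (2 * (j - i)) * h\<eta>)"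
        using that by (simp add: kernel_zero_def of_nat_diff algebra_simps)
      then show ?thesis using sg_multiple_eta_nonzero[of "2 * (j - i)"] that by (simp only: sg_odd) simp
    qed
  qed
  then obtain \<gamma> where \<gamma>: "\<And>y. Phi (x - \<delta>\<eta>) (y - \<delta>\<eta>) = \<gamma> * (\<Prod>j<m. sg (kernel_zero x j + y) * sg (kernel_zero x j - y))" by blast
  obtain E where E: "\<And>y. (\<Prod>j<m. sg (kernel_zero x j + y) * sg (kernel_zero x j - y)) = E * string_kernel x y" using string_kernel_zeros[of x] by blast
  show ?thesis unfolding \<gamma> E by (intro exI[of _ "\<gamma> * E"]) simp
qed

lemma eventually_generic: "eventually generic (at z)"
proof -
  have "eventually (\<lambda>x. \<forall>i\<in>{..<m}. \<forall>j\<in>{..<m}. sg (kernel_zero x i + kernel_zero x j) \<noteq> 0) (at z)"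
  proof (intro eventually_ball_finite finite_lessThan ballI)
    fix i j
    define w where "w = kernel_zero 0 i + kernel_zero 0 j"
    have z: "kernel_zero x i + kernel_zero x j = 2 * x + w" for x by (simp add: kernel_zero_def w_def)
    have "2 * ((- ((1 + \<tau>)/2) - w) / 2) + w = - ((1 + \<tau>)/2)" by (simp add: field_simps)
    then have "sg (2 * ((- ((1 + \<tau>)/2) - w) / 2) + w) \<noteq> 0" using sg_not_zero by (simp only: not_False_eq_True)
    then show "eventually (\<lambda>x. sg (kernel_zero x i + kernel_zero x j) \<noteq> 0) (at z)"
      unfolding z by (rule entire_eventually_nonzero[rotated]) (intro holomorphic_intros)
  qed
  then show ?thesis by eventually_elim (auto simp: generic_def)
qed

lemma string_kernel_nonzero_point: "\<exists>x. string_kernel x y \<noteq> 0"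
proof -
  have nz: "string (m - 1) 0 \<noteq> 0" using string_real_nonzero[of "m - 1" 0] by simp
  have "eventually (\<lambda>x. string (m - 1) (x + y) \<noteq> 0) (at 0)"
    by (rule entire_eventually_nonzero[where p = "- y"]) (auto intro!: holomorphic_intros simp: nz)
  moreover have "eventually (\<lambda>x. string (m - 1) (x - y) \<noteq> 0) (at 0)"
    by (rule entire_eventually_nonzero[where p = y]) (auto intro!: holomorphic_intros simp: nz)
  ultimately have "eventually (\<lambda>x. string_kernel x y \<noteq> 0) (at 0)" unfolding string_kernel_def by eventually_elim simp
  then show ?thesis using eventually_happens[of _ "at (0::complex)"] by auto
qed

text \<open>
  For generic \<open>x\<close> the zeros determine the scalar product up to a factor \<open>\<gamma>(x)\<close>. Symmetry in \<open>x\<close> and \<open>y\<close>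
  makes this factor constant, and the exceptional values of \<open>x\<close> are reached by analytic continuation.
\<close>

theorem Phi_formula: "\<exists>\<gamma>. \<forall>x y. Phi (x - \<delta>\<eta>) (y - \<delta>\<eta>) = \<gamma> * string_kernel x y"
proof -
  obtain y0 where y0: "generic y0" using eventually_happens[OF eventually_generic[of 0]] by auto
  obtain \<gamma> where \<gamma>: "\<And>y. Phi (y0 - \<delta>\<eta>) (y - \<delta>\<eta>) = \<gamma> * string_kernel y0 y" using Phi_generic[OF y0] by blast
  have gen: "Phi (x - \<delta>\<eta>) (y - \<delta>\<eta>) = \<gamma> * string_kernel x y" if x: "generic x" "string_kernel x y0 \<noteq> 0" for x y
  proof -
    obtain \<gamma>' where \<gamma>': "\<And>y. Phi (x - \<delta>\<eta>) (y - \<delta>\<eta>) = \<gamma>' * string_kernel x y" using Phi_generic[OF x(1)] by blast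
    have "\<gamma>' * string_kernel x y0 = \<gamma> * string_kernel x y0"
      using \<gamma>'[of y0] \<gamma>[of x] Phi_sym[of "x - \<delta>\<eta>" "y0 - \<delta>\<eta>"] string_kernel_sym[of x y0] by metis
    then show ?thesis using x(2) \<gamma>'[of y] by simp
  qed
  have "Phi (x - \<delta>\<eta>) (y - \<delta>\<eta>) = \<gamma> * string_kernel x y" for x y
  proof -
    let ?d = "\<lambda>x. (\<Prod>i<m. \<Prod>j<m. sg (kernel_zero x i + kernel_zero x j)) * string_kernel x y0"
    have d: "?d x \<noteq> 0 \<longleftrightarrow> generic x \<and> string_kernel x y0 \<noteq> 0" for x by (auto simp: generic_def prod_zero_iff)
    obtain p where p: "string_kernel p y0 \<noteq> 0" using string_kernel_nonzero_point by blast
    have "eventually (\<lambda>x. string_kernel x y0 \<noteq> 0) (at 0)"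
      by (rule entire_eventually_nonzero[OF string_kernel_holomorphic(2) p])
    with eventually_generic have "eventually (\<lambda>x. generic x \<and> string_kernel x y0 \<noteq> 0) (at 0)" by (rule eventually_conj)
    from eventually_happens[OF this] obtain q where "generic q \<and> string_kernel q y0 \<noteq> 0" by auto
    then have q: "?d q \<noteq> 0" using d by blast
    have "(\<lambda>x. Phi (y - \<delta>\<eta>) (x - \<delta>\<eta>)) = (\<lambda>x. \<gamma> * string_kernel x y)"
    proof (rule entire_cancel[where d = ?d, OF _ _ _ q])
      show "(\<lambda>x. Phi (y - \<delta>\<eta>) (x - \<delta>\<eta>)) holomorphic_on UNIV" by (rule V_D(1)[OF Phi_in_V])
      show "(\<lambda>x. \<gamma> * string_kernel x y) holomorphic_on UNIV" by (intro holomorphic_intros string_kernel_holomorphic)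
      show "?d holomorphic_on UNIV" unfolding kernel_zero_def by (intro holomorphic_intros string_kernel_holomorphic)
      show "Phi (y - \<delta>\<eta>) (x - \<delta>\<eta>) * ?d x = \<gamma> * string_kernel x y * ?d x" for x
      proof (cases "?d x = 0")
        case False
        then show ?thesis using gen[of x y] Phi_sym[of "y - \<delta>\<eta>" "x - \<delta>\<eta>"] unfolding d by simp
      qed (simp only: mult_zero_right)
    qed
    then show ?thesis using Phi_sym[of "x - \<delta>\<eta>" "y - \<delta>\<eta>"] by (metis)
  qed
  then show ?thesis by blast
qed

end

section \<open>Exchanging the spectral parameters\<close>

context sklyanin_strict
begin

lemma tform_pure_sums:
  assumes N: "N > 0" and \<phi>: "\<And>j n. j \<in> J \<Longrightarrow> n \<in> {1..N} \<Longrightarrow> \<phi> j n \<in> V" and \<psi>: "\<And>k n. k \<in> K \<Longrightarrow> n \<in> {1..N} \<Longrightarrow> \<psi> k n \<in> V"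
  shows "tform N (\<lambda>z. \<Sum>j\<in>J. a j * pure_tensor N (\<phi> j) z) (\<lambda>z. \<Sum>k\<in>K. b k * pure_tensor N (\<psi> k) z) =
    (\<Sum>j\<in>J. cnj (a j) * (\<Sum>k\<in>K. b k * (\<Prod>n=1..N. form (\<phi> j n) (\<psi> k n))))"
proof -
  have p: "pure_tensor N (\<phi> j) \<in> H N" if "j \<in> J" for j by (intro tensor_power_pure \<phi> that)
  have q: "pure_tensor N (\<psi> k) \<in> H N" if "k \<in> K" for k by (intro tensor_power_pure \<psi> that)
  have "(\<lambda>z. \<Sum>k\<in>K. b k * pure_tensor N (\<psi> k) z) \<in> H N" by (intro tensor_power_sum N q)
  then have "tform N (\<lambda>z. \<Sum>j\<in>J. a j * pure_tensor N (\<phi> j) z) (\<lambda>z. \<Sum>k\<in>K. b k * pure_tensor N (\<psi> k) z) =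
    (\<Sum>j\<in>J. cnj (a j) * tform N (pure_tensor N (\<phi> j)) (\<lambda>z. \<Sum>k\<in>K. b k * pure_tensor N (\<psi> k) z))"
    by (intro tform_sum N p)
  also have "\<dots> = (\<Sum>j\<in>J. cnj (a j) * (\<Sum>k\<in>K. b k * tform N (pure_tensor N (\<phi> j)) (pure_tensor N (\<psi> k))))"
    by (intro sum.cong refl arg_cong2[of _ _ _ _ "(*)"] tform_sum N p q)
  also have "\<dots> = (\<Sum>j\<in>J. cnj (a j) * (\<Sum>k\<in>K. b k * (\<Prod>n=1..N. form (\<phi> j n) (\<psi> k n))))"
    by (intro sum.cong refl arg_cong2[of _ _ _ _ "(*)"] tform_pure \<phi> \<psi>)
  finally show ?thesis .
qed

abbreviation path_par :: "nat \<Rightarrow> nat \<Rightarrow> (nat \<Rightarrow> nat) \<Rightarrow> nat \<Rightarrow> complex \<Rightarrow> complex" where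
  "path_par N r i n \<equiv> S_par (step r (i n) (cyc_pred N i n)) (cyc_pred N i n)"

abbreviation cyclic_path :: "nat \<Rightarrow> nat \<Rightarrow> (nat \<Rightarrow> nat) \<Rightarrow> bool" where
  "cyclic_path N r i \<equiv> i \<in> {1..N} \<rightarrow>\<^sub>E {1..r} \<and> (\<forall>n\<in>{1..N}. step r (i n) (cyc_pred N i n) \<noteq> 0)"

lemma S_par_cnj: "S_par s j (cnj w) = cnj (S_par s j w)" by (simp add: S_par_def lam_def)

lemma form_S_vec:
  "form (Svec r t i j (cnj w) k) (Svec r t i' j' (- x) k') =
    (if step r i j = 0 \<or> step r i' j' = 0 then 0 else cnj (t k j) * t k' j' * Phi (S_par (step r i j) j w) (S_par (step r i' j') j' (- x)))"
proof (cases "step r i j = 0 \<or> step r i' j' = 0")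
  case True
  then show ?thesis by (auto simp: S_vec_eq form_eq dint_def)
next
  case False
  have V: "phi c \<in> V" for c by (rule br_pair_in_V)
  have "form (\<lambda>z. a * phi c z) (\<lambda>z. b * phi c' z) = cnj a * b * form (phi c) (phi c')" for a b c c'
    using form_lin(1)[OF V[of c] V[of c] V_scale[OF V[of c']], where a = a and b = 0] form_lin(2)[OF V[of c'] V[of c'] V[of c], where a = b and b = 0] by simp
  then show ?thesis using False by (simp add: S_vec_eq S_par_cnj Phi_def)
qed

lemma Q_L_Q_R_from_paths:
  assumes N: "N > 0"
    and sym: "\<And>i i' w x. cyclic_path N r i \<Longrightarrow> cyclic_path N r i' \<Longrightarrow>
      (\<Prod>n=1..N. Phi (path_par N r i n w) (path_par N r i' n (- x))) = (\<Prod>n=1..N. Phi (path_par N r i n x) (path_par N r i' n (- w)))"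
  shows "QL N r t u (QR N r t u' v) = QL N r t u' (QR N r t u v)"
proof -
  let ?J = "index_set N m \<times> ({1..N} \<rightarrow>\<^sub>E {1..r})"
  let ?S = "\<lambda>u p n. Svec r t (snd p n) (cyc_pred N (snd p) n) u (fst p n)"
  have QR: "QR N r t u v = (\<lambda>z. \<Sum>p\<in>?J. v (fst p) * pure_tensor N (?S u p) z)" for u v
    unfolding Q_R_eq_sum case_prod_unfold ..
  have "(\<Prod>n=1..N. form (?S (cnj w) p n) (?S (- x) q n)) = (\<Prod>n=1..N. form (?S (cnj x) p n) (?S (- w) q n))" if "p \<in> ?J" "q \<in> ?J" for p q w x
  proof (cases "cyclic_path N r (snd p) \<and> cyclic_path N r (snd q)")
    case True
    have "(\<Prod>n=1..N. form (?S (cnj w) p n) (?S (- x) q n)) = (\<Prod>n=1..N. (cnj (t (fst p n) (cyc_pred N (snd p) n)) * t (fst q n) (cyc_pred N (snd q) n)) * Phi (path_par N r (snd p) n w) (path_par N r (snd q) n (- x)))" for w x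
      unfolding form_S_vec by (intro prod.cong refl) (use True in \<open>simp only: if_False simp_thms\<close>)
    moreover have "(\<Prod>n=1..N. Phi (path_par N r (snd p) n w) (path_par N r (snd q) n (- x))) = (\<Prod>n=1..N. Phi (path_par N r (snd p) n x) (path_par N r (snd q) n (- w)))"
      by (rule sym) (use True in blast)+
    ultimately show ?thesis by (simp only: prod.distrib)
  next
    case False
    moreover have "snd p \<in> {1..N} \<rightarrow>\<^sub>E {1..r}" "snd q \<in> {1..N} \<rightarrow>\<^sub>E {1..r}" using that by (simp_all only: mem_Times_iff)
    ultimately obtain n where "n \<in> {1..N}" "step r (snd p n) (cyc_pred N (snd p) n) = 0 \<or> step r (snd q n) (cyc_pred N (snd q) n) = 0"
      by blast
    then have "(\<Prod>n=1..N. form (?S (cnj w) p n) (?S (- x) q n)) = 0" for w x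
      unfolding form_S_vec by (intro prod_zero bexI[of _ n]) auto
    then show ?thesis by (simp only:)
  qed
  note prod_eq = this
  have "tform N (QR N r t (cnj w) v) (QR N r t (- x) v') = tform N (QR N r t (cnj x) v) (QR N r t (- w) v')" for w x v'
  proof -
    have "tform N (QR N r t (cnj w) v) (QR N r t (- x) v') =
       (\<Sum>p\<in>?J. cnj (v (fst p)) * (\<Sum>q\<in>?J. v' (fst q) * (\<Prod>n=1..N. form (?S (cnj w) p n) (?S (- x) q n))))" for w x
      unfolding QR by (rule tform_pure_sums[OF N]) (rule S_vec_in_V)+
    moreover have "(\<Sum>p\<in>?J. cnj (v (fst p)) * (\<Sum>q\<in>?J. v' (fst q) * (\<Prod>n=1..N. form (?S (cnj w) p n) (?S (- x) q n)))) =
       (\<Sum>p\<in>?J. cnj (v (fst p)) * (\<Sum>q\<in>?J. v' (fst q) * (\<Prod>n=1..N. form (?S (cnj x) p n) (?S (- w) q n))))"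
      by (intro sum.cong refl arg_cong2[of _ _ _ _ "(*)"] prod_eq)
    ultimately show ?thesis by (simp only:)
  qed
  from this[of "cnj u'" "cnj u"] show ?thesis
    unfolding Q_L_eq[OF N Q_R_in_H[OF N]] by (simp only: complex_cnj_cnj)
qed

text \<open>
  For \<open>\<eta> = 0\<close> there is no difference equation, but each factor is symmetric by itself.
\<close>

lemma Phi_eta_zero:
  assumes "\<eta> = 0" shows "Phi (S_par s j w) (S_par s' j' (- x)) = Phi (S_par s j x) (S_par s' j' (- w))"
proof -
  have "phi (- c) = phi c" for c
    using phi_swap[of "- c"] phi_swap[of c] assms V_D(3)[OF br_pair_in_V] by (simp add: fun_eq_iff)
  then have neg: "Phi c' (- c) = Phi c' c" for c c' by (simp add: Phi_def)
  have p: "S_par s j w = w / 2" for s j w unfolding S_par_def lam_def using assms by simp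
  have "Phi (w / 2) (- (x / 2)) = Phi (x / 2) (- (w / 2))" unfolding neg by (rule Phi_sym)
  then show ?thesis unfolding p by simp
qed

end

sublocale sklyanin_strict_main \<subseteq> sklyanin_strict_nonzero ..

context sklyanin_strict_main
begin

text \<open>
  The factor of the scalar product that changes when the spectral parameters are exchanged;
  \<open>D\<close> is the difference of the parameters.
\<close>

definition exchange_factor :: "int \<Rightarrow> complex \<Rightarrow> complex" where
  "exchange_factor k D = string (m - 1) (D / 2 + of_int k * (of_nat m * h\<eta>))"

lemma exchange_factor_minus: "exchange_factor (- k) D = exchange_factor k (- D)"
  using string_even[of "m - 1" "D / 2 + of_int (- k) * (of_nat m * h\<eta>)"] by (simp add: exchange_factor_def)

lemma string_int: "string n (v + of_int k) = string n v"
proof (induction k rule: int_induct[where k = 0])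
  case (step1 i)
  then show ?case using string_1[of n "v + of_int i"] by (simp add: add.assoc)
next
  case (step2 i)
  then show ?case using string_1[of n "v + of_int (i - 1)"] by simp
qed simp

lemma exchange_factor_period: "exchange_factor (k + n * int r) D = exchange_factor k D"
proof -
  have "of_nat m * h\<eta> * of_nat r = of_int r'" using arg_cong[OF eta_rational, of complex_of_real] by simp
  moreover have "of_int (n * int r) * (of_nat m * h\<eta>) = of_int n * (of_nat m * h\<eta> * of_nat r)" by (simp add: mult_ac)
  ultimately have "of_int (n * int r) * (of_nat m * h\<eta>) = of_int (n * r')" by simp
  then have "D / 2 + of_int (k + n * int r) * (of_nat m * h\<eta>) = D / 2 + of_int k * (of_nat m * h\<eta>) + of_int (n * r')"
    by (simp add: distrib_right)
  then show ?thesis unfolding exchange_factor_def by (simp only: string_int)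
qed

lemma exchange_factor_holomorphic: "f holomorphic_on A \<Longrightarrow> (\<lambda>D. exchange_factor k (f D)) holomorphic_on A"
  unfolding exchange_factor_def by (intro holomorphic_intros) auto

lemma exchange_factor_eventually_nonzero: "eventually (\<lambda>D. exchange_factor k D \<noteq> 0 \<and> exchange_factor k (- D) \<noteq> 0) (at 0)"
proof -
  have nz: "string (m - 1) 0 \<noteq> 0" using string_real_nonzero[of "m - 1" 0] by simp
  have "eventually (\<lambda>D. exchange_factor k D \<noteq> 0) (at 0)"
    by (rule entire_eventually_nonzero[where p = "- 2 * (of_int k * (of_nat m * h\<eta>))"])
       (auto intro!: exchange_factor_holomorphic holomorphic_intros simp: exchange_factor_def nz)
  moreover have "eventually (\<lambda>D. exchange_factor k (- D) \<noteq> 0) (at 0)"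
    by (rule entire_eventually_nonzero[where p = "2 * (of_int k * (of_nat m * h\<eta>))"])
       (auto intro!: exchange_factor_holomorphic holomorphic_intros simp: exchange_factor_def nz)
  ultimately show ?thesis by (rule eventually_conj)
qed

text \<open>
  A discrete primitive of the ratio \<open>exchange_factor k D / exchange_factor k (- D)\<close>, extended evenly to all the integers by \<open>ipot\<close>.
  The extension is consistent because \<open>exchange_factor_minus\<close> inverts the ratio under \<open>k \<mapsto> -k\<close>; likewise the period \<open>r\<close>
  makes the potential symmetric about \<open>r\<close>.
\<close>

fun pot :: "complex \<Rightarrow> nat \<Rightarrow> complex" where
  "pot D 0 = 1"
| "pot D (Suc 0) = 1"
| "pot D (Suc (Suc n)) = pot D n * (exchange_factor (int n + 1) D / exchange_factor (int n + 1) (- D))"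

definition ipot :: "complex \<Rightarrow> int \<Rightarrow> complex" where "ipot D K = pot D (nat \<bar>K\<bar>)"

lemma ipot_even: "ipot D (- K) = ipot D K" by (simp add: ipot_def)

context
  fixes D :: complex
  assumes nz: "\<And>k. exchange_factor k D \<noteq> 0" "\<And>k. exchange_factor k (- D) \<noteq> 0"
begin

lemma ipot_nonzero: "ipot D K \<noteq> 0"
proof -
  have "pot D n \<noteq> 0" for n by (induction n rule: induct_nat_012) (use nz in auto)
  then show ?thesis by (simp add: ipot_def)
qed

lemma pot_step: "pot D (n + 2) * exchange_factor (int n + 1) (- D) = pot D n * exchange_factor (int n + 1) D"
  using nz by (simp add: numeral_2_eq_2)

lemma ipot_step: "ipot D (K + 2) * exchange_factor (K + 1) (- D) = ipot D K * exchange_factor (K + 1) D"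
proof -
  consider "K \<ge> 0" | "K = - 1" | "K \<le> - 2" by linarith
  then show ?thesis
  proof cases
    case 1
    then have "nat \<bar>K + 2\<bar> = nat K + 2" "nat \<bar>K\<bar> = nat K" "int (nat K) + 1 = K + 1" by simp_all
    then show ?thesis unfolding ipot_def using pot_step[of "nat K"] by (simp only:)
  next
    case 2
    then show ?thesis using exchange_factor_minus[of 0 D] by (simp add: ipot_def)
  next
    case 3
    define n where "n = nat (- K - 2)"
    have n: "nat \<bar>K + 2\<bar> = n" "nat \<bar>K\<bar> = n + 2" "K + 1 = - (int n + 1)" using 3 by (auto simp: n_def)
    show ?thesis unfolding ipot_def n exchange_factor_minus using pot_step[of n] by simp
  qed
qed

lemma ipot_reflect_nat: "ipot D (int r + int n) = ipot D (int r - int n)"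
proof (induction n rule: induct_nat_012)
  case 0
  show ?case by simp
next
  case 1
  have "exchange_factor (int r) D = exchange_factor 0 D" "exchange_factor (int r) (- D) = exchange_factor 0 D"
    using exchange_factor_period[of 0 1] exchange_factor_minus[of 0 D] by simp_all
  then show ?case using ipot_step[of "int r - 1"] nz(1)[of 0] by (simp add: add.commute)
next
  case (ge2 n)
  let ?k = "int n + 1"
  have p: "exchange_factor (int r + ?k) E = exchange_factor ?k E" "exchange_factor (int r - ?k) E = exchange_factor ?k (- E)" for E
  proof -
    have "int r + ?k = ?k + 1 * int r" "int r - ?k = - ?k + 1 * int r" by simp_all
    then show "exchange_factor (int r + ?k) E = exchange_factor ?k E" "exchange_factor (int r - ?k) E = exchange_factor ?k (- E)" by (simp_all only: exchange_factor_period exchange_factor_minus)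
  qed
  have e: "int r + int n + 2 = int r + int (Suc (Suc n))" "int r + int n + 1 = int r + ?k"
    "int r - int (Suc (Suc n)) + 2 = int r - int n" "int r - int (Suc (Suc n)) + 1 = int r - ?k" by simp_all
  have "ipot D (int r + int (Suc (Suc n))) * exchange_factor ?k (- D) = ipot D (int r - int n) * exchange_factor ?k D"
    using ipot_step[of "int r + int n"] unfolding e p ge2(1) .
  also have "\<dots> = ipot D (int r - int (Suc (Suc n))) * exchange_factor ?k (- D)"
    using ipot_step[of "int r - int (Suc (Suc n))"] unfolding e p by simp
  finally show ?case using nz(2)[of ?k] by simp
qed

lemma ipot_reflect: "ipot D (2 * int r - K) = ipot D K"
proof (cases "K \<ge> int r")
  case True
  then have "2 * int r - K = int r - int (nat (K - int r))" "K = int r + int (nat (K - int r))" by simp_all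
  then show ?thesis using ipot_reflect_nat by metis
next
  case False
  then have "2 * int r - K = int r + int (nat (int r - K))" "K = int r - int (nat (int r - K))" by simp_all
  then show ?thesis using ipot_reflect_nat by metis
qed

text \<open>
  For a pair of steps, one of \<open>x + x' - 1\<close> and \<open>x - x'\<close> changes by \<open>\<plusminus>2\<close> and the other one stays the same.
  The reflections of either path at the ends of the chain exchange the two quantities up to the
  symmetries of the potential.
\<close>

definition pair_pot :: "int \<Rightarrow> int \<Rightarrow> complex" where
  "pair_pot x x' = ipot D (x + x' - 1) * ipot D (x - x')"

lemma pair_pot_reflect:
  "pair_pot (1 - x) x' = pair_pot x x'" "pair_pot (2 * int r + 1 - x) x' = pair_pot x x'" "pair_pot x' x = pair_pot x x'"
proof -
  have "1 - x + x' - 1 = - (x - x')" "1 - x - x' = - (x + x' - 1)" by simp_all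
  then show "pair_pot (1 - x) x' = pair_pot x x'" unfolding pair_pot_def by (simp only: ipot_even mult.commute)
  have "2 * int r + 1 - x + x' - 1 = 2 * int r - (x - x')" "2 * int r + 1 - x - x' = 2 * int r - (x + x' - 1)" by simp_all
  then show "pair_pot (2 * int r + 1 - x) x' = pair_pot x x'" unfolding pair_pot_def by (simp only: ipot_reflect) (rule mult.commute)
  have "x' + x - 1 = x + x' - 1" "x' - x = - (x - x')" by simp_all
  then show "pair_pot x' x = pair_pot x x'" unfolding pair_pot_def by (simp only: ipot_even)
qed

lemma pair_pot_move:
  assumes "i \<in> {1..r}" "j \<in> {1..r}" "step r i j \<noteq> 0"
  shows "pair_pot (int i) x' = pair_pot (int j + step r i j) x'"
  using assms(1,2)
proof (cases rule: step_cases)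
  case 3
  then show ?thesis using pair_pot_reflect(2)[of "int r + 1" x'] by simp
next
  case 5
  then show ?thesis using pair_pot_reflect(1)[of 0 x'] by simp
qed (use assms(3) in auto)

lemma pair_pot_step:
  assumes "\<bar>s\<bar> = 1" "\<bar>s'\<bar> = 1" "2 * (k - 1) = s * (2 * x - 1) + s' * (2 * x' - 1)"
  shows "pair_pot (x + s) (x' + s') * exchange_factor k (- D) = pair_pot x x' * exchange_factor k D"
proof -
  have m: "ipot D (K - 2) * exchange_factor (1 - K) (- D) = ipot D K * exchange_factor (1 - K) D" for K
    using ipot_step[of "K - 2"] exchange_factor_minus[of "K - 1" D] exchange_factor_minus[of "K - 1" "- D"] by (simp add: algebra_simps)
  consider "s = 1" "s' = 1" | "s = 1" "s' = - 1" | "s = - 1" "s' = 1" | "s = - 1" "s' = - 1" using assms(1,2) by linarith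
  then show ?thesis
  proof cases
    case 1
    then have "k = (x + x' - 1) + 1" "x + s + (x' + s') - 1 = (x + x' - 1) + 2" "x + s - (x' + s') = x - x'" using assms(3) by simp_all
    then show ?thesis unfolding pair_pot_def using ipot_step[of "x + x' - 1"] by (simp only: mult_ac)
  next
    case 2
    then have "k = (x - x') + 1" "x + s + (x' + s') - 1 = x + x' - 1" "x + s - (x' + s') = (x - x') + 2" using assms(3) by simp_all
    then show ?thesis unfolding pair_pot_def using ipot_step[of "x - x'"] by (simp only: mult_ac)
  next
    case 3
    then have "k = 1 - (x - x')" "x + s + (x' + s') - 1 = x + x' - 1" "x + s - (x' + s') = (x - x') - 2" using assms(3) by simp_all
    then show ?thesis unfolding pair_pot_def using m[of "x - x'"] by (simp only: mult_ac)
  next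
    case 4
    then have "k = 1 - (x + x' - 1)" "x + s + (x' + s') - 1 = (x + x' - 1) - 2" "x + s - (x' + s') = x - x'" using assms(3) by simp_all
    then show ?thesis unfolding pair_pot_def using m[of "x + x' - 1"] by (simp only: mult_ac)
  qed
qed

end

text \<open>
  The point at which a pair of steps \<open>j \<rightarrow> i\<close>, \<open>j' \<rightarrow> i'\<close> evaluates the exchange factor. The division is
  exact, as a sum of two odd numbers is even.
\<close>

definition step_idx :: "nat \<Rightarrow> nat \<Rightarrow> nat \<Rightarrow> nat \<Rightarrow> int" where
  "step_idx i j i' j' = (step r i j * (2 * int j - 1) + step r i' j' * (2 * int j' - 1)) div 2 + 1"

lemma step_abs:
  assumes "i \<in> {1..r}" "j \<in> {1..r}" "step r i j \<noteq> 0" shows "\<bar>step r i j\<bar> = 1"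
  using assms(1,2) by (cases rule: step_cases) (use assms(3) in auto)

lemma step_idx:
  assumes "\<bar>step r i j\<bar> = 1" "\<bar>step r i' j'\<bar> = 1"
  shows "2 * (step_idx i j i' j' - 1) = step r i j * (2 * int j - 1) + step r i' j' * (2 * int j' - 1)"
proof -
  have "step r i j = 1 \<or> step r i j = - 1" "step r i' j' = 1 \<or> step r i' j' = - 1" using assms by linarith+
  then have "even (step r i j * (2 * int j - 1) + step r i' j' * (2 * int j' - 1))" by auto
  then show ?thesis unfolding step_idx_def by simp
qed

text \<open>
  By \<open>pair_pot_step\<close> each factor changes by a quotient of potentials, and the quotients cancel around a
  closed path. This needs nonvanishing factors; both sides are entire in \<open>D\<close>, which removes the
  restriction.
\<close>

lemma cyclic_paths_exchange_factor:
  assumes N: "N > 0" and i: "cyclic_path N r i" and i': "cyclic_path N r i'"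
  shows "(\<Prod>n=1..N. exchange_factor (step_idx (i n) (cyc_pred N i n) (i' n) (cyc_pred N i' n)) D) =
    (\<Prod>n=1..N. exchange_factor (step_idx (i n) (cyc_pred N i n) (i' n) (cyc_pred N i' n)) (- D))"
proof -
  define k where "k n = step_idx (i n) (cyc_pred N i n) (i' n) (cyc_pred N i' n)" for n
  have in_r: "i n \<in> {1..r}" "cyc_pred N i n \<in> {1..r}" "i' n \<in> {1..r}" "cyc_pred N i' n \<in> {1..r}" if "n \<in> {1..N}" for n
    using i i' that cyc_pred_in[OF N, of i "{1..r}" n] cyc_pred_in[OF N, of i' "{1..r}" n] by (auto simp: PiE_iff)
  have nzs: "step r (i n) (cyc_pred N i n) \<noteq> 0" "step r (i' n) (cyc_pred N i' n) \<noteq> 0" if "n \<in> {1..N}" for n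
    using i i' that by blast+
  have generic: "(\<Prod>n=1..N. exchange_factor (k n) D) = (\<Prod>n=1..N. exchange_factor (k n) (- D))" if nz: "\<And>k. exchange_factor k D \<noteq> 0" "\<And>k. exchange_factor k (- D) \<noteq> 0" for D
  proof -
    let ?P = "\<lambda>p. pair_pot D (int (fst p)) (int (snd p))"
    have move: "?P (i n, i' n) * exchange_factor (k n) (- D) = ?P (cyc_pred N i n, cyc_pred N i' n) * exchange_factor (k n) D" if n: "n \<in> {1..N}" for n
    proof -
      note a = step_abs[OF in_r(1,2)[OF n] nzs(1)[OF n]] step_abs[OF in_r(3,4)[OF n] nzs(2)[OF n]]
      have "?P (i n, i' n) = pair_pot D (int (cyc_pred N i n) + step r (i n) (cyc_pred N i n)) (int (i' n))"
        unfolding fst_conv snd_conv by (rule pair_pot_move[OF nz in_r(1,2)[OF n] nzs(1)[OF n]])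
      also have "\<dots> = pair_pot D (int (i' n)) (int (cyc_pred N i n) + step r (i n) (cyc_pred N i n))"
        by (rule pair_pot_reflect(3)[OF nz])
      also have "\<dots> = pair_pot D (int (cyc_pred N i' n) + step r (i' n) (cyc_pred N i' n)) (int (cyc_pred N i n) + step r (i n) (cyc_pred N i n))"
        by (rule pair_pot_move[OF nz in_r(3,4)[OF n] nzs(2)[OF n]])
      also have "\<dots> = pair_pot D (int (cyc_pred N i n) + step r (i n) (cyc_pred N i n)) (int (cyc_pred N i' n) + step r (i' n) (cyc_pred N i' n))"
        by (rule pair_pot_reflect(3)[OF nz])
      finally show ?thesis
        unfolding fst_conv snd_conv using pair_pot_step[OF nz a step_idx[OF a]] by (simp only: k_def)
    qed
    have cyc: "cyc_pred N (\<lambda>n. (i n, i' n)) n = (cyc_pred N i n, cyc_pred N i' n)" for n by simp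
    have "(\<Prod>n=1..N. ?P (i n, i' n)) * (\<Prod>n=1..N. exchange_factor (k n) (- D)) = (\<Prod>n=1..N. ?P (cyc_pred N (\<lambda>n. (i n, i' n)) n)) * (\<Prod>n=1..N. exchange_factor (k n) D)"
      unfolding prod.distrib[symmetric] cyc by (intro prod.cong refl move)
    also have "(\<Prod>n=1..N. ?P (cyc_pred N (\<lambda>n. (i n, i' n)) n)) = (\<Prod>n=1..N. ?P (i n, i' n))"
      by (rule prod_cyc_pred[OF N])
    finally have "(\<Prod>n=1..N. ?P (i n, i' n)) * (\<Prod>n=1..N. exchange_factor (k n) (- D)) = (\<Prod>n=1..N. ?P (i n, i' n)) * (\<Prod>n=1..N. exchange_factor (k n) D)" .
    moreover have "(\<Prod>n=1..N. ?P (i n, i' n)) \<noteq> 0"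
      unfolding prod_zero_iff[OF finite_atLeastAtMost] pair_pot_def[OF nz] using ipot_nonzero[OF nz] by auto
    ultimately show ?thesis by simp
  qed
  let ?d = "\<lambda>D. \<Prod>k\<in>{0..<int r}. exchange_factor k D * exchange_factor k (- D)"
  have "eventually (\<lambda>D. \<forall>k\<in>{0..<int r}. exchange_factor k D \<noteq> 0 \<and> exchange_factor k (- D) \<noteq> 0) (at 0)"
    by (intro eventually_ball_finite ballI exchange_factor_eventually_nonzero) simp
  from eventually_happens[OF this] obtain q where "\<forall>k\<in>{0..<int r}. exchange_factor k q \<noteq> 0 \<and> exchange_factor k (- q) \<noteq> 0" by auto
  then have q: "?d q \<noteq> 0" by auto
  have nz: "exchange_factor k D \<noteq> 0" "exchange_factor k (- D) \<noteq> 0" if "?d D \<noteq> 0" for D k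
  proof -
    have "k mod int r \<in> {0..<int r}" using r_pos by simp
    then have "exchange_factor (k mod int r) D \<noteq> 0" "exchange_factor (k mod int r) (- D) \<noteq> 0" using that by auto
    then show "exchange_factor k D \<noteq> 0" "exchange_factor k (- D) \<noteq> 0"
      using exchange_factor_period[of "k mod int r" "k div int r"] by (simp_all add: mod_div_mult_eq)
  qed
  have "(\<lambda>D. \<Prod>n=1..N. exchange_factor (k n) D) = (\<lambda>D. \<Prod>n=1..N. exchange_factor (k n) (- D))"
  proof (rule entire_cancel[where d = ?d, OF _ _ _ q])
    show "(\<Prod>n=1..N. exchange_factor (k n) D) * ?d D = (\<Prod>n=1..N. exchange_factor (k n) (- D)) * ?d D" for D
    proof (cases "?d D = 0")
      case False
      show ?thesis by (simp only: generic[OF nz[OF False]])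
    qed (simp only: mult_zero_right)
  qed (intro holomorphic_intros exchange_factor_holomorphic)+
  then show ?thesis unfolding k_def by (rule fun_cong)
qed

lemma Phi_S_par:
  obtains \<gamma> where "\<And>i j i' j' w x. \<bar>step r i j\<bar> = 1 \<Longrightarrow> \<bar>step r i' j'\<bar> = 1 \<Longrightarrow>
    Phi (S_par (step r i j) j w) (S_par (step r i' j') j' (- x)) =
    \<gamma> * (exchange_factor (step_idx i j i' j') (w - x) * string (m - 1) (of_int (step r i j) * lam j - of_int (step r i' j') * lam j' + (w + x) / 2))"
proof -
  obtain \<gamma> where \<gamma>: "\<And>x y. Phi (x - \<delta>\<eta>) (y - \<delta>\<eta>) = \<gamma> * string_kernel x y" using Phi_formula by blast
  show ?thesis
  proof (rule that)
    fix i j i' j' w x assume a: "\<bar>step r i j\<bar> = 1" "\<bar>step r i' j'\<bar> = 1"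
    let ?s = "step r i j" and ?s' = "step r i' j'"
    have par: "S_par s j u = of_int s * lam j + u / 2 + spin m * h\<eta> - \<delta>\<eta>" for s j u
      using m_pos by (simp add: S_par_def of_nat_diff algebra_simps)
    have "of_int (2 * (step_idx i j i' j' - 1)) = (of_int (?s * (2 * int j - 1) + ?s' * (2 * int j' - 1)) :: complex)"
      unfolding step_idx[OF a] ..
    then have k: "of_int (step_idx i j i' j') = (of_int ?s * (2 * of_nat j - 1) + of_int ?s' * (2 * of_nat j' - 1)) / 2 + (1 :: complex)"
      by (simp add: field_simps)
    have "(of_int ?s * lam j + w / 2 + spin m * h\<eta>) + (of_int ?s' * lam j' + (- x) / 2 + spin m * h\<eta>) = (w - x) / 2 + of_int (step_idx i j i' j') * (of_nat m * h\<eta>)"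
      unfolding k lam_def by (simp add: field_simps)
    moreover have "(of_int ?s * lam j + w / 2 + spin m * h\<eta>) - (of_int ?s' * lam j' + (- x) / 2 + spin m * h\<eta>) = of_int ?s * lam j - of_int ?s' * lam j' + (w + x) / 2"
      by (simp add: field_simps)
    ultimately show "Phi (S_par ?s j w) (S_par ?s' j' (- x)) = \<gamma> * (exchange_factor (step_idx i j i' j') (w - x) * string (m - 1) (of_int ?s * lam j - of_int ?s' * lam j' + (w + x) / 2))"
      unfolding par \<gamma> string_kernel_def exchange_factor_def by (simp only:)
  qed
qed

lemma cyclic_paths_Phi:
  assumes N: "N > 0" and i: "cyclic_path N r i" and i': "cyclic_path N r i'"
  shows "(\<Prod>n=1..N. Phi (path_par N r i n w) (path_par N r i' n (- x))) = (\<Prod>n=1..N. Phi (path_par N r i n x) (path_par N r i' n (- w)))"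
proof -
  obtain \<gamma> where \<gamma>: "\<And>i j i' j' w x. \<bar>step r i j\<bar> = 1 \<Longrightarrow> \<bar>step r i' j'\<bar> = 1 \<Longrightarrow>
    Phi (S_par (step r i j) j w) (S_par (step r i' j') j' (- x)) =
    \<gamma> * (exchange_factor (step_idx i j i' j') (w - x) * string (m - 1) (of_int (step r i j) * lam j - of_int (step r i' j') * lam j' + (w + x) / 2))"
    by (rule Phi_S_par) blast
  have in_r: "i n \<in> {1..r}" "cyc_pred N i n \<in> {1..r}" "i' n \<in> {1..r}" "cyc_pred N i' n \<in> {1..r}" if "n \<in> {1..N}" for n
    using i i' that cyc_pred_in[OF N, of i "{1..r}" n] cyc_pred_in[OF N, of i' "{1..r}" n] by (auto simp: PiE_iff)
  have a: "\<bar>step r (i n) (cyc_pred N i n)\<bar> = 1" "\<bar>step r (i' n) (cyc_pred N i' n)\<bar> = 1" if "n \<in> {1..N}" for n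
    using step_abs in_r[OF that] i i' that by blast+
  define R where "R n y = string (m - 1) (of_int (step r (i n) (cyc_pred N i n)) * lam (cyc_pred N i n) - of_int (step r (i' n) (cyc_pred N i' n)) * lam (cyc_pred N i' n) + y / 2)" for n y
  have "(\<Prod>n=1..N. Phi (path_par N r i n w) (path_par N r i' n (- x))) = (\<Prod>n=1..N. \<gamma> * (exchange_factor (step_idx (i n) (cyc_pred N i n) (i' n) (cyc_pred N i' n)) (w - x) * R n (w + x)))" for w x
    unfolding R_def by (intro prod.cong refl \<gamma> a)
  note e = this[of w x] this[of x w]
  show ?thesis unfolding e prod.distrib using cyclic_paths_exchange_factor[OF N i i', of "w - x"] by (simp only: minus_diff_eq add.commute[of x w])
qed

end

context sklyanin_strict_rational
begin

theorem Q_L_Q_R: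
  assumes "N > 0" shows "QL N r t u (QR N r t u' v) = QL N r t u' (QR N r t u v)"
proof (rule Q_L_Q_R_from_paths[OF assms])
  fix i i' w x assume p: "cyclic_path N r i" "cyclic_path N r i'"
  show "(\<Prod>n=1..N. Phi (path_par N r i n w) (path_par N r i' n (- x))) = (\<Prod>n=1..N. Phi (path_par N r i n x) (path_par N r i' n (- w)))"
  proof (cases "\<eta> = 0")
    case True
    show ?thesis by (intro prod.cong refl Phi_eta_zero[OF True])
  next
    case False
    then interpret sklyanin_strict_main \<tau> \<eta> m r r' by unfold_locales
    show ?thesis by (rule cyclic_paths_Phi[OF assms p])
  qed
qed

end

section \<open>The commuting family\<close>

context sklyanin_strict_rational
begin

context
  fixes N :: nat and t :: "nat \<Rightarrow> nat \<Rightarrow> complex" and u0 :: complex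
  assumes N: "N > 0"
    and bij: "bij_betw (QR N r t u0) (coord_space N m) (H N)" "bij_betw (QL N r t u0) (H N) (coord_space N m)"
begin

definition Q_op :: "complex \<Rightarrow> ((nat \<Rightarrow> complex) \<Rightarrow> complex) \<Rightarrow> (nat \<Rightarrow> complex) \<Rightarrow> complex" where
  "Q_op u F = QR N r t u (inv_into (coord_space N m) (QR N r t u0) F)"

lemma Q_op_in_H: "Q_op u F \<in> H N"
  unfolding Q_op_def by (rule Q_R_in_H[OF N])

lemma inverse_in_K:
  assumes "F \<in> H N"
  shows "inv_into (coord_space N m) (QR N r t u0) F \<in> coord_space N m"
    "QR N r t u0 (inv_into (coord_space N m) (QR N r t u0) F) = F"
  using bij(1) assms by (auto simp: bij_betw_def inv_into_into f_inv_into_f)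

lemma Q_L_Q_op:
  assumes "F \<in> H N" shows "QL N r t u (Q_op u0 F) = QL N r t u F" "QL N r t u (Q_op v F) = QL N r t v (Q_op u F)" "QL N r t u0 (Q_op u F) = QL N r t u F"
proof -
  show a: "QL N r t u (Q_op u0 F) = QL N r t u F" for u by (simp add: Q_op_def inverse_in_K[OF assms])
  show b: "QL N r t u (Q_op v F) = QL N r t v (Q_op u F)" for u v unfolding Q_op_def by (rule Q_L_Q_R[OF N])
  show "QL N r t u0 (Q_op u F) = QL N r t u F" unfolding b[of u0] by (rule a)
qed

lemma inv_Q_L: "X \<in> H N \<Longrightarrow> inv_into (H N) (QL N r t u0) (QL N r t u0 X) = X"
  using bij(2) by (auto simp: bij_betw_def inv_into_f_f)

lemma Q_op_eq: "F \<in> H N \<Longrightarrow> Q_op u F = inv_into (H N) (QL N r t u0) (QL N r t u F)"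
  using inv_Q_L[OF Q_op_in_H, of u F] by (simp add: Q_L_Q_op(3))

lemma Q_op_eqI: "F \<in> H N \<Longrightarrow> X \<in> H N \<Longrightarrow> QL N r t u0 X = QL N r t u F \<Longrightarrow> Q_op u F = X"
  using Q_op_eq inv_Q_L by metis

lemma Q_op_commute:
  assumes "F \<in> H N" shows "Q_op u (Q_op v F) = Q_op v (Q_op u F)"
proof (rule Q_op_eqI[OF Q_op_in_H Q_op_in_H])
  show "QL N r t u0 (Q_op v (Q_op u F)) = QL N r t u (Q_op v F)"
    unfolding Q_L_Q_op(3)[OF Q_op_in_H] by (rule Q_L_Q_op(2)[OF assms])
qed

text \<open>An operator that intertwines both \<open>Q\<^sub>R\<close> and \<open>Q\<^sub>L\<close> with the same coefficients commutes with \<open>Q\<close>.\<close>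

lemma Q_op_intertwine:
  assumes F: "F \<in> H N" and AF: "A F \<in> H N"
    and R: "\<And>v. A (QR N r t u v) = (\<lambda>z. a * QR N r t u1 v z + b * QR N r t u2 v z)"
    and L: "QL N r t u (A F) = (\<lambda>k. a * QL N r t u1 F k + b * QL N r t u2 F k)"
  shows "A (Q_op u F) = (\<lambda>z. a * Q_op u1 F z + b * Q_op u2 F z)" "Q_op u (A F) = (\<lambda>z. a * Q_op u1 F z + b * Q_op u2 F z)"
proof -
  show "A (Q_op u F) = (\<lambda>z. a * Q_op u1 F z + b * Q_op u2 F z)" unfolding Q_op_def by (rule R)
  show "Q_op u (A F) = (\<lambda>z. a * Q_op u1 F z + b * Q_op u2 F z)"
  proof (rule Q_op_eqI[OF AF])
    show "(\<lambda>z. a * Q_op u1 F z + b * Q_op u2 F z) \<in> H N" by (rule tensor_power_lin[OF N Q_op_in_H Q_op_in_H])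
    show "QL N r t u0 (\<lambda>z. a * Q_op u1 F z + b * Q_op u2 F z) = QL N r t u (A F)"
      unfolding Q_L_lin[OF N Q_op_in_H Q_op_in_H] Q_L_Q_op(3)[OF F] L ..
  qed
qed

lemma Q_op_intertwine_single:
  assumes F: "F \<in> H N" and AF: "A F \<in> H N"
    and R: "\<And>v. A (QR N r t u v) = (\<lambda>z. a * QR N r t u1 v z)"
    and L: "QL N r t u (A F) = (\<lambda>k. a * QL N r t u1 F k)"
  shows "A (Q_op u F) = (\<lambda>z. a * Q_op u1 F z)" "Q_op u (A F) = (\<lambda>z. a * Q_op u1 F z)"
  using Q_op_intertwine[of F A u a u1 0 u1] F AF R L by simp_all

end

end

theorem mainTheorem1:
  fixes N m r :: nat and r' :: int and l \<eta> :: real and \<tau> :: complex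
    and t :: "nat \<Rightarrow> nat \<Rightarrow> complex"
    and H K T QR QL U1N U3N hp hm
  assumes "N > 0" and "m > 0" and "l = real m / 2" and "real N * l \<in> \<int>"
    and "Re \<tau> = 0" and "Im \<tau> > 0"
    and "r > 0" and "\<eta> = of_int r' / (2 * l * real r)"
    and "\<eta> \<in> {- 1 / (2 * (2 * l + 1)) .. 1 / (2 * (2 * l + 1))}"
    and "H = tensor_power N (Theta_space \<tau> m)"
    and "K = coord_space N m"
    and "T = transfer \<tau> \<eta> m N"
    and "QR = Q_R \<tau> \<eta> m N r t"
    and "QL = Q_L \<tau> \<eta> m N r t"
    and "U1N = op_tensor_power N (U1_op m)"
    and "U3N = op_tensor_power N (U3_op \<tau> m)"
    and "hp = h_fun \<tau> \<eta> m N 1"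
    and "hm = h_fun \<tau> \<eta> m N (- 1)"
  shows
    "(\<forall>x u. f_fun \<tau> \<eta> m 1 x u \<in> Theta_space \<tau> m \<and> f_fun \<tau> \<eta> m (- 1) x u \<in> Theta_space \<tau> m) \<and>
     (\<eta> \<noteq> 0 \<longrightarrow> (\<forall>u. \<forall>v\<in>K.
        T u (QR u v) = (\<lambda>z. hm u * QR (u - 2 * of_real \<eta>) v z + hp u * QR (u + 2 * of_real \<eta>) v z))) \<and>
     (\<forall>u. \<forall>v\<in>K.
        U1N (QR u v) = (\<lambda>z. exp (- (of_nat N * of_real l * of_real pi * \<i>)) * QR (u + 1) v z) \<and>
        U3N (QR u v) = (\<lambda>z. exp (of_nat N * of_real l * of_real pi * \<i> * (\<tau> - 1)
                                   + 2 * of_nat N * of_real l * of_real pi * \<i> * u) * QR (u + \<tau>) v z)) \<and>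
     (\<bar>\<eta>\<bar> < 1 / (2 * (2 * l + 1)) \<longrightarrow>
        (\<eta> \<noteq> 0 \<longrightarrow> (\<forall>u. \<forall>F\<in>H.
           QL u (T u F) = (\<lambda>k. hm u * QL (u - 2 * of_real \<eta>) F k + hp u * QL (u + 2 * of_real \<eta>) F k))) \<and>
        (\<forall>u u'. \<forall>v\<in>K. QL u (QR u' v) = QL u' (QR u v)) \<and>
        (\<forall>u. \<forall>F\<in>H.
           QL u (U1N F) = (\<lambda>k. exp (- (of_nat N * of_real l * of_real pi * \<i>)) * QL (u + 1) F k) \<and>
           QL u (U3N F) = (\<lambda>k. exp (of_nat N * of_real l * of_real pi * \<i> * (\<tau> - 1)
                                     + 2 * of_nat N * of_real l * of_real pi * \<i> * u) * QL (u + \<tau>) F k)) \<and>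
        (\<forall>u0. bij_betw (QR u0) K H \<and> bij_betw (QL u0) H K \<longrightarrow>
           (\<forall>u. \<forall>F\<in>H. QR u (inv_into K (QR u0) F) = inv_into H (QL u0) (QL u F)) \<and>
           (let Q = (\<lambda>u F. QR u (inv_into K (QR u0) F)) in
              (\<eta> \<noteq> 0 \<longrightarrow> (\<forall>u. \<forall>F\<in>H.
                 T u (Q u F) = Q u (T u F) \<and>
                 Q u (T u F) = (\<lambda>z. hm u * Q (u - 2 * of_real \<eta>) F z + hp u * Q (u + 2 * of_real \<eta>) F z))) \<and>
              (\<forall>u v. \<forall>F\<in>H. Q u (Q v F) = Q v (Q u F)) \<and>
              (\<forall>u. \<forall>F\<in>H.
                 U1N (Q u F) = Q u (U1N F) \<and>
                 Q u (U1N F) = (\<lambda>z. exp (- (of_nat N * of_real l * of_real pi * \<i>)) * Q (u + 1) F z) \<and>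
                 U3N (Q u F) = Q u (U3N F) \<and>
                 Q u (U3N F) = (\<lambda>z. exp (of_nat N * of_real l * of_real pi * \<i> * (\<tau> - 1)
                                          + 2 * of_nat N * of_real l * of_real pi * \<i> * u) * Q (u + \<tau>) F z)))))"
proof -
  note N = assms(1) and m = assms(2) and l = assms(3)
  note defs = assms(10-18)
  interpret sklyanin_rational \<tau> \<eta> m r r'
  proof unfold_locales
    show "\<bar>\<eta>\<bar> \<le> 1 / (2 * (real m + 1))" using assms(9) by (auto simp: l abs_le_iff)
    show "real m * \<eta> * real r = of_int r'" using assms(2,7,8) by (simp add: l)
  qed (use assms in auto)
  have ev: "even (N * m)"
  proof -
    obtain k where "real N * l = of_int k" using assms(4) by (rule Ints_cases)
    then have "real (N * m) = real_of_int (2 * k)" by (simp add: l)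
    then have "int (N * m) = 2 * k" by linarith
    then show ?thesis by presburger
  qed
  have c1: "exp (- (of_nat N * of_real l * of_real pi * \<i>)) = exp (- (of_real pi * \<i> * spin m)) ^ N"
    unfolding exp_of_nat_mult[symmetric] by (rule arg_cong[of _ _ exp]) (simp add: l)
  have c3: "exp (of_nat N * of_real l * of_real pi * \<i> * (\<tau> - 1) + 2 * of_nat N * of_real l * of_real pi * \<i> * u) =
     exp (of_real pi * \<i> * spin m * (\<tau> - 1) + 2 * of_real pi * \<i> * spin m * u) ^ N" for u
    unfolding exp_of_nat_mult[symmetric] by (rule arg_cong[of _ _ exp]) (simp add: l field_simps)
  have strict: "sklyanin_strict_rational \<tau> \<eta> m r r'" if "\<bar>\<eta>\<bar> < 1 / (2 * (2 * l + 1))"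
    by unfold_locales (use that in \<open>simp add: l\<close>)
  have main: "sklyanin_main \<tau> \<eta> m r r'" if "\<eta> \<noteq> 0" by unfold_locales (rule that)
  have strict_main: "sklyanin_strict_main \<tau> \<eta> m r r'" if "\<bar>\<eta>\<bar> < 1 / (2 * (2 * l + 1))" "\<eta> \<noteq> 0"
    using strict[OF that(1)] main[OF that(2)] unfolding sklyanin_strict_main_def by blast
  let ?QR = "Q_R \<tau> \<eta> m N r t" and ?QL = "Q_L \<tau> \<eta> m N r t" and ?T = "transfer \<tau> \<eta> m N"
  let ?H = "tensor_power N V" and ?K = "coord_space N m"
  let ?U1 = "op_tensor_power N (U1_op m)" and ?U3 = "op_tensor_power N (U3_op \<tau> m)"
  let ?c1 = "exp (- (of_real pi * \<i> * spin m)) ^ N"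
  let ?c3 = "\<lambda>u. exp (of_real pi * \<i> * spin m * (\<tau> - 1) + 2 * of_real pi * \<i> * spin m * u) ^ N"
  let ?hm = "h_fun \<tau> \<eta> m N (- 1)" and ?hp = "h_fun \<tau> \<eta> m N 1"
  let ?strict = "\<bar>\<eta>\<bar> < 1 / (2 * (2 * l + 1))"
  have TH: "?T u F \<in> ?H" "?U1 F \<in> ?H" "?U3 F \<in> ?H" if "F \<in> ?H" for u F
    using transfer_in_H[OF N that] op_tensor_power_in_H[OF N U1_linear that] op_tensor_power_in_H[OF N U3_linear that] by simp_all
  have TL: "?QL u (?T u F) = (\<lambda>k. ?hm u * ?QL (u - 2 * h\<eta>) F k + ?hp u * ?QL (u + 2 * h\<eta>) F k)" if ?strict "\<eta> \<noteq> 0" "F \<in> ?H" for u F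
    using sklyanin_strict_main.transfer_Q_L[OF strict_main N] that by blast
  have TR: "?T u (?QR u v) = (\<lambda>z. ?hm u * ?QR (u - 2 * h\<eta>) v z + ?hp u * ?QR (u + 2 * h\<eta>) v z)" if "\<eta> \<noteq> 0" for u v
    by (rule sklyanin_main.transfer_Q_R[OF main[OF that] N])
  show ?thesis
    unfolding defs c1 c3 Let_def
  proof (intro conjI impI allI ballI)
    show "f_fun \<tau> \<eta> m 1 x u \<in> V" "f_fun \<tau> \<eta> m (- 1) x u \<in> V" for x u
      unfolding f_fun_def by (rule br_pair_in_V)+
    show "?T u (?QR u v) = (\<lambda>z. ?hm u * ?QR (u - 2 * h\<eta>) v z + ?hp u * ?QR (u + 2 * h\<eta>) v z)" if "\<eta> \<noteq> 0" for u v
      by (rule TR[OF that])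
    show "?U1 (?QR u v) = (\<lambda>z. ?c1 * ?QR (u + 1) v z)" "?U3 (?QR u v) = (\<lambda>z. ?c3 u * ?QR (u + \<tau>) v z)" for u v
      by (rule U1_Q_R[OF N] U3_Q_R[OF N])+
  next
    assume s: ?strict
    interpret S: sklyanin_strict_rational \<tau> \<eta> m r r' by (rule strict[OF s])
    show "?QL u (?T u F) = (\<lambda>k. ?hm u * ?QL (u - 2 * h\<eta>) F k + ?hp u * ?QL (u + 2 * h\<eta>) F k)" if "\<eta> \<noteq> 0" "F \<in> ?H" for u F
      by (rule TL[OF s that])
    show "?QL u (?QR u' v) = ?QL u' (?QR u v)" for u u' v by (rule S.Q_L_Q_R[OF N])
    show "?QL u (?U1 F) = (\<lambda>k. ?c1 * ?QL (u + 1) F k)" if "F \<in> ?H" for u F by (rule S.U1_Q_L[OF N that ev])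
    show "?QL u (?U3 F) = (\<lambda>k. ?c3 u * ?QL (u + \<tau>) F k)" if "F \<in> ?H" for u F by (rule S.U3_Q_L[OF N that ev])
    fix u0 assume bij: "bij_betw (?QR u0) ?K ?H \<and> bij_betw (?QL u0) ?H ?K"
    note B = bij[THEN conjunct1] bij[THEN conjunct2]
    let ?Q = "\<lambda>u F. ?QR u (inv_into ?K (?QR u0) F)"
    note Q_op_def = S.Q_op_def[OF N B]
    note single = S.Q_op_intertwine_single[OF N B, unfolded Q_op_def]
    show "?Q u F = inv_into ?H (?QL u0) (?QL u F)" if "F \<in> ?H" for u F
      by (rule S.Q_op_eq[OF N B that, unfolded Q_op_def])
    show "?Q u (?Q v F) = ?Q v (?Q u F)" if "F \<in> ?H" for u v F
      by (rule S.Q_op_commute[OF N B that, unfolded Q_op_def])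
    have T: "?T u (?Q u F) = (\<lambda>z. ?hm u * ?Q (u - 2 * h\<eta>) F z + ?hp u * ?Q (u + 2 * h\<eta>) F z)"
      "?Q u (?T u F) = (\<lambda>z. ?hm u * ?Q (u - 2 * h\<eta>) F z + ?hp u * ?Q (u + 2 * h\<eta>) F z)" if "\<eta> \<noteq> 0" "F \<in> ?H" for u F
      by (rule S.Q_op_intertwine[OF N B that(2) TH(1)[OF that(2)] TR[OF that(1)] TL[OF s that], unfolded Q_op_def])+
    show "?T u (?Q u F) = ?Q u (?T u F)"
      "?Q u (?T u F) = (\<lambda>z. ?hm u * ?Q (u - 2 * h\<eta>) F z + ?hp u * ?Q (u + 2 * h\<eta>) F z)" if "\<eta> \<noteq> 0" "F \<in> ?H" for u F
      using T[OF that] by simp_all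
    have U1: "?U1 (?Q u F) = (\<lambda>z. ?c1 * ?Q (u + 1) F z)" "?Q u (?U1 F) = (\<lambda>z. ?c1 * ?Q (u + 1) F z)" if "F \<in> ?H" for u F
      by (rule single[OF that TH(2)[OF that] U1_Q_R[OF N] S.U1_Q_L[OF N that ev]])+
    have U3: "?U3 (?Q u F) = (\<lambda>z. ?c3 u * ?Q (u + \<tau>) F z)" "?Q u (?U3 F) = (\<lambda>z. ?c3 u * ?Q (u + \<tau>) F z)" if "F \<in> ?H" for u F
      by (rule single[OF that TH(3)[OF that] U3_Q_R[OF N] S.U3_Q_L[OF N that ev]])+
    show "?U1 (?Q u F) = ?Q u (?U1 F)" "?Q u (?U1 F) = (\<lambda>z. ?c1 * ?Q (u + 1) F z)"
      "?U3 (?Q u F) = ?Q u (?U3 F)" "?Q u (?U3 F) = (\<lambda>z. ?c3 u * ?Q (u + \<tau>) F z)" if "F \<in> ?H" for u F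
      using U1[OF that] U3[OF that] by simp_all
  qed
qed


end
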